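(* Let $(\mathcal{X},d,\mu)$ be a metric measure space of non-homogeneous type with dominating function $\lambda$, let $\alpha\in(0,1)$ and $b\in\widetilde{\mathrm{RBMO}}(\mu)$. Let $K_\alpha\in L^1_{\mathrm{loc}}((\mathcal X\times\mathcal X)\setminus\{(x,x):x\in\mathcal X\})$ be a generalized fractional integral kernel, i.e. there exist positive constants $C_{(K_\alpha)}$, $\delta\in(0,1]$ and $c_{(K_\alpha)}\in(0,\infty)$, depending only on $K_\alpha$, such that (1) for all $x,y\in\mathcal X$ with $x\ne y$, $|K_\alpha(x,y)|\le C_{(K_\alpha)}\frac{1}{[\lambda(x,d(x,y))]^{1-\alpha}}$; (2) for all $x,\widetilde x,y\in\mathcal X$ with $d(x,y)\ge c_{(K_\alpha)}d(x,\widetilde x)$, $$|K_\alpha(x,y)-K_\alpha(\widetilde x,y)|+|K_\alpha(y,x)-K_\alpha(y,\widetilde x)|\le C_{(K_\alpha)}\frac{[d(x,\widetilde x)]^\delta}{[d(x,y)]^\delta[\lambda(x,d(x,y))]^{1-\alpha}}.$$ Let $T_\alpha$ be a generalized fractional integral with kernel $K_\alpha$, that is, a linear operator such that, for all $f\in L^\infty_b(\mu)$ and $x\notin\operatorname{supp}f$, $T_\alpha f(x)=\int_{\mathcal X}K_\alpha(x,y)f(y)\,d\mu(y)$. Assume that $T_\alpha$ is bounded from $L^p(\mu)$ into $L^q(\mu)$ for all $p\in(1,1/\alpha)$ and $1/q=1/p-\alpha$. Then the commutator $T_{\alpha,b}$, defined by $T_{\alpha,b}f:=bT_\alpha f-T_\alpha(bf)$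 for suitable functions $f$, is bounded from $\widetilde H^1(\mu)$ into $L^{1/(1-\alpha),\infty}(\mu)$, that is, there exists a positive constant $C$ such that, for all $t\in(0,\infty)$ and all $f\in\widetilde H^1(\mu)$, $$\left[\mu(\{x\in\mathcal X:\ |T_{\alpha,b}f(x)|>t\})\right]^{1-\alpha}\le C\,\|b\|_{\widetilde{\mathrm{RBMO}}(\mu)}\,t^{-1}\,\|f\|_{\widetilde H^1(\mu)}.$$
   Context: **Space.** $B(x,r):=\{y\in\mathcal X: d(x,y)<r\}$. A metric space $(\mathcal X,d)$ is geometrically doubling if there is $N_0\in\mathbb N$ such that every ball $B(x,r)$, $x\in\mathcal X$, $r\in(0,\infty)$, is covered by at most $N_0$ balls $B(x_i,r/2)$. $(\mathcal X,d,\mu)$ is upper doubling if $\mu$ is a Borel measure on $\mathcal X$ and there exist a dominating function $\lambda:\mathcal X\times(0,\infty)\to(0,\infty)$ and a positive constant $C_{(\lambda)}$ such that, for each $x$, $r\mapsto\lambda(x,r)$ is non-decreasing and, for all $x\in\mathcal X$, $r\in(0,\infty)$, $\mu(B(x,r))\le\lambda(x,r)\le C_{(\lambda)}\lambda(x,r/2)$. $(\mathcal X,d,\mu)$ is a metric measure space of non-homogeneous type if $(\mathcal X,d)$ is geometrically doubling and $(\mathcal X,d,\mu)$ is upper doubling. It is always assumed (with no loss, after changing $\lambda$) that $\lambda(x,r)\le C_{(\lambda)}\lambda(y,r)$ for all $x,y\in\mathcal X$ with $d(x,y)\le r$. A ball $B$ always comes with a center $c_B$ and radius $r_B$ (equal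 balls have equal centers and radii), and $\rho B:=B(c_B,\rho r_B)$. $L^\infty_b(\mu)$ is the set of $f\in L^\infty(\mu)$ with bounded support. **Discrete coefficient.** For $\rho\in(1,\infty)$ and balls $B\subset S$, $\widetilde K^{(\rho)}_{B,S}:=1+\sum_{k=-\lfloor\log_\rho2\rfloor}^{N^{(\rho)}_{B,S}}\frac{\mu(\rho^kB)}{\lambda(c_B,\rho^kr_B)}$, where $N^{(\rho)}_{B,S}$ is the smallest integer with $\rho^{N^{(\rho)}_{B,S}}r_B\ge r_S$. **Hardy space $\widetilde H^1(\mu)$.** Let $\rho\in(1,\infty)$, $q\in(1,\infty]$, $\gamma\in[1,\infty)$. A function $h\in L^1(\mu)$ is a $(q,\gamma,\rho)_\lambda$-atomic block if (i) $\operatorname{supp}h\subset B$ for some ball $B$; (ii) $\int_{\mathcal X}h\,d\mu=0$; (iii) for $j\in\{1,2\}$ there are functions $a_j$ supported on balls $B_j\subset B$ and numbers $\lambda_j\in\mathbb C$ with $h=\lambda_1a_1+\lambda_2a_2$ and $\|a_j\|_{L^q(\mu)}\le[\mu(\rho B_j)]^{1/q-1}[\widetilde K^{(\rho)}_{B_j,B}]^{-\gamma}$; put $|h|:=|\lambda_1|+|\lambda_2|$. A function $f\in L^1(\mu)$ belongs to the space if $f=\sum_{i=1}^\infty h_i$ in $L^1(\mu)$ with atomic blocks $h_i$ and $\sum_i|h_i|<\infty$; its norm is the infimum of $\sum_i|h_i|$ over all such decompositions. It is known that the space is independent of $\rho,\gamma$ and $q\in(1,\infty]$ up to equivalent norms;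 it is denoted $\widetilde H^1(\mu)$. **Space $\widetilde{\mathrm{RBMO}}(\mu)$.** Let $\rho\in(1,\infty)$, $\gamma\in[1,\infty)$. A function $f\in L^1_{\mathrm{loc}}(\mu)$ belongs to it if there are a positive constant $\widetilde C$ and, for each ball $B$, a number $f_B$ such that $\frac1{\mu(\rho B)}\int_B|f-f_B|\,d\mu\le\widetilde C$ for all balls $B$ and $|f_B-f_{B_1}|\le\widetilde C[\widetilde K^{(\rho)}_{B,B_1}]^\gamma$ for all balls $B\subset B_1$. The norm $\|f\|_{\widetilde{\mathrm{RBMO}}(\mu)}$ is the infimum of such $\widetilde C$. It is known that the space is independent of $\rho,\gamma$ (up to equivalent norms). *)

theory Defs
  imports "HOL-Analysis.Analysis" "HOL-Probability.Essential_Supremum"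
begin

text \<open>The metric space is the whole type. A ball is given by its center \<open>c\<close> and its radius
  \<open>r > 0\<close>, so that \<open>\<rho>B\<close> is \<open>ball c (\<rho> * r)\<close>; inclusions of balls are inclusions of sets.
  Functions are complex valued, and elements of Lebesgue spaces are represented by Borel functions,
  identified only through almost-everywhere statements; the support of such a function is its
  essential support.\<close>

definition geometrically_doubling :: "'a::metric_space set \<Rightarrow> bool" where
  "geometrically_doubling X \<longleftrightarrow>
     (\<exists>N0::nat. \<forall>x\<in>X. \<forall>r>0. \<exists>F\<subseteq>X. finite F \<and> card F \<le> N0 \<and>
        ball x r \<inter> X \<subseteq> (\<Union>y\<in>F. ball y (r / 2)))"

definition upper_doubling ::
  "'a::metric_space measure \<Rightarrow> ('a \<Rightarrow> real \<Rightarrow> real) \<Rightarrow> real \<Rightarrow> bool" where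
  "upper_doubling \<mu> lam C \<longleftrightarrow>
     sets \<mu> = sets borel \<and> 0 < C \<and>
     (\<forall>x. \<forall>r>0. 0 < lam x r) \<and>
     (\<forall>x r s. 0 < r \<longrightarrow> r \<le> s \<longrightarrow> lam x r \<le> lam x s) \<and>
     (\<forall>x. \<forall>r>0. emeasure \<mu> (ball x r) \<le> ennreal (lam x r) \<and> lam x r \<le> C * lam x (r / 2))"

text \<open>The last conjunct is the additional property that may be assumed of a dominating function
  without loss of generality.\<close>

definition nonhomogeneous_space ::
  "'a::metric_space measure \<Rightarrow> ('a \<Rightarrow> real \<Rightarrow> real) \<Rightarrow> bool" where
  "nonhomogeneous_space \<mu> lam \<longleftrightarrow>
     geometrically_doubling (UNIV :: 'a set) \<and>
     (\<exists>C. upper_doubling \<mu> lam C \<and>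
          (\<forall>x y r. 0 < r \<longrightarrow> dist x y \<le> r \<longrightarrow> lam x r \<le> C * lam y r))"

definition ess_support :: "'a::topological_space measure \<Rightarrow> ('a \<Rightarrow> complex) \<Rightarrow> 'a set" where
  "ess_support \<mu> f = {x. \<forall>U. open U \<longrightarrow> x \<in> U \<longrightarrow> \<not> (AE y in \<mu>. y \<in> U \<longrightarrow> f y = 0)}"

definition locally_integrable_on ::
  "'a::topological_space measure \<Rightarrow> 'a set \<Rightarrow> ('a \<Rightarrow> complex) \<Rightarrow> bool" where
  "locally_integrable_on M S f \<longleftrightarrow>
     (\<forall>x\<in>S. \<exists>U. open U \<and> x \<in> U \<and> U \<subseteq> S \<and> set_integrable M U f)"

definition Lp_space :: "'a measure \<Rightarrow> ennreal \<Rightarrow> ('a \<Rightarrow> complex) set" where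
  "Lp_space \<mu> p = {f \<in> borel_measurable \<mu>.
     if p = \<infinity> then esssup \<mu> (\<lambda>x. ereal (cmod (f x))) < \<infinity>
     else integrable \<mu> (\<lambda>x. cmod (f x) powr enn2real p)}"

definition Lp_norm :: "'a measure \<Rightarrow> ennreal \<Rightarrow> ('a \<Rightarrow> complex) \<Rightarrow> real" where
  "Lp_norm \<mu> p f =
     (if p = \<infinity> then real_of_ereal (esssup \<mu> (\<lambda>x. ereal (cmod (f x))))
      else (\<integral>x. cmod (f x) powr enn2real p \<partial>\<mu>) powr (1 / enn2real p))"

definition Linfty_b :: "'a::metric_space measure \<Rightarrow> ('a \<Rightarrow> complex) set" where
  "Linfty_b \<mu> = {f \<in> Lp_space \<mu> \<infinity>. bounded (ess_support \<mu> f)}"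

text \<open>The index \<open>N\<close> may be negative, and the sum is empty if \<open>N\<close> is below the lower limit. For
  balls \<open>ball c r \<subseteq> ball c' s\<close> this requires \<open>r > 2 * s\<close>, hence that the two balls are equal as
  sets.\<close>

definition K_tilde ::
  "'a::metric_space measure \<Rightarrow> ('a \<Rightarrow> real \<Rightarrow> real) \<Rightarrow> real \<Rightarrow> 'a \<Rightarrow> real \<Rightarrow> real \<Rightarrow> real" where
  "K_tilde \<mu> lam \<rho> c r s =
     1 + (\<Sum>k = - \<lfloor>log \<rho> 2\<rfloor> .. (LEAST N::int. \<rho> powi N * r \<ge> s).
            measure \<mu> (ball c (\<rho> powi k * r)) / lam c (\<rho> powi k * r))"

definition block_atom ::
  "'a::metric_space measure \<Rightarrow> ('a \<Rightarrow> real \<Rightarrow> real) \<Rightarrow> ennreal \<Rightarrow> real \<Rightarrow> real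
     \<Rightarrow> 'a \<Rightarrow> real \<Rightarrow> ('a \<Rightarrow> complex) \<Rightarrow> bool" where
  "block_atom \<mu> lam q \<gamma> \<rho> c r a \<longleftrightarrow>
     (\<exists>c' r'. 0 < r' \<and> ball c' r' \<subseteq> ball c r \<and>
        a \<in> Lp_space \<mu> q \<and> ess_support \<mu> a \<subseteq> ball c' r' \<and>
        Lp_norm \<mu> q a \<le> measure \<mu> (ball c' (\<rho> * r')) powr (enn2real (1 / q) - 1)
                          * K_tilde \<mu> lam \<rho> c' r' r powr (- \<gamma>))"

text \<open>\<open>h\<close> is a \<open>(q, \<gamma>, \<rho>)\<close>-atomic block, with coefficients \<open>l1\<close> and \<open>l2\<close>.\<close>

definition atomic_block ::
  "'a::metric_space measure \<Rightarrow> ('a \<Rightarrow> real \<Rightarrow> real) \<Rightarrow> ennreal \<Rightarrow> real \<Rightarrow> real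
     \<Rightarrow> ('a \<Rightarrow> complex) \<Rightarrow> complex \<Rightarrow> complex \<Rightarrow> bool" where
  "atomic_block \<mu> lam q \<gamma> \<rho> h l1 l2 \<longleftrightarrow>
     integrable \<mu> h \<and> integral\<^sup>L \<mu> h = 0 \<and>
     (\<exists>c r. 0 < r \<and> ess_support \<mu> h \<subseteq> ball c r \<and>
        (\<exists>a1 a2. block_atom \<mu> lam q \<gamma> \<rho> c r a1 \<and> block_atom \<mu> lam q \<gamma> \<rho> c r a2 \<and>
           (AE x in \<mu>. h x = l1 * a1 x + l2 * a2 x)))"

definition H1_costs ::
  "'a::metric_space measure \<Rightarrow> ('a \<Rightarrow> real \<Rightarrow> real) \<Rightarrow> ennreal \<Rightarrow> real \<Rightarrow> real
     \<Rightarrow> ('a \<Rightarrow> complex) \<Rightarrow> real set" where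
  "H1_costs \<mu> lam q \<gamma> \<rho> f =
     {s. \<exists>h l1 l2. (\<forall>i::nat. atomic_block \<mu> lam q \<gamma> \<rho> (h i) (l1 i) (l2 i)) \<and>
           (\<lambda>n. \<integral>x. cmod (f x - (\<Sum>i<n. h i x)) \<partial>\<mu>) \<longlonglongrightarrow> 0 \<and>
           (\<lambda>i. cmod (l1 i) + cmod (l2 i)) sums s}"

definition H1_space ::
  "'a::metric_space measure \<Rightarrow> ('a \<Rightarrow> real \<Rightarrow> real) \<Rightarrow> ennreal \<Rightarrow> real \<Rightarrow> real
     \<Rightarrow> ('a \<Rightarrow> complex) set" where
  "H1_space \<mu> lam q \<gamma> \<rho> = {f. integrable \<mu> f \<and> H1_costs \<mu> lam q \<gamma> \<rho> f \<noteq> {}}"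

definition H1_norm ::
  "'a::metric_space measure \<Rightarrow> ('a \<Rightarrow> real \<Rightarrow> real) \<Rightarrow> ennreal \<Rightarrow> real \<Rightarrow> real
     \<Rightarrow> ('a \<Rightarrow> complex) \<Rightarrow> real" where
  "H1_norm \<mu> lam q \<gamma> \<rho> f = Inf (H1_costs \<mu> lam q \<gamma> \<rho> f)"

definition RBMO_bounds ::
  "'a::metric_space measure \<Rightarrow> ('a \<Rightarrow> real \<Rightarrow> real) \<Rightarrow> real \<Rightarrow> real
     \<Rightarrow> ('a \<Rightarrow> complex) \<Rightarrow> real set" where
  "RBMO_bounds \<mu> lam \<gamma> \<rho> f =
     {C. 0 < C \<and> (\<exists>m :: 'a \<Rightarrow> real \<Rightarrow> complex.
        (\<forall>c. \<forall>r>0. (\<integral>\<^sup>+x\<in>ball c r. ennreal (cmod (f x - m c r)) \<partial>\<mu>)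
                      / emeasure \<mu> (ball c (\<rho> * r)) \<le> ennreal C) \<and>
        (\<forall>c r c1 r1. 0 < r \<longrightarrow> 0 < r1 \<longrightarrow> ball c r \<subseteq> ball c1 r1 \<longrightarrow>
           cmod (m c r - m c1 r1) \<le> C * K_tilde \<mu> lam \<rho> c r r1 powr \<gamma>))}"

definition RBMO_space ::
  "'a::metric_space measure \<Rightarrow> ('a \<Rightarrow> real \<Rightarrow> real) \<Rightarrow> real \<Rightarrow> real \<Rightarrow> ('a \<Rightarrow> complex) set" where
  "RBMO_space \<mu> lam \<gamma> \<rho> =
     {f. locally_integrable_on \<mu> UNIV f \<and> RBMO_bounds \<mu> lam \<gamma> \<rho> f \<noteq> {}}"

definition RBMO_norm ::
  "'a::metric_space measure \<Rightarrow> ('a \<Rightarrow> real \<Rightarrow> real) \<Rightarrow> real \<Rightarrow> real \<Rightarrow> ('a \<Rightarrow> complex) \<Rightarrow> real" where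
  "RBMO_norm \<mu> lam \<gamma> \<rho> f = Inf (RBMO_bounds \<mu> lam \<gamma> \<rho> f)"

text \<open>The values of \<open>K\<close> on the diagonal are irrelevant: \<open>K\<close> is only evaluated off the diagonal.\<close>

definition fractional_kernel ::
  "'a::metric_space measure \<Rightarrow> ('a \<Rightarrow> real \<Rightarrow> real) \<Rightarrow> real \<Rightarrow> ('a \<Rightarrow> 'a \<Rightarrow> complex) \<Rightarrow> bool" where
  "fractional_kernel \<mu> lam \<alpha> K \<longleftrightarrow>
     locally_integrable_on (\<mu> \<Otimes>\<^sub>M \<mu>) {(x, y). x \<noteq> y} (\<lambda>(x, y). K x y) \<and>
     (\<exists>C \<delta> c. 0 < C \<and> 0 < \<delta> \<and> \<delta> \<le> 1 \<and> 0 < c \<and>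
        (\<forall>x y. x \<noteq> y \<longrightarrow> cmod (K x y) \<le> C * (1 / lam x (dist x y) powr (1 - \<alpha>))) \<and>
        (\<forall>x x' y. x \<noteq> y \<longrightarrow> x' \<noteq> y \<longrightarrow> dist x y \<ge> c * dist x x' \<longrightarrow>
           cmod (K x y - K x' y) + cmod (K y x - K y x')
             \<le> C * (dist x x' powr \<delta> / (dist x y powr \<delta> * lam x (dist x y) powr (1 - \<alpha>)))))"

text \<open>The domain of a fractional integral of order \<open>\<alpha>\<close>: the linear span of the spaces \<open>L\<^sup>p(\<mu>)\<close> with
  \<open>1 < p < 1 / \<alpha>\<close>. Two summands suffice because the intermediate spaces lie in the sum of the
  extreme ones.\<close>

definition Lp_sum_space :: "'a measure \<Rightarrow> real \<Rightarrow> ('a \<Rightarrow> complex) set" where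
  "Lp_sum_space \<mu> \<alpha> = {f. \<exists>p1\<in>{1<..<1/\<alpha>}. \<exists>p2\<in>{1<..<1/\<alpha>}.
     \<exists>f1\<in>Lp_space \<mu> (ennreal p1). \<exists>f2\<in>Lp_space \<mu> (ennreal p2). f = (\<lambda>x. f1 x + f2 x)}"

definition linear_ae_on ::
  "'a measure \<Rightarrow> ('a \<Rightarrow> complex) set \<Rightarrow> (('a \<Rightarrow> complex) \<Rightarrow> ('a \<Rightarrow> complex)) \<Rightarrow> bool" where
  "linear_ae_on \<mu> D T \<longleftrightarrow>
     (\<forall>f\<in>D. \<forall>g\<in>D. \<forall>c d. AE x in \<mu>. T (\<lambda>y. c * f y + d * g y) x = c * T f x + d * T g x)"

definition fractional_integral ::
  "'a::metric_space measure \<Rightarrow> real \<Rightarrow> ('a \<Rightarrow> 'a \<Rightarrow> complex)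
     \<Rightarrow> (('a \<Rightarrow> complex) \<Rightarrow> ('a \<Rightarrow> complex)) \<Rightarrow> bool" where
  "fractional_integral \<mu> \<alpha> K T \<longleftrightarrow>
     linear_ae_on \<mu> (Lp_sum_space \<mu> \<alpha>) T \<and>
     (\<forall>f\<in>Linfty_b \<mu>. AE x in \<mu>. x \<notin> ess_support \<mu> f \<longrightarrow> T f x = (\<integral>y. K x y * f y \<partial>\<mu>))"

definition bounded_Lp_Lq ::
  "'a measure \<Rightarrow> ennreal \<Rightarrow> ennreal \<Rightarrow> (('a \<Rightarrow> complex) \<Rightarrow> ('a \<Rightarrow> complex)) \<Rightarrow> bool" where
  "bounded_Lp_Lq \<mu> p q T \<longleftrightarrow>
     (\<exists>C\<ge>0. \<forall>f\<in>Lp_space \<mu> p. T f \<in> Lp_space \<mu> q \<and> Lp_norm \<mu> q (T f) \<le> C * Lp_norm \<mu> p f)"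

definition commutator ::
  "('a \<Rightarrow> complex) \<Rightarrow> (('a \<Rightarrow> complex) \<Rightarrow> ('a \<Rightarrow> complex)) \<Rightarrow> ('a \<Rightarrow> complex) \<Rightarrow> ('a \<Rightarrow> complex)" where
  "commutator b T f = (\<lambda>x. b x * T f x - T (\<lambda>y. b y * f y) x)"

text \<open>For a general \<open>f\<close> in the Hardy space the product \<open>b f\<close> need not lie in the domain of \<open>T\<close>, so
  the defining formula of the commutator makes sense only when \<open>f\<close> and \<open>b f\<close> both do; an operator
  on the whole of \<open>H\<close> is a linear extension of that formula.\<close>

definition extends_commutator ::
  "'a measure \<Rightarrow> real \<Rightarrow> ('a \<Rightarrow> complex) \<Rightarrow> (('a \<Rightarrow> complex) \<Rightarrow> ('a \<Rightarrow> complex))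
     \<Rightarrow> ('a \<Rightarrow> complex) set \<Rightarrow> (('a \<Rightarrow> complex) \<Rightarrow> ('a \<Rightarrow> complex)) \<Rightarrow> bool" where
  "extends_commutator \<mu> \<alpha> b T H Tb \<longleftrightarrow>
     linear_ae_on \<mu> H Tb \<and>
     (\<forall>f\<in>H. f \<in> Lp_sum_space \<mu> \<alpha> \<longrightarrow> (\<lambda>x. b x * f x) \<in> Lp_sum_space \<mu> \<alpha> \<longrightarrow>
        (AE x in \<mu>. Tb f x = commutator b T f x))"

end

theory Submission
  imports Defs
begin

text \<open>
The target exponent \<open>1 / (1 - \<alpha>)\<close> exceeds \<open>1\<close>, so the weak Lebesgue space is normable: up to
constants, \<open>g\<close> belongs to it with bound \<open>B\<close> exactly if \<open>\<integral>\<^sub>A |g| \<le> B \<mu>(A)\<^sup>\<alpha>\<close> for all sets \<open>A\<close>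
of finite measure (\<open>weak_bound\<close>). These bounds add, also along infinite series. It therefore suffices to
bound the commutator on one atomic block by the size of the block, with a constant that is uniform in the
symbol, and then to sum; no Calderon-Zygmund decomposition is needed.

For a block \<open>h\<close> supported in \<open>B\<close>, with \<open>m\<^sub>B\<close> the number attached to \<open>B\<close>, the commutator is
\<open>(b - m\<^sub>B) T h - T ((b - m\<^sub>B) h)\<close>. The second term is controlled by the weak type of \<open>T\<close> at the endpoint
\<open>p = 1\<close> (\<open>T_weak_type\<close>): on the indicator of a closed set, \<open>L\<^sup>p\<close>-boundedness acts on the set
and the size of the kernel off the set; additivity of weak bounds then gives simple functions and their limits.
The first term is treated in three regions. Near the ball of an atom, boundedness of \<open>T\<close> meets the
\<open>L\<^sup>p\<close>-oscillation of \<open>b\<close> (\<open>atom_near\<close>). Between that ball and a multiple of \<open>B\<close>, the kernel is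
summed over annuli; the sum produces the coefficient \<open>K\<close> of the two balls, which the normalisation of the
atom cancels (\<open>atom_mid\<close>). Far from \<open>B\<close>, the cancellation of \<open>h\<close> and the regularity of the kernel give
geometric decay (\<open>block_far\<close>). The outcome is \<open>block_weak_bound\<close>.

The oscillation estimates rest on a John-Nirenberg inequality. Since \<open>\<mu>\<close> need not be doubling, the
stopping time only inspects scales that are doubling at the point in question. Almost every point has
arbitrarily small such scales (\<open>doubling_radii_AE\<close>), and along a run of scales that are not doubling
the ratios \<open>\<mu> / lam\<close> grow geometrically, so that the means hardly move (\<open>nondoubling_sum_theta\<close>).

On the Hardy space the operator is the sum of \<open>b T h\<^sub>i - T (b h\<^sub>i)\<close> over a decomposition into blocks
\<open>h\<^sub>i\<close>. That the sum depends only on \<open>f\<close>, that it is linear, and that it agrees with the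
commutator where the latter is defined, all follow from \<open>good_series_consistent\<close>. There \<open>b\<close> is
replaced by its truncation to a disc. Truncation is \<open>1\<close>-Lipschitz, hence does not increase the bounds on
blocks, and for a bounded symbol the commutator is continuous from \<open>L\<^sup>1\<close> into the weak space.
\<close>

section \<open>Measure-theoretic preliminaries\<close>

lemma nn_integral_Holder:
 fixes f g :: "'a => real" and p q F G :: real
 assumes [measurable]: "f \<in> borel_measurable M" "g \<in> borel_measurable M"
  and f0: "\<And>x. 0 \<le> f x" and g0: "\<And>x. 0 \<le> g x"
  and p: "0 < p" and q: "0 < q" and pq: "1 / p + 1 / q = 1"
  and F0: "0 \<le> F" and G0: "0 \<le> G"
  and F: "(\<integral>\<^sup>+x. ennreal (f x powr p) \<partial>M) \<le> ennreal (F powr p)"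
  and G: "(\<integral>\<^sup>+x. ennreal (g x powr q) \<partial>M) \<le> ennreal (G powr q)"
 shows "(\<integral>\<^sup>+x. ennreal (f x * g x) \<partial>M) \<le> ennreal (F * G)"
proof -
 have p1: "1 < p" and q1: "1 < q"
  using p q pq by (smt (verit) divide_less_eq_1_pos zero_less_divide_1_iff)+
 have zero: "(\<integral>\<^sup>+x. ennreal (f x * g x) \<partial>M) = 0"
  if "(\<integral>\<^sup>+x. ennreal (u x powr s) \<partial>M) \<le> ennreal (0 powr s)" and "\<And>x. u x = 0 ==> f x * g x = 0"
   and [measurable]: "u \<in> borel_measurable M" for u s
 proof -
  have "(\<integral>\<^sup>+x. ennreal (u x powr s) \<partial>M) = 0"
   using that(1) by simp
  then have "AE x in M. ennreal (u x powr s) = 0"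
   by (subst (asm) nn_integral_0_iff_AE) auto
  then have "AE x in M. ennreal (f x * g x) = 0"
  proof eventually_elim
   case (elim x)
   then have "u x = 0" by (metis ennreal_eq_0_iff order_antisym powr_eq_0_iff powr_ge_zero)
   then show ?case using that(2)[of x] by auto
  qed
  then show ?thesis
   by (subst nn_integral_0_iff_AE) auto
 qed
 consider "F = 0" | "G = 0" | "0 < F" "0 < G" using F0 G0 by linarith
 then show ?thesis
 proof cases
  case 1
  then show ?thesis using zero[of f p] F by simp
 next
  case 2
  then show ?thesis using zero[of g q] G by simp
 next
  case 3
  have pt: "f x * g x \<le> F * G * ((1 / p) * (f x powr p / F powr p) + (1 / q) * (g x powr q / G powr q))" for x
  proof -
   have "(f x / F) * (g x / G) \<le> (f x / F) powr p / p + (g x / G) powr q / q"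
    by (rule Youngs_inequality) (use p1 q1 pq f0[of x] g0[of x] 3 in auto)
   then have "F * G * ((f x / F) * (g x / G)) \<le> F * G * ((f x / F) powr p / p + (g x / G) powr q / q)"
    using 3 by (intro mult_left_mono) auto
   moreover have "F * G * ((f x / F) * (g x / G)) = f x * g x" using 3 by simp
   ultimately show ?thesis using 3 f0[of x] g0[of x] by (simp add: powr_divide mult.commute[of p] mult.commute[of q])
  qed
  have "(\<integral>\<^sup>+x. ennreal (f x * g x) \<partial>M) \<le>
    (\<integral>\<^sup>+x. ennreal (F * G / p / F powr p) * ennreal (f x powr p)
       + ennreal (F * G / q / G powr q) * ennreal (g x powr q) \<partial>M)"
   using p q 3 pt
   by (intro nn_integral_mono)
    (simp add: ennreal_mult[symmetric] ennreal_plus[symmetric] del: ennreal_plus,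
     simp add: algebra_simps add_divide_distrib)
  also have "... = ennreal (F * G / p / F powr p) * (\<integral>\<^sup>+x. ennreal (f x powr p) \<partial>M)
       + ennreal (F * G / q / G powr q) * (\<integral>\<^sup>+x. ennreal (g x powr q) \<partial>M)"
   by (simp add: nn_integral_add nn_integral_cmult)
  also have "... \<le> ennreal (F * G / p / F powr p) * ennreal (F powr p)
       + ennreal (F * G / q / G powr q) * ennreal (G powr q)"
   using F G by (intro add_mono mult_left_mono) auto
  also have "... = ennreal (F * G / p + F * G / q)"
   using 3 p q by (simp add: ennreal_mult[symmetric] ennreal_plus[symmetric] del: ennreal_plus)
  also have "F * G / p + F * G / q = F * G * (1 / p + 1 / q)" by (simp add: algebra_simps)
  finally show ?thesis using pq by simp
 qed
qed

text \<open>An \<open>L\<^sup>q\<close> bound becomes a power of the measure of the set of integration;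
  with \<open>q = 1 / (1 - \<alpha>)\<close> this is the form in which weak bounds are produced
  below.\<close>

lemma nn_integral_Holder_set:
 fixes g :: "'a => real" and q G :: real
 assumes [measurable]: "g \<in> borel_measurable M" "A \<in> sets M"
  and g0: "\<And>x. 0 \<le> g x" and fin: "emeasure M A < \<infinity>"
  and q: "1 \<le> q" and G0: "0 \<le> G"
  and G: "(\<integral>\<^sup>+x. ennreal (g x powr q) \<partial>M) \<le> ennreal (G powr q)"
 shows "(\<integral>\<^sup>+x\<in>A. ennreal (g x) \<partial>M) \<le> ennreal (G * measure M A powr (1 - 1 / q))"
proof (cases "q = 1")
 case True
 show ?thesis
 proof (cases "measure M A = 0")
  case True
  then have "emeasure M A = 0" using fin by (simp add: emeasure_eq_ennreal_measure top.not_eq_extremum)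
  then have "A \<in> null_sets M" by auto
  then have "AE x in M. ennreal (g x) * indicator A x = 0"
   by (rule AE_I') (auto simp: indicator_def)
  then have "(\<integral>\<^sup>+x\<in>A. ennreal (g x) \<partial>M) = 0"
   by (subst nn_integral_0_iff_AE) auto
  then show ?thesis by simp
 next
  case False
  have "(\<integral>\<^sup>+x\<in>A. ennreal (g x) \<partial>M) \<le> (\<integral>\<^sup>+x. ennreal (g x powr q) \<partial>M)"
   using g0 \<open>q = 1\<close> by (intro nn_integral_mono) (auto simp: indicator_def)
  also have "... \<le> ennreal G" using G G0 \<open>q = 1\<close> by simp
  finally show ?thesis using False \<open>q = 1\<close> by simp
 qed
next
 case False
 then have q1: "1 < q" using q by simp
 define p where "p = q / (q - 1)"
 have p: "0 < p" "1 / p + 1 / q = 1" using q1 by (auto simp: p_def field_simps)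
 have p': "1 - 1 / q = 1 / p" using p by simp
 have "(\<integral>\<^sup>+x. ennreal (g x * indicat_real A x) \<partial>M) \<le> ennreal (G * measure M A powr (1 / p))"
 proof (rule nn_integral_Holder[where p = q and q = p])
  have "(\<integral>\<^sup>+x. ennreal (indicat_real A x powr p) \<partial>M) = (\<integral>\<^sup>+x. indicator A x \<partial>M)"
   using p by (intro nn_integral_cong) (auto simp: indicator_def)
  also have "... = emeasure M A" by simp
  also have "... = ennreal ((measure M A powr (1 / p)) powr p)"
   using fin p by (simp add: emeasure_eq_ennreal_measure top.not_eq_extremum powr_powr)
  finally show "(\<integral>\<^sup>+x. ennreal (indicat_real A x powr p) \<partial>M) \<le> ennreal ((measure M A powr (1 / p)) powr p)"
   by simp
 qed (use g0 G G0 q1 p in auto)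
 also have "(\<integral>\<^sup>+x. ennreal (g x * indicat_real A x) \<partial>M) = (\<integral>\<^sup>+x\<in>A. ennreal (g x) \<partial>M)"
  by (intro nn_integral_cong) (auto simp: indicator_def)
 finally show ?thesis using p' by simp
qed

lemma nn_integral_Holder3:
 fixes f g h :: "'a => real" and p q r F G H :: real
 assumes [measurable]: "f \<in> borel_measurable M" "g \<in> borel_measurable M" "h \<in> borel_measurable M"
  and f0: "\<And>x. 0 \<le> f x" and g0: "\<And>x. 0 \<le> g x" and h0: "\<And>x. 0 \<le> h x"
  and p: "0 < p" and q: "0 < q" and r: "0 < r" and pqr: "1 / p + 1 / q + 1 / r = 1"
  and F0: "0 \<le> F" and G0: "0 \<le> G" and H0: "0 \<le> H"
  and F: "(\<integral>\<^sup>+x. ennreal (f x powr p) \<partial>M) \<le> ennreal (F powr p)"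
  and G: "(\<integral>\<^sup>+x. ennreal (g x powr q) \<partial>M) \<le> ennreal (G powr q)"
  and H: "(\<integral>\<^sup>+x. ennreal (h x powr r) \<partial>M) \<le> ennreal (H powr r)"
 shows "(\<integral>\<^sup>+x. ennreal (f x * (g x * h x)) \<partial>M) \<le> ennreal (F * (G * H))"
proof -
 define s where "s = 1 / (1 / q + 1 / r)"
 have s0: "0 < s" using q r by (simp add: s_def add_pos_pos)
 have s: "1 / p + 1 / s = 1" using pqr by (simp add: s_def)
 have s': "s / q + s / r = 1"
  using q r add_pos_pos[of "1/q" "1/r"] by (simp add: s_def divide_simps)
 show ?thesis
 proof (rule nn_integral_Holder[where p = p and q = s])
  have "(\<integral>\<^sup>+x. ennreal (g x powr s * h x powr s) \<partial>M) \<le> ennreal (G powr s * H powr s)"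
   by (rule nn_integral_Holder[where p = "q / s" and q = "r / s"])
    (use G H G0 H0 q r s0 s' in \<open>auto simp: powr_powr\<close>)
  then show "(\<integral>\<^sup>+x. ennreal ((g x * h x) powr s) \<partial>M) \<le> ennreal ((G * H) powr s)"
   using g0 h0 G0 H0 by (simp add: powr_mult)
 qed (use p s0 s F F0 G0 H0 f0 g0 h0 in auto)
qed

text \<open>Greedy selection of the ball of largest radius; finiteness of the family replaces a bound
  on the radii.\<close>

lemma finite_Vitali_covering:
 fixes c :: "'i => 'a::metric_space" and r :: "'i => real"
 assumes "finite I"
 shows "\<exists>J\<subseteq>I. disjoint_family_on (\<lambda>i. ball (c i) (r i)) J \<and>
     (\<Union>i\<in>I. ball (c i) (r i)) \<subseteq> (\<Union>j\<in>J. ball (c j) (3 * r j))"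
 using assms
proof (induction "card I" arbitrary: I rule: less_induct)
 case less
 show ?case
 proof (cases "I = {}")
  case True
  then show ?thesis by (auto simp: disjoint_family_on_def)
 next
  case False
  then obtain i where i: "i \<in> I" "\<And>j. j \<in> I ==> r j \<le> r i"
  proof -
   have "Max (r ` I) \<in> r ` I" using False less.prems by (intro Max_in) auto
   then obtain i where "i \<in> I" "r i = Max (r ` I)" by auto
   then show thesis using that[of i] less.prems by simp
  qed
  define I' where "I' = {j \<in> I. j \<noteq> i \<and> ball (c j) (r j) \<inter> ball (c i) (r i) = {}}"
  have "card I' < card I" "finite I'"
   using i less.prems by (auto simp: I'_def intro!: psubset_card_mono)
  from less.hyps[OF this] obtain J where J: "J \<subseteq> I'" "disjoint_family_on (\<lambda>i. ball (c i) (r i)) J"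
   "(\<Union>i\<in>I'. ball (c i) (r i)) \<subseteq> (\<Union>j\<in>J. ball (c j) (3 * r j))" by auto
  have sub: "ball (c j) (r j) \<subseteq> ball (c i) (3 * r i)" if j: "j \<in> I" "ball (c j) (r j) \<inter> ball (c i) (r i) \<noteq> {}" for j
  proof
   fix x assume x: "x \<in> ball (c j) (r j)"
   obtain y where y: "dist (c j) y < r j" "dist (c i) y < r i" using j(2) by auto
   have "dist (c i) x \<le> dist (c i) y + (dist (c j) y + dist (c j) x)"
    by (smt (verit) dist_commute dist_triangle)
   then show "x \<in> ball (c i) (3 * r i)" using x y i(2)[OF j(1)] by simp
  qed
  have tr: "ball (c i) (r i) \<subseteq> ball (c i) (3 * r i)"
   by (smt (verit) mem_ball subsetI zero_le_dist)
  show ?thesis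
  proof (intro exI[of _ "insert i J"] conjI)
   show "insert i J \<subseteq> I" using J i by (auto simp: I'_def)
   have "i \<notin> J" using J by (auto simp: I'_def)
   then show "disjoint_family_on (\<lambda>i. ball (c i) (r i)) (insert i J)"
    using J by (subst disjoint_family_on_insert) (auto simp: I'_def)
   show "(\<Union>i\<in>I. ball (c i) (r i)) \<subseteq> (\<Union>j\<in>insert i J. ball (c j) (3 * r j))"
   proof (rule UN_least)
    fix j assume "j \<in> I"
    show "ball (c j) (r j) \<subseteq> (\<Union>j\<in>insert i J. ball (c j) (3 * r j))"
    proof (cases "j \<in> I'")
     case True then show ?thesis using J(3) by blast
    next
     case False
     then have "j = i \<or> ball (c j) (r j) \<inter> ball (c i) (r i) \<noteq> {}"
      using \<open>j \<in> I\<close> by (auto simp: I'_def)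
     then show ?thesis using sub[OF \<open>j \<in> I\<close>] tr by blast
    qed
   qed
  qed
 qed
qed

text \<open>The sets that admit such \<open>F\<close> and \<open>U\<close> for every \<open>e\<close>
  form a sigma-algebra containing the open sets. The measure is only required to be finite on
  \<open>B\<close>, which is why the error is localised there.\<close>

lemma closed_open_approximation:
 fixes M :: "'a::metric_space measure"
 assumes sets: "sets M = sets borel" and B: "B \<in> sets M" and fin: "emeasure M B < \<infinity>"
  and E: "E \<in> sets M" and e: "0 < e"
 shows "\<exists>F U. closed F \<and> open U \<and> F \<subseteq> E \<and> E \<subseteq> U \<and> emeasure M ((U - F) \<inter> B) < ennreal e"
proof -
 have [measurable]: "\<And>U. open U ==> U \<in> sets M" "\<And>F. closed F ==> F \<in> sets M"
  using sets by auto
 note [measurable] = B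
 have dec: "\<exists>n. emeasure M (D n \<inter> B) < ennreal e"
  if D: "\<And>n. D n \<in> sets M" "decseq D" "(\<Inter>n. D n) = {}" "0 < e" for D :: "nat => 'a set" and e
 proof -
  have "(\<lambda>n. emeasure M (D n \<inter> B)) \<longlonglongrightarrow> emeasure M (\<Inter>n. D n \<inter> B)"
  proof (rule Lim_emeasure_decseq)
   show "decseq (\<lambda>n. D n \<inter> B)" using D(2) by (auto simp: decseq_def)
   show "emeasure M (D i \<inter> B) \<noteq> \<infinity>" for i
    using emeasure_mono[of "D i \<inter> B" B M] fin B by (auto simp: top_unique)
  qed (use D(1) B in auto)
  moreover have "(\<Inter>n. D n \<inter> B) = {}" using D(3) by blast
  ultimately have "(\<lambda>n. emeasure M (D n \<inter> B)) \<longlonglongrightarrow> 0" by simp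
  then have "eventually (\<lambda>n. emeasure M (D n \<inter> B) < ennreal e) sequentially"
   using \<open>0 < e\<close> by (intro order_tendstoD) auto
  then show ?thesis by (auto simp: eventually_sequentially)
 qed
 have "E \<in> sigma_sets UNIV {S::'a set. open S}"
  using E sets by (simp add: borel_def)
 then show ?thesis using e
 proof (induction arbitrary: e)
  case (Basic U)
  then have U: "open U" by simp
  define F where "F n = {x. infdist x (- U) \<ge> 1 / real (Suc n)} \<union> (if U = UNIV then UNIV else {})" for n
  have cl: "closed (F n)" for n
   unfolding F_def by (auto intro!: closed_Collect_le continuous_intros)
  have sub: "F n \<subseteq> U" for n by (auto simp: F_def)
  have inc: "F n \<subseteq> F m" if "n \<le> m" for n m
  proof -
   have "1 / real (Suc m) \<le> 1 / real (Suc n)" using that by (simp add: field_simps)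
   then show ?thesis by (auto simp: F_def)
  qed
  have "(\<Inter>n. U - F n) = {}"
  proof -
   have "\<exists>n. x \<in> F n" if "x \<in> U" for x
   proof (cases "U = UNIV")
    case False
    then have "infdist x (- U) \<noteq> 0"
     using U that in_closed_iff_infdist_zero[of "- U" x] by (auto simp: closed_Compl)
    then have "0 < infdist x (- U)" using infdist_nonneg[of x "-U"] by linarith
    then obtain n where "1 / real (Suc n) < infdist x (- U)" using nat_approx_posE by blast
    then show ?thesis by (auto simp: F_def intro!: exI[of _ n])
   qed (auto simp: F_def)
   then show ?thesis by auto
  qed
  moreover have "decseq (\<lambda>n. U - F n)" unfolding decseq_def using inc by blast
  moreover have "U - F n \<in> sets M" for n using U cl by auto
  ultimately obtain n where "emeasure M ((U - F n) \<inter> B) < ennreal e"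
   using dec[of "\<lambda>n. U - F n" e] Basic.prems by blast
  then show ?case using cl sub U by blast
 next
  case Empty
  then show ?case by (intro exI[of _ "{}"]) auto
 next
  case (Compl E)
  from Compl.IH[OF Compl.prems] obtain F U where FU: "closed F" "open U" "F \<subseteq> E" "E \<subseteq> U"
   "emeasure M ((U - F) \<inter> B) < ennreal e" by blast
  then show ?case
   by (intro exI[of _ "- U"] exI[of _ "- F"])
    (auto simp: Diff_eq Int_commute closed_Compl open_Compl)
 next
  case (Union E)
  have "\<exists>F U. closed F \<and> open U \<and> F \<subseteq> E n \<and> E n \<subseteq> U \<and>
    emeasure M ((U - F) \<inter> B) < ennreal ((e / 4) * (1/2)^n)" for n :: nat
   by (rule Union.IH) (use Union.prems in auto)
  then obtain F U where FU: "\<And>n. closed (F n)" "\<And>n. open (U n)" "\<And>n. F n \<subseteq> E n" "\<And>n. E n \<subseteq> U n"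
   "\<And>n. emeasure M ((U n - F n) \<inter> B) < ennreal ((e / 4) * (1/2)^n)" by metis
  define D where "D n = (\<Union>k. F k) - (\<Union>k\<le>n. F k)" for n
  have Dm: "D n \<in> sets M" for n using FU(1) by (auto simp: D_def)
  have Dd: "decseq D" unfolding decseq_def D_def using order_trans by blast
  have De: "(\<Inter>n. D n) = {}" unfolding D_def by auto
  obtain n where n: "emeasure M (D n \<inter> B) < ennreal (e / 4)"
   using dec[of D "e/4", OF Dm Dd De] Union.prems by auto
  have "emeasure M (((\<Union>k. U k) - (\<Union>k\<le>n. F k)) \<inter> B)
    \<le> emeasure M ((\<Union>k. (U k - F k) \<inter> B) \<union> (D n \<inter> B))"
   using FU(1,2) Dm by (intro emeasure_mono) (auto simp: D_def)
  also have "... \<le> emeasure M (\<Union>k. (U k - F k) \<inter> B) + emeasure M (D n \<inter> B)"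
   using FU(1,2) Dm by (intro emeasure_subadditive) auto
  also have "emeasure M (\<Union>k. (U k - F k) \<inter> B) \<le> (\<Sum>k. emeasure M ((U k - F k) \<inter> B))"
   using FU(1,2) by (intro emeasure_subadditive_countably) auto
  also have "... \<le> (\<Sum>k. ennreal ((e / 4) * (1/2)^k))"
   using FU(5) by (intro suminf_le) (auto intro: less_imp_le)
  also have "... = ennreal (\<Sum>k. (e / 4) * (1/2)^k)"
   using Union.prems by (intro suminf_ennreal2 summable_mult) (auto intro!: summable_geometric)
  also have "(\<Sum>k. (e / 4) * (1/2::real)^k) = e / 2"
   by (subst suminf_mult) (auto simp: suminf_geometric)
  finally have "emeasure M (((\<Union>k. U k) - (\<Union>k\<le>n. F k)) \<inter> B) \<le> ennreal (e / 2) + ennreal (e / 4)"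
   using n by (meson add_mono order_trans less_imp_le order_refl)
  also have "... = ennreal (3 * e / 4)" using Union.prems by (simp flip: ennreal_plus)
  also have "... < ennreal e" using Union.prems by (simp add: ennreal_lessI)
  finally have *: "emeasure M (((\<Union>k. U k) - (\<Union>k\<le>n. F k)) \<inter> B) < ennreal e" .
  show ?case
  proof (intro exI conjI)
   show "closed (\<Union>k\<le>n. F k)" using FU(1) by (intro closed_UN) auto
   show "open (\<Union>k. U k)" using FU(2) by (intro open_UN) auto
   show "(\<Union>k\<le>n. F k) \<subseteq> (\<Union>i. E i)" "(\<Union>i. E i) \<subseteq> (\<Union>k. U k)" using FU(3,4) by blast+
  qed (fact *)
 qed
qed

section \<open>Spaces of non-homogeneous type\<close>

text \<open>Lindeloef property. The product space is a metric space as well, and the statement is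
  needed for both.\<close>

lemma countable_subcover_of_dense:
 fixes S D :: "'b::metric_space set"
 assumes D: "countable D" "\<And>x e. 0 < e ==> \<exists>y\<in>D. dist x y < (e::real)"
  and U: "\<And>x. x \<in> S ==> open (U x)" "\<And>x. x \<in> S ==> x \<in> U x"
 shows "\<exists>S'\<subseteq>S. countable S' \<and> S \<subseteq> (\<Union>x\<in>S'. U x)"
proof -
 define P where "P z x \<longleftrightarrow> x \<in> S \<and> ball (fst z) (1 / real (Suc (snd z))) \<subseteq> U x" for z :: "'b \<times> nat" and x
 define Z where "Z = {z \<in> D \<times> UNIV. \<exists>x. P z x}"
 define S' where "S' = (\<lambda>z. SOME x. P z x) ` Z"
 have P: "P z (SOME x. P z x)" if "z \<in> Z" for z
  using that by (auto simp: Z_def intro: someI_ex)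
 have "S' \<subseteq> S" using P by (auto simp: S'_def P_def)
 moreover have "countable S'"
  unfolding S'_def Z_def by (intro countable_image countable_subset[OF _ countable_SIGMA[OF D(1)]]) auto
 moreover have "S \<subseteq> (\<Union>x\<in>S'. U x)"
 proof
  fix x assume x: "x \<in> S"
  then obtain e where e: "0 < e" "ball x e \<subseteq> U x"
   using U by (meson openE)
  obtain n where n: "1 / real (Suc n) < e / 2" using e nat_approx_posE[of "e/2"] by auto
  obtain y where y: "y \<in> D" "dist x y < 1 / real (Suc n)" using D(2)[of "1 / real (Suc n)" x] by auto
  have "ball y (1 / real (Suc n)) \<subseteq> ball x e"
  proof
   fix z assume "z \<in> ball y (1 / real (Suc n))"
   then show "z \<in> ball x e" using y n dist_triangle[of x z y] by (simp add: dist_commute)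
  qed
  then have "P (y, n) x" using x e by (auto simp: P_def)
  then have "(y, n) \<in> Z" using y by (auto simp: Z_def)
  moreover have "x \<in> ball y (1 / real (Suc n))" using y by (simp add: dist_commute)
  ultimately show "x \<in> (\<Union>x\<in>S'. U x)"
   using P[of "(y, n)"] unfolding S'_def P_def by fastforce
 qed
 ultimately show ?thesis by blast
qed

text \<open>Local integrability gives measurability on small open sets, and countably many of them
  cover \<open>S\<close>.\<close>

lemma locally_integrable_on_measurable:
 fixes M :: "'b::metric_space measure" and D :: "'b set"
 assumes D: "countable D" "\<And>x e. 0 < e ==> \<exists>y\<in>D. dist x y < (e::real)"
  and M: "\<And>U. open U ==> U \<in> sets M" and S: "open S" and f: "locally_integrable_on M S f"
 shows "(\<lambda>x. indicator S x *\<^sub>R f x) \<in> borel_measurable M"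
proof -
 obtain U where U: "\<And>x. x \<in> S ==> open (U x) \<and> x \<in> U x \<and> U x \<subseteq> S \<and> set_integrable M (U x) f"
  using f unfolding locally_integrable_on_def by metis
 obtain S' where S': "S' \<subseteq> S" "countable S'" "S \<subseteq> (\<Union>x\<in>S'. U x)"
  using countable_subcover_of_dense[OF D, of S U] U by blast
 have sp: "space M = UNIV" using M[of UNIV] sets.sets_into_space by fastforce
 show ?thesis
 proof (rule measurable_piecewise_restrict[of "insert (- S) (U ` S')"])
  show "countable (insert (- S) (U ` S'))" using S' by auto
  show "A \<inter> space M \<in> sets M" if "A \<in> insert (- S) (U ` S')" for A
  proof -
   have "- S \<in> sets M" using sets.compl_sets[OF M[OF S]] sp by (simp add: Compl_eq_Diff_UNIV)
   then show ?thesis using that U S' sp M by auto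
  qed
  show "space M \<subseteq> \<Union> (insert (- S) (U ` S'))" using S' by auto
  fix A assume A: "A \<in> insert (- S) (U ` S')"
  show "(\<lambda>x. indicator S x *\<^sub>R f x) \<in> borel_measurable (restrict_space M A)"
  proof (cases "A = - S")
   case True
   have "(\<lambda>x. 0) \<in> borel_measurable (restrict_space M A)" by simp
   then show ?thesis
    by (rule measurable_cong[THEN iffD1, rotated]) (auto simp: space_restrict_space True)
  next
   case False
   then obtain x where x: "x \<in> S" "A = U x" using A S' by auto
   then have "(\<lambda>y. indicator A y *\<^sub>R f y) \<in> borel_measurable M"
    using U[of x] unfolding set_integrable_def by auto
   then have "(\<lambda>y. indicator A y *\<^sub>R f y) \<in> borel_measurable (restrict_space M A)"
    by (rule measurable_restrict_space1)
   then show ?thesis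
    by (rule measurable_cong[THEN iffD1, rotated])
     (use U[of x] x in \<open>auto simp: space_restrict_space indicator_def\<close>)
  qed
 qed
qed

text \<open>The constants of the doubling conditions are parameters, so that estimates uniform in all
  other data can refer to them.\<close>

locale nonhomogeneous =
 fixes \<mu> :: "'a::metric_space measure" and lam :: "'a => real => real" and Cl :: real and N0 :: nat
 assumes sets_mu: "sets \<mu> = sets borel"
  and lam_pos: "0 < r ==> 0 < lam x r"
  and lam_mono: "0 < r ==> r \<le> s ==> lam x r \<le> lam x s"
  and emeasure_ball_le: "0 < r ==> emeasure \<mu> (ball x r) \<le> ennreal (lam x r)"
  and lam_half: "0 < r ==> lam x r \<le> Cl * lam x (r / 2)"
  and lam_center: "0 < r ==> dist x y \<le> r ==> lam x r \<le> Cl * lam y r"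
  and geometric_doubling: "0 < r ==> \<exists>F. finite F \<and> card F \<le> N0 \<and> ball (x::'a) r \<subseteq> (\<Union>y\<in>F. ball y (r / 2))"
begin

abbreviation bmeas :: "('a => 'b::topological_space) => bool" where "bmeas f \<equiv> f \<in> borel_measurable \<mu>"
abbreviation vol :: "'a => real => real" where "vol c r \<equiv> measure \<mu> (ball c r)"
abbreviation mass :: "'a set => ('a => real) => ennreal" where "mass A g \<equiv> \<integral>\<^sup>+x\<in>A. ennreal (g x) \<partial>\<mu>"
abbreviation tmass :: "('a => real) => ennreal" where "tmass g \<equiv> \<integral>\<^sup>+x. ennreal (g x) \<partial>\<mu>"

lemma space_mu [simp]: "space \<mu> = UNIV"
 using sets_eq_imp_space_eq[OF sets_mu] by simp

lemma borel_sets [measurable (raw), simp, intro]: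
 shows "open U ==> U \<in> sets \<mu>" and "closed F ==> F \<in> sets \<mu>"
 using sets_mu by auto

lemma borel_measurable_iff: "borel_measurable \<mu> = borel_measurable borel"
 by (rule measurable_cong_sets) (auto simp: sets_mu)

lemma ball_sets [measurable, simp]: "ball x r \<in> sets \<mu>" by auto

lemma C_lam_ge_1: "1 \<le> Cl"
proof -
 obtain x :: 'a where True by simp
 have "lam x (1/2) \<le> lam x 1" "lam x 1 \<le> Cl * lam x (1/2)" "0 < lam x (1/2)"
  using lam_mono[of "1/2" 1 x] lam_half[of 1 x] lam_pos[of "1/2" x] by auto
 then have "1 * lam x (1/2) \<le> Cl * lam x (1/2)" by linarith
 then show ?thesis using \<open>0 < lam x (1/2)\<close> by (simp only: mult_le_cancel_right_pos)
qed

text \<open>The factor by which dilation with ratio \<open>s\<close> can increase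
  \<open>lam\<close>.\<close>

definition dil :: "real => real" where "dil s = Cl ^ nat \<lceil>log 2 s\<rceil>"

lemma dil_ge_1: "1 \<le> dil s"
 using C_lam_ge_1 by (simp add: dil_def)

lemma lam_pow2: "0 < r ==> lam x (2 ^ n * r) \<le> Cl ^ n * lam x r"
proof (induction n)
 case (Suc n)
 have "lam x (2 ^ Suc n * r) \<le> Cl * lam x (2 ^ n * r)"
  using lam_half[of "2 ^ Suc n * r" x] Suc.prems by simp
 also have "... \<le> Cl * (Cl ^ n * lam x r)"
  using Suc C_lam_ge_1 by (intro mult_left_mono) auto
 finally show ?case by (simp add: mult_ac)
qed simp

lemma lam_dilate: "0 < r ==> 0 < s ==> lam x (s * r) \<le> dil s * lam x r"
proof -
 assume r: "0 < r" and s: "0 < s"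
 have "s = 2 powr (log 2 s)" using s by simp
 also have "... \<le> 2 powr real (nat \<lceil>log 2 s\<rceil>)" by (intro powr_mono) (linarith, simp)
 also have "... = 2 ^ nat \<lceil>log 2 s\<rceil>" by (simp add: powr_realpow)
 finally have "lam x (s * r) \<le> lam x (2 ^ nat \<lceil>log 2 s\<rceil> * r)" using r s by (intro lam_mono) auto
 then show ?thesis using lam_pow2[OF r, of x "nat \<lceil>log 2 s\<rceil>"] by (simp add: dil_def)
qed

lemma emeasure_ball_finite: "emeasure \<mu> (ball x r) < \<infinity>"
proof (cases "0 < r")
 case True
 then have "emeasure \<mu> (ball x r) \<le> ennreal (lam x r)" by (rule emeasure_ball_le)
 also have "... < \<infinity>" by simp
 finally show ?thesis .
next
 case False
 then have "ball x r = {}" by simp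
 then show ?thesis by (simp only: emeasure_empty) simp
qed

lemma emeasure_ball: "emeasure \<mu> (ball x r) = ennreal (vol x r)"
 using emeasure_ball_finite[of x r] by (simp add: emeasure_eq_ennreal_measure top.not_eq_extremum)

lemma measure_ball_le: "0 < r ==> vol x r \<le> lam x r"
 using emeasure_ball_le[of r x] lam_pos[of r x] by (simp add: emeasure_ball)

lemma measure_ball_mono: "A \<subseteq> ball x r ==> A \<in> sets \<mu> ==> measure \<mu> A \<le> vol x r"
 using emeasure_ball_finite[of x r] by (intro measure_mono_fmeasurable) (auto simp: fmeasurable_def)

lemma sigma_finite_mu: "sigma_finite_measure \<mu>"
proof
 obtain x :: 'a where True by simp
 show "\<exists>A. countable A \<and> A \<subseteq> sets \<mu> \<and> \<Union> A = space \<mu> \<and> (\<forall>a\<in>A. emeasure \<mu> a \<noteq> \<infinity>)"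
 proof (intro exI conjI ballI)
  show "countable (range (\<lambda>n. ball x (real n)))" by auto
  show "range (\<lambda>n. ball x (real n)) \<subseteq> sets \<mu>" by auto
  show "\<Union> (range (\<lambda>n. ball x (real n))) = space \<mu>"
   using reals_Archimedean2 by auto
  fix a assume "a \<in> range (\<lambda>n. ball x (real n))"
  then show "emeasure \<mu> a \<noteq> \<infinity>" using emeasure_ball_finite by (auto simp: less_top)
 qed
qed

sublocale sigma_finite_measure \<mu> by (rule sigma_finite_mu)

text \<open>The summand of the discrete coefficient. It is at most \<open>1\<close>, and comparable at
  comparable radii.\<close>

definition theta :: "'a => real => real" where "theta c r = vol c r / lam c r"

lemma theta_nonneg: "0 < r ==> 0 \<le> theta c r"
 using lam_pos[of r c] by (simp add: theta_def)

lemma theta_le_1: "0 < r ==> theta c r \<le> 1"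
 using measure_ball_le[of r c] lam_pos[of r c] by (simp add: theta_def)

lemma theta_dilate:
 assumes "0 < u" "u \<le> v" "v \<le> s * u"
 shows "theta c u \<le> dil s * theta c v"
proof -
 have s: "0 < s" using assms by (smt (verit) zero_less_mult_pos2)
 have "lam c v \<le> dil s * lam c u"
  using lam_mono[of v "s * u" c] lam_dilate[of u s c] assms s by linarith
 moreover have "vol c u \<le> vol c v"
  using assms by (intro measure_ball_mono) auto
 ultimately have "vol c u * lam c v \<le> vol c v * (dil s * lam c u)"
  using assms lam_pos[of v c] by (intro mult_mono) auto
 then show ?thesis using assms lam_pos[of u c] lam_pos[of v c]
  by (simp add: theta_def field_simps)
qed

lemma iterated_geometric_doubling:
 assumes "0 < r"
 shows "\<exists>F. finite F \<and> card F \<le> N0 ^ m \<and> ball (x::'a) r \<subseteq> (\<Union>y\<in>F. ball y (r / 2 ^ m))"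
proof (induction m)
 case 0
 show ?case by (intro exI[of _ "{x}"]) auto
next
 case (Suc m)
 then obtain F where F: "finite F" "card F \<le> N0 ^ m" "ball x r \<subseteq> (\<Union>y\<in>F. ball y (r / 2 ^ m))" by auto
 have "\<forall>y::'a. \<exists>G. finite G \<and> card G \<le> N0 \<and> ball y (r / 2 ^ m) \<subseteq> (\<Union>z\<in>G. ball z (r / 2 ^ m / 2))"
 proof
  fix y :: 'a
  have "0 < r / 2 ^ m" using assms by simp
  from geometric_doubling[OF this] show "\<exists>G. finite G \<and> card G \<le> N0 \<and> ball y (r / 2 ^ m) \<subseteq> (\<Union>z\<in>G. ball z (r / 2 ^ m / 2))" .
 qed
 from choice[OF this] obtain G :: "'a => 'a set" where
  "\<forall>y. finite (G y) \<and> card (G y) \<le> N0 \<and> ball y (r / 2 ^ m) \<subseteq> (\<Union>z\<in>G y. ball z (r / 2 ^ m / 2))" by blast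
 then have G: "\<And>y. finite (G y)" "\<And>y. card (G y) \<le> N0"
  "\<And>y. ball y (r / 2 ^ m) \<subseteq> (\<Union>z\<in>G y. ball z (r / 2 ^ m / 2))" by simp_all
 show ?case
 proof (intro exI[of _ "\<Union>y\<in>F. G y"] conjI)
  show "finite (\<Union>y\<in>F. G y)" using F G by auto
  have "card (\<Union>y\<in>F. G y) \<le> (\<Sum>y\<in>F. card (G y))" using F by (intro card_UN_le)
  also have "... \<le> card F * N0" using sum_bounded_above[of F "\<lambda>y. card (G y)" N0] G by simp
  also have "... \<le> N0 ^ Suc m" using F by simp
  finally show "card (\<Union>y\<in>F. G y) \<le> N0 ^ Suc m" .
  show "ball x r \<subseteq> (\<Union>y\<in>(\<Union>y\<in>F. G y). ball y (r / 2 ^ Suc m))"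
  proof
   fix w assume "w \<in> ball x r"
   then obtain y where y: "y \<in> F" "w \<in> ball y (r / 2 ^ m)" using F by blast
   then obtain z where "z \<in> G y" "w \<in> ball z (r / 2 ^ m / 2)" using G(3)[of y] by blast
   then show "w \<in> (\<Union>y\<in>(\<Union>y\<in>F. G y). ball y (r / 2 ^ Suc m))"
    using y by (auto simp: mult.commute)
  qed
 qed
qed

text \<open>Centres of coverings of the balls around one fixed point by ever smaller balls.\<close>

lemma separable: "\<exists>D::'a set. countable D \<and> (\<forall>x e. 0 < e --> (\<exists>y\<in>D. dist x y < (e::real)))"
proof -
 obtain x :: 'a where True by simp
 have "\<forall>n m. \<exists>F. finite F \<and> ball x (real (Suc n)) \<subseteq> (\<Union>y\<in>F. ball y (real (Suc n) / 2 ^ m))"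
  using iterated_geometric_doubling[of "real (Suc _)"] by (metis of_nat_0_less_iff zero_less_Suc)
 then obtain F where F: "\<And>n m. finite (F n m)"
  "\<And>n m. ball x (real (Suc n)) \<subseteq> (\<Union>y\<in>F n m. ball y (real (Suc n) / 2 ^ m))" by metis
 show ?thesis
 proof (intro exI[of _ "\<Union>n m. F n m"] conjI allI impI)
  show "countable (\<Union>n m. F n m)" using F(1) by (intro countable_UN countableI_type countable_finite)
  fix z and e :: real assume e: "0 < e"
  obtain n where n: "dist x z < real n" using reals_Archimedean2 by blast
  obtain m where "real (Suc n) / e < 2 ^ m" using real_arch_pow[of 2 "real (Suc n) / e"] by auto
  then have m: "real (Suc n) / 2 ^ m < e" using e by (simp add: field_simps)
  have "z \<in> ball x (real (Suc n))" using n by simp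
  then obtain y where "y \<in> F n m" "z \<in> ball y (real (Suc n) / 2 ^ m)" using F(2)[of n m] by blast
  then show "\<exists>y\<in>(\<Union>n m. F n m). dist z y < e" using m
   by (intro bexI[of _ y]) (auto simp: dist_commute)
 qed
qed

lemma countable_subcover:
 assumes "\<And>x. x \<in> S ==> open (U x)" "\<And>x. x \<in> S ==> x \<in> U x"
 shows "\<exists>S'\<subseteq>S. countable S' \<and> (S::'a set) \<subseteq> (\<Union>x\<in>S'. U x)"
 using separable countable_subcover_of_dense[OF _ _ assms] by metis

lemma AE_ess_support: "AE x in \<mu>. x \<notin> ess_support \<mu> f --> f x = 0"
proof -
 have "\<forall>x\<in>- ess_support \<mu> f. \<exists>U. open U \<and> x \<in> U \<and> (AE y in \<mu>. y \<in> U --> f y = 0)"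
  by (auto simp: ess_support_def)
 from bchoice[OF this] obtain U where
  "\<forall>x\<in>- ess_support \<mu> f. open (U x) \<and> x \<in> U x \<and> (AE y in \<mu>. y \<in> U x --> f y = 0)" by blast
 then have U: "\<And>x. x \<in> - ess_support \<mu> f ==> open (U x)" "\<And>x. x \<in> - ess_support \<mu> f ==> x \<in> U x"
  "\<And>x. x \<in> - ess_support \<mu> f ==> (AE y in \<mu>. y \<in> U x --> f y = 0)" by simp_all
 have "\<exists>S'\<subseteq>- ess_support \<mu> f. countable S' \<and> - ess_support \<mu> f \<subseteq> (\<Union>x\<in>S'. U x)"
  by (rule countable_subcover) (fact U)+
 then obtain S' where S': "S' \<subseteq> - ess_support \<mu> f" "countable S'" "- ess_support \<mu> f \<subseteq> (\<Union>x\<in>S'. U x)"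
  by (elim exE conjE)
 have "AE y in \<mu>. \<forall>x\<in>S'. y \<in> U x --> f y = 0"
  using S' U(3) by (subst AE_ball_countable) auto
 then show ?thesis
  by eventually_elim (use S' in blast)
qed

lemma ess_support_subset_closed:
 assumes "closed F" "AE x in \<mu>. x \<notin> F --> f x = 0"
 shows "ess_support \<mu> f \<subseteq> F"
proof
 fix x assume x: "x \<in> ess_support \<mu> f"
 show "x \<in> F"
 proof (rule ccontr)
  assume "x \<notin> F"
  have "\<forall>U. open U --> x \<in> U --> \<not> (AE y in \<mu>. y \<in> U --> f y = 0)"
   using x by (simp add: ess_support_def)
  from this[rule_format, of "- F"] show False using \<open>x \<notin> F\<close> assms by (simp add: open_Compl)
 qed
qed

lemma separable_prod:
 "\<exists>D::('a \<times> 'a) set. countable D \<and> (\<forall>x e. 0 < e --> (\<exists>y\<in>D. dist x y < (e::real)))"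
proof -
 obtain D :: "'a set" where D: "countable D" "\<forall>x e. 0 < e --> (\<exists>y\<in>D. dist x y < (e::real))"
  using separable by (elim exE conjE) (rule that)
 have "\<exists>w\<in>D \<times> D. dist x w < e" if e: "0 < e" for x :: "'a \<times> 'a" and e :: real
 proof -
  have e2: "0 < e / 2" using e by simp
  obtain y where y: "y \<in> D" "dist (fst x) y < e / 2" using D(2) e2 by blast
  obtain z where z: "z \<in> D" "dist (snd x) z < e / 2" using D(2) e2 by blast
  have "dist x (y, z) \<le> dist (fst x) y + dist (snd x) z"
   by (simp add: dist_prod_def sqrt_sum_squares_le_sum)
  then show ?thesis using y z by (intro bexI[of _ "(y, z)"]) auto
 qed
 then show ?thesis using D(1) by (intro exI[of _ "D \<times> D"]) auto
qed

text \<open>The product sigma-algebra contains the Borel sets of the product only because the space is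
  separable: an open set is a countable union of open boxes.\<close>

lemma open_prod_sets:
 fixes W :: "('a \<times> 'a) set"
 assumes W: "open W"
 shows "W \<in> sets (\<mu> \<Otimes>\<^sub>M \<mu>)"
proof -
 obtain D :: "('a \<times> 'a) set" where D: "countable D" "\<forall>x e. 0 < e --> (\<exists>y\<in>D. dist x y < (e::real))"
  using separable_prod by (elim exE conjE) (rule that)
 have "\<forall>z\<in>W. \<exists>P. open (fst P) \<and> open (snd P) \<and> z \<in> fst P \<times> snd P \<and> fst P \<times> snd P \<subseteq> W"
 proof
  fix z assume "z \<in> W"
  from open_prod_elim[OF W this] obtain A B where "open A" "open B" "z \<in> A \<times> B" "A \<times> B \<subseteq> W" by blast
  then show "\<exists>P. open (fst P) \<and> open (snd P) \<and> z \<in> fst P \<times> snd P \<and> fst P \<times> snd P \<subseteq> W"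
   by (intro exI[of _ "(A, B)"]) auto
 qed
 from bchoice[OF this] obtain P where
  P: "\<forall>z\<in>W. open (fst (P z)) \<and> open (snd (P z)) \<and> z \<in> fst (P z) \<times> snd (P z) \<and> fst (P z) \<times> snd (P z) \<subseteq> W"
  by blast
 have "\<exists>S'\<subseteq>W. countable S' \<and> W \<subseteq> (\<Union>z\<in>S'. fst (P z) \<times> snd (P z))"
 proof (rule countable_subcover_of_dense[of D])
  show "\<exists>y\<in>D. dist x y < e" if "0 < e" for x e using D(2) that by blast
  show "open (fst (P z) \<times> snd (P z))" if "z \<in> W" for z using P that by (intro open_Times) auto
  show "z \<in> fst (P z) \<times> snd (P z)" if "z \<in> W" for z using P that by blast
 qed (fact D(1))
 then obtain S' where S': "S' \<subseteq> W" "countable S'" "W \<subseteq> (\<Union>z\<in>S'. fst (P z) \<times> snd (P z))"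
  by (elim exE conjE)
 have "W = (\<Union>z\<in>S'. fst (P z) \<times> snd (P z))" using S' P by blast
 also have "... \<in> sets (\<mu> \<Otimes>\<^sub>M \<mu>)"
  using S' P by (intro sets.countable_UN'') (auto intro!: pair_measureI)
 finally show ?thesis .
qed

lemma locally_integrable_measurable:
 assumes "locally_integrable_on \<mu> UNIV f"
 shows "bmeas f"
proof -
 obtain D :: "'a set" where D: "countable D" "\<forall>x e. 0 < e --> (\<exists>y\<in>D. dist x y < (e::real))"
  using separable by (elim exE conjE) (rule that)
 have "bmeas (\<lambda>x. indicator UNIV x *\<^sub>R f x)"
 proof (rule locally_integrable_on_measurable[of D])
  show "\<exists>y\<in>D. dist x y < e" if "0 < e" for x e using D(2) that by blast
 qed (use D(1) assms in simp_all)
 then show ?thesis by simp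
qed

text \<open>The kernel is used through Tonelli, hence must be measurable for the product sigma-algebra;
  the diagonal, where its values are arbitrary, is sent to \<open>0\<close>.\<close>

lemma locally_integrable_off_diagonal_measurable:
 assumes "locally_integrable_on (\<mu> \<Otimes>\<^sub>M \<mu>) {(x, y). x \<noteq> y} (\<lambda>(x, y). K x y)"
 shows "(\<lambda>z. if fst z = snd z then 0 else K (fst z) (snd z)) \<in> borel_measurable (\<mu> \<Otimes>\<^sub>M \<mu>)"
proof -
 obtain D :: "('a \<times> 'a) set" where D: "countable D" "\<forall>x e. 0 < e --> (\<exists>y\<in>D. dist x y < (e::real))"
  using separable_prod by (elim exE conjE) (rule that)
 have "open {z :: 'a \<times> 'a. fst z \<noteq> snd z}"
  by (intro open_Collect_neq continuous_intros)
 moreover have "{z :: 'a \<times> 'a. fst z \<noteq> snd z} = {(x, y). x \<noteq> y}" by auto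
 ultimately have op: "open {(x::'a, y). x \<noteq> y}" by (simp only:)
 have "(\<lambda>z. indicator {(x, y). x \<noteq> y} z *\<^sub>R (case z of (x, y) => K x y)) \<in> borel_measurable (\<mu> \<Otimes>\<^sub>M \<mu>)"
 proof (rule locally_integrable_on_measurable[of D])
  show "\<exists>y\<in>D. dist x y < e" if "0 < e" for x e using D(2) that by blast
 qed (use D(1) assms op open_prod_sets in simp_all)
 also have "(\<lambda>z. indicator {(x, y). x \<noteq> y} z *\<^sub>R (case z of (x, y) => K x y)) =
   (\<lambda>z. if fst z = snd z then 0 else K (fst z) (snd z))"
  by (auto simp: fun_eq_iff indicator_def)
 finally show ?thesis .
qed

lemma lam_dist_measurable [measurable]: "bmeas (\<lambda>x. lam y (dist y x))"
proof -
 define g where "g r = (if 0 < r then lam y r else 0)" for r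
 have "mono g" unfolding g_def mono_def using lam_mono lam_pos by (auto intro: less_imp_le)
 then have g: "g \<in> borel_measurable borel" by (rule borel_measurable_mono)
 have d: "bmeas (\<lambda>x. dist y x)"
  unfolding borel_measurable_iff by (intro borel_measurable_continuous_onI continuous_intros)
 have "bmeas (\<lambda>x. if x \<in> {y} then lam y 0 else g (dist y x))"
  using measurable_compose[OF d g] by (intro measurable_If_set) auto
 also have "(\<lambda>x. if x \<in> {y} then lam y 0 else g (dist y x)) = (\<lambda>x. lam y (dist y x))"
  by (auto simp: g_def fun_eq_iff)
 finally show ?thesis .
qed

lemma lam_less_sets [measurable]: "{x. lam y (dist y x) < s} \<in> sets \<mu>"
proof -
 have "{x \<in> space \<mu>. lam y (dist y x) < s} \<in> sets \<mu>" by measurable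
 then show ?thesis by simp
qed

lemma singleton_sets [measurable]: "{y::'a} \<in> sets \<mu>" by auto

text \<open>The set is contained in a ball centred at \<open>y\<close> of at most twice the distance of
  one of its points, and there \<open>lam\<close> is at most \<open>Cl * s\<close>.\<close>

lemma emeasure_lam_less:
 assumes "0 < s"
 shows "emeasure \<mu> {x. x \<noteq> y \<and> lam y (dist y x) < s} \<le> ennreal (Cl * s)"
proof -
 define V where "V n = {x \<in> ball y (real n). x \<noteq> y \<and> lam y (dist y x) < s}" for n
 have [measurable]: "V n \<in> sets \<mu>" for n
 proof -
  have "V n = {x. lam y (dist y x) < s} \<inter> ball y (real n) - {y}" by (auto simp: V_def)
  also have "... \<in> sets \<mu>" by measurable
  finally show ?thesis .
 qed
 have V: "emeasure \<mu> (V n) \<le> ennreal (Cl * s)" for n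
 proof (cases "V n = {}")
  case False
  define R where "R = (SUP x\<in>V n. dist y x)"
  have bdd: "bdd_above (dist y ` V n)" by (auto simp: V_def intro!: bdd_aboveI[of _ "real n"])
  have R: "dist y x \<le> R" if "x \<in> V n" for x using that bdd unfolding R_def by (rule cSUP_upper)
  obtain x0 where "x0 \<in> V n" using False by auto
  then have "0 < R" using R[of x0] by (auto simp: V_def) (metis dist_pos_lt order_less_le_trans)
  then obtain x where x: "x \<in> V n" "R / 2 < dist y x"
   using less_cSUP_iff[OF False bdd, of "R/2"] unfolding R_def by auto
  have d: "0 < dist y x" using x by (auto simp: V_def)
  have "V n \<subseteq> ball y (2 * dist y x)" using R x by fastforce
  then have "emeasure \<mu> (V n) \<le> emeasure \<mu> (ball y (2 * dist y x))" by (intro emeasure_mono) auto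
  also have "... \<le> ennreal (lam y (2 * dist y x))" using d by (intro emeasure_ball_le) auto
  also have "lam y (2 * dist y x) \<le> Cl * lam y (dist y x)" using lam_half[of "2 * dist y x" y] d by simp
  also have "... \<le> Cl * s" using x C_lam_ge_1 by (intro mult_left_mono) (auto simp: V_def)
  finally show ?thesis by (auto intro: ennreal_leI)
 qed simp
 have "emeasure \<mu> (\<Union>n. V n) = (SUP n. emeasure \<mu> (V n))"
 proof (rule SUP_emeasure_incseq[symmetric])
  show "incseq V" by (auto simp: incseq_def V_def intro: order_less_le_trans)
 qed auto
 also have "... \<le> ennreal (Cl * s)" using V by (intro SUP_least)
 also have "(\<Union>n. V n) = {x. x \<noteq> y \<and> lam y (dist y x) < s}"
  using reals_Archimedean2 by (auto simp: V_def)
 finally show ?thesis .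
qed

text \<open>Away from \<open>y\<close>, the function \<open>x \<mapsto> lam y (dist y x)\<close> takes
  values below \<open>s\<close> on a set of measure \<open>O(s)\<close> only, so its power
  \<open>\<alpha> - 1\<close> is in weak \<open>L\<^sup>q\<close> for \<open>q = 1 / (1 -
  \<alpha>)\<close>, uniformly in \<open>y\<close>. This single estimate is the substitute for the
  homogeneity of the Riesz kernel.\<close>

lemma fractional_kernel_weak_bound:
 fixes \<alpha> :: real
 assumes \<alpha>: "0 < \<alpha>" "\<alpha> < 1"
 shows "\<exists>c>0. \<forall>y. \<forall>A\<in>sets \<mu>. emeasure \<mu> A < \<infinity> -->
  (mass (A - {y}) (\<lambda>x. lam y (dist y x) powr (\<alpha> - 1))) \<le> ennreal (c * measure \<mu> A powr \<alpha>)"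
proof -
 define c where "c = 1 + Cl * 2 powr (1 - \<alpha>) / (1 - 2 powr (- \<alpha>))"
 have q: "2 powr (- \<alpha>) < (1::real)" using \<alpha> powr_less_mono[of "-\<alpha>" 0 2] by simp
 have c: "0 < c" unfolding c_def using q C_lam_ge_1 by (intro add_pos_nonneg) auto
 show ?thesis
 proof (intro exI[of _ c] conjI c allI ballI impI)
  fix y A assume A[measurable]: "A \<in> sets \<mu>" and fin: "emeasure \<mu> A < \<infinity>"
  define a where "a = measure \<mu> A"
  show "mass (A - {y}) (\<lambda>x. lam y (dist y x) powr (\<alpha> - 1)) \<le> ennreal (c * measure \<mu> A powr \<alpha>)"
  proof (cases "a = 0")
   case True
   then have "A \<in> null_sets \<mu>"
    using fin A by (auto simp: a_def emeasure_eq_ennreal_measure top.not_eq_extremum)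
   then have "AE x in \<mu>. ennreal (lam y (dist y x) powr (\<alpha> - 1)) * indicator (A - {y}) x = 0"
    by (rule AE_I') (auto simp: indicator_def)
   then have "mass (A - {y}) (\<lambda>x. lam y (dist y x) powr (\<alpha> - 1)) = (\<integral>\<^sup>+x. 0 \<partial>\<mu>)"
    by (rule nn_integral_cong_AE)
   then show ?thesis by simp
  next
   case False
   then have a: "0 < a" by (simp add: a_def zero_less_measure_iff)
   define V where "V s = {x. x \<noteq> y \<and> lam y (dist y x) < s}" for s
   have [measurable]: "V s \<in> sets \<mu>" for s
   proof -
    have "V s = {x. lam y (dist y x) < s} - {y}" by (auto simp: V_def)
    also have "... \<in> sets \<mu>" by measurable
    finally show ?thesis .
   qed
   define w where "w n = a / 2 ^ Suc n" for n
   have w: "0 < w n" for n using a by (simp add: w_def)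
   have pt: "ennreal (lam y (dist y x) powr (\<alpha> - 1)) * indicator (A - {y}) x \<le>
    ennreal (a powr (\<alpha> - 1)) * indicator A x + (\<Sum>n. ennreal (w n powr (\<alpha> - 1)) * indicator (V (2 * w n)) x)" for x
   proof (cases "x \<in> A - {y}")
    case x: True
    define l where "l = lam y (dist y x)"
    have l: "0 < l" using x by (auto simp: l_def intro!: lam_pos)
    show ?thesis
    proof (cases "a \<le> l")
     case True
     then have "l powr (\<alpha> - 1) \<le> a powr (\<alpha> - 1)" using a \<alpha> by (intro powr_mono2') auto
     then have "ennreal (l powr (\<alpha> - 1)) \<le> ennreal (a powr (\<alpha> - 1))" by (rule ennreal_leI)
     then show ?thesis using x by (auto simp: l_def[symmetric] intro: add_increasing2)
    next
     case False
     define n where "n = (LEAST n. w n \<le> l)"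
     have "\<exists>n. w n \<le> l"
     proof -
      obtain n where "a / l < 2 ^ n" using real_arch_pow[of 2 "a/l"] by auto
      then have "a < l * 2 ^ n" using l by (simp add: field_simps)
      also have "... \<le> l * 2 ^ Suc n" using l by simp
      finally show ?thesis by (auto simp: w_def divide_simps intro!: exI[of _ n])
     qed
     then have n: "w n \<le> l" unfolding n_def by (rule LeastI_ex)
     have n2: "l < 2 * w n"
     proof (cases n)
      case 0
      then show ?thesis using False by (simp add: w_def)
     next
      case (Suc m)
      then have "\<not> w m \<le> l" using not_less_Least[of m "\<lambda>n. w n \<le> l"] by (simp add: n_def)
      then show ?thesis using Suc by (simp add: w_def)
     qed
     have "l powr (\<alpha> - 1) \<le> w n powr (\<alpha> - 1)" using n w[of n] \<alpha> by (intro powr_mono2') auto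
     then have "ennreal (l powr (\<alpha> - 1)) \<le> ennreal (w n powr (\<alpha> - 1)) * indicator (V (2 * w n)) x"
      using x n2 by (auto simp: V_def l_def indicator_def intro: ennreal_leI)
     also have "... \<le> (\<Sum>n. ennreal (w n powr (\<alpha> - 1)) * indicator (V (2 * w n)) x)"
     proof -
      have "h n \<le> (\<Sum>n. h n)" for h :: "nat => ennreal"
       using sum_le_suminf[OF summableI, of "{n}" h] by simp
      then show ?thesis .
     qed
     finally show ?thesis using x by (auto simp: l_def[symmetric] intro: add_increasing)
    qed
   qed simp
   have "mass (A - {y}) (\<lambda>x. lam y (dist y x) powr (\<alpha> - 1)) \<le>
    (\<integral>\<^sup>+x. ennreal (a powr (\<alpha> - 1)) * indicator A x + (\<Sum>n. ennreal (w n powr (\<alpha> - 1)) * indicator (V (2 * w n)) x) \<partial>\<mu>)"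
    by (intro nn_integral_mono pt)
   also have "... = ennreal (a powr (\<alpha> - 1)) * emeasure \<mu> A + (\<Sum>n. ennreal (w n powr (\<alpha> - 1)) * emeasure \<mu> (V (2 * w n)))"
    by (subst nn_integral_add) (auto simp: nn_integral_suminf nn_integral_cmult_indicator)
   also have "... \<le> ennreal (a powr (\<alpha> - 1)) * ennreal a + (\<Sum>n. ennreal (w n powr (\<alpha> - 1)) * ennreal (Cl * (2 * w n)))"
   proof (intro add_mono suminf_le summableI)
    show "ennreal (a powr (\<alpha> - 1)) * emeasure \<mu> A \<le> ennreal (a powr (\<alpha> - 1)) * ennreal a"
     using fin by (simp add: a_def emeasure_eq_ennreal_measure top.not_eq_extremum)
    show "ennreal (w n powr (\<alpha> - 1)) * emeasure \<mu> (V (2 * w n)) \<le> ennreal (w n powr (\<alpha> - 1)) * ennreal (Cl * (2 * w n))" for n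
     unfolding V_def using w[of n] by (intro mult_left_mono emeasure_lam_less) auto
   qed
   also have "(\<lambda>n. ennreal (w n powr (\<alpha> - 1)) * ennreal (Cl * (2 * w n))) =
    (\<lambda>n. ennreal ((Cl * 2 powr (1 - \<alpha>) * a powr \<alpha>) * (2 powr (- \<alpha>)) ^ n))"
   proof
    fix n
    have wn: "w n = a * 2 powr (- real (Suc n))"
     by (simp only: w_def powr_minus powr_realpow[of 2] zero_less_numeral divide_inverse)
    have "w n powr \<alpha> = a powr \<alpha> * 2 powr (- \<alpha> * real (Suc n))"
     unfolding wn using a by (simp add: powr_mult powr_powr algebra_simps)
    also have "(2::real) powr (- \<alpha> * real (Suc n)) = 2 powr (- \<alpha>) * (2 powr (- \<alpha>)) ^ n"
     by (subst powr_realpow[symmetric]) (auto simp: powr_powr powr_add[symmetric] algebra_simps)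
    finally have w2: "w n powr \<alpha> = a powr \<alpha> * (2 powr (- \<alpha>) * (2 powr (- \<alpha>)) ^ n)" .
    have w3: "w n powr (\<alpha> - 1) * w n = w n powr \<alpha>"
     using powr_add[of "w n" "\<alpha> - 1" 1] w[of n] by simp
    have "w n powr (\<alpha> - 1) * (Cl * (2 * w n)) = 2 * Cl * (w n powr (\<alpha> - 1) * w n)" by simp
    also have "... = Cl * (2 powr 1 * 2 powr (- \<alpha>)) * a powr \<alpha> * (2 powr (- \<alpha>)) ^ n"
     unfolding w3 w2 by simp
    also have "(2::real) powr 1 * 2 powr (- \<alpha>) = 2 powr (1 - \<alpha>)" by (simp only: powr_add[symmetric]) simp
    finally show "ennreal (w n powr (\<alpha> - 1)) * ennreal (Cl * (2 * w n)) = ennreal ((Cl * 2 powr (1 - \<alpha>) * a powr \<alpha>) * (2 powr (- \<alpha>)) ^ n)"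
     using w[of n] C_lam_ge_1 by (simp add: ennreal_mult[symmetric])
   qed
   also have "(\<Sum>n. ennreal ((Cl * 2 powr (1 - \<alpha>) * a powr \<alpha>) * (2 powr (- \<alpha>)) ^ n))
    = ennreal (\<Sum>n. (Cl * 2 powr (1 - \<alpha>) * a powr \<alpha>) * (2 powr (- \<alpha>)) ^ n)"
    using q C_lam_ge_1 by (intro suminf_ennreal2 summable_mult summable_geometric) auto
   also have "(\<Sum>n. (Cl * 2 powr (1 - \<alpha>) * a powr \<alpha>) * (2 powr (- \<alpha>)) ^ n) =
    (Cl * 2 powr (1 - \<alpha>) * a powr \<alpha>) * (1 / (1 - 2 powr (- \<alpha>)))"
    using q by (subst suminf_mult) (auto intro!: summable_geometric simp: suminf_geometric)
   also have "ennreal (a powr (\<alpha> - 1)) * ennreal a = ennreal (a powr \<alpha>)"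
    using a by (simp add: ennreal_mult[symmetric] powr_mult_base[symmetric] powr_diff)
   also have "ennreal (a powr \<alpha>) + ennreal (Cl * 2 powr (1 - \<alpha>) * a powr \<alpha> * (1 / (1 - 2 powr - \<alpha>))) =
     ennreal (c * a powr \<alpha>)"
    using q C_lam_ge_1 by (subst ennreal_plus[symmetric]) (auto simp: c_def algebra_simps)
   finally show ?thesis by (simp add: a_def)
  qed
 qed
qed

end

section \<open>Discrete coefficients and regular means\<close>

text \<open>Removes the exponent \<open>g\<close> from the regularity condition on the means. The
  indices from \<open>i\<close> to \<open>j\<close> are cut greedily into runs along which the sum of
  \<open>t\<close> stays bounded; a run costs a constant, and the number of runs is controlled by the
  whole sum.\<close>

lemma greedy_chain:
 fixes m :: "nat => 'b::real_normed_vector" and t :: "nat => real" and C g :: real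
 assumes t: "\<And>k. 0 \<le> t k" "\<And>k. t k \<le> 1" and g: "0 \<le> g" and C: "0 \<le> C"
  and step: "\<And>i j. i \<le> j ==> norm (m i - m j) \<le> C * (1 + (\<Sum>k=i..j. t k)) powr g"
 shows "i \<le> j ==> norm (m i - m j) \<le> C * 4 powr g * (1 + (\<Sum>k=i..j. t k))"
proof (induction "j - i" arbitrary: i rule: less_induct)
 case less
 have s0: "0 \<le> (\<Sum>k=i..j. t k)" for i j by (intro sum_nonneg t)
 have small: "norm (m i - m j) \<le> C * 4 powr g * (1 + (\<Sum>k=i..j. t k))"
  if "i \<le> j" "(\<Sum>k=i..j. t k) \<le> 3" for i j
 proof -
  have "norm (m i - m j) \<le> C * (1 + (\<Sum>k=i..j. t k)) powr g" by (rule step) fact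
  also have "... \<le> C * 4 powr g" using C g that s0[of i j] by (intro mult_left_mono powr_mono2) auto
  also have "... \<le> C * 4 powr g * (1 + (\<Sum>k=i..j. t k))"
   using C s0[of i j] mult_left_mono[of 1 "1 + (\<Sum>k=i..j. t k)" "C * 4 powr g"] by simp
  finally show ?thesis .
 qed
 show ?case
 proof (cases "(\<Sum>k=i..j. t k) \<le> 1")
  case True
  then show ?thesis using small[OF less.prems] by simp
 next
  case False
  define l where "l = (LEAST l. i \<le> l \<and> 1 < (\<Sum>k=i..l. t k))"
  have ex: "i \<le> j \<and> 1 < (\<Sum>k=i..j. t k)" using False less.prems by simp
  have l: "i \<le> l" "1 < (\<Sum>k=i..l. t k)"
   using LeastI[of "\<lambda>l. i \<le> l \<and> 1 < (\<Sum>k=i..l. t k)", OF ex] by (auto simp: l_def)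
  have lj: "l \<le> j" unfolding l_def by (rule Least_le) (fact ex)
  have "(\<Sum>k=i..l. t k) \<le> 2"
  proof (cases "l = i")
   case True
   then show ?thesis using t(2)[of i] by simp
  next
   case False
   then obtain l' where l': "l = Suc l'" "i \<le> l'" using l(1) by (cases l) auto
   have "\<not> (i \<le> l' \<and> 1 < (\<Sum>k=i..l'. t k))"
    by (rule not_less_Least) (use l' in \<open>auto simp: l_def[symmetric]\<close>)
   then show ?thesis using l' t(2)[of l] by simp
  qed
  show ?thesis
  proof (cases "l = j")
   case True
   then show ?thesis using small[OF less.prems] \<open>_ \<le> 2\<close> by simp
  next
   case False
   then have lj': "Suc l \<le> j" using lj by simp
   have sp: "(\<Sum>k=i..j. t k) = (\<Sum>k=i..l. t k) + (\<Sum>k=Suc l..j. t k)"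
   proof -
    have "{i..j} = {i..l} \<union> {Suc l..j}" using l(1) lj by auto
    then show ?thesis by (simp add: sum.union_disjoint)
   qed
   have "norm (m i - m (Suc l)) \<le> C * (1 + (\<Sum>k=i..Suc l. t k)) powr g"
    using l by (intro step) simp
   also have "... \<le> C * 4 powr g"
    using C g \<open>_ \<le> 2\<close> l t(2)[of "Suc l"] s0[of i "Suc l"] by (intro mult_left_mono powr_mono2) auto
   finally have a: "norm (m i - m (Suc l)) \<le> C * 4 powr g * 1" by simp
   have b: "norm (m (Suc l) - m j) \<le> C * 4 powr g * (1 + (\<Sum>k=Suc l..j. t k))"
    using lj' l(1) by (intro less.hyps) auto
   have "norm (m i - m j) \<le> norm (m i - m (Suc l)) + norm (m (Suc l) - m j)"
    using norm_triangle_ineq[of "m i - m (Suc l)" "m (Suc l) - m j"] by simp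
   also have "... \<le> C * 4 powr g * (1 + (1 + (\<Sum>k=Suc l..j. t k)))"
    using a b by (simp add: algebra_simps)
   also have "... \<le> C * 4 powr g * (1 + (\<Sum>k=i..j. t k))"
    using l C by (intro mult_left_mono) (auto simp: sp)
   finally show ?thesis .
  qed
 qed
qed

context nonhomogeneous begin

lemma Least_power_index:
 fixes \<rho> r s :: real
 assumes "1 < \<rho>" "0 < r" "0 < s"
 shows "(LEAST N::int. \<rho> powi N * r \<ge> s) = \<lceil>log \<rho> (s / r)\<rceil>"
proof -
 have eq: "\<rho> powi N * r \<ge> s \<longleftrightarrow> log \<rho> (s / r) \<le> N" for N :: int
 proof -
  have "\<rho> powi N * r \<ge> s \<longleftrightarrow> s / r \<le> \<rho> powr N" using assms by (simp add: powr_real_of_int' divide_le_eq)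
  also have "... \<longleftrightarrow> log \<rho> (s / r) \<le> N" using assms by (simp add: log_le_iff)
  finally show ?thesis .
 qed
 show ?thesis unfolding eq by (rule Least_equality) (auto simp: ceiling_le_iff)
qed

lemma K_tilde_eq:
 assumes "1 < \<rho>" "0 < r" "0 < s"
 shows "K_tilde \<mu> lam \<rho> c r s = 1 + (\<Sum>k = - \<lfloor>log \<rho> 2\<rfloor> .. \<lceil>log \<rho> (s / r)\<rceil>. theta c (\<rho> powi k * r))"
 using assms by (simp add: K_tilde_def theta_def Least_power_index)

lemma K_tilde_ge_1:
 assumes "1 < \<rho>" "0 < r" "0 < s"
 shows "1 \<le> K_tilde \<mu> lam \<rho> c r s"
 unfolding K_tilde_eq[OF assms] using assms by (auto intro!: sum_nonneg theta_nonneg)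

lemma K_tilde_comparable:
 assumes "1 < \<rho>" "1 \<le> A" "0 < r" "0 < s" "s \<le> A * r"
 shows "K_tilde \<mu> lam \<rho> c r s \<le> 1 + real (nat (\<lceil>log \<rho> A\<rceil> + \<lfloor>log \<rho> 2\<rfloor> + 1))"
proof -
 have "(\<Sum>k = - \<lfloor>log \<rho> 2\<rfloor> .. \<lceil>log \<rho> (s / r)\<rceil>. theta c (\<rho> powi k * r))
   \<le> real (card {- \<lfloor>log \<rho> 2\<rfloor> .. \<lceil>log \<rho> (s / r)\<rceil>}) * 1"
  using assms by (intro sum_bounded_above theta_le_1) auto
 also have "... \<le> real (nat (\<lceil>log \<rho> A\<rceil> + \<lfloor>log \<rho> 2\<rfloor> + 1))"
 proof -
  have "log \<rho> (s / r) \<le> log \<rho> A" using assms by (simp add: divide_le_eq)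
  then have "\<lceil>log \<rho> (s / r)\<rceil> \<le> \<lceil>log \<rho> A\<rceil>" by (rule ceiling_mono)
  then show ?thesis by simp
 qed
 finally show ?thesis using assms by (simp add: K_tilde_eq)
qed

text \<open>A power of one base lies within a bounded factor of a power of the other,
  \<open>theta\<close> is comparable at comparable radii, and boundedly many powers of one base share
  the same neighbour.\<close>

lemma K_tilde_change_base:
 assumes \<rho>: "1 < \<rho>" and \<tau>: "1 < \<tau>"
 shows "\<exists>D\<ge>0. \<forall>c r n. 0 < r -->
     K_tilde \<mu> lam \<rho> c r (\<tau> ^ n * r) \<le> D * (1 + (\<Sum>i\<le>n. theta c (\<tau> ^ i * r)))"
proof -
 define l where "l = real_of_int \<lfloor>log \<rho> 2\<rfloor>"
 define a where "a = log \<tau> \<rho>"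
 define M where "M = 1 / a + 1"
 have l: "0 \<le> l" using \<rho> by (simp add: l_def)
 have a: "0 < a" using \<rho> \<tau> by (simp add: a_def)
 have M: "0 \<le> M" using a by (simp add: M_def)
 define D where "D = 2 + l + dil \<tau> * M"
 have D: "0 \<le> D" using l M dil_ge_1[of \<tau>] unfolding D_def by (intro add_nonneg_nonneg mult_nonneg_nonneg) auto
 show ?thesis
 proof (intro exI[of _ D] conjI D allI impI)
  fix c :: 'a and r :: real and n :: nat assume r: "0 < r"
  define N where "N = \<lceil>log \<rho> (\<tau> ^ n)\<rceil>"
  have "1 \<le> \<tau> ^ n" using \<tau> by (intro one_le_power) simp
  then have "0 \<le> log \<rho> (\<tau> ^ n)" using \<rho> by (subst zero_le_log_cancel_iff) auto
  then have N0: "0 \<le> N" by (simp add: N_def)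
  define f where "f k = theta c (\<rho> powi k * r)" for k :: int
  define h where "h i = theta c (\<tau> ^ i * r)" for i :: nat
  have f1: "f k \<le> 1" and f0: "0 \<le> f k" for k using \<rho> r by (auto simp: f_def intro!: theta_le_1 theta_nonneg)
  have h0: "0 \<le> h i" for i using \<tau> r by (auto simp: h_def intro!: theta_nonneg)
  define i where "i k = nat \<lceil>a * real_of_int k\<rceil>" for k :: int
  have key: "f k \<le> dil \<tau> * h (i k)" and ile: "i k \<le> n"
   if k: "k \<in> {0..<N}" for k
  proof -
   have pk: "\<rho> powi k = \<tau> powr (a * k)"
    using \<rho> \<tau> by (simp add: a_def powr_powr[symmetric] powr_real_of_int')
   have ik: "real (i k) = \<lceil>a * real_of_int k\<rceil>" using a k by (simp add: i_def)
   have pi: "\<tau> ^ i k = \<tau> powr real (i k)" using \<tau> by (simp add: powr_realpow)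
   have 1: "\<rho> powi k \<le> \<tau> ^ i k" unfolding pk pi using \<tau> ik by (intro powr_mono) linarith+
   have "\<tau> ^ i k \<le> \<tau> powr (a * k + 1)" unfolding pi using \<tau> ik by (intro powr_mono) linarith+
   then have 2: "\<tau> ^ i k \<le> \<tau> * \<rho> powi k" using \<tau> by (simp add: pk powr_add mult.commute)
   show "f k \<le> dil \<tau> * h (i k)" unfolding f_def h_def
    using 1 2 r \<rho> by (intro theta_dilate) (auto simp: mult.assoc[symmetric])
   have "real_of_int k \<le> log \<rho> (\<tau> ^ n)" using k by (auto simp: N_def) linarith
   also have "... = real n / a" using \<rho> \<tau> by (simp add: a_def log_nat_power log_base_change[of \<tau> \<rho> \<tau>])
   finally have "a * real_of_int k \<le> real n" using a by (simp add: field_simps)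
   then have "\<lceil>a * real_of_int k\<rceil> \<le> int n" by (subst ceiling_le_iff) simp
   then show "i k \<le> n" unfolding i_def nat_le_iff .
  qed
  have cardM: "real (card {k. k \<in> {0..<N} \<and> i k = j}) \<le> M" for j
  proof -
   have "{k. k \<in> {0..<N} \<and> i k = j} \<subseteq> {\<lceil>(real j - 1) / a\<rceil> .. \<lfloor>real j / a\<rfloor>}"
   proof
    fix k assume k: "k \<in> {k. k \<in> {0..<N} \<and> i k = j}"
    then have "real j = \<lceil>a * real_of_int k\<rceil>" using a by (auto simp: i_def)
    then have "real j - 1 \<le> a * real_of_int k" "a * real_of_int k \<le> real j" by linarith+
    then have "(real j - 1) / a \<le> k" "k \<le> real j / a" using a by (auto simp: field_simps)
    then show "k \<in> {\<lceil>(real j - 1) / a\<rceil> .. \<lfloor>real j / a\<rfloor>}" by (simp add: ceiling_le_iff le_floor_iff)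
   qed
   then have "card {k. k \<in> {0..<N} \<and> i k = j} \<le> card {\<lceil>(real j - 1) / a\<rceil> .. \<lfloor>real j / a\<rfloor>}"
    by (intro card_mono) auto
   also have "... = nat (\<lfloor>real j / a\<rfloor> + 1 - \<lceil>(real j - 1) / a\<rceil>)" by simp
   finally have "real (card {k. k \<in> {0..<N} \<and> i k = j}) \<le> max 0 (real_of_int \<lfloor>real j / a\<rfloor> + 1 - real_of_int \<lceil>(real j - 1) / a\<rceil>)"
    by linarith
   also have "... \<le> max 0 (real j / a + 1 - (real j - 1) / a)" by linarith
   also have "real j / a + 1 - (real j - 1) / a = M" by (simp add: M_def diff_divide_distrib)
   finally show ?thesis using M by simp
  qed
  have "(\<Sum>k\<in>{0..<N}. f k) \<le> (\<Sum>k\<in>{0..<N}. dil \<tau> * h (i k))" by (intro sum_mono key)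
  also have "... = dil \<tau> * (\<Sum>k\<in>{0..<N}. h (i k))" by (simp add: sum_distrib_left)
  also have "(\<Sum>k\<in>{0..<N}. h (i k)) = (\<Sum>j\<in>{..n}. \<Sum>k\<in>{k. k \<in> {0..<N} \<and> i k = j}. h (i k))"
   using ile by (intro sum.group[symmetric]) auto
  also have "... = (\<Sum>j\<in>{..n}. real (card {k. k \<in> {0..<N} \<and> i k = j}) * h j)"
   by (intro sum.cong refl) (simp add: sum.cong)
  also have "... \<le> (\<Sum>j\<in>{..n}. M * h j)" using h0 by (intro sum_mono mult_right_mono cardM)
  finally have main: "(\<Sum>k\<in>{0..<N}. f k) \<le> dil \<tau> * M * (\<Sum>j\<le>n. h j)"
   using dil_ge_1[of \<tau>] by (simp add: sum_distrib_left mult.assoc mult_left_mono)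
  have "(\<Sum>k = - \<lfloor>log \<rho> 2\<rfloor> .. N. f k) \<le> (\<Sum>k\<in>{- \<lfloor>log \<rho> 2\<rfloor> ..<0} \<union> {0..<N} \<union> {N}. f k)"
   using f0 by (intro sum_mono2) auto
  also have "... \<le> (\<Sum>k\<in>{- \<lfloor>log \<rho> 2\<rfloor> ..<0}. f k) + (\<Sum>k\<in>{0..<N}. f k) + (\<Sum>k\<in>{N}. f k)"
  proof -
   have "(\<Sum>k\<in>{- \<lfloor>log \<rho> 2\<rfloor> ..<0} \<union> {0..<N} \<union> {N}. f k) = (\<Sum>k\<in>{- \<lfloor>log \<rho> 2\<rfloor> ..<0} \<union> {0..<N}. f k) + (\<Sum>k\<in>{N}. f k)"
    using N0 by (intro sum.union_disjoint) auto
   also have "(\<Sum>k\<in>{- \<lfloor>log \<rho> 2\<rfloor> ..<0} \<union> {0..<N}. f k) = (\<Sum>k\<in>{- \<lfloor>log \<rho> 2\<rfloor> ..<0}. f k) + (\<Sum>k\<in>{0..<N}. f k)"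
    by (intro sum.union_disjoint) auto
   finally show ?thesis by simp
  qed
  also have "(\<Sum>k\<in>{- \<lfloor>log \<rho> 2\<rfloor> ..<0}. f k) \<le> real (card {- \<lfloor>log \<rho> 2\<rfloor> ..<0}) * 1"
   by (intro sum_bounded_above f1)
  also have "... = l" using l by (simp add: l_def)
  finally have "(\<Sum>k = - \<lfloor>log \<rho> 2\<rfloor> .. N. f k) \<le> l + dil \<tau> * M * (\<Sum>j\<le>n. h j) + 1"
   using main f1[of N] by simp
  moreover have "K_tilde \<mu> lam \<rho> c r (\<tau> ^ n * r) = 1 + (\<Sum>k = - \<lfloor>log \<rho> 2\<rfloor> .. N. f k)"
   using \<rho> \<tau> r by (simp add: K_tilde_eq N_def f_def)
  moreover have S0: "0 \<le> (\<Sum>j\<le>n. h j)" by (intro sum_nonneg h0)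
  moreover have "2 + l + dil \<tau> * M * (\<Sum>j\<le>n. h j) \<le> D * (1 + (\<Sum>j\<le>n. h j))"
  proof -
   have "0 \<le> (2 + l) * (\<Sum>j\<le>n. h j)" "0 \<le> dil \<tau> * M"
    using S0 l M dil_ge_1[of \<tau>] by (auto intro!: mult_nonneg_nonneg)
   then show ?thesis by (simp add: D_def algebra_simps)
  qed
  ultimately show "K_tilde \<mu> lam \<rho> c r (\<tau> ^ n * r) \<le> D * (1 + (\<Sum>i\<le>n. theta c (\<tau> ^ i * r)))"
   by (simp add: h_def)
 qed
qed

lemma sum_theta_le_K_tilde:
 assumes \<rho>: "1 < \<rho>" and A: "0 < A"
 shows "\<exists>D\<ge>1. \<forall>c r s n. 0 < r --> 0 < s --> \<rho> ^ n * r \<le> A * max r s -->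
     (\<Sum>k\<le>n. theta c (\<rho> ^ k * r)) \<le> D * K_tilde \<mu> lam \<rho> c r s"
proof -
 obtain p where p: "A < \<rho> ^ p" using real_arch_pow[OF \<rho>] by auto
 define D where "D = 2 + real p"
 show ?thesis
 proof (intro exI[of _ D] conjI allI impI)
  show "1 \<le> D" by (simp add: D_def)
  fix c :: 'a and r s :: real and n :: nat assume r: "0 < r" and s: "0 < s" and n: "\<rho> ^ n * r \<le> A * max r s"
  define N where "N = \<lceil>log \<rho> (s / r)\<rceil>"
  define f where "f k = theta c (\<rho> ^ k * r)" for k
  have f0: "0 \<le> f k" "f k \<le> 1" for k using r \<rho> by (auto simp: f_def intro!: theta_nonneg theta_le_1)
  have sN: "s / r \<le> \<rho> ^ nat N"
  proof -
   have "s / r = \<rho> powr (log \<rho> (s / r))" using \<rho> r s by simp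
   also have "... \<le> \<rho> powr real (nat N)" using \<rho> unfolding N_def by (intro powr_mono) (linarith, simp)
   finally show ?thesis using \<rho> by (simp add: powr_realpow)
  qed
  have "\<rho> ^ n \<le> A * max 1 (s / r)" using n r by (simp add: max_def field_simps split: if_splits)
  also have "... \<le> \<rho> ^ p * \<rho> ^ nat N" using sN p A \<rho> by (intro mult_mono) auto
  finally have "\<rho> ^ n \<le> \<rho> ^ (p + nat N)" by (simp add: power_add)
  then have nle: "n \<le> p + nat N" using \<rho> by simp
  have "(\<Sum>k\<le>n. f k) \<le> (\<Sum>k\<in>{k. k \<le> n \<and> int k \<le> N} \<union> {nat (N + 1)..nat N + p}. f k)"
   using f0 nle by (intro sum_mono2) auto
  also have "... \<le> (\<Sum>k\<in>{k. k \<le> n \<and> int k \<le> N}. f k) + (\<Sum>k\<in>{nat (N + 1)..nat N + p}. f k)"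
   by (subst sum.union_disjoint) auto
  also have "(\<Sum>k\<in>{nat (N + 1)..nat N + p}. f k) \<le> real (card {nat (N + 1)..nat N + p}) * 1"
   by (intro sum_bounded_above f0)
  also have "... \<le> 1 + real p" by simp
  also have "(\<Sum>k\<in>{k. k \<le> n \<and> int k \<le> N}. f k) = (\<Sum>k\<in>int ` {k. k \<le> n \<and> int k \<le> N}. theta c (\<rho> powi k * r))"
   by (subst sum.reindex) (auto simp: f_def)
  also have "... \<le> (\<Sum>k = - \<lfloor>log \<rho> 2\<rfloor> .. N. theta c (\<rho> powi k * r))"
  proof (rule sum_mono2)
   have l0: "- \<lfloor>log \<rho> 2\<rfloor> \<le> 0" using \<rho> by simp
   show "int ` {k. k \<le> n \<and> int k \<le> N} \<subseteq> {- \<lfloor>log \<rho> 2\<rfloor> .. N}"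
   proof
    fix x assume "x \<in> int ` {k. k \<le> n \<and> int k \<le> N}"
    then have "0 \<le> x" "x \<le> N" by auto
    then show "x \<in> {- \<lfloor>log \<rho> 2\<rfloor> .. N}" using order_trans[OF l0, of x] by simp
   qed
  qed (use r \<rho> in \<open>auto intro!: theta_nonneg\<close>)
  finally have "(\<Sum>k\<le>n. f k) \<le> K_tilde \<mu> lam \<rho> c r s + real p"
   using \<rho> r s by (simp add: K_tilde_eq N_def)
  also have "... \<le> K_tilde \<mu> lam \<rho> c r s + real p * K_tilde \<mu> lam \<rho> c r s"
   using K_tilde_ge_1[OF \<rho> r s, of c] by (simp add: mult_le_cancel_left1)
  also have "... \<le> D * K_tilde \<mu> lam \<rho> c r s"
   using K_tilde_ge_1[OF \<rho> r s, of c] by (simp add: D_def algebra_simps)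
  finally show "(\<Sum>k\<le>n. theta c (\<rho> ^ k * r)) \<le> D * K_tilde \<mu> lam \<rho> c r s" by (simp add: f_def)
 qed
qed

end

locale regular_mean_exponents = nonhomogeneous +
 fixes \<rho>\<^sub>b \<gamma>\<^sub>b :: real
 assumes rho_b: "1 < \<rho>\<^sub>b" and gamma_b: "1 \<le> \<gamma>\<^sub>b"
begin

text \<open>The conditions on a symbol with its family of numbers, normalised to constant
  \<open>1\<close>; the general case is obtained by dividing by a bound of the symbol.\<close>

definition regular_means :: "('a => complex) => ('a => real => complex) => bool" where
 "regular_means b m \<longleftrightarrow> b \<in> borel_measurable \<mu> \<and>
  (\<forall>c r. 0 < r --> (mass (ball c r) (\<lambda>x. cmod (b x - m c r))) \<le> emeasure \<mu> (ball c (\<rho>\<^sub>b * r))) \<and>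
  (\<forall>c r c1 r1. 0 < r --> 0 < r1 --> ball c r \<subseteq> ball c1 r1 -->
    cmod (m c r - m c1 r1) \<le> K_tilde \<mu> lam \<rho>\<^sub>b c r r1 powr \<gamma>\<^sub>b)"

lemma regular_means_measurable [measurable (raw)]: "regular_means b m ==> b \<in> borel_measurable \<mu>"
 by (simp add: regular_means_def)

lemma regular_means_oscillation:
 "regular_means b m ==> 0 < r ==>
  (mass (ball c r) (\<lambda>x. cmod (b x - m c r))) \<le> emeasure \<mu> (ball c (\<rho>\<^sub>b * r))"
 unfolding regular_means_def by blast

lemma regular_means_diff:
 "regular_means b m ==> 0 < r ==> 0 < r1 ==> ball c r \<subseteq> ball c1 r1 ==>
  cmod (m c r - m c1 r1) \<le> K_tilde \<mu> lam \<rho>\<^sub>b c r r1 powr \<gamma>\<^sub>b"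
 unfolding regular_means_def by blast

lemma means_comparable:
 assumes "1 \<le> A"
 shows "\<exists>C\<ge>0. \<forall>b m. regular_means b m --> (\<forall>c r c1 r1. 0 < r --> 0 < r1 -->
  ball c r \<subseteq> ball c1 r1 --> r1 \<le> A * r --> cmod (m c r - m c1 r1) \<le> C)"
proof (intro exI conjI allI impI)
 define C where "C = (1 + real (nat (\<lceil>log \<rho>\<^sub>b A\<rceil> + \<lfloor>log \<rho>\<^sub>b 2\<rfloor> + 1))) powr \<gamma>\<^sub>b"
 show "0 \<le> C" by (simp add: C_def)
 fix b :: "'a => complex" and m :: "'a => real => complex" and c c1 :: 'a and r r1 :: real
 assume h: "regular_means b m" "0 < r" "0 < r1" "ball c r \<subseteq> ball c1 r1" "r1 \<le> A * r"
 have "cmod (m c r - m c1 r1) \<le> K_tilde \<mu> lam \<rho>\<^sub>b c r r1 powr \<gamma>\<^sub>b"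
  using h by (intro regular_means_diff)
 also have "... \<le> C" unfolding C_def
  using K_tilde_comparable[OF rho_b assms h(2,3,5), of c] K_tilde_ge_1[OF rho_b h(2,3), of c] gamma_b
  by (intro powr_mono2) auto
 finally show "cmod (m c r - m c1 r1) \<le> C" .
qed

text \<open>The case of concentric balls, where the exponent \<open>\<gamma>\<^sub>b\<close> and the
  base \<open>\<rho>\<^sub>b\<close> are traded for \<open>1\<close> and an arbitrary base.\<close>

lemma means_chain:
 assumes \<tau>: "1 < \<tau>"
 shows "\<exists>C\<ge>0. \<forall>b m. regular_means b m --> (\<forall>c r n. 0 < r -->
  cmod (m c r - m c (\<tau> ^ n * r)) \<le> C * (1 + (\<Sum>i\<le>n. theta c (\<tau> ^ i * r))))"
proof -
 obtain D where D: "0 \<le> D" "\<And>c r n. 0 < r ==>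
   K_tilde \<mu> lam \<rho>\<^sub>b c r (\<tau> ^ n * r) \<le> D * (1 + (\<Sum>i\<le>n. theta c (\<tau> ^ i * r)))"
  using K_tilde_change_base[OF rho_b \<tau>] by blast
 show ?thesis
 proof (intro exI[of _ "D powr \<gamma>\<^sub>b * 4 powr \<gamma>\<^sub>b"] conjI allI impI)
  fix b :: "'a => complex" and m :: "'a => real => complex" and c :: 'a and r :: real and n :: nat
  assume rm: "regular_means b m" and r: "0 < r"
  define t where "t k = theta c (\<tau> ^ k * r)" for k
  have t: "0 \<le> t k" "t k \<le> 1" for k using \<tau> r by (auto simp: t_def intro!: theta_nonneg theta_le_1)
  have step: "cmod (m c (\<tau> ^ i * r) - m c (\<tau> ^ j * r)) \<le> D powr \<gamma>\<^sub>b * (1 + (\<Sum>k=i..j. t k)) powr \<gamma>\<^sub>b"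
   if ij: "i \<le> j" for i j
  proof -
   have pos: "0 < \<tau> ^ i * r" using \<tau> r by simp
   have e: "\<tau> ^ j * r = \<tau> ^ (j - i) * (\<tau> ^ i * r)" using ij by (simp add: power_add[symmetric])
   have "\<tau> ^ i * r \<le> \<tau> ^ j * r" using \<tau> r ij by (intro mult_right_mono power_increasing) auto
   then have "cmod (m c (\<tau> ^ i * r) - m c (\<tau> ^ j * r)) \<le> K_tilde \<mu> lam \<rho>\<^sub>b c (\<tau> ^ i * r) (\<tau> ^ j * r) powr \<gamma>\<^sub>b"
    using \<tau> r by (intro regular_means_diff[OF rm] subset_ball) auto
   also have "... \<le> (D * (1 + (\<Sum>k\<le>j - i. theta c (\<tau> ^ k * (\<tau> ^ i * r))))) powr \<gamma>\<^sub>b"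
    using D(2)[OF pos, of c "j - i"] K_tilde_ge_1[OF rho_b pos, of "\<tau> ^ j * r" c] \<tau> r gamma_b
    unfolding e by (intro powr_mono2) auto
   also have "(\<Sum>k\<le>j - i. theta c (\<tau> ^ k * (\<tau> ^ i * r))) = (\<Sum>k=i..j. t k)"
    using ij by (intro sum.reindex_bij_witness[of _ "\<lambda>k. k - i" "\<lambda>k. k + i"])
     (auto simp: t_def power_add mult.assoc)
   also have "(D * (1 + (\<Sum>k=i..j. t k))) powr \<gamma>\<^sub>b = D powr \<gamma>\<^sub>b * (1 + (\<Sum>k=i..j. t k)) powr \<gamma>\<^sub>b"
    using D t by (intro powr_mult)
   finally show ?thesis .
  qed
  have "cmod (m c (\<tau> ^ 0 * r) - m c (\<tau> ^ n * r)) \<le> D powr \<gamma>\<^sub>b * 4 powr \<gamma>\<^sub>b * (1 + (\<Sum>k=0..n. t k))"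
   by (rule greedy_chain[where m = "\<lambda>k. m c (\<tau> ^ k * r)", OF t _ _ step]) (use gamma_b in auto)
  then show "cmod (m c r - m c (\<tau> ^ n * r)) \<le> D powr \<gamma>\<^sub>b * 4 powr \<gamma>\<^sub>b * (1 + (\<Sum>i\<le>n. theta c (\<tau> ^ i * r)))"
   by (simp add: t_def atMost_atLeast0)
 qed simp
qed

text \<open>Passage from the smaller ball to a concentric dilate of the size of the larger one,
  followed by a comparison of balls of similar radius.\<close>

lemma means_nested:
 assumes \<rho>: "1 < \<rho>"
 shows "\<exists>C\<ge>0. \<forall>b m. regular_means b m --> (\<forall>c r c1 r1. 0 < r --> 0 < r1 -->
  ball c r \<subseteq> ball c1 r1 --> cmod (m c r - m c1 r1) \<le> C * K_tilde \<mu> lam \<rho> c r r1)"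
proof -
 have A: "1 \<le> 2 * \<rho>" using \<rho> by simp
 obtain C1 where C1: "0 \<le> C1" "\<And>b m c r c1 r1. regular_means b m ==> 0 < r ==> 0 < r1 ==>
  ball c r \<subseteq> ball c1 r1 ==> r1 \<le> 2 * \<rho> * r ==> cmod (m c r - m c1 r1) \<le> C1"
  using means_comparable[OF A] by blast
 obtain C2 where C2: "0 \<le> C2" "\<And>b m c r n. regular_means b m ==> 0 < r ==>
  cmod (m c r - m c (\<rho> ^ n * r)) \<le> C2 * (1 + (\<Sum>i\<le>n. theta c (\<rho> ^ i * r)))"
  using means_chain[OF \<rho>] by blast
 have r0: "0 < \<rho>" using \<rho> by simp
 obtain D where D: "1 \<le> D" "\<And>c r s n. 0 < r ==> 0 < s ==> \<rho> ^ n * r \<le> \<rho> * max r s ==>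
     (\<Sum>k\<le>n. theta c (\<rho> ^ k * r)) \<le> D * K_tilde \<mu> lam \<rho> c r s"
  using sum_theta_le_K_tilde[OF \<rho> r0] by blast
 define C where "C = 2 * C1 + C2 * (1 + D)"
 have C: "0 \<le> C" using C1 C2 D by (simp add: C_def)
 show ?thesis
 proof (intro exI[of _ C] conjI C allI impI)
  fix b :: "'a => complex" and m :: "'a => real => complex" and c c1 :: 'a and r r1 :: real
  assume rm: "regular_means b m" and r: "0 < r" and r1: "0 < r1" and sub: "ball c r \<subseteq> ball c1 r1"
  have K: "1 \<le> K_tilde \<mu> lam \<rho> c r r1" by (rule K_tilde_ge_1[OF \<rho> r r1])
  show "cmod (m c r - m c1 r1) \<le> C * K_tilde \<mu> lam \<rho> c r r1"
  proof (cases "r1 \<le> r")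
   case True
   have "1 * r \<le> 2 * \<rho> * r" using \<rho> r by (intro mult_right_mono) auto
   then have "r1 \<le> 2 * \<rho> * r" using True by simp
   then have "cmod (m c r - m c1 r1) \<le> C1" using C1(2)[OF rm r r1 sub] by simp
   also have "... \<le> C * 1" using C1 C2 D by (simp add: C_def)
   also have "... \<le> C * K_tilde \<mu> lam \<rho> c r r1" using K C by (intro mult_left_mono)
   finally show ?thesis .
  next
   case False
   define n where "n = (LEAST n. r1 \<le> \<rho> ^ n * r)"
   have "\<exists>n. r1 \<le> \<rho> ^ n * r"
    using real_arch_pow[OF \<rho>, of "r1 / r"] r by (auto simp: field_simps intro: less_imp_le)
   then have n: "r1 \<le> \<rho> ^ n * r" unfolding n_def by (rule LeastI_ex)
   have "n \<noteq> 0" using False n by (auto intro: ccontr)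
   then obtain n' where n': "n = Suc n'" by (cases n) auto
   have "\<not> r1 \<le> \<rho> ^ n' * r" by (rule not_less_Least) (simp add: n_def[symmetric] n')
   then have n2: "\<rho> ^ n * r \<le> \<rho> * r1" using \<rho> by (simp add: n')
   define R where "R = \<rho> ^ n * r"
   have R: "0 < R" "r1 \<le> R" "R \<le> \<rho> * r1" using \<rho> r n n2 by (auto simp: R_def)
   have "c \<in> ball c1 r1" using sub r by (metis centre_in_ball subsetD)
   have s1: "ball c1 r1 \<subseteq> ball c (2 * R)"
   proof
    fix x assume "x \<in> ball c1 r1"
    then show "x \<in> ball c (2 * R)"
     using \<open>c \<in> ball c1 r1\<close> R dist_triangle[of c x c1] by (simp add: dist_commute)
   qed
   have s2: "ball c R \<subseteq> ball c (2 * R)" using R by auto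
   have e1: "cmod (m c r - m c R) \<le> C2 * (1 + D * K_tilde \<mu> lam \<rho> c r r1)"
   proof -
    have "\<rho> * r1 \<le> \<rho> * max r r1" using \<rho> by (intro mult_left_mono) auto
    then have "\<rho> ^ n * r \<le> \<rho> * max r r1" using n2 by simp
    from D(2)[OF r r1 this, of c] have "(\<Sum>i\<le>n. theta c (\<rho> ^ i * r)) \<le> D * K_tilde \<mu> lam \<rho> c r r1" .
    then have "C2 * (1 + (\<Sum>i\<le>n. theta c (\<rho> ^ i * r))) \<le> C2 * (1 + D * K_tilde \<mu> lam \<rho> c r r1)"
     using C2(1) by (intro mult_left_mono) auto
    then show ?thesis using C2(2)[OF rm r, of c n] by (simp add: R_def)
   qed
   have e2: "cmod (m c R - m c (2 * R)) \<le> C1"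
    by (rule C1(2)[OF rm]) (use R s2 \<rho> in auto)
   have e3: "cmod (m c1 r1 - m c (2 * R)) \<le> C1"
    by (rule C1(2)[OF rm]) (use R s1 r1 in auto)
   have "cmod (m c r - m c1 r1) \<le> cmod (m c r - m c R) + cmod (m c R - m c (2 * R)) + cmod (m c1 r1 - m c (2 * R))"
    using norm_triangle_ineq4[of "(m c r - m c R) + (m c R - m c (2 * R))" "m c1 r1 - m c (2 * R)"]
     norm_triangle_ineq[of "m c r - m c R" "m c R - m c (2 * R)"] by simp
   also have "... \<le> 2 * C1 * 1 + C2 * (1 + D * K_tilde \<mu> lam \<rho> c r r1)" using e1 e2 e3 by simp
   also have "... \<le> 2 * C1 * K_tilde \<mu> lam \<rho> c r r1 + C2 * (K_tilde \<mu> lam \<rho> c r r1 + D * K_tilde \<mu> lam \<rho> c r r1)"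
    using K C1(1) C2(1) D(1) by (intro add_mono mult_left_mono) auto
   also have "... = C * K_tilde \<mu> lam \<rho> c r r1" by (simp add: C_def algebra_simps)
   finally show ?thesis .
  qed
 qed
qed

text \<open>Cover the ball by boundedly many balls so small that their dilates by
  \<open>\<rho>\<^sub>b\<close> stay inside the dilate by \<open>\<rho>\<close>.\<close>

lemma mean_oscillation:
 assumes \<rho>: "1 < \<rho>"
 shows "\<exists>C\<ge>0. \<forall>b m. regular_means b m --> (\<forall>c r. 0 < r -->
  (mass (ball c r) (\<lambda>x. cmod (b x - m c r))) \<le> ennreal (C * vol c (\<rho> * r)))"
proof -
 obtain p where p: "(1 + \<rho>\<^sub>b) / (\<rho> - 1) < 2 ^ p" using real_arch_pow[of 2] by auto
 have A: "1 \<le> 2 ^ p * \<rho>" using \<rho> one_le_power[of "2::real" p] mult_mono[of 1 "2 ^ p" 1 \<rho>] by simp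
 obtain C1 where C1: "0 \<le> C1" "\<And>b m c r c1 r1. regular_means b m ==> 0 < r ==> 0 < r1 ==>
  ball c r \<subseteq> ball c1 r1 ==> r1 \<le> 2 ^ p * \<rho> * r ==> cmod (m c r - m c1 r1) \<le> C1"
  using means_comparable[OF A] by blast
 define C where "C = real (N0 ^ p) * (1 + 2 * C1)"
 have C: "0 \<le> C" using C1 by (simp add: C_def)
 show ?thesis
 proof (intro exI[of _ C] conjI C allI impI)
  fix b :: "'a => complex" and m :: "'a => real => complex" and c :: 'a and r :: real
  assume rm: "regular_means b m" and r: "0 < r"
  have [measurable]: "bmeas b" using rm by (rule regular_means_measurable)
  define s where "s = r / 2 ^ p"
  have s: "0 < s" using r by (simp add: s_def)
  have sr: "r + s + \<rho>\<^sub>b * s \<le> \<rho> * r"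
  proof -
   have "1 + \<rho>\<^sub>b < 2 ^ p * (\<rho> - 1)" using p \<rho> by (simp add: divide_less_eq)
   then have "(1 + \<rho>\<^sub>b) * s < 2 ^ p * (\<rho> - 1) * s" using s by (rule mult_strict_right_mono)
   also have "... = (\<rho> - 1) * r" by (simp add: s_def)
   finally show ?thesis by (simp add: algebra_simps)
  qed
  obtain F :: "'a set" where F: "finite F" "card F \<le> N0 ^ p" "ball c r \<subseteq> (\<Union>y\<in>F. ball y s)"
   using iterated_geometric_doubling[OF r, of p c] unfolding s_def by blast
  define G where "G = {y \<in> F. ball y s \<inter> ball c r \<noteq> {}}"
  have G: "finite G" "card G \<le> N0 ^ p" "ball c r \<subseteq> (\<Union>y\<in>G. ball y s)"
  proof -
   show "finite G" using F by (simp add: G_def)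
   have "card G \<le> card F" using F by (intro card_mono) (auto simp: G_def)
   then show "card G \<le> N0 ^ p" using F by simp
   show "ball c r \<subseteq> (\<Union>y\<in>G. ball y s)" using F(3) unfolding G_def by blast
  qed
  have B: "mass (ball y s) (\<lambda>x. cmod (b x - m c r)) \<le> ennreal ((1 + 2 * C1) * vol c (\<rho> * r))"
   if y: "y \<in> G" for y
  proof -
   obtain z where z: "dist y z < s" "dist c z < r" using y by (auto simp: G_def)
   have cy: "dist c y < r + s" using z dist_triangle[of c y z] by (simp add: dist_commute)
   have sub: "ball y (\<rho>\<^sub>b * s) \<subseteq> ball c (\<rho> * r)" "ball y s \<subseteq> ball c (\<rho> * r)" "ball c r \<subseteq> ball c (\<rho> * r)"
   proof -
    show "ball y (\<rho>\<^sub>b * s) \<subseteq> ball c (\<rho> * r)"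
    proof
     fix x assume "x \<in> ball y (\<rho>\<^sub>b * s)"
     then show "x \<in> ball c (\<rho> * r)" using cy sr dist_triangle[of c x y] by simp
    qed
    have "s \<le> \<rho>\<^sub>b * s" using rho_b s by simp
    then show "ball y s \<subseteq> ball c (\<rho> * r)" using \<open>ball y (\<rho>\<^sub>b * s) \<subseteq> _\<close> by (meson order_trans subset_ball)
    show "ball c r \<subseteq> ball c (\<rho> * r)" using \<rho> r by (intro subset_ball) simp
   qed
   have "cmod (m y s - m c (\<rho> * r)) \<le> C1"
    by (rule C1(2)[OF rm s _ sub(2)]) (use \<rho> r in \<open>auto simp: s_def\<close>)
   moreover have "cmod (m c r - m c (\<rho> * r)) \<le> C1"
   proof (rule C1(2)[OF rm r _ sub(3)])
    show "\<rho> * r \<le> 2 ^ p * \<rho> * r" using \<rho> r one_le_power[of "2::real" p] by simp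
   qed (use \<rho> r in auto)
   ultimately have mm: "cmod (m y s - m c r) \<le> 2 * C1"
    using norm_triangle_ineq4[of "m y s - m c (\<rho> * r)" "m c r - m c (\<rho> * r)"] by simp
   have "mass (ball y s) (\<lambda>x. cmod (b x - m c r)) \<le>
     (\<integral>\<^sup>+x. ennreal (cmod (b x - m y s)) * indicator (ball y s) x + ennreal (2 * C1) * indicator (ball y s) x \<partial>\<mu>)"
   proof (intro nn_integral_mono)
    fix x
    have "cmod (b x - m c r) \<le> cmod (b x - m y s) + 2 * C1"
     using norm_triangle_ineq[of "b x - m y s" "m y s - m c r"] mm by simp
    then show "ennreal (cmod (b x - m c r)) * indicator (ball y s) x \<le>
      ennreal (cmod (b x - m y s)) * indicator (ball y s) x + ennreal (2 * C1) * indicator (ball y s) x"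
     using C1(1) by (auto simp: indicator_def simp flip: ennreal_plus intro!: ennreal_leI)
   qed
   also have "... = mass (ball y s) (\<lambda>x. cmod (b x - m y s)) + ennreal (2 * C1) * emeasure \<mu> (ball y s)"
    by (subst nn_integral_add) (auto simp: nn_integral_cmult_indicator)
   also have "... \<le> emeasure \<mu> (ball c (\<rho> * r)) + ennreal (2 * C1) * emeasure \<mu> (ball c (\<rho> * r))"
   proof (intro add_mono mult_left_mono)
    have "mass (ball y s) (\<lambda>x. cmod (b x - m y s)) \<le> emeasure \<mu> (ball y (\<rho>\<^sub>b * s))"
     by (rule regular_means_oscillation[OF rm s])
    also have "... \<le> emeasure \<mu> (ball c (\<rho> * r))" using sub by (intro emeasure_mono) auto
    finally show "mass (ball y s) (\<lambda>x. cmod (b x - m y s)) \<le> emeasure \<mu> (ball c (\<rho> * r))" .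
    show "emeasure \<mu> (ball y s) \<le> emeasure \<mu> (ball c (\<rho> * r))" using sub by (intro emeasure_mono) auto
   qed auto
   also have "... = ennreal ((1 + 2 * C1) * vol c (\<rho> * r))"
    using C1(1) by (simp add: emeasure_ball ennreal_mult[symmetric] algebra_simps flip: ennreal_plus)
   finally show ?thesis .
  qed
  have "mass (ball c r) (\<lambda>x. cmod (b x - m c r)) \<le>
   (\<integral>\<^sup>+x. (\<Sum>y\<in>G. ennreal (cmod (b x - m c r)) * indicator (ball y s) x) \<partial>\<mu>)"
  proof (intro nn_integral_mono)
   fix x
   show "ennreal (cmod (b x - m c r)) * indicator (ball c r) x \<le> (\<Sum>y\<in>G. ennreal (cmod (b x - m c r)) * indicator (ball y s) x)"
   proof (cases "x \<in> ball c r")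
    case True
    then obtain y where y: "y \<in> G" "x \<in> ball y s" using G(3) by blast
    have "ennreal (cmod (b x - m c r)) * indicator (ball y s) x \<le> (\<Sum>y\<in>G. ennreal (cmod (b x - m c r)) * indicator (ball y s) x)"
     using G(1) y by (intro member_le_sum) auto
    then show ?thesis using True y by simp
   qed simp
  qed
  also have "... = (\<Sum>y\<in>G. \<integral>\<^sup>+x\<in>ball y s. ennreal (cmod (b x - m c r)) \<partial>\<mu>)"
   by (intro nn_integral_sum) auto
  also have "... \<le> (\<Sum>y\<in>G. ennreal ((1 + 2 * C1) * vol c (\<rho> * r)))" by (intro sum_mono B)
  also have "... = ennreal (real (card G) * ((1 + 2 * C1) * vol c (\<rho> * r)))"
   using C1(1) by (simp add: ennreal_mult ennreal_of_nat_eq_real_of_nat)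
  also have "... \<le> ennreal (C * vol c (\<rho> * r))"
  proof (rule ennreal_leI)
   have "real (card G) \<le> real (N0 ^ p)" using G(2) of_nat_le_iff by blast
   then show "real (card G) * ((1 + 2 * C1) * vol c (\<rho> * r)) \<le> C * vol c (\<rho> * r)"
    unfolding C_def mult.assoc[symmetric] using C1(1) by (intro mult_right_mono) auto
  qed
  finally show "mass (ball c r) (\<lambda>x. cmod (b x - m c r)) \<le> ennreal (C * vol c (\<rho> * r))" .
 qed
qed

end

section \<open>Doubling radii\<close>

lemma emeasure_countable_UN_le:
 assumes S: "countable S" and A: "\<And>i. i \<in> S ==> A i \<in> sets M"
  and le: "\<And>I. finite I ==> I \<subseteq> S ==> emeasure M (\<Union>i\<in>I. A i) \<le> b"
 shows "emeasure M (\<Union>i\<in>S. A i) \<le> b"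
proof (cases "S = {}")
 case False
 define f where "f = from_nat_into S"
 have f: "f n \<in> S" for n using False by (simp add: f_def from_nat_into)
 have rf: "range f = S" using False S by (simp add: f_def range_from_nat_into)
 define V where "V n = (\<Union>i\<in>f ` {..n}. A i)" for n
 have "emeasure M (\<Union>n. V n) = (SUP n. emeasure M (V n))"
 proof (rule SUP_emeasure_incseq[symmetric])
  show "range V \<subseteq> sets M" using A f by (auto simp: V_def)
  show "incseq V" by (force simp: V_def incseq_def)
 qed
 also have "... \<le> b" unfolding V_def using f by (intro SUP_least le) auto
 also have "(\<Union>n. V n) = (\<Union>i\<in>S. A i)" unfolding V_def rf[symmetric] by auto
 finally show ?thesis .
qed simp

context nonhomogeneous begin

lemma fmeasurable_bounded: "A \<subseteq> ball x r ==> A \<in> sets \<mu> ==> A \<in> fmeasurable \<mu>"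
 using emeasure_ball_finite[of x r] emeasure_mono[of A "ball x r" \<mu>]
 by (intro fmeasurableI) auto

text \<open>Enclose \<open>Z\<close> in an open set \<open>U\<close> with \<open>\<mu>(U - Z)\<close>
  small and choose the balls inside \<open>U\<close>. A disjoint Vitali subfamily
  \<open>B\<^sub>j\<close> gives \<open>\<mu>(Z) \<le> \<Sum> \<mu>(3 B\<^sub>j) \<le> \<beta> \<Sum>
  \<mu>(B\<^sub>j) \<le> 2 \<beta> \<Sum> \<mu>(B\<^sub>j - Z) \<le> 2 \<beta> \<mu>(U - Z)\<close>.
  Differentiation of integrals, which may fail for \<open>\<mu>\<close>, is avoided.\<close>

lemma thin_set_null:
 fixes Z :: "'a set"
 assumes Z[measurable]: "Z \<in> sets \<mu>" and ZB: "Z \<subseteq> ball c r" and \<beta>: "0 \<le> \<beta>"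
  and thin: "AE x in \<mu>. x \<in> Z --> (\<forall>e>0. \<exists>s. 0 < s \<and> s < e \<and>
   vol x (3 * s) \<le> \<beta> * vol x s \<and>
   2 * measure \<mu> (Z \<inter> ball x s) \<le> vol x s)"
 shows "emeasure \<mu> Z = 0"
proof -
 define P where "P x e s \<longleftrightarrow> 0 < s \<and> s < e \<and> vol x (3 * s) \<le> \<beta> * vol x s \<and>
   2 * measure \<mu> (Z \<inter> ball x s) \<le> vol x s" for x and e s :: real
 obtain N where N: "N \<in> null_sets \<mu>" "\<And>x. x \<in> Z ==> x \<notin> N ==> \<forall>e>0. \<exists>s. P x e s"
 proof -
  have "AE x in \<mu>. x \<in> Z --> (\<forall>e>0. \<exists>s. P x e s)" using thin by (simp only: P_def)
  then have "\<exists>N\<in>null_sets \<mu>. {x \<in> space \<mu>. \<not> (x \<in> Z --> (\<forall>e>0. \<exists>s. P x e s))} \<subseteq> N"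
   by (simp only: eventually_ae_filter)
  then obtain N where N: "N \<in> null_sets \<mu>" "{x \<in> space \<mu>. \<not> (x \<in> Z --> (\<forall>e>0. \<exists>s. P x e s))} \<subseteq> N"
   by (elim bexE)
  have "\<forall>e>0. \<exists>s. P x e s" if "x \<in> Z" "x \<notin> N" for x
   using N(2) that space_mu by blast
  with N(1) show thesis by (rule that)
 qed
 have bound: "emeasure \<mu> Z \<le> ennreal (2 * \<beta> * e)" if e: "0 < e" for e
 proof -
  obtain F U where FU: "closed F" "open U" "F \<subseteq> Z" "Z \<subseteq> U" "emeasure \<mu> ((U - F) \<inter> ball c r) < ennreal e"
   using closed_open_approximation[OF sets_mu ball_sets[of c r] emeasure_ball_finite Z e]
   by (elim exE conjE) (rule that)
  define W where "W = U \<inter> ball c r"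
  have W: "open W" "Z \<subseteq> W" using FU ZB by (auto simp: W_def)
  have [measurable]: "W \<in> sets \<mu>" using W by auto
  have Wfm: "A \<in> fmeasurable \<mu>" if "A \<subseteq> W" "A \<in> sets \<mu>" for A
   using that by (intro fmeasurable_bounded[of A c r]) (auto simp: W_def)
  have We: "measure \<mu> (W - Z) \<le> e"
  proof -
   have "emeasure \<mu> (W - Z) \<le> emeasure \<mu> ((U - F) \<inter> ball c r)"
    using FU by (intro emeasure_mono) (auto simp: W_def)
   then have "emeasure \<mu> (W - Z) \<le> ennreal e" using FU(5) by simp
   then show ?thesis using e by (simp add: measure_def enn2real_leI)
  qed
  have "\<forall>x\<in>Z - N. \<exists>s. P x s s \<or> (0 < s \<and> ball x s \<subseteq> W \<and> (\<exists>e. P x e s))"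
  proof
   fix x assume x: "x \<in> Z - N"
   then obtain e where e: "0 < e" "ball x e \<subseteq> W" using W by (meson openE subsetD DiffD1)
   then obtain s where "P x e s" using N(2) x by blast
   then show "\<exists>s. P x s s \<or> (0 < s \<and> ball x s \<subseteq> W \<and> (\<exists>e. P x e s))"
    using e by (intro exI[of _ s]) (auto simp: P_def)
  qed
  from bchoice[OF this] obtain s where
   s0: "\<forall>x\<in>Z - N. P x (s x) (s x) \<or> (0 < s x \<and> ball x (s x) \<subseteq> W \<and> (\<exists>e. P x e (s x)))" by blast
  have s: "0 < s x" "ball x (s x) \<subseteq> W" "vol x (3 * s x) \<le> \<beta> * vol x (s x)"
    "2 * measure \<mu> (Z \<inter> ball x (s x)) \<le> vol x (s x)" if "x \<in> Z - N" for x
   using s0 that by (auto simp: P_def)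
  have "\<exists>S'\<subseteq>Z - N. countable S' \<and> Z - N \<subseteq> (\<Union>x\<in>S'. ball x (s x))"
   by (rule countable_subcover) (use s in auto)
  then obtain S' where S': "S' \<subseteq> Z - N" "countable S'" "Z - N \<subseteq> (\<Union>x\<in>S'. ball x (s x))" by blast
  have "emeasure \<mu> (\<Union>x\<in>S'. ball x (s x)) \<le> ennreal (2 * \<beta> * e)"
  proof (rule emeasure_countable_UN_le[OF S'(2)])
   fix I assume I: "finite I" "I \<subseteq> S'"
   obtain J where J: "J \<subseteq> I" "disjoint_family_on (\<lambda>i. ball i (s i)) J"
     "(\<Union>i\<in>I. ball i (s i)) \<subseteq> (\<Union>j\<in>J. ball j (3 * s j))"
    using finite_Vitali_covering[OF I(1), of "\<lambda>x. x" s] by blast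
   have finJ: "finite J" using J I finite_subset by blast
   have JZ: "x \<in> Z - N" if "x \<in> J" for x using that J I S' by blast
   have "emeasure \<mu> (\<Union>i\<in>I. ball i (s i)) \<le> emeasure \<mu> (\<Union>j\<in>J. ball j (3 * s j))"
    using J(3) finJ by (intro emeasure_mono) auto
   also have "... \<le> (\<Sum>j\<in>J. emeasure \<mu> (ball j (3 * s j)))"
    using finJ by (intro emeasure_subadditive_finite) auto
   also have "... = ennreal (\<Sum>j\<in>J. vol j (3 * s j))"
    by (simp add: emeasure_ball sum_ennreal)
   finally have 1: "emeasure \<mu> (\<Union>i\<in>I. ball i (s i)) \<le> ennreal (\<Sum>j\<in>J. vol j (3 * s j))" .
   have "(\<Sum>j\<in>J. vol j (3 * s j)) \<le> (\<Sum>j\<in>J. 2 * \<beta> * measure \<mu> (ball j (s j) - Z))"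
   proof (rule sum_mono)
    fix j assume j: "j \<in> J"
    note sj = s[OF JZ[OF j]]
    have "measure \<mu> ((Z \<inter> ball j (s j)) \<union> (ball j (s j) - Z)) \<le> measure \<mu> (Z \<inter> ball j (s j)) + measure \<mu> (ball j (s j) - Z)"
     by (rule measure_Un_le) auto
    moreover have "(Z \<inter> ball j (s j)) \<union> (ball j (s j) - Z) = ball j (s j)" by blast
    ultimately have "vol j (s j) \<le> 2 * measure \<mu> (ball j (s j) - Z)"
     using sj(4) by simp
    then have "\<beta> * vol j (s j) \<le> \<beta> * (2 * measure \<mu> (ball j (s j) - Z))"
     using \<beta> by (rule mult_left_mono)
    then show "vol j (3 * s j) \<le> 2 * \<beta> * measure \<mu> (ball j (s j) - Z)" using sj(3) by simp
   qed
   also have "... = 2 * \<beta> * (\<Sum>j\<in>J. measure \<mu> (ball j (s j) - Z))" by (simp add: sum_distrib_left)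
   also have "(\<Sum>j\<in>J. measure \<mu> (ball j (s j) - Z)) = measure \<mu> (\<Union>j\<in>J. ball j (s j) - Z)"
   proof (rule measure_UNION'[symmetric, OF finJ])
    show "ball j (s j) - Z \<in> fmeasurable \<mu>" if "j \<in> J" for j
     using s(2)[OF JZ[OF that]] by (intro Wfm) auto
    show "pairwise (\<lambda>x y. disjnt (ball x (s x) - Z) (ball y (s y) - Z)) J"
     unfolding pairwise_def disjnt_def
    proof (intro ballI impI)
     fix x y assume "x \<in> J" "y \<in> J" "x \<noteq> y"
     then have "ball x (s x) \<inter> ball y (s y) = {}" using J(2) unfolding disjoint_family_on_def by blast
     then show "(ball x (s x) - Z) \<inter> (ball y (s y) - Z) = {}" by blast
    qed
   qed
   also have "measure \<mu> (\<Union>j\<in>J. ball j (s j) - Z) \<le> measure \<mu> (W - Z)"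
   proof (rule measure_mono_fmeasurable)
    show "(\<Union>j\<in>J. ball j (s j) - Z) \<subseteq> W - Z" using s(2) JZ by blast
    show "(\<Union>j\<in>J. ball j (s j) - Z) \<in> sets \<mu>" using finJ by (intro sets.finite_UN) auto
    show "W - Z \<in> fmeasurable \<mu>" by (rule Wfm) auto
   qed
   also note We
   finally have "(\<Sum>j\<in>J. vol j (3 * s j)) \<le> 2 * \<beta> * e"
    using \<beta> by (simp add: mult_left_mono)
   then show "emeasure \<mu> (\<Union>i\<in>I. ball i (s i)) \<le> ennreal (2 * \<beta> * e)"
    by (rule order_trans[OF 1 ennreal_leI])
  qed auto
  moreover have "emeasure \<mu> Z \<le> emeasure \<mu> ((\<Union>x\<in>S'. ball x (s x)) \<union> N)"
   using S' N(1) by (intro emeasure_mono) (auto intro!: sets.countable_UN')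
  moreover have "emeasure \<mu> ((\<Union>x\<in>S'. ball x (s x)) \<union> N) = emeasure \<mu> (\<Union>x\<in>S'. ball x (s x))"
   using S' N(1) by (intro emeasure_Un_null_set) (auto intro!: sets.countable_UN')
  ultimately show ?thesis by simp
 qed
 show ?thesis
 proof (rule ccontr)
  assume "emeasure \<mu> Z \<noteq> 0"
  moreover have "emeasure \<mu> Z = ennreal (measure \<mu> Z)"
   using fmeasurable_bounded[OF ZB Z] by (simp add: emeasure_eq_measure2)
  ultimately have z: "0 < measure \<mu> Z" by (simp add: zero_less_measure_iff)
  have "emeasure \<mu> Z \<le> ennreal (2 * \<beta> * (measure \<mu> Z / (4 * \<beta> + 1)))"
   using z \<beta> by (intro bound) auto
  then have "measure \<mu> Z \<le> 2 * \<beta> * (measure \<mu> Z / (4 * \<beta> + 1))"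
   using \<open>emeasure \<mu> Z = _\<close> \<beta> z by simp
  then have "measure \<mu> Z * (4 * \<beta> + 1) \<le> 2 * \<beta> * measure \<mu> Z" using \<beta> by (simp add: field_simps)
  then have "measure \<mu> Z * (2 * \<beta> + 1) \<le> 0" by (simp add: algebra_simps)
  then show False using z \<beta> by (simp add: mult_le_0_iff)
 qed
qed

text \<open>If all scales beyond \<open>i0\<close> fail at \<open>x\<close>, the ball around
  \<open>x\<close> at the \<open>n\<close>-th further scale has measure at most \<open>\<beta>\<close>
  to the power \<open>-n\<close> times a constant. Since \<open>(N0 ^ a) ^ n\<close> balls of that
  scale cover the ball, up to a constant, and \<open>N0 ^ a < \<beta>\<close>, the set of such points
  is null.\<close>

lemma doubling_radii_AE:
 fixes c :: 'a
 assumes r: "0 < r" and \<sigma>: "0 < \<sigma>" and \<beta>: "real (N0 ^ a) < \<beta>"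
 shows "AE x in \<mu>. x \<in> ball c r --> (\<forall>i0. \<exists>i\<ge>i0.
  vol x (2 ^ a * (\<sigma> / (2 ^ a) ^ i)) \<le> \<beta> * vol x (\<sigma> / (2 ^ a) ^ i))"
proof -
 have \<beta>0: "0 < \<beta>" using \<beta> by (meson le_less_trans of_nat_0_le_iff)
 define s where "s i = \<sigma> / (2 ^ a) ^ i" for i
 have s: "0 < s i" "s i \<le> \<sigma>" for i using \<sigma> by (auto simp: s_def field_simps)
 define dbl where "dbl x i \<longleftrightarrow> vol x (2 ^ a * s i) \<le> \<beta> * vol x (s i)" for x :: 'a and i
 have "AE x in \<mu>. x \<in> ball c r --> (\<exists>i\<ge>i0. dbl x i)" for i0
 proof -
  define Y where "Y = {x \<in> ball c r. \<forall>i\<ge>i0. \<not> dbl x i}"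
  define M where "M = vol c (r + \<sigma>)"
  have dec: "vol x (s (i0 + j)) \<le> M / \<beta> ^ j" if x: "x \<in> Y" for x j
  proof (induction j)
   case 0
   have "ball x (s i0) \<subseteq> ball c (r + \<sigma>)"
   proof
    fix y assume "y \<in> ball x (s i0)"
    then show "y \<in> ball c (r + \<sigma>)" using x s(2)[of i0] dist_triangle[of c y x] by (auto simp: Y_def)
   qed
   then show ?case by (simp add: M_def measure_ball_mono)
  next
   case (Suc j)
   have "\<not> dbl x (i0 + Suc j)" using x by (simp add: Y_def)
   moreover have "2 ^ a * s (i0 + Suc j) = s (i0 + j)" by (simp add: s_def)
   ultimately have "\<beta> * vol x (s (i0 + Suc j)) < vol x (s (i0 + j))"
    by (simp add: dbl_def)
   also have "... \<le> M / \<beta> ^ j" by (rule Suc)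
   finally show ?case using \<beta>0 by (simp add: field_simps)
  qed
  obtain k0 where k0: "2 * r / s i0 < 2 ^ k0" using real_arch_pow[of 2] by auto
  have cov: "\<exists>W. W \<in> sets \<mu> \<and> Y \<subseteq> W \<and> emeasure \<mu> W \<le> ennreal (real (N0 ^ k0) * M * (real (N0 ^ a) / \<beta>) ^ j)" for j
  proof -
   define q where "q = r / 2 ^ (k0 + a * j)"
   have q: "2 * q \<le> s (i0 + j)"
   proof -
    have "2 * r \<le> s i0 * 2 ^ k0" using k0 s(1)[of i0] by (simp add: field_simps)
    moreover have "s i0 = s (i0 + j) * 2 ^ (a * j)" by (simp add: s_def power_add power_mult)
    ultimately have "2 * r \<le> s (i0 + j) * 2 ^ (k0 + a * j)" by (simp add: power_add mult_ac)
    then show ?thesis by (simp add: q_def divide_le_eq)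
   qed
   obtain F :: "'a set" where F: "finite F" "card F \<le> N0 ^ (k0 + a * j)" "ball c r \<subseteq> (\<Union>y\<in>F. ball y q)"
    using iterated_geometric_doubling[OF r, of "k0 + a * j" c] unfolding q_def by blast
   define F' where "F' = {y \<in> F. ball y q \<inter> Y \<noteq> {}}"
   have "\<forall>y\<in>F'. \<exists>z. z \<in> ball y q \<inter> Y" by (auto simp: F'_def)
   from bchoice[OF this] obtain z where z: "\<forall>y\<in>F'. z y \<in> ball y q \<inter> Y" by blast
   define W where "W = (\<Union>y\<in>F'. ball (z y) (s (i0 + j)))"
   have F': "finite F'" "card F' \<le> N0 ^ (k0 + a * j)"
    using F card_mono[of F F'] by (auto simp: F'_def)
   have "Y \<subseteq> W"
   proof
    fix x assume x: "x \<in> Y"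
    then obtain y where y: "y \<in> F" "x \<in> ball y q" using F(3) by (auto simp: Y_def)
    then have yF: "y \<in> F'" using x by (auto simp: F'_def)
    then have "dist (z y) x < 2 * q" using z y dist_triangle[of "z y" x y] by (auto simp: dist_commute)
    then show "x \<in> W" using yF q by (force simp: W_def)
   qed
   moreover have "emeasure \<mu> W \<le> ennreal (real (N0 ^ k0) * M * (real (N0 ^ a) / \<beta>) ^ j)"
   proof -
    have "emeasure \<mu> W \<le> (\<Sum>y\<in>F'. emeasure \<mu> (ball (z y) (s (i0 + j))))"
     unfolding W_def using F' by (intro emeasure_subadditive_finite) auto
    also have "... \<le> (\<Sum>y\<in>F'. ennreal (M / \<beta> ^ j))"
     unfolding emeasure_ball using z by (intro sum_mono ennreal_leI dec) auto
    also have "... = ennreal (real (card F') * (M / \<beta> ^ j))"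
     using \<beta>0 by (simp add: ennreal_mult[symmetric] M_def ennreal_of_nat_eq_real_of_nat)
    also have "... \<le> ennreal (real (N0 ^ (k0 + a * j)) * (M / \<beta> ^ j))"
     using F'(2) \<beta>0 by (intro ennreal_leI mult_right_mono) (auto simp: M_def simp del: of_nat_power)
    also have "real (N0 ^ (k0 + a * j)) * (M / \<beta> ^ j) = real (N0 ^ k0) * M * (real (N0 ^ a) / \<beta>) ^ j"
     by (simp add: power_add power_mult power_divide)
    finally show ?thesis .
   qed
   moreover have "W \<in> sets \<mu>" unfolding W_def using F' by auto
   ultimately show ?thesis by blast
  qed
  have "\<forall>j. \<exists>W. W \<in> sets \<mu> \<and> Y \<subseteq> W \<and>
    emeasure \<mu> W \<le> ennreal (real (N0 ^ k0) * M * (real (N0 ^ a) / \<beta>) ^ j)"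
   by (intro allI cov)
  from choice[OF this] obtain W where W: "\<forall>j. W j \<in> sets \<mu> \<and> Y \<subseteq> W j \<and>
    emeasure \<mu> (W j) \<le> ennreal (real (N0 ^ k0) * M * (real (N0 ^ a) / \<beta>) ^ j)" by blast
  have "(\<lambda>j. ennreal (real (N0 ^ k0) * M * (real (N0 ^ a) / \<beta>) ^ j)) \<longlonglongrightarrow> ennreal (real (N0 ^ k0) * M * 0)"
   using \<beta> \<beta>0 by (intro tendsto_ennrealI tendsto_mult tendsto_const LIMSEQ_power_zero) auto
  then have lim: "(\<lambda>j. ennreal (real (N0 ^ k0) * M * (real (N0 ^ a) / \<beta>) ^ j)) \<longlonglongrightarrow> 0" by simp
  have "emeasure \<mu> (\<Inter>j. W j) \<le> ennreal (real (N0 ^ k0) * M * (real (N0 ^ a) / \<beta>) ^ j)" for j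
  proof -
   have "emeasure \<mu> (\<Inter>j. W j) \<le> emeasure \<mu> (W j)" using W by (intro emeasure_mono) auto
   also have "... \<le> ennreal (real (N0 ^ k0) * M * (real (N0 ^ a) / \<beta>) ^ j)" using W by blast
   finally show ?thesis .
  qed
  then have "emeasure \<mu> (\<Inter>j. W j) \<le> 0"
   by (rule LIMSEQ_le_const[OF lim, OF exI, OF allI, OF impI])
  then have "(\<Inter>j. W j) \<in> null_sets \<mu>" using W by (auto simp: null_sets_def)
  moreover have "{x \<in> space \<mu>. \<not> (x \<in> ball c r --> (\<exists>i\<ge>i0. dbl x i))} \<subseteq> (\<Inter>j. W j)"
   using W by (auto simp: Y_def)
  ultimately show ?thesis by (rule AE_I')
 qed
 then have "AE x in \<mu>. \<forall>i0. x \<in> ball c r --> (\<exists>i\<ge>i0. dbl x i)" by (subst AE_all_countable) auto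
 then show ?thesis unfolding dbl_def s_def by eventually_elim auto
qed

text \<open>While the measure grows by more than \<open>2 * dil \<tau>\<close>, the dominating function
  grows by at most \<open>dil \<tau>\<close>, so \<open>theta\<close> at least doubles from each scale
  to the next. The sum is then governed by its last term, and \<open>theta \<le> 1\<close>.\<close>

lemma nondoubling_sum_theta:
 fixes x :: 'a
 assumes \<tau>: "1 < \<tau>" and \<beta>: "2 * dil \<tau> \<le> \<beta>" and u: "0 < u"
  and nd: "\<And>l. 1 \<le> l ==> l < n ==> \<beta> * vol x (\<tau> ^ l * u) < vol x (\<tau> ^ Suc l * u)"
 shows "(\<Sum>l\<le>n. theta x (\<tau> ^ l * u)) \<le> 3"
proof -
 define t where "t l = theta x (\<tau> ^ l * u)" for l
 have t1: "t l \<le> 1" for l using \<tau> u by (auto simp: t_def intro!: theta_le_1)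
 have half: "t l \<le> t (Suc l) / 2" if l: "1 \<le> l" "l < n" for l
 proof -
  define v where "v = \<tau> ^ l * u"
  have v: "0 < v" "0 < \<tau> * v" using \<tau> u by (auto simp: v_def)
  have \<beta>0: "0 < \<beta>" using \<beta> dil_ge_1[of \<tau>] by simp
  have 1: "\<beta> * vol x v \<le> vol x (\<tau> * v)" using nd[OF l] by (simp add: v_def mult.assoc)
  have 2: "lam x (\<tau> * v) \<le> dil \<tau> * lam x v" using \<tau> v by (intro lam_dilate) auto
  have "(2 * dil \<tau>) * vol x v \<le> vol x (\<tau> * v)"
   using 1 \<beta> by (smt (verit) measure_nonneg mult_right_mono)
  then have "(2 * dil \<tau>) * vol x v * lam x (\<tau> * v) \<le> vol x (\<tau> * v) * (dil \<tau> * lam x v)"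
   using 2 lam_pos[OF v(2), of x] by (intro mult_mono) auto
  then have "dil \<tau> * (2 * vol x v * lam x (\<tau> * v)) \<le> dil \<tau> * (vol x (\<tau> * v) * lam x v)"
   by (simp add: mult_ac)
  then have "2 * vol x v * lam x (\<tau> * v) \<le> vol x (\<tau> * v) * lam x v"
   using dil_ge_1[of \<tau>] by simp
  then show ?thesis using lam_pos[OF v(1), of x] lam_pos[OF v(2), of x]
   by (simp add: t_def theta_def v_def[symmetric] mult.assoc) (simp add: field_simps)
 qed
 have geo: "p < n ==> t (n - p) \<le> (1 / 2) ^ p" for p
 proof (induction p)
  case (Suc p)
  have "t (n - Suc p) \<le> t (Suc (n - Suc p)) / 2" using Suc.prems by (intro half) auto
  also have "Suc (n - Suc p) = n - p" using Suc.prems by simp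
  finally show ?case using Suc by simp
 qed (simp add: t1)
 have "(\<Sum>l\<le>n. t l) = t 0 + (\<Sum>l\<in>{1..n}. t l)"
  by (simp add: sum.atMost_shift atMost_atLeast0 sum.atLeast_Suc_atMost[of 0 n])
 also have "(\<Sum>l\<in>{1..n}. t l) = (\<Sum>p\<in>{..<n}. t (n - p))"
  by (rule sum.reindex_bij_witness[of _ "\<lambda>p. n - p" "\<lambda>l. n - l"]) auto
 also have "... \<le> (\<Sum>p\<in>{..<n}. (1 / 2) ^ p)" using geo by (intro sum_mono) auto
 also have "... \<le> (2::real)" by (simp add: geometric_sum)
 finally show ?thesis using t1[of 0] by (simp add: t_def)
qed

end

section \<open>The John--Nirenberg inequality\<close>

lemma indicator_subset_le: "A \<subseteq> B ==> indicator A x \<le> (indicator B x :: ennreal)"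
 by (auto simp: indicator_def)

context regular_mean_exponents begin

text \<open>One generation of the stopping time. Balls at which the mean leaves the
  \<open>L\<close>-neighbourhood of \<open>m c r\<close> carry a small proportion of the mass, because
  \<open>b\<close> has bounded mean oscillation; inside them the hypothesis at height \<open>t\<close>
  applies; outside them \<open>b\<close> is almost everywhere within \<open>2 * L\<close> of \<open>m c
  r\<close>.\<close>

lemma John_Nirenberg_step:
 assumes \<rho>: "1 < \<rho>"
 shows "\<exists>L>0. \<forall>b m. regular_means b m --> (\<forall>t \<Phi>. 0 \<le> t --> 0 \<le> \<Phi> -->
  (\<forall>c r. 0 < r --> measure \<mu> {y \<in> ball c r. t < cmod (b y - m c r)} \<le> \<Phi> * vol c (\<rho> * r)) -->
  (\<forall>c r. 0 < r --> measure \<mu> {y \<in> ball c r. t + 2 * L < cmod (b y - m c r)} \<le> (\<Phi> / 2) * vol c (\<rho> * r)))"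
proof -
 define \<epsilon> where "\<epsilon> = (\<rho> - 1) / 2"
 have \<epsilon>: "0 < \<epsilon>" "1 + \<epsilon> < \<rho>" using \<rho> by (auto simp: \<epsilon>_def field_simps)
 obtain a where a: "3 * \<rho> < 2 ^ a" using real_arch_pow[of 2 "3 * \<rho>"] by auto
 define \<tau> where "\<tau> = (2::real) ^ a"
 have \<tau>: "1 < \<tau>" "3 * \<rho> \<le> \<tau>" using a \<rho> by (auto simp: \<tau>_def)
 define \<beta> where "\<beta> = 2 * dil \<tau> + real (N0 ^ a) + 1"
 have \<beta>: "0 < \<beta>" "2 * dil \<tau> \<le> \<beta>" "real (N0 ^ a) < \<beta>" using dil_ge_1[of \<tau>] by (auto simp: \<beta>_def simp del: of_nat_power)
 obtain CG where CG: "0 \<le> CG" "\<And>b m c r n. regular_means b m ==> 0 < r ==>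
  cmod (m c r - m c (\<tau> ^ n * r)) \<le> CG * (1 + (\<Sum>i\<le>n. theta c (\<tau> ^ i * r)))"
  using means_chain[OF \<tau>(1)] by blast
 define A where "A = 3 + \<rho> + \<rho> / \<epsilon>"
 have A: "1 \<le> A" "3 \<le> A" "\<rho> \<le> A" "\<rho> / \<epsilon> \<le> A" using \<rho> \<epsilon> by (auto simp: A_def)
 obtain C1 where C1: "0 \<le> C1" "\<And>b m c r c1 r1. regular_means b m ==> 0 < r ==> 0 < r1 ==>
  ball c r \<subseteq> ball c1 r1 ==> r1 \<le> A * r ==> cmod (m c r - m c1 r1) \<le> C1"
  using means_comparable[OF A(1)] by blast
 obtain CO where CO: "0 \<le> CO" "\<And>b m c r. regular_means b m ==> 0 < r ==>
  (mass (ball c r) (\<lambda>x. cmod (b x - m c r))) \<le> ennreal (CO * vol c (\<rho> * r))"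
  using mean_oscillation[OF \<rho>] by blast
 have "1 < \<rho> / (1 + \<epsilon>)" using \<epsilon> by simp
 from mean_oscillation[OF this] obtain CO' where CO': "0 \<le> CO'" "\<And>b m c r. regular_means b m ==> 0 < r ==>
  (mass (ball c r) (\<lambda>x. cmod (b x - m c r))) \<le> ennreal (CO' * vol c (\<rho> / (1 + \<epsilon>) * r))"
  by blast
 define C2 where "C2 = CO' + C1"
 have C2: "0 \<le> C2" using CO' C1 by (simp add: C2_def)
 \<comment> \<open>The summands secure in turn that scale \<open>\<sigma>\<close> is never selected,
   that drift between scales and tripling of a selected ball cost at most another \<open>L\<close>,
   that an unselected doubling ball is at least half free of the level set, and that selected balls
   carry a small part of the mass.\<close>
 define L where "L = 1 + 3 * C1 + 4 * CG + 2 * CO * \<beta> + 2 * \<beta> * C2"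
 have L: "0 < L" "2 * C1 \<le> L" "4 * CG + C1 \<le> L" "2 * (CO * \<beta>) \<le> L" "2 * \<beta> * C2 \<le> L - CO * \<beta>"
 proof -
  have "0 \<le> CO * \<beta>" "0 \<le> \<beta> * C2" using CO(1) \<beta>(1) C2 by auto
  then show "0 < L" "2 * C1 \<le> L" "4 * CG + C1 \<le> L" "2 * (CO * \<beta>) \<le> L" "2 * \<beta> * C2 \<le> L - CO * \<beta>"
   unfolding L_def using C1(1) CG(1) by linarith+
 qed
 show ?thesis
 proof (intro exI[of _ L] conjI L(1) allI impI)
  fix b :: "'a => complex" and m :: "'a => real => complex" and t \<Phi> :: real and c0 :: 'a and r0 :: real
  assume rm: "regular_means b m" and t: "0 \<le> t" and \<Phi>: "0 \<le> \<Phi>" and r0: "0 < r0"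
   and H: "\<forall>c r. 0 < r --> measure \<mu> {y \<in> ball c r. t < cmod (b y - m c r)} \<le> \<Phi> * vol c (\<rho> * r)"
  have bm[measurable]: "bmeas b" using rm by (rule regular_means_measurable)
  have Gsets: "{y \<in> ball c r. u < cmod (b y - z)} \<in> sets \<mu>" for c r u z
  proof -
   have "{y \<in> space \<mu>. u < cmod (b y - z)} \<inter> ball c r \<in> sets \<mu>" by measurable
   moreover have "{y \<in> ball c r. u < cmod (b y - z)} = {y \<in> space \<mu>. u < cmod (b y - z)} \<inter> ball c r" by auto
   ultimately show ?thesis by simp
  qed
  define m0 where "m0 = m c0 r0"
  define \<sigma> where "\<sigma> = \<epsilon> * r0"
  have \<sigma>: "0 < \<sigma>" using \<epsilon> r0 by (simp add: \<sigma>_def)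
  define s where "s i = \<sigma> / \<tau> ^ i" for i
  have s: "0 < s i" "s i \<le> \<sigma>" for i using \<sigma> \<tau> by (auto simp: s_def divide_le_eq)
  define dbl where "dbl x i \<longleftrightarrow> vol x (\<tau> * s i) \<le> \<beta> * vol x (s i)" for x :: 'a and i
  \<comment> \<open>A scale is selected at \<open>x\<close> if it is doubling and the mean there has
    left the \<open>L\<close>-neighbourhood of \<open>m0\<close>; \<open>R x\<close> is the largest
    selected scale.\<close>
  define sel where "sel x i \<longleftrightarrow> dbl x i \<and> L < cmod (m x (s i) - m0)" for x i
  define Sg where "Sg = {x \<in> ball c0 r0. \<exists>i. sel x i}"
  define R where "R x = s (LEAST i. sel x i)" for x
  have R: "0 < R x" "R x \<le> \<sigma>" for x using s by (auto simp: R_def)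
  have near: "ball x u \<subseteq> ball c0 ((1 + \<epsilon>) * r0)" if "x \<in> ball c0 r0" "u \<le> \<sigma>" for x u
  proof
   fix y assume "y \<in> ball x u"
   then show "y \<in> ball c0 ((1 + \<epsilon>) * r0)"
    using that dist_triangle[of c0 y x] by (simp add: \<sigma>_def algebra_simps)
  qed
  have rr: "(1 + \<epsilon>) * r0 \<le> \<rho> * r0" using \<epsilon> r0 by (intro mult_right_mono) auto
  have subB: "ball c0 r0 \<subseteq> ball c0 (\<rho> * r0)" using \<rho> r0 by (intro subset_ball) simp
  have m_top: "cmod (m x \<sigma> - m0) \<le> L" if x: "x \<in> ball c0 r0" for x
  proof -
   have "ball x \<sigma> \<subseteq> ball c0 (\<rho> * r0)" using near[OF x order_refl] subset_ball[OF rr] by (rule order_trans)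
   moreover have "\<rho> * r0 \<le> A * \<sigma>"
   proof -
    have "\<rho> / \<epsilon> * \<sigma> \<le> A * \<sigma>" using A(4) \<sigma> by (intro mult_right_mono) auto
    then show ?thesis using \<epsilon> by (simp add: \<sigma>_def)
   qed
   ultimately have "cmod (m x \<sigma> - m c0 (\<rho> * r0)) \<le> C1"
    using \<rho> r0 by (intro C1(2)[OF rm \<sigma>]) auto
   moreover have "cmod (m c0 r0 - m c0 (\<rho> * r0)) \<le> C1"
    using \<rho> r0 A(3) subB by (intro C1(2)[OF rm r0]) (auto intro: mult_right_mono)
   ultimately show ?thesis
    using norm_triangle_ineq4[of "m x \<sigma> - m c0 (\<rho> * r0)" "m c0 r0 - m c0 (\<rho> * r0)"] L(2) by (simp add: m0_def)
  qed
  \<comment> \<open>below the selected scale the means have barely moved\<close>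
  have mR: "cmod (m x (R x) - m0) \<le> L + 4 * CG" and selR: "dbl x (LEAST i. sel x i)" "L < cmod (m x (R x) - m0)"
   if x: "x \<in> Sg" for x
  proof -
   define i where "i = (LEAST i. sel x i)"
   have "\<exists>i. sel x i" using x by (simp add: Sg_def)
   then have sel: "sel x i" unfolding i_def by (rule LeastI_ex)
   then show "dbl x (LEAST i. sel x i)" "L < cmod (m x (R x) - m0)" by (auto simp: sel_def i_def R_def)
   have xB: "x \<in> ball c0 r0" using x by (simp add: Sg_def)
   have up: "cmod (m x (s i) - m x (s j)) \<le> 4 * CG" if j: "j \<le> i" "\<And>k. j < k ==> k < i ==> \<not> dbl x k" for j
   proof -
    have sj: "\<tau> ^ l * s i = s (i - l)" if "l \<le> i" for l
     using \<tau>(1) that by (simp add: s_def field_simps power_add[symmetric])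
    have "(\<Sum>l\<le>i - j. theta x (\<tau> ^ l * s i)) \<le> 3"
    proof (rule nondoubling_sum_theta[OF \<tau>(1) \<beta>(2) s(1)])
     fix l assume l: "1 \<le> l" "l < i - j"
     then have "\<not> dbl x (i - l)" by (intro j(2)) auto
     then show "\<beta> * vol x (\<tau> ^ l * s i) < vol x (\<tau> ^ Suc l * s i)"
      using l sj[of l] by (simp add: dbl_def mult.assoc)
    qed
    then have "CG * (1 + (\<Sum>l\<le>i - j. theta x (\<tau> ^ l * s i))) \<le> CG * 4" using CG by (intro mult_left_mono) auto
    then show ?thesis using CG(2)[OF rm s(1)[of i], of x "i - j"] sj[of "i - j"] j(1) by simp
   qed
   have "\<exists>j. cmod (m x (s i) - m x (s j)) \<le> 4 * CG \<and> cmod (m x (s j) - m0) \<le> L"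
   proof (cases "\<exists>j<i. dbl x j")
    case True
    define j where "j = Max {j. j < i \<and> dbl x j}"
    have fin: "finite {j. j < i \<and> dbl x j}" by simp
    have "j \<in> {j. j < i \<and> dbl x j}" unfolding j_def using True by (intro Max_in[OF fin]) auto
    then have j: "j < i" "dbl x j" by auto
    have "\<not> dbl x k" if k: "j < k" "k < i" for k
    proof
     assume "dbl x k"
     then have "k \<in> {j. j < i \<and> dbl x j}" using k by simp
     then have "k \<le> j" unfolding j_def by (rule Max_ge[OF fin])
     then show False using k by simp
    qed
    then have "cmod (m x (s i) - m x (s j)) \<le> 4 * CG" using j by (intro up) auto
    moreover have "\<not> sel x j" using j(1) unfolding i_def by (rule not_less_Least)
    ultimately show ?thesis using j by (auto simp: sel_def)
   next
    case False
    then have "cmod (m x (s i) - m x (s 0)) \<le> 4 * CG" by (intro up) auto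
    then show ?thesis using m_top[OF xB] by (intro exI[of _ 0]) (auto simp: s_def)
   qed
   then obtain j where j: "cmod (m x (s i) - m x (s j)) \<le> 4 * CG" "cmod (m x (s j) - m0) \<le> L" by blast
   then show "cmod (m x (R x) - m0) \<le> L + 4 * CG"
    using norm_triangle_ineq[of "m x (s i) - m x (s j)" "m x (s j) - m0"] by (simp add: R_def i_def)
  qed
  have m3R: "cmod (m x (3 * R x) - m0) \<le> 2 * L" if x: "x \<in> Sg" for x
  proof -
   have "cmod (m x (R x) - m x (3 * R x)) \<le> C1"
    using R[of x] A(2) by (intro C1(2)[OF rm]) (auto intro: subset_ball mult_right_mono)
   then show ?thesis using mR[OF x] L(3)
    norm_triangle_ineq4[of "m x (R x) - m0" "m x (R x) - m x (3 * R x)"] by simp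
  qed
  have dblR: "vol x u \<le> \<beta> * vol x (R x)" if x: "x \<in> Sg" and u: "u \<le> \<tau> * R x" for x u
  proof -
   have "vol x u \<le> vol x (\<tau> * R x)" using u by (intro measure_ball_mono subset_ball) auto
   also have "... \<le> \<beta> * vol x (R x)" using selR(1)[OF x] by (simp add: dbl_def R_def)
   finally show ?thesis .
  qed
  have B0int: "mass (ball c0 ((1 + \<epsilon>) * r0)) (\<lambda>y. cmod (b y - m0)) \<le> ennreal (C2 * vol c0 (\<rho> * r0))"
  proof -
   define r1 where "r1 = (1 + \<epsilon>) * r0"
   have r1: "0 < r1" "r0 \<le> r1" "\<rho> / (1 + \<epsilon>) * r1 = \<rho> * r0" "r1 \<le> \<rho> * r0"
    using \<epsilon> r0 rr by (auto simp: r1_def)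
   have "r1 \<le> A * r0" using r1(4) A(3) r0 by (smt (verit) mult_right_mono)
   then have mm: "cmod (m c0 r1 - m0) \<le> C1"
    using C1(2)[OF rm r0 r1(1) subset_ball[OF r1(2)]] by (simp add: m0_def norm_minus_commute)
   have "mass (ball c0 r1) (\<lambda>y. cmod (b y - m0)) \<le>
     (\<integral>\<^sup>+y. ennreal (cmod (b y - m c0 r1)) * indicator (ball c0 r1) y + ennreal C1 * indicator (ball c0 r1) y \<partial>\<mu>)"
   proof (intro nn_integral_mono)
    fix y
    have "cmod (b y - m0) \<le> cmod (b y - m c0 r1) + C1"
     using norm_triangle_ineq[of "b y - m c0 r1" "m c0 r1 - m0"] mm by simp
    then show "ennreal (cmod (b y - m0)) * indicator (ball c0 r1) y \<le>
      ennreal (cmod (b y - m c0 r1)) * indicator (ball c0 r1) y + ennreal C1 * indicator (ball c0 r1) y"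
     using C1(1) by (auto simp: indicator_def simp flip: ennreal_plus intro!: ennreal_leI)
   qed
   also have "... = mass (ball c0 r1) (\<lambda>y. cmod (b y - m c0 r1)) + ennreal C1 * emeasure \<mu> (ball c0 r1)"
    by (subst nn_integral_add) (auto simp: nn_integral_cmult_indicator)
   also have "... \<le> ennreal (CO' * vol c0 (\<rho> * r0)) + ennreal C1 * emeasure \<mu> (ball c0 (\<rho> * r0))"
    using CO'(2)[OF rm r1(1), of c0] r1(3,4)
    by (intro add_mono mult_left_mono emeasure_mono subset_ball) auto
   also have "... = ennreal (C2 * vol c0 (\<rho> * r0))"
    using C1 CO' by (simp add: emeasure_ball ennreal_mult[symmetric] C2_def algebra_simps flip: ennreal_plus)
   finally show ?thesis by (simp add: r1_def)
  qed
  define M where "M = vol c0 (\<rho> * r0)"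
  define G where "G = {y \<in> ball c0 r0. t + 2 * L < cmod (b y - m0)}"
  have [measurable]: "G \<in> sets \<mu>" unfolding G_def by (rule Gsets)
  have small: "emeasure \<mu> (G \<inter> (\<Union>x\<in>I. ball x (R x))) \<le> ennreal (\<Phi> / 2 * M)" if I: "finite I" "I \<subseteq> Sg" for I
  proof -
   obtain J where J: "J \<subseteq> I" "disjoint_family_on (\<lambda>i. ball i (R i)) J"
     "(\<Union>i\<in>I. ball i (R i)) \<subseteq> (\<Union>j\<in>J. ball j (3 * R j))"
    using finite_Vitali_covering[OF I(1), of "\<lambda>x. x" R] by blast
   have finJ: "finite J" using J I finite_subset by blast
   have JS: "x \<in> Sg" if "x \<in> J" for x using that J I by blast
   define V where "V = (\<Sum>x\<in>J. vol x (R x))"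
   \<comment> \<open>the selected balls carry little mass since the mean jumps by \<open>L\<close> there\<close>
   have "ennreal (L * V) \<le> ennreal (C2 * M + CO * \<beta> * V)"
   proof -
    have "ennreal (L * V) = (\<Sum>x\<in>J. ennreal (L * vol x (R x)))"
     using L(1) by (simp add: V_def sum_distrib_left sum_ennreal)
    also have "... \<le> (\<Sum>x\<in>J. (mass (ball x (R x)) (\<lambda>y. cmod (b y - m0))) + ennreal (CO * \<beta> * vol x (R x)))"
    proof (rule sum_mono)
     fix x assume "x \<in> J"
     then have x: "x \<in> Sg" by (rule JS)
     have "ennreal (L * vol x (R x)) = (\<integral>\<^sup>+y. ennreal L * indicator (ball x (R x)) y \<partial>\<mu>)"
      using L(1) by (simp add: nn_integral_cmult_indicator emeasure_ball ennreal_mult)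
     also have "... \<le> (\<integral>\<^sup>+y. ennreal (cmod (b y - m0)) * indicator (ball x (R x)) y
       + ennreal (cmod (b y - m x (R x))) * indicator (ball x (R x)) y \<partial>\<mu>)"
     proof (intro nn_integral_mono)
      fix y
      have "L \<le> cmod (b y - m0) + cmod (b y - m x (R x))"
       using selR(2)[OF x] norm_triangle_ineq4[of "b y - m0" "b y - m x (R x)"] by simp
      then show "ennreal L * indicator (ball x (R x)) y \<le> ennreal (cmod (b y - m0)) * indicator (ball x (R x)) y
       + ennreal (cmod (b y - m x (R x))) * indicator (ball x (R x)) y"
       by (auto simp: indicator_def simp flip: ennreal_plus intro!: ennreal_leI)
     qed
     also have "... = mass (ball x (R x)) (\<lambda>y. cmod (b y - m0))
       + mass (ball x (R x)) (\<lambda>y. cmod (b y - m x (R x)))"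
      by (intro nn_integral_add) auto
     also have "mass (ball x (R x)) (\<lambda>y. cmod (b y - m x (R x))) \<le> ennreal (CO * vol x (\<rho> * R x))"
      by (rule CO(2)[OF rm R(1)])
     also have "CO * vol x (\<rho> * R x) \<le> CO * \<beta> * vol x (R x)"
     proof -
      have "\<rho> * R x \<le> \<tau> * R x" using \<tau> \<rho> R(1)[of x] by (intro mult_right_mono) auto
      from mult_left_mono[OF dblR[OF x this] CO(1)] show ?thesis by (simp add: mult.assoc)
     qed
     finally show "ennreal (L * vol x (R x)) \<le>
      (mass (ball x (R x)) (\<lambda>y. cmod (b y - m0))) + ennreal (CO * \<beta> * vol x (R x))"
      by (simp add: ennreal_leI add_left_mono)
    qed
    also have "... = (\<Sum>x\<in>J. \<integral>\<^sup>+y\<in>ball x (R x). ennreal (cmod (b y - m0)) \<partial>\<mu>) + ennreal (CO * \<beta> * V)"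
     using CO(1) \<beta>(1) by (simp add: sum.distrib V_def sum_distrib_left sum_ennreal)
    also have "(\<Sum>x\<in>J. \<integral>\<^sup>+y\<in>ball x (R x). ennreal (cmod (b y - m0)) \<partial>\<mu>) =
     (mass ((\<Union>x\<in>J. ball x (R x))) (\<lambda>y. cmod (b y - m0)))"
    proof -
     have "(\<Sum>x\<in>J. \<integral>\<^sup>+y\<in>ball x (R x). ennreal (cmod (b y - m0)) \<partial>\<mu>) =
       (\<integral>\<^sup>+y. (\<Sum>x\<in>J. ennreal (cmod (b y - m0)) * indicator (ball x (R x)) y) \<partial>\<mu>)"
      by (intro nn_integral_sum[symmetric]) auto
     also have "... = (\<integral>\<^sup>+y. ennreal (cmod (b y - m0)) * indicator (\<Union>x\<in>J. ball x (R x)) y \<partial>\<mu>)"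
      by (simp add: sum_distrib_left[symmetric] indicator_UN_disjoint[OF finJ J(2)])
     finally show ?thesis .
    qed
    also have "... \<le> (mass (ball c0 ((1 + \<epsilon>) * r0)) (\<lambda>y. cmod (b y - m0)))"
    proof (intro nn_integral_mono mult_left_mono)
     fix y
     have "(\<Union>x\<in>J. ball x (R x)) \<subseteq> ball c0 ((1 + \<epsilon>) * r0)"
      using near R(2) JS by (intro UN_least) (auto simp: Sg_def)
     then show "indicator (\<Union>x\<in>J. ball x (R x)) y \<le> (indicator (ball c0 ((1 + \<epsilon>) * r0)) y :: ennreal)"
      by (rule indicator_subset_le)
    qed simp
    also note B0int
    finally show ?thesis using C2 CO(1) \<beta>(1)
     by (simp add: M_def V_def sum_nonneg flip: ennreal_plus)
   qed
   then have "L * V \<le> C2 * M + CO * \<beta> * V"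
    using C2 CO(1) \<beta>(1) by (subst (asm) ennreal_le_iff) (auto simp: M_def V_def sum_nonneg)
   then have "(L - CO * \<beta>) * V \<le> C2 * M" by (simp add: algebra_simps)
   moreover have V0: "0 \<le> V" by (simp add: V_def sum_nonneg)
   ultimately have "2 * \<beta> * C2 * V \<le> C2 * M" using L(5) mult_right_mono[OF L(5) V0] by simp
   moreover have "V * L \<le> C2 * M + CO * \<beta> * V" using \<open>L * V \<le> _\<close> by (simp add: mult.commute)
   ultimately have V: "2 * \<beta> * V \<le> M"
   proof (cases "C2 = 0")
    case True
    then have "(L - CO * \<beta>) * V \<le> 0" using \<open>(L - CO * \<beta>) * V \<le> C2 * M\<close> by simp
    moreover have "0 < L - CO * \<beta>" using L(1,4) CO(1) \<beta>(1) by (simp add: less_le_trans[of _ "L / 2"])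
    ultimately have "V = 0" using V0 by (simp add: mult_le_0_iff)
    then show ?thesis by (simp add: M_def)
   next
    case False
    then show ?thesis using \<open>2 * \<beta> * C2 * V \<le> C2 * M\<close> C2
     by (simp add: mult.commute[of _ C2] mult.left_commute[of _ C2])
   qed
   have "emeasure \<mu> (G \<inter> (\<Union>x\<in>I. ball x (R x))) \<le> emeasure \<mu> (\<Union>x\<in>J. G \<inter> ball x (3 * R x))"
    using J(3) finJ by (intro emeasure_mono) auto
   also have "... \<le> (\<Sum>x\<in>J. emeasure \<mu> (G \<inter> ball x (3 * R x)))"
    using finJ by (intro emeasure_subadditive_finite) auto
   also have "... \<le> (\<Sum>x\<in>J. ennreal (\<Phi> * (\<beta> * vol x (R x))))"
   proof (rule sum_mono)
    fix x assume "x \<in> J"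
    then have x: "x \<in> Sg" by (rule JS)
    define E where "E = {y \<in> ball x (3 * R x). t < cmod (b y - m x (3 * R x))}"
    have E: "E \<in> fmeasurable \<mu>" unfolding E_def by (rule fmeasurable_bounded[OF _ Gsets]) auto
    \<comment> \<open>The mean of the tripled ball is within \<open>2 * L\<close> of \<open>m0\<close>,
      so the level \<open>t + 2 * L\<close> about \<open>m0\<close> implies the level \<open>t\<close>
      about it.\<close>
    have "G \<inter> ball x (3 * R x) \<subseteq> E"
    proof
     fix y assume y: "y \<in> G \<inter> ball x (3 * R x)"
     have "cmod (b y - m0) \<le> cmod (b y - m x (3 * R x)) + cmod (m x (3 * R x) - m0)"
      using norm_triangle_ineq[of "b y - m x (3 * R x)" "m x (3 * R x) - m0"] by simp
     then show "y \<in> E" using y m3R[OF x] by (auto simp: G_def E_def)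
    qed
    then have "emeasure \<mu> (G \<inter> ball x (3 * R x)) \<le> emeasure \<mu> E"
     using E by (intro emeasure_mono) auto
    also have "... = ennreal (measure \<mu> E)" using E by (simp add: emeasure_eq_measure2)
    also have "... \<le> ennreal (\<Phi> * vol x (\<rho> * (3 * R x)))"
     using H R(1)[of x] unfolding E_def by (intro ennreal_leI) simp
    also have "... \<le> ennreal (\<Phi> * (\<beta> * vol x (R x)))"
    proof (intro ennreal_leI mult_left_mono \<Phi> dblR[OF x])
     show "\<rho> * (3 * R x) \<le> \<tau> * R x" using mult_right_mono[OF \<tau>(2), of "R x"] R(1)[of x] by simp
    qed
    finally show "emeasure \<mu> (G \<inter> ball x (3 * R x)) \<le> ennreal (\<Phi> * (\<beta> * vol x (R x)))" .
   qed
   also have "... = ennreal (\<Phi> * (\<beta> * V))"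
    using \<Phi> \<beta>(1) by (simp add: V_def sum_distrib_left sum_ennreal)
   also have "... \<le> ennreal (\<Phi> / 2 * M)"
    using V \<Phi> mult_left_mono[of "\<beta> * V" "M / 2" \<Phi>] by (intro ennreal_leI) simp
   finally show ?thesis .
  qed
  have "\<exists>S'\<subseteq>Sg. countable S' \<and> Sg \<subseteq> (\<Union>x\<in>S'. ball x (R x))"
   by (rule countable_subcover) (use R in auto)
  then obtain S' where S': "S' \<subseteq> Sg" "countable S'" "Sg \<subseteq> (\<Union>x\<in>S'. ball x (R x))" by blast
  define O' where "O' = (\<Union>x\<in>S'. ball x (R x))"
  have [measurable]: "O' \<in> sets \<mu>" unfolding O'_def using S'(2) by (intro sets.countable_UN') auto
  have "emeasure \<mu> (\<Union>x\<in>S'. G \<inter> ball x (R x)) \<le> ennreal (\<Phi> / 2 * M)"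
  proof (rule emeasure_countable_UN_le[OF S'(2)])
   fix I assume "finite I" "I \<subseteq> S'"
   then have "emeasure \<mu> (G \<inter> (\<Union>i\<in>I. ball i (R i))) \<le> ennreal (\<Phi> / 2 * M)"
    using S'(1) by (intro small) blast+
   moreover have "G \<inter> (\<Union>i\<in>I. ball i (R i)) = (\<Union>i\<in>I. G \<inter> ball i (R i))" by blast
   ultimately show "emeasure \<mu> (\<Union>i\<in>I. G \<inter> ball i (R i)) \<le> ennreal (\<Phi> / 2 * M)"
    by (simp only:)
  qed measurable
  moreover have "(\<Union>x\<in>S'. G \<inter> ball x (R x)) = G \<inter> O'" unfolding O'_def by blast
  ultimately have GO: "emeasure \<mu> (G \<inter> O') \<le> ennreal (\<Phi> / 2 * M)" by (simp only:)
  \<comment> \<open>A point of \<open>G\<close> outside the selected balls has arbitrarily small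
    doubling scales, at all of which the mean is within \<open>L\<close> of \<open>m0\<close>; by
    Chebyshev \<open>G\<close> fills at most half of those balls.\<close>
  have "emeasure \<mu> (G - O') = 0"
  proof (rule thin_set_null)
   show "G - O' \<in> sets \<mu>" by measurable
   show "G - O' \<subseteq> ball c0 r0" by (auto simp: G_def)
   show "0 \<le> \<beta>" using \<beta>(1) by (rule less_imp_le)
   have ae: "AE x in \<mu>. x \<in> ball c0 r0 --> (\<forall>i0. \<exists>i\<ge>i0. dbl x i)"
    using doubling_radii_AE[OF r0 \<sigma> \<beta>(3)] by (simp add: dbl_def s_def \<tau>_def)
   show "AE x in \<mu>. x \<in> G - O' --> (\<forall>e>0. \<exists>s. 0 < s \<and> s < e \<and>
    vol x (3 * s) \<le> \<beta> * vol x s \<and>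
    2 * measure \<mu> ((G - O') \<inter> ball x s) \<le> vol x s)"
    using ae
   proof eventually_elim
    case (elim x)
    show ?case
    proof (intro impI allI)
     fix e :: real assume x: "x \<in> G - O'" and e: "0 < e"
     obtain i0 where i0: "\<sigma> / e < \<tau> ^ i0" using real_arch_pow[OF \<tau>(1)] by blast
     have xB: "x \<in> ball c0 r0" using x by (simp add: G_def)
     then obtain i where i: "i0 \<le> i" "dbl x i" using elim by blast
     have "\<tau> ^ i0 \<le> \<tau> ^ i" using \<tau>(1) i(1) by (intro power_increasing) auto
     then have "\<sigma> / e < \<tau> ^ i" using i0 by linarith
     then have se: "s i < e" using e \<tau>(1) by (simp add: s_def field_simps)
     have "x \<notin> Sg" using x S'(3) by (auto simp: O'_def)
     then have "\<not> sel x i" using xB by (auto simp: Sg_def)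
     then have mi: "cmod (m x (s i) - m0) \<le> L" using i(2) by (auto simp: sel_def)
     have d: "vol x u \<le> \<beta> * vol x (s i)" if "u \<le> \<tau> * s i" for u
     proof -
      have "vol x u \<le> vol x (\<tau> * s i)" using that by (intro measure_ball_mono subset_ball) auto
      then show ?thesis using i(2) by (simp add: dbl_def)
     qed
     have "2 * measure \<mu> ((G - O') \<inter> ball x (s i)) \<le> vol x (s i)"
     proof -
      define E where "E = (G - O') \<inter> ball x (s i)"
      have [measurable]: "E \<in> sets \<mu>" by (simp add: E_def)
      have E: "E \<in> fmeasurable \<mu>" by (rule fmeasurable_bounded[of _ x "s i"]) (auto simp: E_def)
      have "ennreal (L * measure \<mu> E) = (\<integral>\<^sup>+y. ennreal L * indicator E y \<partial>\<mu>)"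
       using L(1) E by (simp add: nn_integral_cmult_indicator emeasure_eq_measure2 ennreal_mult)
      also have "... \<le> (mass (ball x (s i)) (\<lambda>y. cmod (b y - m x (s i))))"
      proof (intro nn_integral_mono)
       fix y
       show "ennreal L * indicator E y \<le> ennreal (cmod (b y - m x (s i))) * indicator (ball x (s i)) y"
       proof (cases "y \<in> E")
        case True
        then have "2 * L < cmod (b y - m0)" "y \<in> ball x (s i)" using t by (auto simp: E_def G_def)
        moreover have "cmod (b y - m0) \<le> cmod (b y - m x (s i)) + cmod (m x (s i) - m0)"
         using norm_triangle_ineq[of "b y - m x (s i)" "m x (s i) - m0"] by simp
        ultimately show ?thesis using mi by (auto intro!: ennreal_leI simp: indicator_def)
       qed simp
      qed
      also have "... \<le> ennreal (CO * vol x (\<rho> * s i))" by (rule CO(2)[OF rm s(1)])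
      finally have "L * measure \<mu> E \<le> CO * vol x (\<rho> * s i)"
       using CO(1) by (subst (asm) ennreal_le_iff) auto
      also have "... \<le> CO * (\<beta> * vol x (s i))"
      proof (intro mult_left_mono CO(1) d)
       show "\<rho> * s i \<le> \<tau> * s i" using \<tau> \<rho> s(1)[of i] by (intro mult_right_mono) auto
      qed
      also have "... \<le> L / 2 * vol x (s i)"
       using mult_right_mono[OF L(4), of "vol x (s i) / 2"] by simp
      finally have "L * (2 * measure \<mu> E) \<le> L * vol x (s i)" by simp
      then show ?thesis using L(1) by (simp add: E_def)
     qed
     moreover have "vol x (3 * s i) \<le> \<beta> * vol x (s i)"
      using \<tau> \<rho> s(1)[of i] by (intro d mult_right_mono) auto
     ultimately show "\<exists>s. 0 < s \<and> s < e \<and> vol x (3 * s) \<le> \<beta> * vol x s \<and>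
       2 * measure \<mu> ((G - O') \<inter> ball x s) \<le> vol x s"
      using s(1)[of i] se by blast
    qed
   qed
  qed
  moreover have "emeasure \<mu> G \<le> emeasure \<mu> (G \<inter> O') + emeasure \<mu> (G - O')"
  proof -
   have "G = (G \<inter> O') \<union> (G - O')" by blast
   then show ?thesis using emeasure_subadditive[of "G \<inter> O'" \<mu> "G - O'"] by simp
  qed
  ultimately have "emeasure \<mu> G \<le> ennreal (\<Phi> / 2 * M)" using GO by simp
  then show "measure \<mu> {y \<in> ball c0 r0. t + 2 * L < cmod (b y - m c0 r0)} \<le> (\<Phi> / 2) * vol c0 (\<rho> * r0)"
  proof -
   have "measure \<mu> G = enn2real (emeasure \<mu> G)" by (simp only: measure_def)
   also have "... \<le> \<Phi> / 2 * M"
    using \<Phi> by (intro enn2real_leI \<open>emeasure \<mu> G \<le> ennreal (\<Phi> / 2 * M)\<close>) (simp add: M_def)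
   finally show ?thesis by (simp only: G_def M_def m0_def)
  qed
 qed
qed

lemma John_Nirenberg:
 assumes \<rho>: "1 < \<rho>"
 shows "\<exists>L>0. \<forall>b m. regular_means b m --> (\<forall>c r n. 0 < r -->
  measure \<mu> {y \<in> ball c r. 2 * L * real n < cmod (b y - m c r)} \<le> (1 / 2) ^ n * vol c (\<rho> * r))"
proof -
 obtain L where L: "0 < L" "\<forall>b m. regular_means b m --> (\<forall>t \<Phi>. 0 \<le> t --> 0 \<le> \<Phi> -->
  (\<forall>c r. 0 < r --> measure \<mu> {y \<in> ball c r. t < cmod (b y - m c r)} \<le> \<Phi> * vol c (\<rho> * r)) -->
  (\<forall>c r. 0 < r --> measure \<mu> {y \<in> ball c r. t + 2 * L < cmod (b y - m c r)} \<le> (\<Phi> / 2) * vol c (\<rho> * r)))"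
  using John_Nirenberg_step[OF \<rho>] by (elim exE conjE) (rule that)
 show ?thesis
 proof (intro exI[of _ L] conjI L(1) allI impI)
  fix b :: "'a => complex" and m :: "'a => real => complex" and c :: 'a and r :: real and n :: nat
  assume rm: "regular_means b m" and r: "0 < r"
  note [measurable] = regular_means_measurable[OF rm]
  have "\<forall>c r. 0 < r --> measure \<mu> {y \<in> ball c r. 2 * L * real n < cmod (b y - m c r)} \<le> (1 / 2) ^ n * vol c (\<rho> * r)"
  proof (induction n)
   case 0
   show ?case
   proof (intro allI impI)
    fix c :: 'a and r :: real assume r: "0 < r"
    have "{y \<in> space \<mu>. 2 * L * real 0 < cmod (b y - m c r)} \<inter> ball c r \<in> sets \<mu>" by measurable
    moreover have "{y \<in> space \<mu>. 2 * L * real 0 < cmod (b y - m c r)} \<inter> ball c r = {y \<in> ball c r. 2 * L * real 0 < cmod (b y - m c r)}"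
     by auto
    ultimately have "{y \<in> ball c r. 2 * L * real 0 < cmod (b y - m c r)} \<in> sets \<mu>" by (simp only:)
    moreover have "{y \<in> ball c r. 2 * L * real 0 < cmod (b y - m c r)} \<subseteq> ball c r" by blast
    moreover have "ball c r \<subseteq> ball c (\<rho> * r)" using \<rho> r by (intro subset_ball) simp
    ultimately have "measure \<mu> {y \<in> ball c r. 2 * L * real 0 < cmod (b y - m c r)} \<le> vol c (\<rho> * r)"
     by (meson measure_ball_mono order_trans)
    then show "measure \<mu> {y \<in> ball c r. 2 * L * real 0 < cmod (b y - m c r)} \<le> (1 / 2) ^ 0 * vol c (\<rho> * r)"
     by simp
   qed
  next
   case (Suc n)
   have e: "2 * L * real (Suc n) = 2 * L * real n + 2 * L" by (simp add: algebra_simps)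
   have "0 \<le> 2 * L * real n" using L(1) by simp
   have "\<forall>c r. 0 < r --> measure \<mu> {y \<in> ball c r. 2 * L * real n + 2 * L < cmod (b y - m c r)}
     \<le> ((1 / 2) ^ n / 2) * vol c (\<rho> * r)"
    by (rule L(2)[THEN spec, THEN spec, THEN mp, OF rm, THEN spec, THEN spec, THEN mp, THEN mp, THEN mp, OF \<open>0 \<le> 2 * L * real n\<close> _ Suc])
     simp
   then show ?case unfolding e by simp
  qed
  then show "measure \<mu> {y \<in> ball c r. 2 * L * real n < cmod (b y - m c r)} \<le> (1 / 2) ^ n * vol c (\<rho> * r)"
   using r by blast
 qed
qed

lemma summable_powr_geometric:
 fixes p :: real
 shows "summable (\<lambda>n. real (Suc n) powr p * (1 / 2) ^ n)"
proof -
 have "(\<lambda>n. (real (Suc (Suc n)) / real (Suc n)) powr p * (1 / 2)) \<longlonglongrightarrow> 1 powr p * (1 / 2)"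
 proof (intro tendsto_intros)
  have "(\<lambda>n. 1 + inverse (real (Suc n))) \<longlonglongrightarrow> 1 + 0"
   by (intro tendsto_intros LIMSEQ_inverse_real_of_nat)
  moreover have "(\<lambda>n. 1 + inverse (real (Suc n))) = (\<lambda>n. real (Suc (Suc n)) / real (Suc n))"
   by (auto simp: fun_eq_iff field_simps)
  ultimately show "(\<lambda>n. real (Suc (Suc n)) / real (Suc n)) \<longlonglongrightarrow> 1" by simp
 qed auto
 then have "eventually (\<lambda>n. (real (Suc (Suc n)) / real (Suc n)) powr p * (1 / 2) < 3 / 4) sequentially"
  by (rule order_tendstoD) simp
 then obtain N where N: "\<And>n. n \<ge> N ==> (real (Suc (Suc n)) / real (Suc n)) powr p * (1 / 2) < 3 / 4"
  by (auto simp: eventually_sequentially)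
 show ?thesis
 proof (rule summable_ratio_test[of "3 / 4" N])
  fix n assume n: "n \<ge> N"
  have "real (Suc (Suc n)) powr p * (1 / 2) ^ Suc n =
    ((real (Suc (Suc n)) / real (Suc n)) powr p * (1 / 2)) * (real (Suc n) powr p * (1 / 2) ^ n)"
   by (simp add: powr_divide)
  also have "... \<le> 3 / 4 * (real (Suc n) powr p * (1 / 2) ^ n)"
   using N[OF n] by (intro mult_right_mono) auto
  finally show "norm (real (Suc (Suc n)) powr p * (1 / 2) ^ Suc n) \<le> 3 / 4 * norm (real (Suc n) powr p * (1 / 2) ^ n)"
   by simp
 qed simp
qed

text \<open>Summation of the exponential decay over the level sets.\<close>

lemma power_oscillation:
 assumes \<rho>: "1 < \<rho>" and p: "0 < p"
 shows "\<exists>C\<ge>0. \<forall>b m. regular_means b m --> (\<forall>c r. 0 < r -->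
  (mass (ball c r) (\<lambda>x. cmod (b x - m c r) powr p)) \<le> ennreal (C * vol c (\<rho> * r)))"
proof -
 obtain L where L: "0 < L" "\<And>b m c r n. regular_means b m ==> 0 < r ==>
  measure \<mu> {y \<in> ball c r. 2 * L * real n < cmod (b y - m c r)} \<le> (1 / 2) ^ n * vol c (\<rho> * r)"
  using John_Nirenberg[OF \<rho>] by blast
 define w where "w n = (2 * L * real (Suc n)) powr p" for n
 have w_eq: "w n * (1 / 2) ^ n = (2 * L) powr p * (real (Suc n) powr p * (1 / 2) ^ n)" for n
  using L(1) by (simp add: w_def powr_mult mult.assoc)
 have sm: "summable (\<lambda>n. w n * (1 / 2) ^ n)"
  unfolding w_eq by (intro summable_mult summable_powr_geometric)
 define C where "C = (\<Sum>n. w n * (1 / 2) ^ n)"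
 have C: "0 \<le> C" unfolding C_def by (intro suminf_nonneg sm) (simp add: w_def)
 show ?thesis
 proof (intro exI[of _ C] conjI C allI impI)
  fix b :: "'a => complex" and m :: "'a => real => complex" and c :: 'a and r :: real
  assume rm: "regular_means b m" and r: "0 < r"
  have [measurable]: "bmeas b" using rm by (rule regular_means_measurable)
  define g where "g y = cmod (b y - m c r)" for y
  define E where "E n = {y \<in> ball c r. 2 * L * real n < g y}" for n
  define M where "M = vol c (\<rho> * r)"
  have Em[measurable]: "E n \<in> sets \<mu>" for n
  proof -
   have "{y \<in> space \<mu>. 2 * L * real n < cmod (b y - m c r)} \<inter> ball c r \<in> sets \<mu>" by measurable
   moreover have "E n = {y \<in> space \<mu>. 2 * L * real n < cmod (b y - m c r)} \<inter> ball c r" by (auto simp: E_def g_def)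
   ultimately show ?thesis by simp
  qed
  have E: "emeasure \<mu> (E n) \<le> ennreal ((1 / 2) ^ n * M)" for n
  proof -
   have "E n \<in> fmeasurable \<mu>" by (rule fmeasurable_bounded[OF _ Em, of _ c r]) (auto simp: E_def)
   then show ?thesis using L(2)[OF rm r, of c n]
    by (simp add: emeasure_eq_measure2 E_def g_def M_def ennreal_leI)
  qed
  have "mass (ball c r) (\<lambda>x. g x powr p) \<le> (\<integral>\<^sup>+x. (\<Sum>n. ennreal (w n) * indicator (E n) x) \<partial>\<mu>)"
  proof (intro nn_integral_mono)
   fix x
   show "ennreal (g x powr p) * indicator (ball c r) x \<le> (\<Sum>n. ennreal (w n) * indicator (E n) x)"
   proof (cases "x \<in> ball c r \<and> 0 < g x")
    case True
    define n where "n = nat (\<lceil>g x / (2 * L)\<rceil> - 1)"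
    have pos: "0 < g x / (2 * L)" using True L(1) by simp
    have "real n < g x / (2 * L)" "g x / (2 * L) \<le> real (Suc n)" using pos unfolding n_def by linarith+
    then have n: "2 * L * real n < g x" "g x \<le> 2 * L * real (Suc n)"
     using L(1) by (auto simp: field_simps)
    have "ennreal (g x powr p) \<le> ennreal (w n)"
     unfolding w_def using n(2) p True by (intro ennreal_leI powr_mono2) auto
    also have "... = ennreal (w n) * indicator (E n) x" using n(1) True by (simp add: E_def)
    also have "... \<le> (\<Sum>n. ennreal (w n) * indicator (E n) x)"
    proof -
     have "h n \<le> (\<Sum>n. h n)" for h :: "nat => ennreal"
      using sum_le_suminf[OF summableI, of "{n}" h] by simp
     then show ?thesis .
    qed
    finally show ?thesis using True by simp
   next
    case False
    then have "x \<notin> ball c r \<or> g x = 0" by (auto simp: g_def)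
    then show ?thesis by auto
   qed
  qed
  also have "... = (\<Sum>n. ennreal (w n) * emeasure \<mu> (E n))"
   by (subst nn_integral_suminf) (auto simp: nn_integral_cmult_indicator)
  also have "... \<le> (\<Sum>n. ennreal (w n * (1 / 2) ^ n * M))"
  proof (intro suminf_le summableI)
   fix n
   have "ennreal (w n) * emeasure \<mu> (E n) \<le> ennreal (w n) * ennreal ((1 / 2) ^ n * M)"
    by (intro mult_left_mono E) auto
   also have "... = ennreal (w n * (1 / 2) ^ n * M)"
    by (simp add: ennreal_mult[symmetric] w_def M_def mult.assoc)
   finally show "ennreal (w n) * emeasure \<mu> (E n) \<le> ennreal (w n * (1 / 2) ^ n * M)" .
  qed
  also have "... = ennreal (\<Sum>n. w n * (1 / 2) ^ n * M)"
   by (intro suminf_ennreal2 summable_mult2 sm) (simp add: w_def M_def)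
  also have "(\<Sum>n. w n * (1 / 2) ^ n * M) = C * M" unfolding C_def by (rule suminf_mult2[OF sm, symmetric])
  finally show "mass (ball c r) (\<lambda>x. cmod (b x - m c r) powr p) \<le> ennreal (C * vol c (\<rho> * r))"
   by (simp add: g_def M_def)
 qed
qed

end

section \<open>Strong and weak bounds\<close>

text \<open>Membership in \<open>L\<^sup>p\<close> with norm at most \<open>F\<close>, expressed
  without the norm of the space: this form composes with estimates of non-negative integrals.\<close>

definition Lp_bound :: "'a measure => real => real => ('a => complex) => bool" where
 "Lp_bound M p F f \<longleftrightarrow> f \<in> borel_measurable M \<and> 0 \<le> F \<and>
  (\<integral>\<^sup>+x. ennreal (cmod (f x) powr p) \<partial>M) \<le> ennreal (F powr p)"

text \<open>The normed version of weak \<open>L\<^sup>q\<close> for \<open>q = 1 / (1 -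
  \<alpha>)\<close>. Unlike the distributional quasi-norm it is additive without loss.\<close>

definition weak_bound :: "'a measure => real => real => ('a => complex) => bool" where
 "weak_bound M \<alpha> B g \<longleftrightarrow> g \<in> borel_measurable M \<and> 0 \<le> B \<and>
  (\<forall>A\<in>sets M. emeasure M A < \<infinity> -->
    (\<integral>\<^sup>+x\<in>A. ennreal (cmod (g x)) \<partial>M) \<le> ennreal (B * measure M A powr \<alpha>))"

lemma Lp_spaceI:
 assumes "Lp_bound M p F f" "0 < p"
 shows "f \<in> Lp_space M (ennreal p)" and "Lp_norm M (ennreal p) f \<le> F"
proof -
 have [measurable]: "f \<in> borel_measurable M" and F: "0 \<le> F"
  and b: "(\<integral>\<^sup>+x. ennreal (cmod (f x) powr p) \<partial>M) \<le> ennreal (F powr p)"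
  using assms by (auto simp: Lp_bound_def)
 have i: "integrable M (\<lambda>x. cmod (f x) powr p)"
  using order_le_less_trans[OF b ennreal_less_top] by (intro integrableI_bounded) auto
 then show "f \<in> Lp_space M (ennreal p)" using assms(2) by (simp add: Lp_space_def)
 have "ennreal (\<integral>x. cmod (f x) powr p \<partial>M) \<le> ennreal (F powr p)"
  using b i by (simp add: nn_integral_eq_integral)
 then have "(\<integral>x. cmod (f x) powr p \<partial>M) \<le> F powr p" by (simp add: ennreal_le_iff)
 then have "(\<integral>x. cmod (f x) powr p \<partial>M) powr (1 / p) \<le> (F powr p) powr (1 / p)"
  using assms(2) by (intro powr_mono2) auto
 also have "... = F" using assms(2) F by (simp add: powr_powr)
 finally show "Lp_norm M (ennreal p) f \<le> F" using assms(2) by (simp add: Lp_norm_def)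
qed

lemma Lp_spaceD:
 assumes "f \<in> Lp_space M (ennreal p)" "0 < p" "Lp_norm M (ennreal p) f \<le> F"
 shows "Lp_bound M p F f"
proof -
 have i: "integrable M (\<lambda>x. cmod (f x) powr p)" and [measurable]: "f \<in> borel_measurable M"
  using assms by (auto simp: Lp_space_def)
 have n: "(\<integral>x. cmod (f x) powr p \<partial>M) powr (1 / p) \<le> F" using assms by (simp add: Lp_norm_def)
 have F: "0 \<le> F" using n powr_ge_zero order_trans by blast
 have "((\<integral>x. cmod (f x) powr p \<partial>M) powr (1 / p)) powr p \<le> F powr p"
  using n assms(2) by (intro powr_mono2) auto
 then have "(\<integral>x. cmod (f x) powr p \<partial>M) \<le> F powr p" using assms(2) by (simp add: powr_powr)
 then show ?thesis using F i by (simp add: Lp_bound_def nn_integral_eq_integral ennreal_leI)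
qed

lemma Lp_bound_AE:
 assumes "Lp_bound M p F f" "g \<in> borel_measurable M" "AE x in M. cmod (g x) \<le> cmod (f x)" "0 \<le> p"
 shows "Lp_bound M p F g"
proof -
 have "(\<integral>\<^sup>+x. ennreal (cmod (g x) powr p) \<partial>M) \<le> (\<integral>\<^sup>+x. ennreal (cmod (f x) powr p) \<partial>M)"
 proof (rule nn_integral_mono_AE)
  show "AE x in M. ennreal (cmod (g x) powr p) \<le> ennreal (cmod (f x) powr p)"
   using assms(3)
  proof eventually_elim
   case (elim x)
   then show ?case using assms(4) by (intro ennreal_leI powr_mono2) auto
  qed
 qed
 then show ?thesis using assms by (auto simp: Lp_bound_def intro: order_trans)
qed

lemma Lp_bound_set_integral:
 assumes "Lp_bound M p F f" "1 \<le> p" "A \<in> sets M" "emeasure M A < \<infinity>"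
 shows "(\<integral>\<^sup>+x\<in>A. ennreal (cmod (f x)) \<partial>M) \<le> ennreal (F * measure M A powr (1 - 1 / p))"
 using assms by (intro nn_integral_Holder_set) (auto simp: Lp_bound_def)

lemma Lp_bound_ex:
 assumes "f \<in> borel_measurable M" "(\<integral>\<^sup>+x. ennreal (cmod (f x) powr p) \<partial>M) < \<infinity>" "0 < p"
 shows "Lp_bound M p (enn2real (\<integral>\<^sup>+x. ennreal (cmod (f x) powr p) \<partial>M) powr (1 / p)) f"
 using assms by (simp add: Lp_bound_def powr_powr)

lemma Lp_space_iff:
 assumes "0 < p"
 shows "f \<in> Lp_space M (ennreal p) \<longleftrightarrow> f \<in> borel_measurable M \<and> (\<integral>\<^sup>+x. ennreal (cmod (f x) powr p) \<partial>M) < \<infinity>"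
proof
 assume "f \<in> Lp_space M (ennreal p)"
 then have "Lp_bound M p (Lp_norm M (ennreal p) f) f" using assms by (intro Lp_spaceD) auto
 then show "f \<in> borel_measurable M \<and> (\<integral>\<^sup>+x. ennreal (cmod (f x) powr p) \<partial>M) < \<infinity>"
  by (auto simp: Lp_bound_def intro: order_le_less_trans)
next
 assume "f \<in> borel_measurable M \<and> (\<integral>\<^sup>+x. ennreal (cmod (f x) powr p) \<partial>M) < \<infinity>"
 then show "f \<in> Lp_space M (ennreal p)"
  using Lp_spaceI(1)[OF Lp_bound_ex assms] assms by blast
qed

lemma Lp_space_add:
 assumes "0 < p" "f \<in> Lp_space M (ennreal p)" "g \<in> Lp_space M (ennreal p)"
 shows "(\<lambda>x. c * f x + d * g x) \<in> Lp_space M (ennreal p)"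
proof -
 have [measurable]: "f \<in> borel_measurable M" "g \<in> borel_measurable M"
  and fin: "(\<integral>\<^sup>+x. ennreal (cmod (f x) powr p) \<partial>M) < \<infinity>" "(\<integral>\<^sup>+x. ennreal (cmod (g x) powr p) \<partial>M) < \<infinity>"
  using assms by (auto simp: Lp_space_iff)
 have pt: "cmod (c * f x + d * g x) powr p \<le> (2 * cmod c) powr p * cmod (f x) powr p + (2 * cmod d) powr p * cmod (g x) powr p" for x
 proof -
  define u v where "u = cmod c * cmod (f x)" and "v = cmod d * cmod (g x)"
  have "cmod (c * f x + d * g x) \<le> u + v"
   using norm_triangle_ineq[of "c * f x" "d * g x"] by (simp add: u_def v_def norm_mult)
  also have "u + v \<le> max (2 * u) (2 * v)" by simp
  finally have "cmod (c * f x + d * g x) powr p \<le> max (2 * u) (2 * v) powr p"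
   using assms(1) by (intro powr_mono2) auto
  also have "... \<le> (2 * u) powr p + (2 * v) powr p" by (simp add: max_def)
  finally show ?thesis by (simp add: u_def v_def powr_mult)
 qed
 have "(\<integral>\<^sup>+x. ennreal (cmod (c * f x + d * g x) powr p) \<partial>M) \<le>
  (\<integral>\<^sup>+x. ennreal ((2 * cmod c) powr p) * ennreal (cmod (f x) powr p) + ennreal ((2 * cmod d) powr p) * ennreal (cmod (g x) powr p) \<partial>M)"
  using pt by (intro nn_integral_mono) (simp add: ennreal_mult[symmetric] ennreal_plus[symmetric] ennreal_leI del: ennreal_plus)
 also have "... = ennreal ((2 * cmod c) powr p) * (\<integral>\<^sup>+x. ennreal (cmod (f x) powr p) \<partial>M) +
   ennreal ((2 * cmod d) powr p) * (\<integral>\<^sup>+x. ennreal (cmod (g x) powr p) \<partial>M)"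
  by (simp add: nn_integral_add nn_integral_cmult)
 also have "... < \<infinity>" using fin by (simp add: ennreal_mult_less_top)
 finally show ?thesis using assms(1) by (simp add: Lp_space_iff)
qed

lemma weak_boundD:
 assumes "weak_bound M \<alpha> B g"
 shows "g \<in> borel_measurable M" "0 \<le> B"
  "\<And>A. A \<in> sets M ==> emeasure M A < \<infinity> ==> (\<integral>\<^sup>+x\<in>A. ennreal (cmod (g x)) \<partial>M) \<le> ennreal (B * measure M A powr \<alpha>)"
 using assms unfolding weak_bound_def by blast+

lemma weak_bound_AE_le:
 assumes f: "weak_bound M \<alpha> B f" and g: "g \<in> borel_measurable M" and le: "AE x in M. cmod (g x) \<le> D * cmod (f x)" and D: "0 \<le> D"
 shows "weak_bound M \<alpha> (D * B) g"
 unfolding weak_bound_def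
proof (intro conjI g ballI impI)
 show "0 \<le> D * B" using D weak_boundD(2)[OF f] by simp
 fix A assume A[measurable]: "A \<in> sets M" and fin: "emeasure M A < \<infinity>"
 have [measurable]: "f \<in> borel_measurable M" by (rule weak_boundD(1)[OF f])
 have "(\<integral>\<^sup>+x\<in>A. ennreal (cmod (g x)) \<partial>M) \<le> (\<integral>\<^sup>+x. ennreal D * (ennreal (cmod (f x)) * indicator A x) \<partial>M)"
 proof (rule nn_integral_mono_AE)
  show "AE x in M. ennreal (cmod (g x)) * indicator A x \<le> ennreal D * (ennreal (cmod (f x)) * indicator A x)"
   using le
  proof eventually_elim
   case (elim x)
   then show ?case using D by (auto simp: indicator_def ennreal_mult[symmetric] intro!: ennreal_leI)
  qed
 qed
 also have "... = ennreal D * (\<integral>\<^sup>+x\<in>A. ennreal (cmod (f x)) \<partial>M)" by (intro nn_integral_cmult) auto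
 also have "... \<le> ennreal D * ennreal (B * measure M A powr \<alpha>)" by (intro mult_left_mono weak_boundD(3)[OF f A fin]) auto
 also have "... = ennreal (D * B * measure M A powr \<alpha>)"
  using D weak_boundD(2)[OF f] by (simp add: ennreal_mult[symmetric] mult.assoc)
 finally show "(\<integral>\<^sup>+x\<in>A. ennreal (cmod (g x)) \<partial>M) \<le> ennreal (D * B * measure M A powr \<alpha>)" .
qed

lemma weak_bound_cong_AE:
 assumes "weak_bound M \<alpha> B f" "g \<in> borel_measurable M" "AE x in M. g x = f x"
 shows "weak_bound M \<alpha> B g"
proof -
 have "weak_bound M \<alpha> (1 * B) g"
  using assms by (intro weak_bound_AE_le[OF assms(1,2)]) (auto elim!: eventually_mono)
 then show ?thesis by simp
qed

lemma weak_bound_mono: "weak_bound M \<alpha> B f ==> B \<le> B' ==> weak_bound M \<alpha> B' f"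
proof -
 assume f: "weak_bound M \<alpha> B f" and le: "B \<le> B'"
 have "ennreal (B * measure M A powr \<alpha>) \<le> ennreal (B' * measure M A powr \<alpha>)" for A
  using le by (intro ennreal_leI mult_right_mono) auto
 then show ?thesis
  using weak_boundD[OF f] le unfolding weak_bound_def by (meson order_trans)
qed

lemma weak_bound_cmult: "weak_bound M \<alpha> B f ==> weak_bound M \<alpha> (cmod c * B) (\<lambda>x. c * f x)"
 by (rule weak_bound_AE_le) (auto simp: norm_mult dest: weak_boundD)

lemma weak_bound_add:
 assumes f: "weak_bound M \<alpha> B f" and g: "weak_bound M \<alpha> D g"
 shows "weak_bound M \<alpha> (B + D) (\<lambda>x. f x + g x)"
 unfolding weak_bound_def
proof (intro conjI ballI impI)
 have [measurable]: "f \<in> borel_measurable M" "g \<in> borel_measurable M"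
  using weak_boundD(1)[OF f] weak_boundD(1)[OF g] .
 show "(\<lambda>x. f x + g x) \<in> borel_measurable M" by measurable
 show "0 \<le> B + D" using weak_boundD(2)[OF f] weak_boundD(2)[OF g] by simp
 fix A assume A[measurable]: "A \<in> sets M" and fin: "emeasure M A < \<infinity>"
 have "(\<integral>\<^sup>+x\<in>A. ennreal (cmod (f x + g x)) \<partial>M) \<le>
  (\<integral>\<^sup>+x. ennreal (cmod (f x)) * indicator A x + ennreal (cmod (g x)) * indicator A x \<partial>M)"
  by (intro nn_integral_mono) (auto simp: indicator_def norm_triangle_ineq intro!: ennreal_leI simp flip: ennreal_plus)
 also have "... = (\<integral>\<^sup>+x\<in>A. ennreal (cmod (f x)) \<partial>M) + (\<integral>\<^sup>+x\<in>A. ennreal (cmod (g x)) \<partial>M)"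
  by (intro nn_integral_add) auto
 also have "... \<le> ennreal (B * measure M A powr \<alpha>) + ennreal (D * measure M A powr \<alpha>)"
  by (intro add_mono weak_boundD(3)[OF f A fin] weak_boundD(3)[OF g A fin])
 also have "... = ennreal ((B + D) * measure M A powr \<alpha>)"
  using weak_boundD(2)[OF f] weak_boundD(2)[OF g] by (simp add: algebra_simps flip: ennreal_plus)
 finally show "(\<integral>\<^sup>+x\<in>A. ennreal (cmod (f x + g x)) \<partial>M) \<le> ennreal ((B + D) * measure M A powr \<alpha>)" .
qed

text \<open>Convergence in \<open>L\<^sup>1\<close> on sets of finite measure suffices, which is what
  boundedness of the operator on \<open>L\<^sup>p\<close> provides.\<close>

lemma weak_bound_limit:
 assumes g[measurable]: "g \<in> borel_measurable M" and f: "\<And>n. weak_bound M \<alpha> (D n) (f n)"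
  and D: "D \<longlonglongrightarrow> B"
  and lim: "\<And>A. A \<in> sets M ==> emeasure M A < \<infinity> ==> (\<lambda>n. \<integral>\<^sup>+x\<in>A. ennreal (cmod (g x - f n x)) \<partial>M) \<longlonglongrightarrow> 0"
 shows "weak_bound M \<alpha> B g"
 unfolding weak_bound_def
proof (intro conjI g ballI impI)
 show "0 \<le> B" by (rule LIMSEQ_le_const[OF D]) (use weak_boundD(2)[OF f] in blast)
 fix A assume A[measurable]: "A \<in> sets M" and fin: "emeasure M A < \<infinity>"
 have [measurable]: "f n \<in> borel_measurable M" for n by (rule weak_boundD(1)[OF f])
 have "(\<lambda>n. (\<integral>\<^sup>+x\<in>A. ennreal (cmod (g x - f n x)) \<partial>M) + ennreal (D n * measure M A powr \<alpha>))
   \<longlonglongrightarrow> 0 + ennreal (B * measure M A powr \<alpha>)"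
  by (intro tendsto_add lim[OF A fin] tendsto_ennrealI tendsto_mult D tendsto_const)
 then have L: "(\<lambda>n. (\<integral>\<^sup>+x\<in>A. ennreal (cmod (g x - f n x)) \<partial>M) + ennreal (D n * measure M A powr \<alpha>))
   \<longlonglongrightarrow> ennreal (B * measure M A powr \<alpha>)" by (simp only: add_0)
 have le: "(\<integral>\<^sup>+x\<in>A. ennreal (cmod (g x)) \<partial>M) \<le> (\<integral>\<^sup>+x\<in>A. ennreal (cmod (g x - f n x)) \<partial>M) + ennreal (D n * measure M A powr \<alpha>)" for n
 proof -
  have "(\<integral>\<^sup>+x\<in>A. ennreal (cmod (g x)) \<partial>M) \<le>
   (\<integral>\<^sup>+x. ennreal (cmod (g x - f n x)) * indicator A x + ennreal (cmod (f n x)) * indicator A x \<partial>M)"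
  proof (intro nn_integral_mono)
   fix x
   have "cmod (g x) \<le> cmod (g x - f n x) + cmod (f n x)" using norm_triangle_ineq[of "g x - f n x" "f n x"] by simp
   then show "ennreal (cmod (g x)) * indicator A x \<le> ennreal (cmod (g x - f n x)) * indicator A x + ennreal (cmod (f n x)) * indicator A x"
    by (auto simp: indicator_def intro!: ennreal_leI simp flip: ennreal_plus)
  qed
  also have "... = (\<integral>\<^sup>+x\<in>A. ennreal (cmod (g x - f n x)) \<partial>M) + (\<integral>\<^sup>+x\<in>A. ennreal (cmod (f n x)) \<partial>M)"
   by (intro nn_integral_add) auto
  also have "... \<le> (\<integral>\<^sup>+x\<in>A. ennreal (cmod (g x - f n x)) \<partial>M) + ennreal (D n * measure M A powr \<alpha>)"
   by (intro add_left_mono weak_boundD(3)[OF f A fin])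
  finally show ?thesis .
 qed
 show "(\<integral>\<^sup>+x\<in>A. ennreal (cmod (g x)) \<partial>M) \<le> ennreal (B * measure M A powr \<alpha>)"
  by (rule LIMSEQ_le_const[OF L]) (use le in blast)
qed

text \<open>Apply the bound to subsets \<open>A\<close> of the level set of finite measure, where
  \<open>t * \<mu>(A) \<le> \<integral>\<^sub>A |g|\<close>, and exhaust the level set.\<close>

lemma weak_bound_measure:
 assumes g: "weak_bound M \<alpha> B g" and t: "0 < t" and \<alpha>: "0 < \<alpha>" "\<alpha> < 1" and sf: "sigma_finite_measure M"
 shows "emeasure M {x \<in> space M. t < cmod (g x)} < \<infinity>"
  and "measure M {x \<in> space M. t < cmod (g x)} powr (1 - \<alpha>) \<le> B / t"
proof -
 have [measurable]: "g \<in> borel_measurable M" and B: "0 \<le> B" using weak_boundD[OF g] by auto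
 define E where "E = {x \<in> space M. t < cmod (g x)}"
 have [measurable]: "E \<in> sets M" by (simp add: E_def)
 have bd: "measure M A powr (1 - \<alpha>) \<le> B / t" if A[measurable]: "A \<in> sets M" "emeasure M A < \<infinity>" "A \<subseteq> E" for A
 proof (cases "measure M A = 0")
  case False
  then have a: "0 < measure M A" by (simp add: zero_less_measure_iff)
  have "ennreal (t * measure M A) = (\<integral>\<^sup>+x. ennreal t * indicator A x \<partial>M)"
   using that t by (simp add: nn_integral_cmult_indicator ennreal_mult emeasure_eq_ennreal_measure top.not_eq_extremum)
  also have "... \<le> (\<integral>\<^sup>+x\<in>A. ennreal (cmod (g x)) \<partial>M)"
   using that(3) by (intro nn_integral_mono) (auto simp: indicator_def E_def intro!: ennreal_leI)
  also have "... \<le> ennreal (B * measure M A powr \<alpha>)" using that by (intro weak_boundD(3)[OF g])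
  finally have "t * measure M A \<le> B * measure M A powr \<alpha>" using B by (subst (asm) ennreal_le_iff) auto
  then have "t * measure M A * measure M A powr (- \<alpha>) \<le> B * measure M A powr \<alpha> * measure M A powr (- \<alpha>)"
   by (intro mult_right_mono) auto
  moreover have "measure M A powr \<alpha> * measure M A powr (- \<alpha>) = 1" using a by (simp add: powr_add[symmetric])
  moreover have "measure M A * measure M A powr (- \<alpha>) = measure M A powr (1 - \<alpha>)"
   using a powr_add[of "measure M A" 1 "- \<alpha>"] by simp
  ultimately have "t * measure M A powr (1 - \<alpha>) \<le> B" by (simp add: mult.assoc)
  then show ?thesis using t by (simp add: field_simps)
 qed (use B t in simp)
 obtain S where S: "range S \<subseteq> sets M" "(\<Union>i. S i) = space M" "\<And>i. emeasure M (S i) \<noteq> \<infinity>" "incseq S"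
  by (rule sigma_finite_measure.sigma_finite_incseq[OF sf]) (rule that)
 define u where "u = (B / t) powr (1 / (1 - \<alpha>))"
 have "emeasure M (E \<inter> S i) \<le> ennreal u" for i
 proof -
  have "emeasure M (E \<inter> S i) \<le> emeasure M (S i)" using S by (intro emeasure_mono) auto
  also have "... < \<infinity>" using S(3)[of i] by (simp add: top.not_eq_extremum)
  finally have fin: "emeasure M (E \<inter> S i) < \<infinity>" .
  have "measure M (E \<inter> S i) powr (1 - \<alpha>) \<le> B / t" using S fin by (intro bd) auto
  then have "(measure M (E \<inter> S i) powr (1 - \<alpha>)) powr (1 / (1 - \<alpha>)) \<le> u"
   unfolding u_def using \<alpha> by (intro powr_mono2) auto
  then have "measure M (E \<inter> S i) \<le> u" using \<alpha> by (simp add: powr_powr)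
  then show ?thesis using fin by (simp add: emeasure_eq_ennreal_measure top.not_eq_extremum ennreal_leI)
 qed
 moreover have "(SUP i. emeasure M (E \<inter> S i)) = emeasure M (\<Union>i. E \<inter> S i)"
 proof (rule SUP_emeasure_incseq)
  show "range (\<lambda>i. E \<inter> S i) \<subseteq> sets M" using S(1) by auto
  show "incseq (\<lambda>i. E \<inter> S i)" using S(4) unfolding incseq_def by blast
 qed
 moreover have "(\<Union>i. E \<inter> S i) = E" using S(2) by (auto simp: E_def)
 ultimately have "emeasure M E \<le> ennreal u" using SUP_least[of UNIV "\<lambda>i. emeasure M (E \<inter> S i)" "ennreal u"] by simp
 then show fin: "emeasure M {x \<in> space M. t < cmod (g x)} < \<infinity>"
  unfolding E_def[symmetric] by (rule order_le_less_trans) simp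
 show "measure M {x \<in> space M. t < cmod (g x)} powr (1 - \<alpha>) \<le> B / t"
  unfolding E_def[symmetric] using fin by (intro bd) (auto simp: E_def)
qed

lemma integrable_of_Lp_finite_support:
 assumes f: "f \<in> Lp_space M (ennreal p)" and p: "1 \<le> p" and A: "A \<in> sets M" "emeasure M A < \<infinity>"
  and supp: "AE x in M. x \<notin> A --> f x = 0"
 shows "integrable M f"
proof -
 have [measurable]: "f \<in> borel_measurable M" using f by (simp add: Lp_space_def)
 have b: "Lp_bound M p (Lp_norm M (ennreal p) f) f" using f p by (intro Lp_spaceD) auto
 have "(\<integral>\<^sup>+x. ennreal (cmod (f x)) \<partial>M) = (\<integral>\<^sup>+x\<in>A. ennreal (cmod (f x)) \<partial>M)"
  using supp by (intro nn_integral_cong_AE) (auto elim!: eventually_mono simp: indicator_def)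
 also have "... < \<infinity>" using Lp_bound_set_integral[OF b p A] by (rule order_le_less_trans) simp
 finally show ?thesis by (intro integrableI_bounded) auto
qed

section \<open>Fractional integral operators\<close>

locale fractional_operator = nonhomogeneous +
 fixes \<alpha> :: real and K :: "'a => 'a => complex" and T :: "('a => complex) => ('a => complex)"
 assumes alpha: "0 < \<alpha>" "\<alpha> < 1"
  and kernel: "fractional_kernel \<mu> lam \<alpha> K"
  and operator: "fractional_integral \<mu> \<alpha> K T"
  and bounded: "\<And>p s::real. 1 < p ==> p < 1 / \<alpha> ==> 1 / s = 1 / p - \<alpha> ==> bounded_Lp_Lq \<mu> (ennreal p) (ennreal s) T"
begin

abbreviation Lp :: "real => ('a => complex) set" where "Lp p \<equiv> Lp_space \<mu> (ennreal p)"
abbreviation weak :: "real => ('a => complex) => bool" where "weak \<equiv> weak_bound \<mu> \<alpha>"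

text \<open>The exponent \<open>s\<close> with \<open>1 / s = 1 / p - \<alpha>\<close>.\<close>

definition conj_exp :: "real => real" where "conj_exp p = 1 / (1 / p - \<alpha>)"

definition admissible :: "real => bool" where "admissible p \<longleftrightarrow> 1 < p \<and> p < 1 / \<alpha>"

lemma admissible_pos: "admissible p ==> 0 < p" "admissible p ==> 1 < p"
 by (auto simp: admissible_def)

lemma conj_exp:
 assumes "admissible p"
 shows "1 / conj_exp p = 1 / p - \<alpha>" "p < conj_exp p" "1 < conj_exp p"
proof -
 have p: "1 < p" "p * \<alpha> < 1" using assms alpha by (auto simp: admissible_def field_simps)
 then have "\<alpha> < 1 / p" by (simp add: field_simps)
 then have d: "0 < 1 / p - \<alpha>" "1 / p - \<alpha> < 1 / p" using alpha by auto
 show "1 / conj_exp p = 1 / p - \<alpha>" by (simp add: conj_exp_def)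
 have "1 / (1 / p) < 1 / (1 / p - \<alpha>)" using d p by (intro divide_strict_left_mono) auto
 then show "p < conj_exp p" by (simp add: conj_exp_def)
 then show "1 < conj_exp p" using p by simp
qed

lemma T_bounded:
 assumes p: "admissible p"
 shows "\<exists>C\<ge>0. \<forall>f F. Lp_bound \<mu> p F f --> Lp_bound \<mu> (conj_exp p) (C * F) (T f)"
proof -
 have s: "1 / conj_exp p = 1 / p - \<alpha>" "0 < conj_exp p" using conj_exp[OF p] by auto
 have "bounded_Lp_Lq \<mu> (ennreal p) (ennreal (conj_exp p)) T"
  using p s by (intro bounded) (auto simp: admissible_def)
 then obtain C where C: "0 \<le> C" "\<And>f. f \<in> Lp p ==> T f \<in> Lp (conj_exp p)"
  "\<And>f. f \<in> Lp p ==> Lp_norm \<mu> (ennreal (conj_exp p)) (T f) \<le> C * Lp_norm \<mu> (ennreal p) f"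
  unfolding bounded_Lp_Lq_def by blast
 show ?thesis
 proof (intro exI[of _ C] conjI C(1) allI impI)
  fix f F assume f: "Lp_bound \<mu> p F f"
  note fs = Lp_spaceI[OF f admissible_pos(1)[OF p]]
  have "Lp_norm \<mu> (ennreal (conj_exp p)) (T f) \<le> C * F"
   using C(3)[OF fs(1)] mult_left_mono[OF fs(2) C(1)] by simp
  then show "Lp_bound \<mu> (conj_exp p) (C * F) (T f)" using C(2)[OF fs(1)] s by (intro Lp_spaceD) auto
 qed
qed

lemma T_space:
 assumes "admissible p" "f \<in> Lp p"
 shows "T f \<in> Lp (conj_exp p)"
proof -
 have "bounded_Lp_Lq \<mu> (ennreal p) (ennreal (conj_exp p)) T"
  using assms conj_exp[OF assms(1)] by (intro bounded) (auto simp: admissible_def)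
 then show ?thesis using assms(2) unfolding bounded_Lp_Lq_def by blast
qed

lemma T_measurable: "admissible p ==> f \<in> Lp p ==> T f \<in> borel_measurable \<mu>"
 using T_space by (auto simp: Lp_space_def)

lemma zero_Lp: "(\<lambda>x. 0) \<in> Lp p"
 by (simp add: Lp_space_def)

lemma Lp_in_sum_space:
 assumes "admissible p" "f \<in> Lp p"
 shows "f \<in> Lp_sum_space \<mu> \<alpha>"
 unfolding Lp_sum_space_def
proof (intro CollectI bexI)
 show "f = (\<lambda>x. f x + (\<lambda>x. 0) x)" by simp
qed (use assms zero_Lp in \<open>auto simp: admissible_def\<close>)

lemma T_linear:
 assumes "f \<in> Lp_sum_space \<mu> \<alpha>" "g \<in> Lp_sum_space \<mu> \<alpha>"
 shows "AE x in \<mu>. T (\<lambda>y. c * f y + d * g y) x = c * T f x + d * T g x"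
 using operator assms unfolding fractional_integral_def linear_ae_on_def by blast

lemma T_diff:
 assumes "f \<in> Lp_sum_space \<mu> \<alpha>" "g \<in> Lp_sum_space \<mu> \<alpha>"
 shows "AE x in \<mu>. T (\<lambda>y. f y - g y) x = T f x - T g x"
 using T_linear[OF assms, of 1 "- 1"] by simp

lemma T_zero: "AE x in \<mu>. T (\<lambda>x. 0) x = 0"
proof -
 obtain p where p: "admissible p" using alpha dense[of 1 "1 / \<alpha>"] by (auto simp: admissible_def)
 have z: "(\<lambda>x. 0) \<in> Lp_sum_space \<mu> \<alpha>" by (rule Lp_in_sum_space[OF p zero_Lp])
 show ?thesis using T_linear[OF z z, of 0 0] by simp
qed

lemma T_tendsto_zero:
 assumes p: "admissible p" and f: "\<And>n. f n \<in> borel_measurable \<mu>"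
  and lim: "(\<lambda>n. \<integral>\<^sup>+x. ennreal (cmod (f n x) powr p) \<partial>\<mu>) \<longlonglongrightarrow> 0"
  and A: "A \<in> sets \<mu>" "emeasure \<mu> A < \<infinity>"
 shows "(\<lambda>n. \<integral>\<^sup>+x\<in>A. ennreal (cmod (T (f n) x)) \<partial>\<mu>) \<longlonglongrightarrow> 0"
proof -
 obtain C where C: "0 \<le> C" "\<And>f F. Lp_bound \<mu> p F f ==> Lp_bound \<mu> (conj_exp p) (C * F) (T f)"
  using T_bounded[OF p] by blast
 define e where "e n = tmass (\<lambda>x. cmod (f n x) powr p)" for n
 define F where "F n = enn2real (e n) powr (1 / p)" for n
 define w where "w = measure \<mu> A powr (1 - 1 / conj_exp p)"
 have ev: "eventually (\<lambda>n. e n < \<infinity>) sequentially"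
  using order_tendstoD(2)[OF lim, of \<infinity>] by (simp add: e_def)
 have "(\<lambda>n. enn2real (e n)) \<longlonglongrightarrow> enn2real 0"
  using lim unfolding e_def[symmetric] by (intro tendsto_enn2real) auto
 then have "(\<lambda>n. F n) \<longlonglongrightarrow> 0 powr (1 / p)"
  unfolding F_def using admissible_pos(1)[OF p] by (intro tendsto_powr') auto
 then have "(\<lambda>n. ennreal (C * F n * w)) \<longlonglongrightarrow> ennreal (C * 0 * w)"
  by (intro tendsto_ennrealI tendsto_mult tendsto_const) simp
 then have up: "(\<lambda>n. ennreal (C * F n * w)) \<longlonglongrightarrow> 0" by simp
 show ?thesis
 proof (rule tendsto_sandwich[OF _ _ tendsto_const up])
  show "eventually (\<lambda>n. (mass A (\<lambda>x. cmod (T (f n) x))) \<le> ennreal (C * F n * w)) sequentially"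
   using ev
  proof eventually_elim
   case (elim n)
   then have "Lp_bound \<mu> p (F n) (f n)"
    using f admissible_pos(1)[OF p] unfolding F_def e_def by (intro Lp_bound_ex) auto
   then have "Lp_bound \<mu> (conj_exp p) (C * F n) (T (f n))" by (rule C(2))
   then show ?case unfolding w_def using conj_exp(3)[OF p] A by (intro Lp_bound_set_integral) auto
  qed
 qed simp
qed

lemma Lp_bound_zero:
 assumes "Lp_bound \<mu> p 0 f" "0 < p"
 shows "AE x in \<mu>. f x = 0"
proof -
 have [measurable]: "bmeas f" using assms by (simp add: Lp_bound_def)
 have "tmass (\<lambda>x. cmod (f x) powr p) = 0" using assms by (simp add: Lp_bound_def)
 then have "AE x in \<mu>. ennreal (cmod (f x) powr p) = 0" by (subst (asm) nn_integral_0_iff_AE) auto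
 then show ?thesis
 proof eventually_elim
  case (elim x)
  then have "cmod (f x) powr p = 0" by (metis ennreal_eq_0_iff order_antisym powr_ge_zero)
  then show ?case by simp
 qed
qed

text \<open>The operator acts on functions, not on classes; boundedness makes it respect equality
  almost everywhere.\<close>

lemma T_cong_AE:
 assumes p: "admissible p" and f: "f \<in> Lp p" and g: "g \<in> Lp p"
  and fg: "AE x in \<mu>. f x = g x"
 shows "AE x in \<mu>. T f x = T g x"
proof -
 obtain C where C: "0 \<le> C" "\<And>f F. Lp_bound \<mu> p F f ==> Lp_bound \<mu> (conj_exp p) (C * F) (T f)"
  using T_bounded[OF p] by blast
 have [measurable]: "bmeas f" "bmeas g" using f g by (auto simp: Lp_space_def)
 have "tmass (\<lambda>x. cmod (f x - g x) powr p) = (\<integral>\<^sup>+x. 0 \<partial>\<mu>)"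
  using fg by (intro nn_integral_cong_AE) (auto elim!: eventually_mono)
 then have "Lp_bound \<mu> p 0 (\<lambda>x. f x - g x)" by (simp add: Lp_bound_def)
 from C(2)[OF this] have "Lp_bound \<mu> (conj_exp p) 0 (T (\<lambda>x. f x - g x))" by simp
 then have "AE x in \<mu>. T (\<lambda>x. f x - g x) x = 0" using conj_exp(3)[OF p] by (intro Lp_bound_zero) auto
 moreover have "AE x in \<mu>. T (\<lambda>y. f y - g y) x = T f x - T g x"
  by (intro T_diff Lp_in_sum_space[OF p] f g)
 ultimately show ?thesis by eventually_elim simp
qed

definition K0 :: "'a => 'a => complex" where "K0 x y = (if x = y then 0 else K x y)"

lemma K0_measurable: "(\<lambda>z. K0 (fst z) (snd z)) \<in> borel_measurable (\<mu> \<Otimes>\<^sub>M \<mu>)"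
 using locally_integrable_off_diagonal_measurable[of K] kernel
 unfolding fractional_kernel_def K0_def by blast

lemma K0_measurable1 [measurable]: "bmeas (\<lambda>x. K0 x y)"
 using measurable_compose[OF measurable_Pair2'[of y \<mu> \<mu>] K0_measurable] by simp

lemma K0_measurable2 [measurable]: "K0 x \<in> borel_measurable \<mu>"
 using measurable_compose[OF measurable_Pair1'[of x \<mu> \<mu>] K0_measurable] by simp

lemma kernel_constants:
 obtains C \<delta> cK where "0 < C" "\<forall>x y. x \<noteq> y --> cmod (K x y) \<le> C * (1 / lam x (dist x y) powr (1 - \<alpha>))"
  "0 < \<delta>" "\<delta> \<le> 1" "0 < cK"
  "\<forall>x x' y. x \<noteq> y --> x' \<noteq> y --> dist x y \<ge> cK * dist x x' -->
     cmod (K x y - K x' y) + cmod (K y x - K y x')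
      \<le> C * (dist x x' powr \<delta> / (dist x y powr \<delta> * lam x (dist x y) powr (1 - \<alpha>)))"
 using conjunct2[OF kernel[unfolded fractional_kernel_def]]
 by (elim exE conjE) (rule that)

lemma K_size: "\<exists>C\<ge>0. \<forall>x y. x \<noteq> y --> cmod (K x y) \<le> C * lam x (dist x y) powr (\<alpha> - 1)"
proof -
 obtain C \<delta> cK where C: "0 < C" "\<forall>x y. x \<noteq> y --> cmod (K x y) \<le> C * (1 / lam x (dist x y) powr (1 - \<alpha>))"
  by (rule kernel_constants)
 have "1 / lam x (dist x y) powr (1 - \<alpha>) = lam x (dist x y) powr (\<alpha> - 1)" for x y
  using powr_minus_divide[of "lam x (dist x y)" "1 - \<alpha>"] by simp
 then show ?thesis using C by (intro exI[of _ C]) auto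
qed

lemma lam_powr_center:
 assumes "0 < u" "lam y u \<le> D * lam x v" "0 < v" "0 < D"
 shows "lam x v powr (\<alpha> - 1) \<le> D powr (1 - \<alpha>) * lam y u powr (\<alpha> - 1)"
proof -
 have pos: "0 < lam y u" "0 < lam x v" using assms lam_pos by auto
 have "(D * lam x v) powr (\<alpha> - 1) \<le> lam y u powr (\<alpha> - 1)"
  using assms pos alpha by (intro powr_mono2') auto
 then have "D powr (1 - \<alpha>) * (D powr (\<alpha> - 1) * lam x v powr (\<alpha> - 1)) \<le> D powr (1 - \<alpha>) * lam y u powr (\<alpha> - 1)"
  using assms pos by (simp add: powr_mult mult_left_mono)
 moreover have "D powr (1 - \<alpha>) * D powr (\<alpha> - 1) = 1" using assms by (simp add: powr_add[symmetric])
 ultimately show ?thesis by (simp add: mult.assoc[symmetric])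
qed

text \<open>The size condition is anchored at the first argument; \<open>lam_center\<close> moves it to
  the second, over which the weak bound is uniform.\<close>

lemma K_size': "\<exists>C\<ge>0. \<forall>x y. x \<noteq> y --> cmod (K x y) \<le> C * lam y (dist y x) powr (\<alpha> - 1)"
proof -
 obtain C where C: "0 \<le> C" "\<And>x y. x \<noteq> y ==> cmod (K x y) \<le> C * lam x (dist x y) powr (\<alpha> - 1)"
  using K_size by blast
 have Cl: "0 < Cl" using C_lam_ge_1 by simp
 show ?thesis
 proof (intro exI[of _ "C * Cl powr (1 - \<alpha>)"] conjI allI impI)
  fix x y :: 'a assume xy: "x \<noteq> y"
  then have d: "0 < dist x y" by simp
  have "lam y (dist x y) \<le> Cl * lam x (dist x y)" using d by (intro lam_center) (auto simp: dist_commute)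
  then have "lam x (dist x y) powr (\<alpha> - 1) \<le> Cl powr (1 - \<alpha>) * lam y (dist x y) powr (\<alpha> - 1)"
   using d Cl by (intro lam_powr_center) auto
  then have "C * lam x (dist x y) powr (\<alpha> - 1) \<le> C * (Cl powr (1 - \<alpha>) * lam y (dist x y) powr (\<alpha> - 1))"
   using C by (intro mult_left_mono) auto
  then show "cmod (K x y) \<le> C * Cl powr (1 - \<alpha>) * lam y (dist y x) powr (\<alpha> - 1)"
   using C(2)[OF xy] by (simp add: dist_commute mult.assoc)
 qed (use C in simp)
qed

lemma K0_weak_bound:
 "\<exists>C\<ge>0. \<forall>y. \<forall>A\<in>sets \<mu>. emeasure \<mu> A < \<infinity> -->
  (mass A (\<lambda>x. cmod (K0 x y))) \<le> ennreal (C * measure \<mu> A powr \<alpha>)"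
proof -
 obtain C where C: "0 \<le> C" "\<And>x y. x \<noteq> y ==> cmod (K x y) \<le> C * lam y (dist y x) powr (\<alpha> - 1)"
  using K_size' by blast
 obtain c where c: "0 < c" "\<forall>y. \<forall>A\<in>sets \<mu>. emeasure \<mu> A < \<infinity> -->
  (mass (A - {y}) (\<lambda>x. lam y (dist y x) powr (\<alpha> - 1))) \<le> ennreal (c * measure \<mu> A powr \<alpha>)"
  using fractional_kernel_weak_bound[OF alpha] by (elim exE conjE) (rule that)
 show ?thesis
 proof (intro exI[of _ "C * c"] conjI allI ballI impI)
  fix y A assume A[measurable]: "A \<in> sets \<mu>" and fin: "emeasure \<mu> A < \<infinity>"
  have "mass A (\<lambda>x. cmod (K0 x y)) \<le>
    (\<integral>\<^sup>+x. ennreal C * (ennreal (lam y (dist y x) powr (\<alpha> - 1)) * indicator (A - {y}) x) \<partial>\<mu>)"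
  proof (intro nn_integral_mono)
   fix x
   show "ennreal (cmod (K0 x y)) * indicator A x \<le> ennreal C * (ennreal (lam y (dist y x) powr (\<alpha> - 1)) * indicator (A - {y}) x)"
    using C(2)[of x y] C(1)
    by (cases "x = y") (auto simp: K0_def indicator_def ennreal_mult[symmetric] intro!: ennreal_leI)
  qed
  also have "... = ennreal C * mass (A - {y}) (\<lambda>x. lam y (dist y x) powr (\<alpha> - 1))"
   by (intro nn_integral_cmult) measurable
  also have "... \<le> ennreal C * ennreal (c * measure \<mu> A powr \<alpha>)" using c(2) A fin by (intro mult_left_mono) auto
  also have "... = ennreal (C * c * measure \<mu> A powr \<alpha>)" using C c by (simp add: ennreal_mult[symmetric] mult.assoc)
  finally show "mass A (\<lambda>x. cmod (K0 x y)) \<le> ennreal (C * c * measure \<mu> A powr \<alpha>)" .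
 qed (use C c in simp)
qed

text \<open>Tonelli: integrate the weak bound of \<open>K0\<close> in its first argument against
  \<open>f\<close> in the second.\<close>

lemma potential_weak_bound:
 "\<exists>C\<ge>0. \<forall>f. f \<in> borel_measurable \<mu> --> (\<forall>A\<in>sets \<mu>. emeasure \<mu> A < \<infinity> -->
  (\<integral>\<^sup>+x\<in>A. (tmass (\<lambda>y. cmod (K0 x y * f y))) \<partial>\<mu>) \<le>
   ennreal (C * measure \<mu> A powr \<alpha>) * tmass (\<lambda>y. cmod (f y)))"
proof -
 obtain C where C: "0 \<le> C" "\<forall>y. \<forall>A\<in>sets \<mu>. emeasure \<mu> A < \<infinity> -->
  (mass A (\<lambda>x. cmod (K0 x y))) \<le> ennreal (C * measure \<mu> A powr \<alpha>)"
  using K0_weak_bound by (elim exE conjE) (rule that)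
 interpret pair_sigma_finite \<mu> \<mu> ..
 show ?thesis
 proof (intro exI[of _ C] conjI C(1) allI ballI impI)
  fix f :: "'a => complex" and A assume f[measurable]: "bmeas f" and A[measurable]: "A \<in> sets \<mu>" and fin: "emeasure \<mu> A < \<infinity>"
  note K0_measurable[measurable]
  have "(\<integral>\<^sup>+x\<in>A. (tmass (\<lambda>y. cmod (K0 x y * f y))) \<partial>\<mu>) =
   (\<integral>\<^sup>+x. (\<integral>\<^sup>+y. ennreal (cmod (K0 (fst (x, y)) (snd (x, y)) * f (snd (x, y)))) * indicator A (fst (x, y)) \<partial>\<mu>) \<partial>\<mu>)"
   by (intro nn_integral_cong) (simp add: nn_integral_multc)
  also have "... = (\<integral>\<^sup>+y. (\<integral>\<^sup>+x. ennreal (cmod (K0 (fst (x, y)) (snd (x, y)) * f (snd (x, y)))) * indicator A (fst (x, y)) \<partial>\<mu>) \<partial>\<mu>)"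
   by (rule Fubini[symmetric]) measurable
  also have "... = (\<integral>\<^sup>+y. ennreal (cmod (f y)) * mass A (\<lambda>x. cmod (K0 x y)) \<partial>\<mu>)"
   by (intro nn_integral_cong, subst nn_integral_cmult[symmetric])
    (auto simp: norm_mult ennreal_mult mult_ac)
  also have "... \<le> (\<integral>\<^sup>+y. ennreal (cmod (f y)) * ennreal (C * measure \<mu> A powr \<alpha>) \<partial>\<mu>)"
   using C(2) A fin by (intro nn_integral_mono mult_left_mono) auto
  also have "... = ennreal (C * measure \<mu> A powr \<alpha>) * tmass (\<lambda>y. cmod (f y))"
   by (subst nn_integral_multc) (auto simp: mult.commute)
  finally show "(\<integral>\<^sup>+x\<in>A. (tmass (\<lambda>y. cmod (K0 x y * f y))) \<partial>\<mu>) \<le>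
   ennreal (C * measure \<mu> A powr \<alpha>) * tmass (\<lambda>y. cmod (f y))" .
 qed
qed

lemma bounded_Linfty_b:
 assumes f[measurable]: "bmeas f" and B: "\<And>x. cmod (f x) \<le> B" and supp: "AE x in \<mu>. x \<notin> cball c r --> f x = 0"
 shows "f \<in> Linfty_b \<mu>"
proof -
 have "esssup \<mu> (\<lambda>x. ereal (cmod (f x))) \<le> ereal B" using B by (intro esssup_I) auto
 then have "esssup \<mu> (\<lambda>x. ereal (cmod (f x))) < \<infinity>" by (rule order_le_less_trans) simp
 moreover have "ess_support \<mu> f \<subseteq> cball c r" by (rule ess_support_subset_closed[OF closed_cball supp])
 ultimately show ?thesis using bounded_subset[OF bounded_cball] by (auto simp: Linfty_b_def Lp_space_def)
qed

lemma T_kernel: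
 assumes "f \<in> Linfty_b \<mu>" "closed F" "AE x in \<mu>. x \<notin> F --> f x = 0"
 shows "AE x in \<mu>. x \<notin> F --> T f x = (\<integral>y. K0 x y * f y \<partial>\<mu>)"
proof -
 have m: "bmeas f" using assms by (simp add: Linfty_b_def Lp_space_def)
 have "AE x in \<mu>. x \<notin> ess_support \<mu> f --> T f x = (\<integral>y. K x y * f y \<partial>\<mu>)"
  using operator assms(1) unfolding fractional_integral_def by blast
 moreover have "AE x in \<mu>. x \<notin> ess_support \<mu> f --> f x = 0" by (rule AE_ess_support)
 ultimately show ?thesis
 proof eventually_elim
  case (elim x)
  show ?case
  proof
   assume x: "x \<notin> F"
   have "x \<notin> ess_support \<mu> f" using ess_support_subset_closed[OF assms(2,3)] x by blast
   then have "T f x = (\<integral>y. K x y * f y \<partial>\<mu>)" "f x = 0" using elim by auto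
   moreover have "(\<lambda>y. K x y * f y) = (\<lambda>y. K0 x y * f y)"
    using \<open>f x = 0\<close> by (auto simp: K0_def fun_eq_iff)
   ultimately show "T f x = (\<integral>y. K0 x y * f y \<partial>\<mu>)" by simp
  qed
 qed
qed

lemma norm_integral_le_nn_integral:
 fixes g :: "'a => complex"
 shows "ennreal (cmod (\<integral>y. g y \<partial>\<mu>)) \<le> (tmass (\<lambda>y. cmod (g y)))"
 by (cases "integrable \<mu> g") (auto simp: integral_norm_bound_ennreal not_integrable_integral_eq)

end

context fractional_operator begin

section \<open>The weak type of the operator on integrable functions\<close>

lemma Lp_bound_indicator:
 assumes "E \<in> sets \<mu>" "emeasure \<mu> E < \<infinity>" "0 < p"
 shows "Lp_bound \<mu> p (measure \<mu> E powr (1 / p)) (indicator E)"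
proof -
 have "tmass (\<lambda>x. cmod (indicator E x) powr p) = (\<integral>\<^sup>+x. indicator E x \<partial>\<mu>)"
  using assms(3) by (intro nn_integral_cong) (auto simp: indicator_def)
 also have "... = ennreal (measure \<mu> E)"
  using assms by (simp add: emeasure_eq_ennreal_measure top.not_eq_extremum)
 finally show ?thesis using assms by (simp add: Lp_bound_def powr_powr)
qed

text \<open>On \<open>A \<inter> E\<close> use \<open>L\<^sup>p\<close>-boundedness and Hoelder, with
  \<open>\<mu>(A \<inter> E) \<le> min (\<mu> A) (\<mu> E)\<close>. Off \<open>E\<close> the kernel
  formula holds because \<open>E\<close> is closed and bounded, and \<open>potential_weak_bound\<close>
  applies.\<close>

lemma T_indicator_closed:
 "\<exists>C\<ge>0. \<forall>E (c::'a) r. closed E --> E \<subseteq> cball c r --> weak (C * measure \<mu> E) (T (indicator E))"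
proof -
 obtain p where p: "admissible p" using alpha dense[of 1 "1 / \<alpha>"] by (auto simp: admissible_def)
 obtain C1 where C1: "0 \<le> C1" "\<And>f F. Lp_bound \<mu> p F f ==> Lp_bound \<mu> (conj_exp p) (C1 * F) (T f)"
  using T_bounded[OF p] by blast
 obtain C2 where C2: "0 \<le> C2" "\<forall>f. f \<in> borel_measurable \<mu> --> (\<forall>A\<in>sets \<mu>. emeasure \<mu> A < \<infinity> -->
  (\<integral>\<^sup>+x\<in>A. (tmass (\<lambda>y. cmod (K0 x y * f y))) \<partial>\<mu>) \<le>
   ennreal (C2 * measure \<mu> A powr \<alpha>) * tmass (\<lambda>y. cmod (f y)))"
  using potential_weak_bound by (elim exE conjE) (rule that)
 show ?thesis
 proof (intro exI[of _ "C1 + C2"] conjI allI impI)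
  fix E :: "'a set" and c r assume E: "closed E" "E \<subseteq> cball c r"
  have [measurable]: "E \<in> sets \<mu>" using E by auto
  define f where "f = (indicator E :: 'a => complex)"
  have [measurable]: "bmeas f" by (simp add: f_def)
  have "E \<subseteq> ball c (r + 1)" using E by auto
  then have "E \<in> fmeasurable \<mu>" by (rule fmeasurable_bounded) simp
  then have finE: "emeasure \<mu> E < \<infinity>" "emeasure \<mu> E = ennreal (measure \<mu> E)"
   using emeasure_eq_measure2[of E \<mu>] unfolding fmeasurable_def by blast+
  define e where "e = measure \<mu> E"
  have e0: "0 \<le> e" by (simp add: e_def)
  have fp: "Lp_bound \<mu> p (e powr (1 / p)) f"
   unfolding f_def e_def using admissible_pos(1)[OF p] finE by (intro Lp_bound_indicator) auto
  have fL: "f \<in> Linfty_b \<mu>"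
  proof (rule bounded_Linfty_b[of f 1 c r])
   show "AE x in \<mu>. x \<notin> cball c r --> f x = 0"
    using E(2) by (intro AE_I2) (auto simp: f_def indicator_def)
  qed (auto simp: f_def indicator_def)
  have Tf: "Lp_bound \<mu> (conj_exp p) (C1 * e powr (1 / p)) (T f)" by (rule C1(2)[OF fp])
  have Tm[measurable]: "T f \<in> borel_measurable \<mu>" using Tf by (simp add: Lp_bound_def)
  have off: "AE x in \<mu>. x \<notin> E --> T f x = (\<integral>y. K0 x y * f y \<partial>\<mu>)"
   by (rule T_kernel[OF fL E(1)]) (simp add: f_def)
  show "weak ((C1 + C2) * measure \<mu> E) (T (indicator E))"
   unfolding weak_bound_def f_def[symmetric] e_def[symmetric]
  proof (intro conjI Tm ballI impI)
   show "0 \<le> (C1 + C2) * e" using C1 C2 e0 by simp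
   fix A assume A[measurable]: "A \<in> sets \<mu>" and fin: "emeasure \<mu> A < \<infinity>"
   have AE: "emeasure \<mu> (A \<inter> E) \<le> emeasure \<mu> A" "emeasure \<mu> (A - E) \<le> emeasure \<mu> A"
    by (auto intro!: emeasure_mono)
   then have finAE: "emeasure \<mu> (A \<inter> E) < \<infinity>" "emeasure \<mu> (A - E) < \<infinity>"
    using fin by (auto intro: order_le_less_trans)
   have Afm: "A \<in> fmeasurable \<mu>" "E \<in> fmeasurable \<mu>" using fin finE by (auto simp: fmeasurable_def)
   have mA: "measure \<mu> (A \<inter> E) \<le> measure \<mu> A" "measure \<mu> (A \<inter> E) \<le> e" "measure \<mu> (A - E) \<le> measure \<mu> A"
    using Afm by (auto simp: e_def intro!: measure_mono_fmeasurable)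
   have on: "mass (A \<inter> E) (\<lambda>x. cmod (T f x)) \<le> ennreal (C1 * e * measure \<mu> A powr \<alpha>)"
   proof -
    have ex: "1 - 1 / conj_exp p = \<alpha> + (1 - 1 / p)" using conj_exp(1)[OF p] by simp
    have p0: "0 \<le> 1 - 1 / p" using admissible_pos(2)[OF p] by simp
    have "mass (A \<inter> E) (\<lambda>x. cmod (T f x)) \<le> ennreal (C1 * e powr (1 / p) * measure \<mu> (A \<inter> E) powr (1 - 1 / conj_exp p))"
     using conj_exp(3)[OF p] finAE by (intro Lp_bound_set_integral[OF Tf]) auto
    also have "... \<le> ennreal (C1 * e * measure \<mu> A powr \<alpha>)"
    proof (rule ennreal_leI)
     have "measure \<mu> (A \<inter> E) powr (1 - 1 / conj_exp p) = measure \<mu> (A \<inter> E) powr \<alpha> * measure \<mu> (A \<inter> E) powr (1 - 1 / p)"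
      unfolding ex by (simp add: powr_add)
     also have "... \<le> measure \<mu> A powr \<alpha> * e powr (1 - 1 / p)"
      using mA alpha p0 by (intro mult_mono powr_mono2) auto
     finally have "C1 * e powr (1 / p) * measure \<mu> (A \<inter> E) powr (1 - 1 / conj_exp p) \<le>
       C1 * e powr (1 / p) * (measure \<mu> A powr \<alpha> * e powr (1 - 1 / p))"
      using C1 by (intro mult_left_mono) auto
     also have "... = C1 * (e powr (1 / p) * e powr (1 - 1 / p)) * measure \<mu> A powr \<alpha>" by simp
     also have "e powr (1 / p) * e powr (1 - 1 / p) = e" using e0 by (simp add: powr_add[symmetric])
     finally show "C1 * e powr (1 / p) * measure \<mu> (A \<inter> E) powr (1 - 1 / conj_exp p) \<le> C1 * e * measure \<mu> A powr \<alpha>" .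
    qed
    finally show ?thesis .
   qed
   have off': "mass (A - E) (\<lambda>x. cmod (T f x)) \<le> ennreal (C2 * e * measure \<mu> A powr \<alpha>)"
   proof -
    have "mass (A - E) (\<lambda>x. cmod (T f x)) \<le> (\<integral>\<^sup>+x\<in>A - E. (tmass (\<lambda>y. cmod (K0 x y * f y))) \<partial>\<mu>)"
    proof (rule nn_integral_mono_AE)
     show "AE x in \<mu>. ennreal (cmod (T f x)) * indicator (A - E) x \<le> (tmass (\<lambda>y. cmod (K0 x y * f y))) * indicator (A - E) x"
      using off
     proof eventually_elim
      case (elim x)
      then show ?case using norm_integral_le_nn_integral[of "\<lambda>y. K0 x y * f y"]
       by (auto simp: indicator_def)
     qed
    qed
    also have "... \<le> ennreal (C2 * measure \<mu> (A - E) powr \<alpha>) * tmass (\<lambda>y. cmod (f y))"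
     by (rule C2(2)[rule_format]) (use finAE in auto)
    also have "tmass (\<lambda>y. cmod (f y)) = (\<integral>\<^sup>+y. indicator E y \<partial>\<mu>)"
     by (intro nn_integral_cong) (auto simp: f_def indicator_def)
    also have "... = ennreal e" using finE by (simp add: e_def)
    also have "ennreal (C2 * measure \<mu> (A - E) powr \<alpha>) * ennreal e = ennreal (C2 * e * measure \<mu> (A - E) powr \<alpha>)"
     using C2 e0 by (simp add: ennreal_mult[symmetric] mult_ac)
    also have "... \<le> ennreal (C2 * e * measure \<mu> A powr \<alpha>)"
     using C2(1) e0 mA alpha by (intro ennreal_leI mult_left_mono powr_mono2) auto
    finally show ?thesis .
   qed
   have "mass A (\<lambda>x. cmod (T f x)) =
    (\<integral>\<^sup>+x. ennreal (cmod (T f x)) * indicator (A \<inter> E) x + ennreal (cmod (T f x)) * indicator (A - E) x \<partial>\<mu>)"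
    by (intro nn_integral_cong) (auto simp: indicator_def)
   also have "... = mass (A \<inter> E) (\<lambda>x. cmod (T f x)) + mass (A - E) (\<lambda>x. cmod (T f x))"
    by (intro nn_integral_add) auto
   also have "... \<le> ennreal (C1 * e * measure \<mu> A powr \<alpha>) + ennreal (C2 * e * measure \<mu> A powr \<alpha>)"
    by (intro add_mono on off')
   also have "... = ennreal ((C1 + C2) * e * measure \<mu> A powr \<alpha>)"
    using C1(1) C2(1) e0 by (simp add: algebra_simps flip: ennreal_plus)
   finally show "mass A (\<lambda>x. cmod (T f x)) \<le> ennreal ((C1 + C2) * e * measure \<mu> A powr \<alpha>)" .
  qed
 qed (use C1 C2 in simp)
qed

lemma closed_inner_approximation:
 assumes E[measurable]: "E \<in> sets \<mu>" and fin: "emeasure \<mu> E < \<infinity>" and e: "0 < e"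
 shows "\<exists>F (c::'a) r. closed F \<and> F \<subseteq> E \<and> F \<subseteq> cball c r \<and> emeasure \<mu> (E - F) < ennreal e"
proof -
 obtain c :: 'a where True by simp
 have "(\<lambda>n. emeasure \<mu> (E - ball c (real n))) \<longlonglongrightarrow> emeasure \<mu> (\<Inter>n. E - ball c (real n))"
 proof (rule Lim_emeasure_decseq)
  show "decseq (\<lambda>n. E - ball c (real n))" by (auto simp: decseq_def)
  show "emeasure \<mu> (E - ball c (real n)) \<noteq> \<infinity>" for n
   using emeasure_mono[of "E - ball c (real n)" E \<mu>] fin by (auto simp: top_unique)
 qed auto
 moreover have "(\<Inter>n. E - ball c (real n)) = {}" using reals_Archimedean2 by auto
 ultimately have "(\<lambda>n. emeasure \<mu> (E - ball c (real n))) \<longlonglongrightarrow> 0" by (simp only: emeasure_empty)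
 then have "eventually (\<lambda>n. emeasure \<mu> (E - ball c (real n)) < ennreal (e / 2)) sequentially"
  using e by (intro order_tendstoD) auto
 then obtain n where n: "emeasure \<mu> (E - ball c (real n)) < ennreal (e / 2)" by (auto simp: eventually_sequentially)
 have e4: "0 < e / 4" using e by simp
 have EB: "E \<inter> ball c (real n) \<in> sets \<mu>" by simp
 obtain F U where FU: "closed F" "open U" "F \<subseteq> E \<inter> ball c (real n)" "E \<inter> ball c (real n) \<subseteq> U"
   "emeasure \<mu> ((U - F) \<inter> ball c (real n)) < ennreal (e / 4)"
  using closed_open_approximation[OF sets_mu ball_sets[of c "real n"] emeasure_ball_finite EB e4]
  by (elim exE conjE) (rule that)
 have [measurable]: "F \<in> sets \<mu>" "U \<in> sets \<mu>" using FU by auto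
 have "emeasure \<mu> (E - F) \<le> emeasure \<mu> ((E - ball c (real n)) \<union> ((U - F) \<inter> ball c (real n)))"
  using FU(4) by (intro emeasure_mono) auto
 also have "... \<le> emeasure \<mu> (E - ball c (real n)) + emeasure \<mu> ((U - F) \<inter> ball c (real n))"
  by (intro emeasure_subadditive) auto
 also have "... \<le> ennreal (e / 2) + ennreal (e / 4)"
  using n FU(5) by (intro add_mono) auto
 also have "... = ennreal (3 * e / 4)" using e by (simp flip: ennreal_plus)
 also have "... < ennreal e" using e by (simp add: ennreal_lessI)
 finally have "emeasure \<mu> (E - F) < ennreal e" .
 moreover have "F \<subseteq> cball c (real n)" using FU(3) by auto
 ultimately show ?thesis using FU(1,3) by blast
qed

text \<open>Approximation by closed subsets from inside, for which the indicators converge in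
  \<open>L\<^sup>p\<close>.\<close>

lemma T_indicator:
 "\<exists>C\<ge>0. \<forall>E. E \<in> sets \<mu> --> emeasure \<mu> E < \<infinity> --> weak (C * measure \<mu> E) (T (indicator E))"
proof -
 obtain p where p: "admissible p" using alpha dense[of 1 "1 / \<alpha>"] by (auto simp: admissible_def)
 obtain C where C: "0 \<le> C" "\<forall>E (c::'a) r. closed E --> E \<subseteq> cball c r --> weak (C * measure \<mu> E) (T (indicator E))"
  using T_indicator_closed by (elim exE conjE) (rule that)
 show ?thesis
 proof (intro exI[of _ C] conjI C(1) allI impI)
  fix E assume E[measurable]: "E \<in> sets \<mu>" and fin: "emeasure \<mu> E < \<infinity>"
  have "\<forall>n::nat. \<exists>F. closed F \<and> F \<subseteq> E \<and> (\<exists>(c::'a) r. F \<subseteq> cball c r) \<and> emeasure \<mu> (E - F) < ennreal (1 / real (Suc n))"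
  proof
   fix n :: nat
   have "0 < 1 / real (Suc n)" by simp
   from closed_inner_approximation[OF E fin this]
   show "\<exists>F. closed F \<and> F \<subseteq> E \<and> (\<exists>(c::'a) r. F \<subseteq> cball c r) \<and> emeasure \<mu> (E - F) < ennreal (1 / real (Suc n))"
    by blast
  qed
  from choice[OF this] obtain F where
   F: "\<forall>n. closed (F n) \<and> F n \<subseteq> E \<and> (\<exists>(c::'a) r. F n \<subseteq> cball c r) \<and> emeasure \<mu> (E - F n) < ennreal (1 / real (Suc n))"
   by blast
  have [measurable]: "F n \<in> sets \<mu>" for n using F by auto
  have fm: "E \<in> fmeasurable \<mu>" using fin by (simp add: fmeasurable_def)
  have finF: "emeasure \<mu> G < \<infinity>" if "G \<subseteq> E" "G \<in> sets \<mu>" for G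
   using emeasure_mono[of G E \<mu>] that fin by (auto intro: order_le_less_trans)
  have ind: "indicator G \<in> Lp p" if "G \<subseteq> E" "G \<in> sets \<mu>" for G
   using admissible_pos(1)[OF p] finF[OF that] that(2) by (intro Lp_spaceI(1)[OF Lp_bound_indicator]) auto
  show "weak (C * measure \<mu> E) (T (indicator E))"
  proof (rule weak_bound_limit[where f = "\<lambda>n. T (indicator (F n))" and D = "\<lambda>n. C * measure \<mu> E"])
   show "T (indicator E) \<in> borel_measurable \<mu>" using ind[of E] by (intro T_measurable[OF p]) auto
   show "weak (C * measure \<mu> E) (T (indicator (F n)))" for n
   proof (rule weak_bound_mono)
    from F have Fn: "closed (F n)" "\<exists>(c::'a) r. F n \<subseteq> cball c r" by simp_all
    then obtain c :: 'a and r where "F n \<subseteq> cball c r" by (elim exE)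
    then show "weak (C * measure \<mu> (F n)) (T (indicator (F n)))"
     by (rule C(2)[rule_format, OF Fn(1)])
    show "C * measure \<mu> (F n) \<le> C * measure \<mu> E"
     using C(1) F fm by (intro mult_left_mono measure_mono_fmeasurable) auto
   qed
   show "(\<lambda>n. C * measure \<mu> E) \<longlonglongrightarrow> C * measure \<mu> E" by simp
   fix A assume A: "A \<in> sets \<mu>" "emeasure \<mu> A < \<infinity>"
   have dm[measurable]: "bmeas (\<lambda>x. indicator E x - indicator (F n) x :: complex)" for n by measurable
   have "(\<lambda>n. \<integral>\<^sup>+x\<in>A. ennreal (cmod (T (\<lambda>x. indicator E x - indicator (F n) x) x)) \<partial>\<mu>) \<longlonglongrightarrow> 0"
   proof (rule T_tendsto_zero[OF p dm _ A])
    have eq: "tmass (\<lambda>x. cmod (indicator E x - indicator (F n) x) powr p) = emeasure \<mu> (E - F n)" for n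
    proof -
     have "tmass (\<lambda>x. cmod (indicator E x - indicator (F n) x) powr p) = (\<integral>\<^sup>+x. indicator (E - F n) x \<partial>\<mu>)"
      using F[rule_format, of n] by (intro nn_integral_cong) (auto simp: indicator_def)
     then show ?thesis by simp
    qed
    have "(\<lambda>n. ennreal (1 / real (Suc n))) \<longlonglongrightarrow> ennreal 0"
     using LIMSEQ_inverse_real_of_nat by (intro tendsto_ennrealI) (simp add: inverse_eq_divide)
    then have up: "(\<lambda>n. ennreal (1 / real (Suc n))) \<longlonglongrightarrow> 0" by simp
    have "(\<lambda>n. emeasure \<mu> (E - F n)) \<longlonglongrightarrow> 0"
    proof (rule tendsto_sandwich[OF _ _ tendsto_const up])
     show "eventually (\<lambda>n. emeasure \<mu> (E - F n) \<le> ennreal (1 / real (Suc n))) sequentially"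
      using F by (intro always_eventually allI less_imp_le) blast
    qed simp
    then show "(\<lambda>n. \<integral>\<^sup>+x. ennreal (cmod (indicator E x - indicator (F n) x) powr p) \<partial>\<mu>) \<longlonglongrightarrow> 0"
     by (simp only: eq)
   qed
   moreover have "mass A (\<lambda>x. cmod (T (\<lambda>x. indicator E x - indicator (F n) x) x))
     = mass A (\<lambda>x. cmod (T (indicator E) x - T (indicator (F n)) x))" for n
   proof (rule nn_integral_cong_AE)
    have "AE x in \<mu>. T (\<lambda>x. indicator E x - indicator (F n) x) x = T (indicator E) x - T (indicator (F n)) x"
     using F ind by (intro T_diff Lp_in_sum_space[OF p]) auto
    then show "AE x in \<mu>. ennreal (cmod (T (\<lambda>x. indicator E x - indicator (F n) x) x)) * indicator A x
     = ennreal (cmod (T (indicator E) x - T (indicator (F n)) x)) * indicator A x"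
     by eventually_elim simp
   qed
   ultimately show "(\<lambda>n. \<integral>\<^sup>+x\<in>A. ennreal (cmod (T (indicator E) x - T (indicator (F n)) x)) \<partial>\<mu>) \<longlonglongrightarrow> 0"
    by simp
  qed
 qed
qed

text \<open>Additivity of weak bounds turns the estimate for indicators, the restricted type, into the
  estimate for simple functions without loss.\<close>

lemma T_simple:
 assumes C: "0 \<le> C" "\<forall>E. E \<in> sets \<mu> --> emeasure \<mu> E < \<infinity> --> weak (C * measure \<mu> E) (T (indicator E))"
  and I: "finite I" and E: "\<And>i. i \<in> I ==> E i \<in> sets \<mu>" "\<And>i. i \<in> I ==> emeasure \<mu> (E i) < \<infinity>"
  and p: "admissible p"
 shows "(\<lambda>x. \<Sum>i\<in>I. z i * indicator (E i) x) \<in> Lp p \<and>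
  weak (C * (\<Sum>i\<in>I. cmod (z i) * measure \<mu> (E i))) (T (\<lambda>x. \<Sum>i\<in>I. z i * indicator (E i) x))"
 using I E
proof (induction I)
 case empty
 have "weak 0 (\<lambda>x. 0)" by (simp add: weak_bound_def)
 then have "weak 0 (T (\<lambda>x. 0))"
  by (rule weak_bound_cong_AE) (use T_measurable[OF p zero_Lp] T_zero in auto)
 then show ?case using zero_Lp by simp
next
 case (insert i I)
 define g where "g x = (\<Sum>i\<in>I. z i * indicator (E i) x)" for x
 have IH: "g \<in> Lp p" "weak (C * (\<Sum>i\<in>I. cmod (z i) * measure \<mu> (E i))) (T g)"
  using insert unfolding g_def by auto
 have ind: "indicator (E i) \<in> Lp p"
  using admissible_pos(1)[OF p] insert.prems by (intro Lp_spaceI(1)[OF Lp_bound_indicator]) auto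
 have Ti: "weak (C * measure \<mu> (E i)) (T (indicator (E i)))" using C(2) insert.prems by blast
 have eq: "(\<lambda>x. \<Sum>i\<in>insert i I. z i * indicator (E i) x) = (\<lambda>x. z i * indicator (E i) x + 1 * g x)"
  by (simp only: g_def sum.insert[OF insert.hyps] mult_1)
 have sp: "(\<lambda>x. z i * indicator (E i) x + 1 * g x) \<in> Lp p"
  using admissible_pos(1)[OF p] ind IH(1) by (intro Lp_space_add) auto
 have lin: "AE x in \<mu>. T (\<lambda>x. z i * indicator (E i) x + 1 * g x) x = z i * T (indicator (E i)) x + 1 * T g x"
  by (intro T_linear Lp_in_sum_space[OF p] ind IH(1))
 have wb: "weak (cmod (z i) * (C * measure \<mu> (E i)) + C * (\<Sum>i\<in>I. cmod (z i) * measure \<mu> (E i)))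
   (\<lambda>x. z i * T (indicator (E i)) x + 1 * T g x)"
  using weak_bound_add[OF weak_bound_cmult[OF Ti, of "z i"] IH(2)] by simp
 have "weak (cmod (z i) * (C * measure \<mu> (E i)) + C * (\<Sum>i\<in>I. cmod (z i) * measure \<mu> (E i)))
   (T (\<lambda>x. z i * indicator (E i) x + 1 * g x))"
  by (rule weak_bound_cong_AE[OF wb T_measurable[OF p sp] lin])
 moreover have "cmod (z i) * (C * measure \<mu> (E i)) + C * (\<Sum>i\<in>I. cmod (z i) * measure \<mu> (E i)) =
   C * (\<Sum>i\<in>insert i I. cmod (z i) * measure \<mu> (E i))"
  unfolding sum.insert[OF insert.hyps] by (simp add: distrib_left mult.left_commute)
 ultimately show ?case using sp unfolding eq by (simp only: simp_thms)
qed

text \<open>The constant does not depend on \<open>p\<close>, which enters only qualitatively: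
  convergence of simple functions in \<open>L\<^sup>p\<close> is transported by
  \<open>T\<close>.\<close>

lemma T_weak_type:
 "\<exists>C\<ge>0. \<forall>p f. admissible p --> f \<in> Lp p --> integrable \<mu> f -->
  weak (C * (\<integral>x. cmod (f x) \<partial>\<mu>)) (T f)"
proof -
 obtain C where C: "0 \<le> C" "\<forall>E. E \<in> sets \<mu> --> emeasure \<mu> E < \<infinity> --> weak (C * measure \<mu> E) (T (indicator E))"
  using T_indicator by (elim exE conjE) (rule that)
 show ?thesis
 proof (intro exI[of _ C] conjI C(1) allI impI)
  fix p f assume p: "admissible p" and f: "f \<in> Lp p" and fi: "integrable \<mu> f"
  have [measurable]: "bmeas f" using f by (simp add: Lp_space_def)
  have pp: "0 < p" by (rule admissible_pos(1)[OF p])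
  obtain F where F: "\<forall>i. simple_function \<mu> (F i)" "\<forall>x\<in>space \<mu>. (\<lambda>i. F i x) \<longlonglongrightarrow> f x"
   "\<forall>i. \<forall>x\<in>space \<mu>. dist (F i x) 0 \<le> 2 * dist (f x) 0"
   using borel_measurable_implies_sequence_metric[OF \<open>f \<in> borel_measurable \<mu>\<close>, of 0] by (elim exE conjE) (rule that)
  have Fl: "(\<lambda>i. F i x) \<longlonglongrightarrow> f x" and Fb: "cmod (F i x) \<le> 2 * cmod (f x)" for i x using F by auto
  have Fm[measurable]: "F i \<in> borel_measurable \<mu>" for i using F(1) by (simp add: borel_measurable_simple_function)
  have Fi: "integrable \<mu> (F i)" for i
   by (rule Bochner_Integration.integrable_bound[of \<mu> "\<lambda>x. 2 * cmod (f x)"]) (use fi Fb in auto)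
  have simp: "F i \<in> Lp p \<and> weak (C * (\<integral>x. cmod (F i x) \<partial>\<mu>)) (T (F i))" for i
  proof -
   define V where "V = range (F i) - {0}"
   define E where "E v = F i -` {v}" for v
   have finV: "finite V" using F(1) unfolding V_def simple_function_def by auto
   have Em: "E v \<in> sets \<mu>" for v
   proof -
    have "F i -` {v} \<inter> space \<mu> \<in> sets \<mu>" by (rule measurable_sets[OF Fm]) auto
    then show ?thesis by (simp add: E_def)
   qed
   have Ef: "emeasure \<mu> (E v) < \<infinity>" if "v \<in> V" for v
   proof -
    have v: "0 < cmod v" using that by (simp add: V_def)
    have "ennreal (cmod v) * emeasure \<mu> (E v) = (\<integral>\<^sup>+x. ennreal (cmod v) * indicator (E v) x \<partial>\<mu>)"
     using Em by (simp add: nn_integral_cmult_indicator)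
    also have "... \<le> (tmass (\<lambda>x. cmod (F i x)))"
     by (intro nn_integral_mono) (auto simp: E_def indicator_def)
    also have "... < \<infinity>" using Fi[of i] by (simp add: integrable_iff_bounded)
    finally show ?thesis using v by (auto simp: ennreal_mult_less_top)
   qed
   have rep: "F i x = (\<Sum>v\<in>V. v * indicator (E v) x)" for x
   proof -
    have "(\<Sum>v\<in>V. v * indicator (E v) x) = (\<Sum>v\<in>V. if v = F i x then v else 0)"
     by (intro sum.cong) (auto simp: E_def indicator_def)
    also have "... = F i x" using finV by (simp add: V_def)
    finally show ?thesis by simp
   qed
   have nrep: "cmod (F i x) = (\<Sum>v\<in>V. cmod v * indicator (E v) x)" for x
   proof -
    have "(\<Sum>v\<in>V. cmod v * indicator (E v) x) = (\<Sum>v\<in>V. if v = F i x then cmod v else 0)"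
     by (intro sum.cong) (auto simp: E_def indicator_def)
    also have "... = cmod (F i x)" using finV by (simp add: V_def)
    finally show ?thesis by simp
   qed
   have "(\<integral>x. cmod (F i x) \<partial>\<mu>) = (\<Sum>v\<in>V. \<integral>x. cmod v * indicator (E v) x \<partial>\<mu>)"
    unfolding nrep using Em Ef
    by (intro Bochner_Integration.integral_sum integrable_mult_right integrable_real_indicator) auto
   also have "... = (\<Sum>v\<in>V. cmod v * measure \<mu> (E v))" using Em by simp
   finally have I: "(\<integral>x. cmod (F i x) \<partial>\<mu>) = (\<Sum>v\<in>V. cmod v * measure \<mu> (E v))" .
   have Feq: "F i = (\<lambda>x. \<Sum>v\<in>V. v * indicator (E v) x)" using rep by (rule ext)
   show ?thesis
    unfolding I by (subst (1 2) Feq) (rule T_simple[OF C finV Em Ef p, of "\<lambda>v. v"])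
  qed
  show "weak (C * (\<integral>x. cmod (f x) \<partial>\<mu>)) (T f)"
  proof (rule weak_bound_limit[where f = "\<lambda>i. T (F i)" and D = "\<lambda>i. C * (\<integral>x. cmod (F i x) \<partial>\<mu>)"])
   show "T f \<in> borel_measurable \<mu>" by (rule T_measurable[OF p f])
   show "weak (C * (\<integral>x. cmod (F i x) \<partial>\<mu>)) (T (F i))" for i using simp by blast
   have "(\<lambda>i. \<integral>x. cmod (F i x) \<partial>\<mu>) \<longlonglongrightarrow> (\<integral>x. cmod (f x) \<partial>\<mu>)"
   proof (rule integral_dominated_convergence[where w = "\<lambda>x. 2 * cmod (f x)"])
    show "AE x in \<mu>. (\<lambda>i. cmod (F i x)) \<longlonglongrightarrow> cmod (f x)" by (intro AE_I2 tendsto_norm Fl)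
   qed (use fi Fb in auto)
   then show "(\<lambda>i. C * (\<integral>x. cmod (F i x) \<partial>\<mu>)) \<longlonglongrightarrow> C * (\<integral>x. cmod (f x) \<partial>\<mu>)"
    by (intro tendsto_mult tendsto_const)
   fix A assume A: "A \<in> sets \<mu>" "emeasure \<mu> A < \<infinity>"
   have "(\<lambda>i. \<integral>\<^sup>+x\<in>A. ennreal (cmod (T (\<lambda>x. f x - F i x) x)) \<partial>\<mu>) \<longlonglongrightarrow> 0"
   proof (rule T_tendsto_zero[OF p _ _ A])
    show "bmeas (\<lambda>x. f x - F i x)" for i by measurable
    have "(\<lambda>i. \<integral>\<^sup>+x. ennreal (cmod (f x - F i x) powr p) \<partial>\<mu>) \<longlonglongrightarrow> (\<integral>\<^sup>+x. 0 \<partial>\<mu>)"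
    proof (rule nn_integral_dominated_convergence[where w = "\<lambda>x. ennreal ((3 * cmod (f x)) powr p)"])
     show "AE x in \<mu>. ennreal (cmod (f x - F i x) powr p) \<le> ennreal ((3 * cmod (f x)) powr p)" for i
     proof (rule AE_I2)
      fix x
      have "cmod (f x - F i x) \<le> 3 * cmod (f x)" using norm_triangle_ineq4[of "f x" "F i x"] Fb[of i x] by simp
      then show "ennreal (cmod (f x - F i x) powr p) \<le> ennreal ((3 * cmod (f x)) powr p)"
       using pp by (intro ennreal_leI powr_mono2) auto
     qed
     have "tmass (\<lambda>x. (3 * cmod (f x)) powr p) = ennreal (3 powr p) * tmass (\<lambda>x. cmod (f x) powr p)"
      by (subst nn_integral_cmult[symmetric]) (auto simp: powr_mult ennreal_mult)
     also have "... < \<infinity>" using f pp by (simp add: Lp_space_iff ennreal_mult_less_top)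
     finally show "tmass (\<lambda>x. (3 * cmod (f x)) powr p) < \<infinity>" .
     show "AE x in \<mu>. (\<lambda>i. ennreal (cmod (f x - F i x) powr p)) \<longlonglongrightarrow> 0"
     proof (rule AE_I2)
      fix x
      have "(\<lambda>i. cmod (f x - F i x)) \<longlonglongrightarrow> cmod (f x - f x)" by (intro tendsto_intros Fl)
      then have "(\<lambda>i. cmod (f x - F i x) powr p) \<longlonglongrightarrow> 0 powr p"
       using pp by (intro tendsto_powr') auto
      then have "(\<lambda>i. ennreal (cmod (f x - F i x) powr p)) \<longlonglongrightarrow> ennreal 0" by (intro tendsto_ennrealI) simp
      then show "(\<lambda>i. ennreal (cmod (f x - F i x) powr p)) \<longlonglongrightarrow> 0" by simp
     qed
    qed auto
    then show "(\<lambda>i. \<integral>\<^sup>+x. ennreal (cmod (f x - F i x) powr p) \<partial>\<mu>) \<longlonglongrightarrow> 0" by simp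
   qed
   moreover have "mass A (\<lambda>x. cmod (T (\<lambda>x. f x - F i x) x)) = mass A (\<lambda>x. cmod (T f x - T (F i) x))" for i
   proof (rule nn_integral_cong_AE)
    have "AE x in \<mu>. T (\<lambda>x. f x - F i x) x = T f x - T (F i) x"
     using simp f by (intro T_diff Lp_in_sum_space[OF p]) auto
    then show "AE x in \<mu>. ennreal (cmod (T (\<lambda>x. f x - F i x) x)) * indicator A x = ennreal (cmod (T f x - T (F i) x)) * indicator A x"
     by eventually_elim simp
   qed
   ultimately show "(\<lambda>i. \<integral>\<^sup>+x\<in>A. ennreal (cmod (T f x - T (F i) x)) \<partial>\<mu>) \<longlonglongrightarrow> 0" by simp
  qed
 qed
qed

text \<open>The kernel formula is postulated for bounded functions only, while the atoms used below are
  merely in \<open>L\<^sup>p\<close>. Truncate \<open>a\<close>: the operator converges on one side,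
  and the absolutely convergent potential of \<open>potential_weak_bound\<close> on the other.\<close>

lemma T_kernel_Lp:
 fixes c :: 'a
 assumes p: "admissible p" and a: "a \<in> Lp p" and supp: "AE x in \<mu>. x \<notin> cball c r --> a x = 0"
 shows "AE x in \<mu>. x \<notin> cball c r --> integrable \<mu> (\<lambda>y. K0 x y * a y) \<and> T a x = (\<integral>y. K0 x y * a y \<partial>\<mu>)"
proof -
 have [measurable]: "bmeas a" using a by (simp add: Lp_space_def)
 have pp: "0 < p" "1 \<le> p" using admissible_pos[OF p] by auto
 note K0_measurable[measurable]
 have "cball c r \<in> fmeasurable \<mu>" by (rule fmeasurable_bounded[of _ c "r + 1"]) auto
 then have ai: "integrable \<mu> a"
  using supp by (intro integrable_of_Lp_finite_support[OF a pp(2), of "cball c r"]) (auto simp: fmeasurable_def)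
 obtain C where C: "0 \<le> C" "\<forall>f. f \<in> borel_measurable \<mu> --> (\<forall>A\<in>sets \<mu>. emeasure \<mu> A < \<infinity> -->
  (\<integral>\<^sup>+x\<in>A. (tmass (\<lambda>y. cmod (K0 x y * f y))) \<partial>\<mu>) \<le>
   ennreal (C * measure \<mu> A powr \<alpha>) * tmass (\<lambda>y. cmod (f y)))"
  using potential_weak_bound by (elim exE conjE) (rule that)
 have Im[measurable]: "bmeas (\<lambda>x. \<integral>\<^sup>+y. ennreal (cmod (K0 x y * f y)) \<partial>\<mu>)"
  if f[measurable]: "bmeas f" for f
 proof -
  have "(\<lambda>z. ennreal (cmod (K0 (fst z) (snd z) * f (snd z)))) \<in> borel_measurable (\<mu> \<Otimes>\<^sub>M \<mu>)" by measurable
  from borel_measurable_nn_integral_fst[OF this] show ?thesis by simp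
 qed
 have Bm[measurable]: "bmeas (\<lambda>x. \<integral>y. K0 x y * a y \<partial>\<mu>)"
 proof -
  have "(\<lambda>(x, y). K0 x y * a y) \<in> borel_measurable (\<mu> \<Otimes>\<^sub>M \<mu>)"
   unfolding case_prod_beta by measurable
  then show ?thesis by (rule borel_measurable_lebesgue_integral)
 qed
 have [measurable]: "T a \<in> borel_measurable \<mu>" by (rule T_measurable[OF p a])
 define b where "b n x = (if cmod (a x) \<le> real n then a x else 0)" for n x
 have [measurable]: "b n \<in> borel_measurable \<mu>" for n unfolding b_def by measurable
 have ble: "cmod (b n x) \<le> cmod (a x)" "cmod (a x - b n x) \<le> cmod (a x)" for n x by (auto simp: b_def)
 have blim: "(\<lambda>n. b n x) \<longlonglongrightarrow> a x" for x
 proof (rule tendsto_eventually)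
  obtain N where "cmod (a x) \<le> real N" using real_arch_simple by blast
  then show "eventually (\<lambda>n. b n x = a x) sequentially"
   unfolding eventually_sequentially b_def by (intro exI[of _ N]) auto
 qed
 have bL: "b n \<in> Linfty_b \<mu>" for n
  by (rule bounded_Linfty_b[of _ "real n" c r]) (use supp in \<open>auto simp: b_def elim!: eventually_mono\<close>)
 have bp: "b n \<in> Lp p" for n
 proof -
  have "Lp_bound \<mu> p (Lp_norm \<mu> (ennreal p) a) a" using a pp by (intro Lp_spaceD) auto
  then have "Lp_bound \<mu> p (Lp_norm \<mu> (ennreal p) a) (b n)"
   by (rule Lp_bound_AE) (use ble pp in auto)
  then show ?thesis using pp by (intro Lp_spaceI)
 qed
 have Tb: "AE x in \<mu>. x \<notin> cball c r --> T (b n) x = (\<integral>y. K0 x y * b n y \<partial>\<mu>)" for n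
  by (rule T_kernel[OF bL closed_cball]) (use supp in \<open>auto simp: b_def elim!: eventually_mono\<close>)
 have main: "AE x in \<mu>. x \<in> ball c (real M) - cball c r --> integrable \<mu> (\<lambda>y. K0 x y * a y) \<and> T a x = (\<integral>y. K0 x y * a y \<partial>\<mu>)" for M :: nat
 proof -
  define A where "A = ball c (real M) - cball c r"
  have A[measurable]: "A \<in> sets \<mu>" by (simp add: A_def)
  have "A \<in> fmeasurable \<mu>" by (rule fmeasurable_bounded[of _ c "real M"]) (auto simp: A_def)
  then have finA: "emeasure \<mu> A < \<infinity>" by (simp add: fmeasurable_def)
  have "(\<integral>\<^sup>+x\<in>A. (tmass (\<lambda>y. cmod (K0 x y * a y))) \<partial>\<mu>) \<le> ennreal (C * measure \<mu> A powr \<alpha>) * tmass (\<lambda>y. cmod (a y))"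
   by (rule C(2)[rule_format]) (use finA in auto)
  also have "... < \<infinity>" using ai by (simp add: integrable_iff_bounded ennreal_mult_less_top)
  finally have "AE x in \<mu>. (tmass (\<lambda>y. cmod (K0 x y * a y))) * indicator A x \<noteq> \<infinity>"
   by (intro nn_integral_PInf_AE) auto
  then have int: "AE x in \<mu>. x \<in> A --> integrable \<mu> (\<lambda>y. K0 x y * a y)"
  proof eventually_elim
   case (elim x)
   then show ?case by (auto simp: integrable_iff_bounded less_top)
  qed
  define D where "D x = T a x - (\<integral>y. K0 x y * a y \<partial>\<mu>)" for x
  have [measurable]: "bmeas D" unfolding D_def by measurable
  define J where "J n x = tmass (\<lambda>y. cmod (K0 x y * (a y - b n y)))" for n x
  have [measurable]: "J n \<in> borel_measurable \<mu>" for n unfolding J_def by measurable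
  have TDm[measurable]: "T (\<lambda>y. a y - b n y) \<in> borel_measurable \<mu>" for n
   using Lp_space_add[OF pp(1) a bp, of 1 "- 1" n] by (intro T_measurable[OF p]) simp
  have le: "mass A (\<lambda>x. cmod (D x)) \<le>
    (mass A (\<lambda>x. cmod (T (\<lambda>y. a y - b n y) x))) + ennreal (C * measure \<mu> A powr \<alpha>) * tmass (\<lambda>y. cmod (a y - b n y))" for n
  proof -
   have Td: "AE x in \<mu>. T (\<lambda>y. a y - b n y) x = T a x - T (b n) x"
    by (intro T_diff Lp_in_sum_space[OF p] a bp)
   have "AE x in \<mu>. ennreal (cmod (D x)) * indicator A x \<le>
     ennreal (cmod (T (\<lambda>y. a y - b n y) x)) * indicator A x + J n x * indicator A x"
    using Td int Tb[of n]
   proof eventually_elim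
    case (elim x)
    show ?case
    proof (cases "x \<in> A")
     case True
     then have ix: "integrable \<mu> (\<lambda>y. K0 x y * a y)" and xr: "x \<notin> cball c r" using elim by (auto simp: A_def)
     have ib: "integrable \<mu> (\<lambda>y. K0 x y * b n y)"
      by (rule Bochner_Integration.integrable_bound[OF ix]) (use ble in \<open>auto simp: norm_mult intro!: mult_left_mono\<close>)
     have "(\<integral>y. K0 x y * a y \<partial>\<mu>) - (\<integral>y. K0 x y * b n y \<partial>\<mu>) = (\<integral>y. K0 x y * (a y - b n y) \<partial>\<mu>)"
      using ix ib by (subst Bochner_Integration.integral_diff[symmetric]) (auto simp: algebra_simps)
     then have "D x = T (\<lambda>y. a y - b n y) x - (\<integral>y. K0 x y * (a y - b n y) \<partial>\<mu>)"
      using elim xr by (simp add: D_def algebra_simps)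
     then have "cmod (D x) \<le> cmod (T (\<lambda>y. a y - b n y) x) + cmod (\<integral>y. K0 x y * (a y - b n y) \<partial>\<mu>)"
      using norm_triangle_ineq4 by simp
     then have "ennreal (cmod (D x)) \<le> ennreal (cmod (T (\<lambda>y. a y - b n y) x)) + ennreal (cmod (\<integral>y. K0 x y * (a y - b n y) \<partial>\<mu>))"
      by (simp add: ennreal_leI flip: ennreal_plus)
     also have "... \<le> ennreal (cmod (T (\<lambda>y. a y - b n y) x)) + J n x"
      unfolding J_def by (intro add_left_mono norm_integral_le_nn_integral)
     finally show ?thesis using True by simp
    qed simp
   qed
   then have "mass A (\<lambda>x. cmod (D x)) \<le>
     (\<integral>\<^sup>+x. ennreal (cmod (T (\<lambda>y. a y - b n y) x)) * indicator A x + J n x * indicator A x \<partial>\<mu>)"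
    by (rule nn_integral_mono_AE)
   also have "... = mass A (\<lambda>x. cmod (T (\<lambda>y. a y - b n y) x)) + (\<integral>\<^sup>+x\<in>A. J n x \<partial>\<mu>)"
    by (intro nn_integral_add) auto
   also have "(\<integral>\<^sup>+x\<in>A. J n x \<partial>\<mu>) \<le> ennreal (C * measure \<mu> A powr \<alpha>) * tmass (\<lambda>y. cmod (a y - b n y))"
    unfolding J_def by (rule C(2)[rule_format]) (use finA in auto)
   finally show ?thesis by (simp add: add_left_mono)
  qed
  have l1: "(\<lambda>n. \<integral>\<^sup>+y. ennreal (cmod (a y - b n y) powr s) \<partial>\<mu>) \<longlonglongrightarrow> 0"
   if s: "0 < s" and fin: "tmass (\<lambda>y. cmod (a y) powr s) < \<infinity>" for s
  proof -
   have "(\<lambda>n. \<integral>\<^sup>+y. ennreal (cmod (a y - b n y) powr s) \<partial>\<mu>) \<longlonglongrightarrow> (\<integral>\<^sup>+y. 0 \<partial>\<mu>)"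
   proof (rule nn_integral_dominated_convergence[where w = "\<lambda>y. ennreal (cmod (a y) powr s)", OF _ _ _ _ fin])
    show "AE y in \<mu>. ennreal (cmod (a y - b n y) powr s) \<le> ennreal (cmod (a y) powr s)" for n
     using ble s by (intro AE_I2 ennreal_leI powr_mono2) auto
    show "AE y in \<mu>. (\<lambda>n. ennreal (cmod (a y - b n y) powr s)) \<longlonglongrightarrow> 0"
    proof (rule AE_I2)
     fix y
     have "(\<lambda>n. cmod (a y - b n y)) \<longlonglongrightarrow> cmod (a y - a y)" by (intro tendsto_intros blim)
     then have "(\<lambda>n. cmod (a y - b n y) powr s) \<longlonglongrightarrow> 0 powr s"
      using s by (intro tendsto_powr') auto
     then have "(\<lambda>n. ennreal (cmod (a y - b n y) powr s)) \<longlonglongrightarrow> ennreal 0" by (intro tendsto_ennrealI) simp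
     then show "(\<lambda>n. ennreal (cmod (a y - b n y) powr s)) \<longlonglongrightarrow> 0" by simp
    qed
   qed auto
   then show ?thesis by simp
  qed
  have "(\<lambda>n. \<integral>\<^sup>+x\<in>A. ennreal (cmod (T (\<lambda>y. a y - b n y) x)) \<partial>\<mu>) \<longlonglongrightarrow> 0"
   using a pp by (intro T_tendsto_zero[OF p _ l1 A finA]) (auto simp: Lp_space_iff)
  moreover have "(\<lambda>n. \<integral>\<^sup>+y. ennreal (cmod (a y - b n y)) \<partial>\<mu>) \<longlonglongrightarrow> 0"
   using l1[of 1] ai by (simp add: integrable_iff_bounded)
  ultimately have "(\<lambda>n. (mass A (\<lambda>x. cmod (T (\<lambda>y. a y - b n y) x))) + ennreal (C * measure \<mu> A powr \<alpha>) * tmass (\<lambda>y. cmod (a y - b n y)))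
   \<longlonglongrightarrow> 0 + ennreal (C * measure \<mu> A powr \<alpha>) * 0"
   by (intro tendsto_add ennreal_tendsto_cmult) auto
  then have "(\<lambda>n. (mass A (\<lambda>x. cmod (T (\<lambda>y. a y - b n y) x))) + ennreal (C * measure \<mu> A powr \<alpha>) * tmass (\<lambda>y. cmod (a y - b n y)))
   \<longlonglongrightarrow> 0" by simp
  then have "mass A (\<lambda>x. cmod (D x)) \<le> 0"
   by (rule LIMSEQ_le_const) (use le in blast)
  then have "mass A (\<lambda>x. cmod (D x)) = 0" by simp
  then have "AE x in \<mu>. ennreal (cmod (D x)) * indicator A x = 0"
   by (subst (asm) nn_integral_0_iff_AE) auto
  then show ?thesis
   using int
  proof eventually_elim
   case (elim x)
   show ?case
   proof
    assume "x \<in> ball c (real M) - cball c r"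
    then have "x \<in> A" by (simp add: A_def)
    then show "integrable \<mu> (\<lambda>y. K0 x y * a y) \<and> T a x = (\<integral>y. K0 x y * a y \<partial>\<mu>)"
     using elim by (auto simp: D_def)
   qed
  qed
 qed
 have "AE x in \<mu>. \<forall>M::nat. x \<in> ball c (real M) - cball c r --> integrable \<mu> (\<lambda>y. K0 x y * a y) \<and> T a x = (\<integral>y. K0 x y * a y \<partial>\<mu>)"
  by (subst AE_all_countable) (intro allI main)
 then show ?thesis
 proof eventually_elim
  case (elim x)
  obtain M :: nat where "dist c x < real M" using reals_Archimedean2 by blast
  then show ?case using elim by auto
 qed
qed

end

section \<open>Shells and atoms\<close>

text \<open>One exponent \<open>p\<close> serves all atoms: lowering the exponent of an atom only
  weakens its normalisation.\<close>

locale commutator_setting =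
 fractional_operator \<mu> lam Cl N0 \<alpha> K T + regular_mean_exponents \<mu> lam Cl N0 \<rho>\<^sub>b \<gamma>\<^sub>b
 for \<mu> :: "'a::metric_space measure" and lam Cl N0 \<alpha> K T \<rho>\<^sub>b \<gamma>\<^sub>b +
 fixes \<rho> p :: real
 assumes rho: "1 < \<rho>" and p: "admissible p"
begin

text \<open>The target exponent; \<open>\<alpha> = 1 - 1 / q\<^sub>0\<close>.\<close>

definition q\<^sub>0 :: real where "q\<^sub>0 = 1 / (1 - \<alpha>)"

lemma q0: "1 < q\<^sub>0" "1 - 1 / q\<^sub>0 = \<alpha>" "(1 - \<alpha>) * q\<^sub>0 = 1"
 using alpha by (auto simp: q\<^sub>0_def field_simps)

text \<open>The number of the shell \<open>\<sigma> ^ k * u \<le> dist c x < \<sigma> ^ (k + 1) *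
  u\<close> that contains \<open>x\<close>.\<close>

definition shell_index :: "real => real => 'a => 'a => nat" where
 "shell_index \<sigma> u c x = nat \<lfloor>log \<sigma> (dist c x / u)\<rfloor>"

lemma shell_index:
 assumes "1 < \<sigma>" "0 < u" "u \<le> dist c x"
 shows "\<sigma> ^ shell_index \<sigma> u c x * u \<le> dist c x" "dist c x < \<sigma> ^ (shell_index \<sigma> u c x + 1) * u"
proof -
 define l where "l = log \<sigma> (dist c x / u)"
 have q: "1 \<le> dist c x / u" using assms by simp
 then have q': "0 < dist c x / u" by linarith
 have l0: "0 \<le> l" unfolding l_def using assms(1) q q' by (subst zero_le_log_cancel_iff)
 have k: "real (shell_index \<sigma> u c x) = of_int \<lfloor>l\<rfloor>" using l0 by (simp add: shell_index_def l_def)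
 have e: "dist c x / u = \<sigma> powr l" using assms(1) q' unfolding l_def by (subst powr_log_cancel) auto
 have "\<sigma> ^ shell_index \<sigma> u c x = \<sigma> powr real (shell_index \<sigma> u c x)" using assms by (simp add: powr_realpow)
 also have "... \<le> dist c x / u" unfolding e using assms k by (intro powr_mono) linarith+
 finally show "\<sigma> ^ shell_index \<sigma> u c x * u \<le> dist c x" using assms by (simp add: field_simps)
 have "dist c x / u < \<sigma> powr real (shell_index \<sigma> u c x + 1)" unfolding e using assms k by (intro powr_less_mono) linarith+
 also have "... = \<sigma> ^ (shell_index \<sigma> u c x + 1)" using assms by (simp only: powr_realpow)
 finally show "dist c x < \<sigma> ^ (shell_index \<sigma> u c x + 1) * u" using assms by (simp add: field_simps)
qed

lemma dist_measurable [measurable]: "dist c \<in> borel_measurable \<mu>"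
 unfolding borel_measurable_iff by (intro borel_measurable_continuous_onI continuous_intros)

lemma shell_index_measurable [measurable]: "shell_index \<sigma> u c \<in> measurable \<mu> (count_space UNIV)"
 unfolding shell_index_def by measurable

lemma outside_measurable [measurable]: "{x. u \<le> dist c x} \<in> sets \<mu>"
proof -
 have "{x \<in> space \<mu>. u \<le> dist c x} \<in> sets \<mu>" by measurable
 then show ?thesis by simp
qed

text \<open>On each shell the oscillation of \<open>b\<close> about the mean at that scale is in
  \<open>L\<close> to the power \<open>q\<^sub>0\<close>, with mass controlled by the ball two scales
  up. The weighted sum over the shells is at most \<open>V\<close>, and Hoelder on \<open>A\<close>
  leaves the power \<open>\<alpha>\<close> of its measure.\<close>

lemma shell_bound:
 assumes \<sigma>: "1 < \<sigma>"
 shows "\<exists>C\<ge>0. \<forall>b m. regular_means b m --> (\<forall>c u w V A. 0 < u --> (\<forall>k. 0 \<le> w k) --> 0 \<le> V -->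
  (\<forall>n. (\<Sum>k<n. w k powr q\<^sub>0 * vol c (\<sigma> ^ (k + 2) * u)) \<le> V) --> A \<in> sets \<mu> --> emeasure \<mu> A < \<infinity> -->
  (mass (A \<inter> {x. u \<le> dist c x}) (\<lambda>x. cmod (b x - m c (\<sigma> ^ (shell_index \<sigma> u c x + 1) * u)) * w (shell_index \<sigma> u c x)))
   \<le> ennreal ((C * V) powr (1 - \<alpha>) * measure \<mu> A powr \<alpha>))"
proof -
 have q00: "0 < q\<^sub>0" using q0 by simp
 obtain C where C: "0 \<le> C" "\<forall>b m. regular_means b m --> (\<forall>c r. 0 < r -->
  (mass (ball c r) (\<lambda>x. cmod (b x - m c r) powr q\<^sub>0)) \<le> ennreal (C * vol c (\<sigma> * r)))"
  using power_oscillation[OF \<sigma> q00] by (elim exE conjE) (rule that)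
 show ?thesis
 proof (intro exI[of _ C] conjI C(1) allI impI)
  fix b :: "'a => complex" and m :: "'a => real => complex" and c :: 'a and u V :: real and w :: "nat => real" and A
  assume rm: "regular_means b m" and u: "0 < u" and w: "\<forall>k. 0 \<le> w k" and V: "0 \<le> V"
   and sumV: "\<forall>n. (\<Sum>k<n. w k powr q\<^sub>0 * vol c (\<sigma> ^ (k + 2) * u)) \<le> V"
   and A[measurable]: "A \<in> sets \<mu>" and fin: "emeasure \<mu> A < \<infinity>"
  note [measurable] = regular_means_measurable[OF rm]
  define k where "k = shell_index \<sigma> u c"
  have km[measurable]: "k \<in> measurable \<mu> (count_space UNIV)" unfolding k_def by measurable
  define f where "f i x = (if u \<le> dist c x then cmod (b x - m c (\<sigma> ^ (i + 1) * u)) * w i else 0)" for i x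
  have fm: "f i \<in> borel_measurable \<mu>" for i unfolding f_def by measurable
  define g where "g x = f (k x) x" for x
  have gm[measurable]: "bmeas g"
   unfolding g_def by (rule measurable_compose_countable[OF fm km])
  have g0: "0 \<le> g x" for x using w by (simp add: g_def f_def)
  have pos: "0 < \<sigma> ^ (i + 1) * u" for i using \<sigma> u by simp
  have "tmass (\<lambda>x. g x powr q\<^sub>0) \<le>
   (\<integral>\<^sup>+x. (\<Sum>i. ennreal (w i powr q\<^sub>0) * (ennreal (cmod (b x - m c (\<sigma> ^ (i + 1) * u)) powr q\<^sub>0) * indicator (ball c (\<sigma> ^ (i + 1) * u)) x)) \<partial>\<mu>)"
  proof (rule nn_integral_mono)
   fix x
   define h where "h i = ennreal (w i powr q\<^sub>0) * (ennreal (cmod (b x - m c (\<sigma> ^ (i + 1) * u)) powr q\<^sub>0) * indicator (ball c (\<sigma> ^ (i + 1) * u)) x)" for i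
   have hs: "h i \<le> (\<Sum>i. h i)" for i using sum_le_suminf[OF summableI, of "{i}" h] by simp
   have "ennreal (g x powr q\<^sub>0) \<le> h (k x)"
   proof (cases "u \<le> dist c x")
    case True
    then have "x \<in> ball c (\<sigma> ^ (k x + 1) * u)" using shell_index(2)[OF \<sigma> u True] by (simp add: k_def)
    then show ?thesis using True w
     by (simp add: h_def g_def f_def powr_mult ennreal_mult[symmetric] mult.commute)
   qed (simp add: g_def f_def)
   then show "ennreal (g x powr q\<^sub>0) \<le> (\<Sum>i. ennreal (w i powr q\<^sub>0) * (ennreal (cmod (b x - m c (\<sigma> ^ (i + 1) * u)) powr q\<^sub>0) * indicator (ball c (\<sigma> ^ (i + 1) * u)) x))"
    using hs[of "k x"] unfolding h_def by (rule order_trans)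
  qed
  also have "... = (\<Sum>i. ennreal (w i powr q\<^sub>0) * mass (ball c (\<sigma> ^ (i + 1) * u)) (\<lambda>x. cmod (b x - m c (\<sigma> ^ (i + 1) * u)) powr q\<^sub>0))"
   by (subst nn_integral_suminf) (auto simp: nn_integral_cmult)
  also have "... \<le> (\<Sum>i. ennreal (C * (w i powr q\<^sub>0 * vol c (\<sigma> ^ (i + 2) * u))))"
  proof (intro suminf_le summableI)
   fix i
   have "mass (ball c (\<sigma> ^ (i + 1) * u)) (\<lambda>x. cmod (b x - m c (\<sigma> ^ (i + 1) * u)) powr q\<^sub>0)
     \<le> ennreal (C * vol c (\<sigma> * (\<sigma> ^ (i + 1) * u)))"
    by (rule C(2)[rule_format, OF rm pos])
   then have "ennreal (w i powr q\<^sub>0) * mass (ball c (\<sigma> ^ (i + 1) * u)) (\<lambda>x. cmod (b x - m c (\<sigma> ^ (i + 1) * u)) powr q\<^sub>0)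
     \<le> ennreal (w i powr q\<^sub>0) * ennreal (C * vol c (\<sigma> * (\<sigma> ^ (i + 1) * u)))"
    by (intro mult_left_mono) auto
   then show "ennreal (w i powr q\<^sub>0) * mass (ball c (\<sigma> ^ (i + 1) * u)) (\<lambda>x. cmod (b x - m c (\<sigma> ^ (i + 1) * u)) powr q\<^sub>0)
     \<le> ennreal (C * (w i powr q\<^sub>0 * vol c (\<sigma> ^ (i + 2) * u)))"
    using C(1) by (simp add: ennreal_mult[symmetric] mult_ac)
  qed
  also have "... \<le> ennreal (C * V)"
  proof (rule suminf_le_const[OF summableI])
   fix n
   have "(\<Sum>i<n. ennreal (C * (w i powr q\<^sub>0 * vol c (\<sigma> ^ (i + 2) * u))))
    = ennreal (C * (\<Sum>i<n. w i powr q\<^sub>0 * vol c (\<sigma> ^ (i + 2) * u)))"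
    using C(1) by (simp add: sum_ennreal sum_distrib_left)
   also have "... \<le> ennreal (C * V)" using sumV C(1) by (intro ennreal_leI mult_left_mono) auto
   finally show "(\<Sum>i<n. ennreal (C * (w i powr q\<^sub>0 * vol c (\<sigma> ^ (i + 2) * u)))) \<le> ennreal (C * V)" .
  qed
  also have "C * V = ((C * V) powr (1 - \<alpha>)) powr q\<^sub>0" using C(1) V q0(3) by (simp add: powr_powr)
  finally have G: "tmass (\<lambda>x. g x powr q\<^sub>0) \<le> ennreal (((C * V) powr (1 - \<alpha>)) powr q\<^sub>0)" .
  have "mass (A \<inter> {x. u \<le> dist c x}) (\<lambda>x. cmod (b x - m c (\<sigma> ^ (shell_index \<sigma> u c x + 1) * u)) * w (shell_index \<sigma> u c x))
   = mass A g"
   by (intro nn_integral_cong) (auto simp: g_def f_def k_def indicator_def)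
  also have "... \<le> ennreal ((C * V) powr (1 - \<alpha>) * measure \<mu> A powr (1 - 1 / q\<^sub>0))"
   using q0(1) by (intro nn_integral_Holder_set g0 fin G) auto
  finally show "mass (A \<inter> {x. u \<le> dist c x}) (\<lambda>x. cmod (b x - m c (\<sigma> ^ (shell_index \<sigma> u c x + 1) * u)) * w (shell_index \<sigma> u c x))
   \<le> ennreal ((C * V) powr (1 - \<alpha>) * measure \<mu> A powr \<alpha>)" by (simp only: q0(2))
 qed
qed

text \<open>The exponent \<open>q\<^sub>0\<close> turns the kernel size \<open>lam\<close> to the power
  \<open>\<alpha> - 1\<close> into \<open>1 / lam\<close>, so that weight times measure is
  \<open>theta\<close>, the summand of the discrete coefficient.\<close>

lemma shell_weight:
 assumes "1 < \<sigma>" "0 < u"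
 shows "(lam c (\<sigma> ^ k * u) powr (\<alpha> - 1)) powr q\<^sub>0 * vol c (\<sigma> ^ (k + 2) * u)
   \<le> dil (\<sigma>\<^sup>2) * theta c (\<sigma> ^ (k + 2) * u)"
proof -
 define v where "v = \<sigma> ^ k * u"
 have v: "0 < v" "0 < \<sigma>\<^sup>2 * v" using assms by (auto simp: v_def)
 have e: "\<sigma> ^ (k + 2) * u = \<sigma>\<^sup>2 * v" by (simp add: v_def power_add power2_eq_square)
 have l: "0 < lam c v" "0 < lam c (\<sigma>\<^sup>2 * v)" using v lam_pos by auto
 have "(\<alpha> - 1) * q\<^sub>0 = - 1" using q0(3) by (simp add: algebra_simps)
 then have "(lam c v powr (\<alpha> - 1)) powr q\<^sub>0 = 1 / lam c v" using l by (simp add: powr_powr powr_minus_divide)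
 moreover have "1 / lam c v \<le> dil (\<sigma>\<^sup>2) / lam c (\<sigma>\<^sup>2 * v)"
  using lam_dilate[of v "\<sigma>\<^sup>2" c] v l assms by (simp add: field_simps)
 ultimately have "(lam c v powr (\<alpha> - 1)) powr q\<^sub>0 * vol c (\<sigma>\<^sup>2 * v) \<le> dil (\<sigma>\<^sup>2) / lam c (\<sigma>\<^sup>2 * v) * vol c (\<sigma>\<^sup>2 * v)"
  by (simp only: mult_right_mono measure_nonneg)
 then show ?thesis unfolding e v_def[symmetric] by (simp add: theta_def)
qed

text \<open>Atoms with exponent \<open>p\<close> and \<open>\<gamma> = 1\<close>. Atoms with larger
  exponents or larger \<open>\<gamma>\<close> are of this kind.\<close>

definition atom_on :: "'a => real => 'a => real => ('a => complex) => bool" where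
 "atom_on c' r' c r a \<longleftrightarrow> 0 < r' \<and> 0 < r \<and> ball c' r' \<subseteq> ball c r \<and>
  (AE x in \<mu>. x \<notin> ball c' r' --> a x = 0) \<and>
  Lp_bound \<mu> p (vol c' (\<rho> * r') powr (1 / p - 1) / K_tilde \<mu> lam \<rho> c' r' r) a"

lemma atom_onD:
 assumes "atom_on c' r' c r a"
 shows "0 < r'" "0 < r" "ball c' r' \<subseteq> ball c r" "AE x in \<mu>. x \<notin> ball c' r' --> a x = 0"
  "Lp_bound \<mu> p (vol c' (\<rho> * r') powr (1 / p - 1) / K_tilde \<mu> lam \<rho> c' r' r) a"
  "a \<in> Lp p" "bmeas a" "1 \<le> K_tilde \<mu> lam \<rho> c' r' r"
  "dist c c' < r"
proof -
 show r: "0 < r'" "0 < r" and sub: "ball c' r' \<subseteq> ball c r" and ae: "AE x in \<mu>. x \<notin> ball c' r' --> a x = 0"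
  and b: "Lp_bound \<mu> p (vol c' (\<rho> * r') powr (1 / p - 1) / K_tilde \<mu> lam \<rho> c' r' r) a"
  using assms unfolding atom_on_def by blast+
 show "a \<in> Lp p" using Lp_spaceI(1)[OF b] admissible_pos(1)[OF p] by simp
 show "bmeas a" using b by (simp add: Lp_bound_def)
 show "1 \<le> K_tilde \<mu> lam \<rho> c' r' r" by (rule K_tilde_ge_1[OF rho r])
 have "c' \<in> ball c' r'" using r by simp
 then show "dist c c' < r" using sub by (simp add: subset_iff)
qed

lemma powr_cancel_le_1: "0 \<le> M ==> M powr (1 / p - 1) * M powr (1 - 1 / p) \<le> (1::real)"
 by (cases "M = 0") (auto simp: powr_add[symmetric])

lemma atom_L1:
 assumes a: "atom_on c' r' c r a"
 shows "integrable \<mu> a" "(\<integral>x. cmod (a x) \<partial>\<mu>) \<le> 1 / K_tilde \<mu> lam \<rho> c' r' r"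
proof -
 note D = atom_onD[OF a]
 define K where "K = K_tilde \<mu> lam \<rho> c' r' r"
 define M where "M = vol c' (\<rho> * r')"
 have K: "1 \<le> K" using D(8) by (simp add: K_def)
 have p1: "1 < p" "0 \<le> 1 - 1 / p" using admissible_pos(2)[OF p] by auto
 have [measurable]: "bmeas a" by (rule D(7))
 show i: "integrable \<mu> a"
  by (rule integrable_of_Lp_finite_support[OF D(6) _ _ _ D(4)]) (use p1 emeasure_ball_finite in auto)
 have "ennreal (\<integral>x. cmod (a x) \<partial>\<mu>) = tmass (\<lambda>x. cmod (a x))"
  using i by (intro nn_integral_eq_integral[symmetric]) auto
 also have "... = mass (ball c' r') (\<lambda>x. cmod (a x))"
 proof (rule nn_integral_cong_AE)
  show "AE x in \<mu>. ennreal (cmod (a x)) = ennreal (cmod (a x)) * indicator (ball c' r') x"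
   using D(4) by eventually_elim (auto simp: indicator_def)
 qed
 also have "... \<le> ennreal (M powr (1 / p - 1) / K * vol c' r' powr (1 - 1 / p))"
  using Lp_bound_set_integral[OF D(5), of "ball c' r'"] p1 emeasure_ball_finite unfolding K_def M_def by simp
 also have "... \<le> ennreal (1 / K)"
 proof (rule ennreal_leI)
  have "vol c' r' \<le> M" unfolding M_def
   using D(1) rho by (intro measure_ball_mono subset_ball) auto
  then have "vol c' r' powr (1 - 1 / p) \<le> M powr (1 - 1 / p)" using p1 by (intro powr_mono2) auto
  then have "M powr (1 / p - 1) * vol c' r' powr (1 - 1 / p) \<le> M powr (1 / p - 1) * M powr (1 - 1 / p)"
   by (intro mult_left_mono) auto
  also have "... \<le> 1" by (rule powr_cancel_le_1) (simp add: M_def)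
  finally show "M powr (1 / p - 1) / K * vol c' r' powr (1 - 1 / p) \<le> 1 / K"
   using K by (simp add: divide_right_mono)
 qed
 finally show "(\<integral>x. cmod (a x) \<partial>\<mu>) \<le> 1 / K_tilde \<mu> lam \<rho> c' r' r"
  using K by (simp add: K_def ennreal_le_iff)
qed

definition p' :: real where "p' = p / (p - 1)"

lemma p': "0 < p'" "1 / p + 1 / p' = 1" "1 / p' = 1 - 1 / p"
 using admissible_pos(2)[OF p] by (auto simp: p'_def field_simps)

text \<open>The means of the two balls differ by \<open>O(K)\<close>, with \<open>K\<close> their
  coefficient, and the norm of the atom is \<open>1 / K\<close> in \<open>L\<^sup>1\<close>; the
  oscillation about the mean of the small ball is paired with the atom by Hoelder.\<close>

lemma atom_times_oscillation:
 "\<exists>C\<ge>0. \<forall>b m. regular_means b m --> (\<forall>c' r' c r a. atom_on c' r' c r a -->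
  (tmass (\<lambda>x. cmod (b x - m c r) * cmod (a x))) \<le> ennreal C)"
proof -
 obtain C1 where C1: "0 \<le> C1" "\<forall>b m. regular_means b m --> (\<forall>c r. 0 < r -->
  (mass (ball c r) (\<lambda>x. cmod (b x - m c r) powr p')) \<le> ennreal (C1 * vol c (\<rho> * r)))"
  using power_oscillation[OF rho p'(1)] by (elim exE conjE) (rule that)
 obtain C2 where C2: "0 \<le> C2" "\<forall>b m. regular_means b m --> (\<forall>c r c1 r1. 0 < r --> 0 < r1 -->
  ball c r \<subseteq> ball c1 r1 --> cmod (m c r - m c1 r1) \<le> C2 * K_tilde \<mu> lam \<rho> c r r1)"
  using means_nested[OF rho] by (elim exE conjE) (rule that)
 show ?thesis
 proof (intro exI[of _ "C1 powr (1 / p') + C2"] conjI allI impI)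
  fix b :: "'a => complex" and m :: "'a => real => complex" and c' c :: 'a and r' r :: real and a
  assume rm: "regular_means b m" and a: "atom_on c' r' c r a"
  note D = atom_onD[OF a]
  note [measurable] = regular_means_measurable[OF rm] D(7)
  define K where "K = K_tilde \<mu> lam \<rho> c' r' r"
  define M where "M = vol c' (\<rho> * r')"
  have K: "1 \<le> K" using D(8) by (simp add: K_def)
  have M: "0 \<le> M" by (simp add: M_def)
  have mm: "cmod (m c' r' - m c r) \<le> C2 * K"
   unfolding K_def by (rule C2(2)[rule_format, OF rm D(1-3)])
  have "tmass (\<lambda>x. cmod (a x) * (cmod (b x - m c' r') * indicat_real (ball c' r') x))
   \<le> ennreal (M powr (1 / p - 1) / K * (C1 * M) powr (1 / p'))"
  proof (rule nn_integral_Holder[where p = p and q = p'])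
   show "tmass (\<lambda>x. cmod (a x) powr p) \<le> ennreal ((M powr (1 / p - 1) / K) powr p)"
    using D(5) unfolding Lp_bound_def K_def M_def by blast
   have "tmass (\<lambda>x. (cmod (b x - m c' r') * indicat_real (ball c' r') x) powr p')
     = mass (ball c' r') (\<lambda>x. cmod (b x - m c' r') powr p')"
    using p'(1) by (intro nn_integral_cong) (auto simp: indicator_def)
   also have "... \<le> ennreal (C1 * M)" unfolding M_def by (rule C1(2)[rule_format, OF rm D(1)])
   also have "C1 * M = ((C1 * M) powr (1 / p')) powr p'" using C1(1) M p'(1) by (simp add: powr_powr)
   finally show "tmass (\<lambda>x. (cmod (b x - m c' r') * indicat_real (ball c' r') x) powr p') \<le> ennreal (((C1 * M) powr (1 / p')) powr p')" .
  qed (use admissible_pos[OF p] p' K in auto)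
  also have "... \<le> ennreal (C1 powr (1 / p'))"
  proof (rule ennreal_leI)
   have "M powr (1 / p - 1) / K * (C1 * M) powr (1 / p') = C1 powr (1 / p') * (M powr (1 / p - 1) * M powr (1 - 1 / p)) / K"
    using C1(1) M by (simp add: powr_mult p'(3))
   also have "... \<le> C1 powr (1 / p') * 1 / 1"
    using K powr_cancel_le_1[OF M] by (intro frac_le mult_left_mono) auto
   finally show "M powr (1 / p - 1) / K * (C1 * M) powr (1 / p') \<le> C1 powr (1 / p')" by simp
  qed
  finally have h1: "tmass (\<lambda>x. cmod (a x) * (cmod (b x - m c' r') * indicat_real (ball c' r') x)) \<le> ennreal (C1 powr (1 / p'))" .
  have "ennreal (C2 * K) * tmass (\<lambda>x. cmod (a x)) = ennreal (C2 * K * (\<integral>x. cmod (a x) \<partial>\<mu>))"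
   using atom_L1(1)[OF a] C2(1) K by (subst nn_integral_eq_integral) (auto simp: ennreal_mult)
  also have "... \<le> ennreal C2"
  proof (rule ennreal_leI)
   have "C2 * K * (\<integral>x. cmod (a x) \<partial>\<mu>) \<le> C2 * K * (1 / K)"
    using atom_L1(2)[OF a] C2(1) K unfolding K_def by (intro mult_left_mono) auto
   then show "C2 * K * (\<integral>x. cmod (a x) \<partial>\<mu>) \<le> C2" using K by simp
  qed
  finally have h2: "ennreal (C2 * K) * tmass (\<lambda>x. cmod (a x)) \<le> ennreal C2" .
  have "tmass (\<lambda>x. cmod (b x - m c r) * cmod (a x)) \<le>
    (\<integral>\<^sup>+x. ennreal (cmod (a x) * (cmod (b x - m c' r') * indicat_real (ball c' r') x)) + ennreal (C2 * K) * ennreal (cmod (a x)) \<partial>\<mu>)"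
  proof (rule nn_integral_mono_AE)
   show "AE x in \<mu>. ennreal (cmod (b x - m c r) * cmod (a x)) \<le>
     ennreal (cmod (a x) * (cmod (b x - m c' r') * indicat_real (ball c' r') x)) + ennreal (C2 * K) * ennreal (cmod (a x))"
    using D(4)
   proof eventually_elim
    case (elim x)
    show ?case
    proof (cases "x \<in> ball c' r'")
     case True
     have "cmod (b x - m c r) \<le> cmod (b x - m c' r') + C2 * K"
      using norm_triangle_ineq[of "b x - m c' r'" "m c' r' - m c r"] mm by simp
     then have "cmod (b x - m c r) * cmod (a x) \<le> (cmod (b x - m c' r') + C2 * K) * cmod (a x)"
      by (intro mult_right_mono) auto
     also have "... = cmod (a x) * (cmod (b x - m c' r') * indicat_real (ball c' r') x) + C2 * K * cmod (a x)"
      using True by (simp add: algebra_simps)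
     finally have "ennreal (cmod (b x - m c r) * cmod (a x)) \<le> ennreal (cmod (a x) * (cmod (b x - m c' r') * indicat_real (ball c' r') x) + C2 * K * cmod (a x))"
      by (rule ennreal_leI)
     then show ?thesis using C2(1) K by (simp add: ennreal_mult ennreal_plus)
    next
     case False
     then show ?thesis using elim by simp
    qed
   qed
  qed
  also have "... = tmass (\<lambda>x. cmod (a x) * (cmod (b x - m c' r') * indicat_real (ball c' r') x)) + ennreal (C2 * K) * tmass (\<lambda>x. cmod (a x))"
   by (subst nn_integral_add) (auto simp: nn_integral_cmult)
  also have "... \<le> ennreal (C1 powr (1 / p')) + ennreal C2" by (intro add_mono h1 h2)
  also have "... = ennreal (C1 powr (1 / p') + C2)" using C2(1) by (simp flip: ennreal_plus)
  finally show "tmass (\<lambda>x. cmod (b x - m c r) * cmod (a x)) \<le> ennreal (C1 powr (1 / p') + C2)" .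
 qed (use C2 in simp)
qed

text \<open>By Hoelder with high powers of the oscillation; an arbitrarily small loss in the exponent
  pays for the unboundedness of \<open>b\<close>.\<close>

lemma times_b_Lp:
 assumes rm: "regular_means b m" and a: "a \<in> Lp p" and supp: "AE x in \<mu>. x \<notin> ball c r --> a x = 0"
  and r: "0 < r" and s: "1 < s" "s < p"
 shows "a \<in> Lp s" "(\<lambda>x. (b x - z) * a x) \<in> Lp s"
proof -
 note [measurable] = regular_means_measurable[OF rm]
 have [measurable]: "bmeas a" and ap: "tmass (\<lambda>x. cmod (a x) powr p) < \<infinity>"
  using a admissible_pos(1)[OF p] by (auto simp: Lp_space_iff)
 define v where "v = 1 / (1 / s - 1 / p)"
 have sp: "0 < 1 / s - 1 / p" using s by (simp add: field_simps)
 have v: "0 < v" using sp by (simp add: v_def)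
 have vs: "s / v + s / p = 1" using s by (simp add: v_def field_simps)
 have "tmass (\<lambda>x. cmod (a x) powr s) \<le> (\<integral>\<^sup>+x. indicator (ball c r) x + ennreal (cmod (a x) powr p) \<partial>\<mu>)"
 proof (rule nn_integral_mono_AE)
  show "AE x in \<mu>. ennreal (cmod (a x) powr s) \<le> indicator (ball c r) x + ennreal (cmod (a x) powr p)"
   using supp
  proof eventually_elim
   case (elim x)
   show ?case
   proof (cases "x \<in> ball c r")
    case True
    have "cmod (a x) powr s \<le> 1 + cmod (a x) powr p"
    proof (cases "cmod (a x) \<le> 1")
     case True
     then have "cmod (a x) powr s \<le> 1" using s by (intro powr_le1) auto
     then show ?thesis by (simp add: add_increasing2)
    next
     case False
     then have "cmod (a x) powr s \<le> cmod (a x) powr p" using s by (intro powr_mono) auto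
     then show ?thesis by simp
    qed
    then show ?thesis using True by (simp add: ennreal_leI flip: ennreal_plus ennreal_1)
   qed (use elim in simp)
  qed
 qed
 also have "... = emeasure \<mu> (ball c r) + tmass (\<lambda>x. cmod (a x) powr p)"
  by (subst nn_integral_add) auto
 also have "... < \<infinity>" using ap emeasure_ball_finite[of c r] by (simp add: less_top)
 finally show as: "a \<in> Lp s" using s by (simp add: Lp_space_iff)
 obtain C1 where C1: "0 \<le> C1" "\<forall>b m. regular_means b m --> (\<forall>c r. 0 < r -->
  (mass (ball c r) (\<lambda>x. cmod (b x - m c r) powr v)) \<le> ennreal (C1 * vol c (\<rho> * r)))"
  using power_oscillation[OF rho v] by (elim exE conjE) (rule that)
 have "tmass (\<lambda>x. cmod ((b x - m c r) * a x) powr s) \<le>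
  (\<integral>\<^sup>+x. ennreal (cmod (b x - m c r) powr v) * indicator (ball c r) x + ennreal (cmod (a x) powr p) \<partial>\<mu>)"
 proof (rule nn_integral_mono_AE)
  show "AE x in \<mu>. ennreal (cmod ((b x - m c r) * a x) powr s) \<le>
    ennreal (cmod (b x - m c r) powr v) * indicator (ball c r) x + ennreal (cmod (a x) powr p)"
   using supp
  proof eventually_elim
   case (elim x)
   show ?case
   proof (cases "x \<in> ball c r")
    case True
    define X Y where "X = cmod (b x - m c r) powr s" and "Y = cmod (a x) powr s"
    have vs1: "1 < v / s" "1 < p / s"
    proof -
     show "1 < p / s" using s by simp
     have "s / v < 1" using vs s admissible_pos(1)[OF p] by (smt (verit) divide_pos_pos)
     then show "1 < v / s" using s v by (simp add: field_simps)
    qed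
    have "X * Y \<le> X powr (v / s) / (v / s) + Y powr (p / s) / (p / s)"
     using vs1 vs by (intro Youngs_inequality) (auto simp: X_def Y_def)
    also have "... \<le> X powr (v / s) / 1 + Y powr (p / s) / 1"
     using vs1 by (intro add_mono divide_left_mono) auto
    also have "... = cmod (b x - m c r) powr v + cmod (a x) powr p"
     using s by (simp add: X_def Y_def powr_powr)
    finally have "cmod ((b x - m c r) * a x) powr s \<le> cmod (b x - m c r) powr v + cmod (a x) powr p"
     by (simp add: X_def Y_def norm_mult powr_mult)
    then show ?thesis using True by (simp add: ennreal_leI flip: ennreal_plus)
   qed (use elim in simp)
  qed
 qed
 also have "... = mass (ball c r) (\<lambda>x. cmod (b x - m c r) powr v) + tmass (\<lambda>x. cmod (a x) powr p)"
  by (intro nn_integral_add) auto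
 also have "... < \<infinity>"
  using order_le_less_trans[OF C1(2)[rule_format, OF rm r, of c] ennreal_less_top] ap by (simp add: less_top)
 finally have "(\<lambda>x. (b x - m c r) * a x) \<in> Lp s" using s by (simp add: Lp_space_iff)
 from Lp_space_add[OF _ this as, of 1 "m c r - z"] s
 show "(\<lambda>x. (b x - z) * a x) \<in> Lp s" by (simp add: algebra_simps)
qed

section \<open>The commutator on atomic blocks\<close>

definition \<rho>\<^sub>1 :: real where "\<rho>\<^sub>1 = (1 + \<rho>) / 2"

lemma rho1: "1 < \<rho>\<^sub>1" "\<rho>\<^sub>1 < \<rho>" "1 < \<rho> / \<rho>\<^sub>1"
 using rho by (auto simp: \<rho>\<^sub>1_def field_simps)

text \<open>Three factors: the oscillation of \<open>b\<close> in a high power, \<open>T a\<close> in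
  the exponent \<open>s\<close> with \<open>1 / s = 1 / p - \<alpha>\<close>, and the indicator of
  \<open>A\<close>. The change of mean costs the coefficient of the two balls, which the normalisation
  of the atom cancels. The intermediate dilation \<open>\<rho>\<^sub>1\<close> leaves room for the
  dilation in the oscillation estimate.\<close>

lemma atom_near:
 "\<exists>C\<ge>0. \<forall>b m. regular_means b m --> (\<forall>c' r' c r a A. atom_on c' r' c r a --> A \<in> sets \<mu> --> emeasure \<mu> A < \<infinity> -->
  (mass (A \<inter> ball c' (\<rho>\<^sub>1 * r')) (\<lambda>x. cmod (b x - m c r) * cmod (T a x))) \<le> ennreal (C * measure \<mu> A powr \<alpha>))"
proof -
 obtain C1 where C1: "0 \<le> C1" "\<forall>b m. regular_means b m --> (\<forall>c r. 0 < r -->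
  (mass (ball c r) (\<lambda>x. cmod (b x - m c r) powr p')) \<le> ennreal (C1 * vol c (\<rho> / \<rho>\<^sub>1 * r)))"
  using power_oscillation[OF rho1(3) p'(1)] by (elim exE conjE) (rule that)
 obtain C2 where C2: "0 \<le> C2" "\<forall>b m. regular_means b m --> (\<forall>c r c1 r1. 0 < r --> 0 < r1 -->
  ball c r \<subseteq> ball c1 r1 --> cmod (m c r - m c1 r1) \<le> C2 * K_tilde \<mu> lam \<rho> c r r1)"
  using means_nested[OF rho] by (elim exE conjE) (rule that)
 obtain C3 where C3: "0 \<le> C3" "\<forall>b m. regular_means b m --> (\<forall>c r c1 r1. 0 < r --> 0 < r1 -->
  ball c r \<subseteq> ball c1 r1 --> r1 \<le> \<rho>\<^sub>1 * r --> cmod (m c r - m c1 r1) \<le> C3)"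
  using means_comparable[OF less_imp_le[OF rho1(1)]] by (elim exE conjE) (rule that)
 obtain CT where CT: "0 \<le> CT" "\<forall>f F. Lp_bound \<mu> p F f --> Lp_bound \<mu> (conj_exp p) (CT * F) (T f)"
  using T_bounded[OF p] by (elim exE conjE) (rule that)
 define d where "d = C2 + C3"
 define E where "E = 2 * (C1 + d powr p') powr (1 / p')"
 have d: "0 \<le> d" using C2 C3 by (simp add: d_def)
 show ?thesis
 proof (intro exI[of _ "CT * E"] conjI allI impI)
  show "0 \<le> CT * E" using CT(1) by (simp add: E_def)
  fix b :: "'a => complex" and m :: "'a => real => complex" and c' c :: 'a and r' r :: real and a A
  assume rm: "regular_means b m" and a: "atom_on c' r' c r a" and A[measurable]: "A \<in> sets \<mu>" and fin: "emeasure \<mu> A < \<infinity>"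
  note D = atom_onD[OF a]
  have Tm: "T a \<in> borel_measurable \<mu>" by (rule T_measurable[OF p D(6)])
  note [measurable] = regular_means_measurable[OF rm] D(7) Tm
  define K where "K = K_tilde \<mu> lam \<rho> c' r' r"
  define M where "M = vol c' (\<rho> * r')"
  have K: "1 \<le> K" using D(8) by (simp add: K_def)
  have M: "0 \<le> M" by (simp add: M_def)
  define r1 where "r1 = \<rho>\<^sub>1 * r'"
  have r1: "0 < r1" "r' \<le> r1" "\<rho> / \<rho>\<^sub>1 * r1 = \<rho> * r'" using rho1 D(1) by (auto simp: r1_def)
  have "cmod (m c' r' - m c r) \<le> C2 * K"
   unfolding K_def by (rule C2(2)[rule_format, OF rm D(1-3)])
  moreover have "cmod (m c' r' - m c' r1) \<le> C3"
   by (rule C3(2)[rule_format, OF rm D(1) r1(1)]) (use r1 in \<open>auto simp: r1_def\<close>)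
  moreover have "C3 * 1 \<le> C3 * K" using K C3(1) by (intro mult_left_mono)
  ultimately have mm: "cmod (m c' r1 - m c r) \<le> d * K"
   using norm_triangle_ineq4[of "m c' r' - m c r" "m c' r' - m c' r1"] by (simp add: d_def algebra_simps)
  have G: "tmass (\<lambda>x. (cmod (b x - m c r) * indicat_real (ball c' r1) x) powr p') \<le> ennreal ((E * K * M powr (1 / p')) powr p')"
  proof -
   have "tmass (\<lambda>x. (cmod (b x - m c r) * indicat_real (ball c' r1) x) powr p') \<le>
    (\<integral>\<^sup>+x. ennreal (2 powr p') * (ennreal (cmod (b x - m c' r1) powr p') * indicator (ball c' r1) x) + ennreal (2 powr p' * (d * K) powr p') * indicator (ball c' r1) x \<partial>\<mu>)"
   proof (rule nn_integral_mono)
    fix x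
    define X where "X = cmod (b x - m c' r1)"
    have "cmod (b x - m c r) \<le> X + d * K"
     unfolding X_def using norm_triangle_ineq[of "b x - m c' r1" "m c' r1 - m c r"] mm by simp
    also have "... \<le> max (2 * X) (2 * (d * K))" by simp
    finally have "cmod (b x - m c r) powr p' \<le> max (2 * X) (2 * (d * K)) powr p'"
     using p'(1) by (intro powr_mono2) auto
    also have "... \<le> (2 * X) powr p' + (2 * (d * K)) powr p'" by (simp add: max_def)
    also have "... = 2 powr p' * X powr p' + 2 powr p' * (d * K) powr p'"
     using d K by (simp add: powr_mult X_def)
    finally have "ennreal (cmod (b x - m c r) powr p') \<le> ennreal (2 powr p') * ennreal (X powr p') + ennreal (2 powr p' * (d * K) powr p')"
     by (simp add: ennreal_leI ennreal_mult[symmetric] ennreal_plus[symmetric] del: ennreal_plus)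
    then show "ennreal ((cmod (b x - m c r) * indicat_real (ball c' r1) x) powr p') \<le>
     ennreal (2 powr p') * (ennreal (cmod (b x - m c' r1) powr p') * indicator (ball c' r1) x) + ennreal (2 powr p' * (d * K) powr p') * indicator (ball c' r1) x"
     by (auto simp: indicator_def X_def)
   qed
   also have "... = ennreal (2 powr p') * mass (ball c' r1) (\<lambda>x. cmod (b x - m c' r1) powr p') + ennreal (2 powr p' * (d * K) powr p') * emeasure \<mu> (ball c' r1)"
    by (subst nn_integral_add) (auto simp: nn_integral_cmult nn_integral_cmult_indicator)
   also have "... \<le> ennreal (2 powr p') * ennreal (C1 * M) + ennreal (2 powr p' * (d * K) powr p') * ennreal M"
   proof (intro add_mono mult_left_mono)
    show "mass (ball c' r1) (\<lambda>x. cmod (b x - m c' r1) powr p') \<le> ennreal (C1 * M)"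
     using C1(2)[rule_format, OF rm r1(1), of c'] unfolding M_def r1(3) .
    show "emeasure \<mu> (ball c' r1) \<le> ennreal M"
     unfolding M_def emeasure_ball r1_def using rho1 D(1) by (intro ennreal_leI measure_ball_mono subset_ball) auto
   qed auto
   also have "... = ennreal (2 powr p' * (C1 + (d * K) powr p') * M)"
    using C1(1) M by (simp add: ennreal_mult[symmetric] algebra_simps flip: ennreal_plus)
   also have "... \<le> ennreal ((E * K * M powr (1 / p')) powr p')"
   proof (rule ennreal_leI)
    have "1 \<le> K powr p'" using K p'(1) by (simp add: ge_one_powr_ge_zero)
    then have "C1 * 1 \<le> C1 * K powr p'" using C1(1) by (intro mult_left_mono)
    then have "C1 + (d * K) powr p' \<le> (C1 + d powr p') * K powr p'" using d K by (simp add: powr_mult algebra_simps)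
    then have "2 powr p' * (C1 + (d * K) powr p') * M \<le> 2 powr p' * ((C1 + d powr p') * K powr p') * M"
     using M by (intro mult_right_mono mult_left_mono) auto
    also have "... = (E * K * M powr (1 / p')) powr p'"
     using C1(1) d K M p'(1) by (simp add: E_def powr_mult powr_powr)
    finally show "2 powr p' * (C1 + (d * K) powr p') * M \<le> (E * K * M powr (1 / p')) powr p'" .
   qed
   finally show ?thesis .
  qed
  have F: "Lp_bound \<mu> (conj_exp p) (CT * (M powr (1 / p - 1) / K)) (T a)"
   unfolding M_def K_def by (rule CT(2)[rule_format, OF D(5)])
  have H: "tmass (\<lambda>x. indicat_real A x powr (1 / \<alpha>)) \<le> ennreal ((measure \<mu> A powr \<alpha>) powr (1 / \<alpha>))"
  proof -
   have "tmass (\<lambda>x. indicat_real A x powr (1 / \<alpha>)) = (\<integral>\<^sup>+x. indicator A x \<partial>\<mu>)"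
    using alpha by (intro nn_integral_cong) (auto simp: indicator_def)
   then show ?thesis using fin alpha by (simp add: powr_powr emeasure_eq_ennreal_measure top.not_eq_extremum)
  qed
  have "mass (A \<inter> ball c' (\<rho>\<^sub>1 * r')) (\<lambda>x. cmod (b x - m c r) * cmod (T a x)) =
    (tmass (\<lambda>x. cmod (T a x) * ((cmod (b x - m c r) * indicat_real (ball c' r1) x) * indicat_real A x)))"
   by (intro nn_integral_cong) (auto simp: indicator_def r1_def mult.commute)
  also have "... \<le> ennreal ((CT * (M powr (1 / p - 1) / K)) * ((E * K * M powr (1 / p')) * measure \<mu> A powr \<alpha>))"
  proof (rule nn_integral_Holder3[where p = "conj_exp p" and q = p' and r = "1 / \<alpha>"])
   show "1 / conj_exp p + 1 / p' + 1 / (1 / \<alpha>) = 1" using conj_exp(1)[OF p] p'(3) by simp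
   show "tmass (\<lambda>x. cmod (T a x) powr conj_exp p) \<le> ennreal ((CT * (M powr (1 / p - 1) / K)) powr conj_exp p)"
    using F by (simp add: Lp_bound_def)
   show "0 \<le> E * K * M powr (1 / p')" using K by (simp add: E_def)
  qed (use G H conj_exp(3)[OF p] p' alpha CT K in auto)
  also have "... \<le> ennreal (CT * E * measure \<mu> A powr \<alpha>)"
  proof (rule ennreal_leI)
   have "(CT * (M powr (1 / p - 1) / K)) * ((E * K * M powr (1 / p')) * measure \<mu> A powr \<alpha>)
    = CT * E * measure \<mu> A powr \<alpha> * (M powr (1 / p - 1) * M powr (1 - 1 / p))"
    using K by (simp add: p'(3))
   also have "... \<le> CT * E * measure \<mu> A powr \<alpha> * 1"
    using powr_cancel_le_1[OF M] CT(1) by (intro mult_left_mono) (auto simp: E_def)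
   finally show "(CT * (M powr (1 / p - 1) / K)) * ((E * K * M powr (1 / p')) * measure \<mu> A powr \<alpha>) \<le> CT * E * measure \<mu> A powr \<alpha>" by simp
  qed
  finally show "mass (A \<inter> ball c' (\<rho>\<^sub>1 * r')) (\<lambda>x. cmod (b x - m c r) * cmod (T a x)) \<le> ennreal (CT * E * measure \<mu> A powr \<alpha>)" .
 qed
qed

text \<open>Off a dilate of the support, \<open>dist x y\<close> and \<open>dist c x\<close> are
  comparable, hence so are the values of \<open>lam\<close>.\<close>

lemma T_off_ball:
 "\<exists>C\<ge>0. \<forall>c r a. 0 < r --> a \<in> Lp p --> (AE x in \<mu>. x \<notin> ball c r --> a x = 0) -->
  (AE x in \<mu>. \<rho>\<^sub>1 * r \<le> dist c x --> cmod (T a x) \<le> C * (\<integral>y. cmod (a y) \<partial>\<mu>) * lam c (dist c x) powr (\<alpha> - 1))"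
proof -
 obtain C where C: "0 \<le> C" "\<forall>x y. x \<noteq> y --> cmod (K x y) \<le> C * lam x (dist x y) powr (\<alpha> - 1)"
  using K_size by (elim exE conjE) (rule that)
 define \<eta> where "\<eta> = 1 - 1 / \<rho>\<^sub>1"
 have \<eta>: "0 < \<eta>" using rho1 by (simp add: \<eta>_def)
 define D where "D = Cl * dil (1 / \<eta>)"
 have D: "0 < D" using C_lam_ge_1 dil_ge_1[of "1 / \<eta>"] by (simp add: D_def)
 show ?thesis
 proof (intro exI[of _ "C * D powr (1 - \<alpha>)"] conjI allI impI)
  show "0 \<le> C * D powr (1 - \<alpha>)" using C(1) by simp
  fix c :: 'a and r :: real and a
  assume r: "0 < r" and a: "a \<in> Lp p" and supp: "AE x in \<mu>. x \<notin> ball c r --> a x = 0"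
  have [measurable]: "bmeas a" using a by (simp add: Lp_space_def)
  have ai: "integrable \<mu> a"
   by (rule integrable_of_Lp_finite_support[OF a _ _ _ supp]) (use admissible_pos(2)[OF p] emeasure_ball_finite in auto)
  have supp': "AE x in \<mu>. x \<notin> cball c r --> a x = 0" using supp by eventually_elim auto
  show "AE x in \<mu>. \<rho>\<^sub>1 * r \<le> dist c x --> cmod (T a x) \<le> C * D powr (1 - \<alpha>) * (\<integral>y. cmod (a y) \<partial>\<mu>) * lam c (dist c x) powr (\<alpha> - 1)"
   using T_kernel_Lp[OF p a supp']
  proof eventually_elim
   case (elim x)
   show ?case
   proof
    assume x: "\<rho>\<^sub>1 * r \<le> dist c x"
    define e where "e = dist c x"
    have "1 * r < \<rho>\<^sub>1 * r" using rho1 r by (intro mult_strict_right_mono) auto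
    then have "r < e" using x unfolding e_def by linarith
    then have xr: "x \<notin> cball c r" "0 < e" using r by (auto simp: e_def)
    define W where "W = C * D powr (1 - \<alpha>) * lam c e powr (\<alpha> - 1)"
    have W0: "0 \<le> W" using C(1) by (simp add: W_def)
    have kb: "cmod (K0 x y) \<le> W" if y: "y \<in> ball c r" for y
    proof (cases "x = y")
     case False
     have "r \<le> e / \<rho>\<^sub>1" using x rho1 by (simp add: e_def field_simps)
     then have ye: "\<eta> * e \<le> dist x y"
      using y dist_triangle[of c x y] by (simp add: \<eta>_def e_def algebra_simps dist_commute)
     have pos: "0 < \<eta> * e" using \<eta> xr by simp
     have "lam c e \<le> Cl * lam x e" using xr by (intro lam_center) (auto simp: e_def)
     also have "lam x e \<le> dil (1 / \<eta>) * lam x (\<eta> * e)"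
      using lam_dilate[OF pos, of "1 / \<eta>" x] \<eta> by simp
     also have "lam x (\<eta> * e) \<le> lam x (dist x y)" using pos ye by (intro lam_mono)
     finally have "lam c e \<le> D * lam x (dist x y)"
      using C_lam_ge_1 dil_ge_1[of "1 / \<eta>"] by (simp add: D_def mult.assoc mult_left_mono)
     then have "lam x (dist x y) powr (\<alpha> - 1) \<le> D powr (1 - \<alpha>) * lam c e powr (\<alpha> - 1)"
      using xr pos ye D False by (intro lam_powr_center) auto
     then have "C * lam x (dist x y) powr (\<alpha> - 1) \<le> W"
      using C(1) by (simp add: W_def mult.assoc mult_left_mono)
     then show ?thesis using C(2) False by (force simp: K0_def intro: order_trans)
    qed (use W0 in \<open>simp add: K0_def\<close>)
    have "T a x = (\<integral>y. K0 x y * a y \<partial>\<mu>)" "integrable \<mu> (\<lambda>y. K0 x y * a y)" using elim xr by auto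
    then have "cmod (T a x) \<le> (\<integral>y. cmod (K0 x y * a y) \<partial>\<mu>)" by simp
    also have "... \<le> (\<integral>y. W * cmod (a y) \<partial>\<mu>)"
    proof (rule integral_mono_AE)
     show "AE y in \<mu>. cmod (K0 x y * a y) \<le> W * cmod (a y)"
      using supp
     proof eventually_elim
      case (elim y)
      then show ?case using kb[of y] by (cases "y \<in> ball c r") (auto simp: norm_mult intro: mult_right_mono)
     qed
    qed (use \<open>integrable \<mu> (\<lambda>y. K0 x y * a y)\<close> ai in auto)
    finally show "cmod (T a x) \<le> C * D powr (1 - \<alpha>) * (\<integral>y. cmod (a y) \<partial>\<mu>) * lam c (dist c x) powr (\<alpha> - 1)"
     by (simp add: W_def e_def mult_ac)
   qed
  qed
 qed
qed

text \<open>Sum over shells around the centre of the atom. Splitting off the mean at the scale of the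
  shell, the oscillation part is handled by \<open>shell_bound\<close>, whose weights sum to at most
  the coefficient \<open>K\<close> by \<open>sum_theta_le_K_tilde\<close>; the differences of means are
  \<open>O(K)\<close> as well. The \<open>L\<^sup>1\<close> norm of the atom is \<open>1 /
  K\<close>.\<close>

lemma atom_mid:
 assumes \<kappa>: "1 \<le> \<kappa>"
 shows "\<exists>C\<ge>0. \<forall>b m. regular_means b m --> (\<forall>c' r' c r a A. atom_on c' r' c r a --> A \<in> sets \<mu> --> emeasure \<mu> A < \<infinity> -->
  (mass (A \<inter> ball c (\<kappa> * r) \<inter> {x. \<rho>\<^sub>1 * r' \<le> dist c' x}) (\<lambda>x. cmod (b x - m c r) * cmod (T a x))) \<le> ennreal (C * measure \<mu> A powr \<alpha>))"
proof -
 obtain C2 where C2: "0 \<le> C2" "\<forall>b m. regular_means b m --> (\<forall>c r c1 r1. 0 < r --> 0 < r1 -->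
  ball c r \<subseteq> ball c1 r1 --> cmod (m c r - m c1 r1) \<le> C2 * K_tilde \<mu> lam \<rho> c r r1)"
  using means_nested[OF rho] by (elim exE conjE) (rule that)
 obtain C3 where C3: "0 \<le> C3" "\<forall>b m. regular_means b m --> (\<forall>c r c1 r1. 0 < r --> 0 < r1 -->
  ball c r \<subseteq> ball c1 r1 --> r1 \<le> \<rho>\<^sub>1 * r --> cmod (m c r - m c1 r1) \<le> C3)"
  using means_comparable[OF less_imp_le[OF rho1(1)]] by (elim exE conjE) (rule that)
 obtain CG where CG: "0 \<le> CG" "\<forall>b m. regular_means b m --> (\<forall>c r n. 0 < r -->
  cmod (m c r - m c (\<rho> ^ n * r)) \<le> CG * (1 + (\<Sum>i\<le>n. theta c (\<rho> ^ i * r))))"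
  using means_chain[OF rho] by (elim exE conjE) (rule that)
 define A\<^sub>0 where "A\<^sub>0 = \<rho> ^ 3 * (\<kappa> + 1)"
 have A0: "0 < A\<^sub>0" using rho \<kappa> by (simp add: A\<^sub>0_def)
 obtain DK where DK: "1 \<le> DK" "\<forall>c r s n. 0 < r --> 0 < s --> \<rho> ^ n * r \<le> A\<^sub>0 * max r s -->
     (\<Sum>k\<le>n. theta c (\<rho> ^ k * r)) \<le> DK * K_tilde \<mu> lam \<rho> c r s"
  using sum_theta_le_K_tilde[OF rho A0] by (elim exE conjE) (rule that)
 obtain CS where CS: "0 \<le> CS" "\<forall>b m. regular_means b m --> (\<forall>c u w V A. 0 < u --> (\<forall>k. 0 \<le> w k) --> 0 \<le> V -->
  (\<forall>n. (\<Sum>k<n. w k powr q\<^sub>0 * vol c (\<rho> ^ (k + 2) * u)) \<le> V) --> A \<in> sets \<mu> --> emeasure \<mu> A < \<infinity> -->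
  (mass (A \<inter> {x. u \<le> dist c x}) (\<lambda>x. cmod (b x - m c (\<rho> ^ (shell_index \<rho> u c x + 1) * u)) * w (shell_index \<rho> u c x)))
   \<le> ennreal ((CS * V) powr (1 - \<alpha>) * measure \<mu> A powr \<alpha>))"
  using shell_bound[OF rho] by (elim exE conjE) (rule that)
 obtain C5 where C5: "0 \<le> C5" "\<forall>c r a. 0 < r --> a \<in> Lp p --> (AE x in \<mu>. x \<notin> ball c r --> a x = 0) -->
  (AE x in \<mu>. \<rho>\<^sub>1 * r \<le> dist c x --> cmod (T a x) \<le> C5 * (\<integral>y. cmod (a y) \<partial>\<mu>) * lam c (dist c x) powr (\<alpha> - 1))"
  using T_off_ball by (elim exE conjE) (rule that)
 obtain cw where cw: "0 < cw" "\<forall>y. \<forall>A\<in>sets \<mu>. emeasure \<mu> A < \<infinity> -->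
  (mass (A - {y}) (\<lambda>x. lam y (dist y x) powr (\<alpha> - 1))) \<le> ennreal (cw * measure \<mu> A powr \<alpha>)"
  using fractional_kernel_weak_bound[OF alpha] by (elim exE conjE) (rule that)
 define d where "d = C3 + CG + CG * DK + C2"
 have d: "0 \<le> d" using C2 C3 CG DK by (simp add: d_def)
 define W where "W = dil (\<rho>\<^sup>2) * dil \<rho> * DK"
 have W: "0 \<le> W" using dil_ge_1[of \<rho>] dil_ge_1[of "\<rho>\<^sup>2"] DK(1) by (simp add: W_def)
 show ?thesis
 proof (intro exI[of _ "C5 * (CS * W) powr (1 - \<alpha>) + C5 * d * cw"] conjI allI impI)
  show "0 \<le> C5 * (CS * W) powr (1 - \<alpha>) + C5 * d * cw" using C5 d cw by simp
  fix b :: "'a => complex" and m :: "'a => real => complex" and c' c :: 'a and r' r :: real and a A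
  assume rm: "regular_means b m" and a: "atom_on c' r' c r a" and A[measurable]: "A \<in> sets \<mu>" and fin: "emeasure \<mu> A < \<infinity>"
  note D = atom_onD[OF a]
  have Tm: "T a \<in> borel_measurable \<mu>" by (rule T_measurable[OF p D(6)])
  note [measurable] = regular_means_measurable[OF rm] D(7) Tm
  define K where "K = K_tilde \<mu> lam \<rho> c' r' r"
  have K: "1 \<le> K" using D(8) by (simp add: K_def)
  define u where "u = \<rho>\<^sub>1 * r'"
  have u: "0 < u" "r' \<le> u" "u \<le> \<rho> * r'" using rho1 D(1) by (auto simp: u_def)
  define k where "k = shell_index \<rho> u c'"
  have [measurable]: "k \<in> measurable \<mu> (count_space UNIV)" unfolding k_def by measurable
  define ok where "ok i \<longleftrightarrow> \<rho> ^ i * u \<le> (\<kappa> + 1) * r" for i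
  define w where "w i = (if ok i then lam c' (\<rho> ^ i * u) powr (\<alpha> - 1) else 0)" for i
  have sumtheta: "(\<Sum>j\<le>n + 3. theta c' (\<rho> ^ j * r')) \<le> DK * K" if n: "ok n" for n
  proof -
   have "\<rho> ^ n * r' \<le> (\<kappa> + 1) * r" using n u rho by (simp add: ok_def) (smt (verit) mult_left_mono zero_less_power)
   then have "\<rho> ^ 3 * (\<rho> ^ n * r') \<le> \<rho> ^ 3 * ((\<kappa> + 1) * r)" using rho by (intro mult_left_mono) auto
   also have "... = A\<^sub>0 * r" by (simp add: A\<^sub>0_def)
   also have "... \<le> A\<^sub>0 * max r' r" using A0 by (intro mult_left_mono) auto
   finally have "\<rho> ^ (n + 3) * r' \<le> A\<^sub>0 * max r' r" by (simp add: power_add mult_ac)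
   then show ?thesis unfolding K_def by (rule DK(2)[rule_format, OF D(1,2)])
  qed
  have theta0: "0 \<le> theta c' (\<rho> ^ j * r')" for j using rho D(1) by (intro theta_nonneg) auto
  have sumV: "(\<Sum>i<n. w i powr q\<^sub>0 * vol c' (\<rho> ^ (i + 2) * u)) \<le> W * K" for n
  proof (cases "\<exists>i<n. ok i")
   case False
   then have "(\<Sum>i<n. w i powr q\<^sub>0 * vol c' (\<rho> ^ (i + 2) * u)) = 0"
    by (intro sum.neutral) (auto simp: w_def)
   then show ?thesis using W K by simp
  next
   case True
   define I where "I = {i. i < n \<and> ok i}"
   have I: "finite I" "I \<noteq> {}" using True by (auto simp: I_def)
   have MaxI: "ok (Max I)" using Max_in[OF I] by (simp add: I_def)
   have "(\<Sum>i<n. w i powr q\<^sub>0 * vol c' (\<rho> ^ (i + 2) * u)) = (\<Sum>i\<in>I. w i powr q\<^sub>0 * vol c' (\<rho> ^ (i + 2) * u))"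
    by (intro sum.mono_neutral_right) (auto simp: I_def w_def)
   also have "... \<le> (\<Sum>i\<in>I. dil (\<rho>\<^sup>2) * dil \<rho> * theta c' (\<rho> ^ (i + 3) * r'))"
   proof (rule sum_mono)
    fix i assume "i \<in> I"
    then have "w i = lam c' (\<rho> ^ i * u) powr (\<alpha> - 1)" by (simp add: w_def I_def)
    then have "w i powr q\<^sub>0 * vol c' (\<rho> ^ (i + 2) * u) \<le> dil (\<rho>\<^sup>2) * theta c' (\<rho> ^ (i + 2) * u)"
     using shell_weight[OF rho u(1)] by simp
    also have "theta c' (\<rho> ^ (i + 2) * u) \<le> dil \<rho> * theta c' (\<rho> ^ (i + 3) * r')"
    proof (rule theta_dilate)
     show "0 < \<rho> ^ (i + 2) * u" using rho u by simp
     have "\<rho> ^ (i + 2) * u \<le> \<rho> ^ (i + 2) * (\<rho> * r')" using rho u by (intro mult_left_mono) auto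
     then show "\<rho> ^ (i + 2) * u \<le> \<rho> ^ (i + 3) * r'" by (simp add: power_add mult_ac numeral_3_eq_3)
     have "\<rho> ^ (i + 3) * r' \<le> \<rho> ^ (i + 3) * u" using rho u by (intro mult_left_mono) auto
     then show "\<rho> ^ (i + 3) * r' \<le> \<rho> * (\<rho> ^ (i + 2) * u)" by (simp add: power_add mult_ac numeral_3_eq_3)
    qed
    finally show "w i powr q\<^sub>0 * vol c' (\<rho> ^ (i + 2) * u) \<le> dil (\<rho>\<^sup>2) * dil \<rho> * theta c' (\<rho> ^ (i + 3) * r')"
     using dil_ge_1[of "\<rho>\<^sup>2"] by (simp add: mult.assoc mult_left_mono)
   qed
   also have "... = dil (\<rho>\<^sup>2) * dil \<rho> * (\<Sum>i\<in>I. theta c' (\<rho> ^ (i + 3) * r'))" by (simp add: sum_distrib_left)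
   also have "(\<Sum>i\<in>I. theta c' (\<rho> ^ (i + 3) * r')) = (\<Sum>j\<in>(\<lambda>i. i + 3) ` I. theta c' (\<rho> ^ j * r'))"
    by (subst sum.reindex) (auto simp: inj_on_def)
   also have "dil (\<rho>\<^sup>2) * dil \<rho> * \<dots> \<le> dil (\<rho>\<^sup>2) * dil \<rho> * (\<Sum>j\<le>Max I + 3. theta c' (\<rho> ^ j * r'))"
    using dil_ge_1[of "\<rho>\<^sup>2"] dil_ge_1[of \<rho>] theta0 I by (intro mult_left_mono sum_mono2) auto
   also have "... \<le> dil (\<rho>\<^sup>2) * dil \<rho> * (DK * K)"
    using dil_ge_1[of "\<rho>\<^sup>2"] dil_ge_1[of \<rho>] by (intro mult_left_mono sumtheta[OF MaxI]) auto
   finally show ?thesis by (simp add: W_def mult.assoc)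
  qed
  have mk: "cmod (m c' (\<rho> ^ (i + 1) * u) - m c r) \<le> d * K" if i: "ok i" for i
  proof -
   have pos: "0 < \<rho> ^ (i + 1) * r'" "0 < \<rho> ^ (i + 1) * u" using rho D(1) u by auto
   have "cmod (m c' (\<rho> ^ (i + 1) * r') - m c' (\<rho> ^ (i + 1) * u)) \<le> C3"
    by (rule C3(2)[rule_format, OF rm pos]) (use rho u in \<open>auto simp: u_def intro!: subset_ball\<close>)
   moreover have "cmod (m c' r' - m c' (\<rho> ^ (i + 1) * r')) \<le> CG * (1 + DK * K)"
   proof -
    have "(\<Sum>j\<le>i + 1. theta c' (\<rho> ^ j * r')) \<le> (\<Sum>j\<le>i + 3. theta c' (\<rho> ^ j * r'))"
     using theta0 by (intro sum_mono2) auto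
    then have "CG * (1 + (\<Sum>j\<le>i + 1. theta c' (\<rho> ^ j * r'))) \<le> CG * (1 + DK * K)"
     using sumtheta[OF i] CG(1) by (intro mult_left_mono) auto
    then show ?thesis using CG(2)[rule_format, OF rm D(1), of c' "i + 1"] by simp
   qed
   moreover have "cmod (m c' r' - m c r) \<le> C2 * K"
    unfolding K_def by (rule C2(2)[rule_format, OF rm D(1-3)])
   moreover have "C3 * 1 \<le> C3 * K" "CG * 1 \<le> CG * K"
    by (fact mult_left_mono[OF K C3(1)], fact mult_left_mono[OF K CG(1)])
   moreover have "cmod (m c' (\<rho> ^ (i + 1) * u) - m c r) \<le>
     cmod (m c' (\<rho> ^ (i + 1) * r') - m c' (\<rho> ^ (i + 1) * u)) + cmod (m c' r' - m c' (\<rho> ^ (i + 1) * r')) + cmod (m c' r' - m c r)"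
    using norm_triangle_ineq4[of "m c' r' - m c r" "(m c' r' - m c' (\<rho> ^ (i + 1) * r')) + (m c' (\<rho> ^ (i + 1) * r') - m c' (\<rho> ^ (i + 1) * u))"]
     norm_triangle_ineq[of "m c' r' - m c' (\<rho> ^ (i + 1) * r')" "m c' (\<rho> ^ (i + 1) * r') - m c' (\<rho> ^ (i + 1) * u)"] by simp
   ultimately show ?thesis by (simp add: d_def algebra_simps)
  qed
  define g1 where "g1 x = ennreal (cmod (b x - m c' (\<rho> ^ (k x + 1) * u)) * w (k x)) * indicator (A \<inter> {x. u \<le> dist c' x}) x" for x
  define g2 where "g2 x = ennreal (lam c' (dist c' x) powr (\<alpha> - 1)) * indicator (A - {c'}) x" for x
  have wm: "bmeas (\<lambda>x. w (k x))" by measurable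
  have g1m[measurable]: "bmeas g1"
  proof -
   have "bmeas (\<lambda>x. cmod (b x - m c' (\<rho> ^ (i + 1) * u)))" for i by measurable
   then have "bmeas (\<lambda>x. cmod (b x - m c' (\<rho> ^ (k x + 1) * u)))"
    by (rule measurable_compose_countable) measurable
   then show ?thesis using wm unfolding g1_def by measurable
  qed
  have g2m[measurable]: "bmeas g2" unfolding g2_def by measurable
  have "mass (A \<inter> ball c (\<kappa> * r) \<inter> {x. \<rho>\<^sub>1 * r' \<le> dist c' x}) (\<lambda>x. cmod (b x - m c r) * cmod (T a x))
   \<le> (\<integral>\<^sup>+x. ennreal (C5 / K) * g1 x + ennreal (C5 * d) * g2 x \<partial>\<mu>)"
  proof (rule nn_integral_mono_AE)
   have "AE x in \<mu>. \<rho>\<^sub>1 * r' \<le> dist c' x --> cmod (T a x) \<le> C5 * (\<integral>y. cmod (a y) \<partial>\<mu>) * lam c' (dist c' x) powr (\<alpha> - 1)"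
    by (rule C5(2)[rule_format, OF D(1,6,4)])
   then show "AE x in \<mu>. ennreal (cmod (b x - m c r) * cmod (T a x)) * indicator (A \<inter> ball c (\<kappa> * r) \<inter> {x. \<rho>\<^sub>1 * r' \<le> dist c' x}) x
    \<le> ennreal (C5 / K) * g1 x + ennreal (C5 * d) * g2 x"
   proof eventually_elim
    case (elim x)
    show ?case
    proof (cases "x \<in> A \<inter> ball c (\<kappa> * r) \<inter> {x. \<rho>\<^sub>1 * r' \<le> dist c' x}")
     case True
     then have x: "x \<in> A" "dist c x < \<kappa> * r" "u \<le> dist c' x" by (auto simp: u_def)
     have xc: "x \<noteq> c'" using x u by auto
     define l where "l = lam c' (dist c' x) powr (\<alpha> - 1)"
     have si: "\<rho> ^ k x * u \<le> dist c' x" using shell_index(1)[OF rho u(1) x(3)] by (simp add: k_def)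
     have "dist c' x \<le> (\<kappa> + 1) * r" using x(2) D(9) dist_triangle[of c' x c] by (simp add: dist_commute algebra_simps)
     then have okx: "ok (k x)" using si by (simp add: ok_def)
     have "lam c' (\<rho> ^ k x * u) \<le> lam c' (dist c' x)" using si rho u by (intro lam_mono) auto
     then have lw: "l \<le> w (k x)" unfolding l_def w_def using okx alpha lam_pos[of "\<rho> ^ k x * u" c'] rho u
      by (auto intro!: powr_mono2')
     have "cmod (T a x) \<le> C5 * (\<integral>y. cmod (a y) \<partial>\<mu>) * l" using elim x by (simp add: l_def u_def)
     also have "... \<le> C5 * (1 / K) * l"
      using atom_L1(2)[OF a] C5(1) unfolding K_def by (intro mult_right_mono mult_left_mono) (auto simp: l_def)
     finally have Ta: "cmod (T a x) \<le> C5 / K * l" by simp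
     define X where "X = cmod (b x - m c' (\<rho> ^ (k x + 1) * u))"
     have "cmod (b x - m c r) \<le> X + d * K"
      unfolding X_def using norm_triangle_ineq[of "b x - m c' (\<rho> ^ (k x + 1) * u)" "m c' (\<rho> ^ (k x + 1) * u) - m c r"] mk[OF okx] by simp
     then have "cmod (b x - m c r) * cmod (T a x) \<le> (X + d * K) * (C5 / K * l)"
      using Ta d K by (intro mult_mono) (auto simp: X_def)
     also have "... = C5 / K * (X * l) + C5 * d * l" using K by (simp add: field_simps)
     also have "... \<le> C5 / K * (X * w (k x)) + C5 * d * l"
      using lw C5(1) K by (intro add_right_mono mult_left_mono) (auto simp: X_def)
     finally have "cmod (b x - m c r) * cmod (T a x) \<le> C5 / K * (X * w (k x)) + C5 * d * l" .
     then have "ennreal (cmod (b x - m c r) * cmod (T a x)) \<le> ennreal (C5 / K) * ennreal (X * w (k x)) + ennreal (C5 * d) * ennreal l"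
      using C5(1) K d by (simp add: ennreal_leI ennreal_mult[symmetric] ennreal_plus[symmetric] X_def w_def l_def del: ennreal_plus)
     then show ?thesis using True x xc by (simp add: g1_def g2_def X_def l_def)
    qed simp
   qed
  qed
  also have "... = ennreal (C5 / K) * (\<integral>\<^sup>+x. g1 x \<partial>\<mu>) + ennreal (C5 * d) * (\<integral>\<^sup>+x. g2 x \<partial>\<mu>)"
   by (subst nn_integral_add) (auto simp: nn_integral_cmult)
  also have "... \<le> ennreal (C5 / K) * ennreal ((CS * (W * K)) powr (1 - \<alpha>) * measure \<mu> A powr \<alpha>) + ennreal (C5 * d) * ennreal (cw * measure \<mu> A powr \<alpha>)"
  proof (intro add_mono mult_left_mono)
   show "(\<integral>\<^sup>+x. g1 x \<partial>\<mu>) \<le> ennreal ((CS * (W * K)) powr (1 - \<alpha>) * measure \<mu> A powr \<alpha>)"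
    unfolding g1_def k_def
    by (rule CS(2)[rule_format, OF rm u(1)]) (use sumV W K A fin in \<open>auto simp: w_def\<close>)
   show "(\<integral>\<^sup>+x. g2 x \<partial>\<mu>) \<le> ennreal (cw * measure \<mu> A powr \<alpha>)"
    unfolding g2_def using cw(2) A fin by blast
  qed auto
  also have "... \<le> ennreal ((C5 * (CS * W) powr (1 - \<alpha>) + C5 * d * cw) * measure \<mu> A powr \<alpha>)"
  proof -
   have "K powr (1 - \<alpha>) \<le> K powr 1" using K alpha by (intro powr_mono) auto
   then have Kle: "K powr (1 - \<alpha>) / K \<le> 1" using K by simp
   have "C5 / K * ((CS * (W * K)) powr (1 - \<alpha>) * measure \<mu> A powr \<alpha>) = C5 * (CS * W) powr (1 - \<alpha>) * measure \<mu> A powr \<alpha> * (K powr (1 - \<alpha>) / K)"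
    using CS(1) W K by (simp add: powr_mult mult.assoc[symmetric])
   also have "... \<le> C5 * (CS * W) powr (1 - \<alpha>) * measure \<mu> A powr \<alpha> * 1"
    using Kle C5(1) by (intro mult_left_mono) auto
   finally have 1: "C5 / K * ((CS * (W * K)) powr (1 - \<alpha>) * measure \<mu> A powr \<alpha>) \<le> C5 * (CS * W) powr (1 - \<alpha>) * measure \<mu> A powr \<alpha>" by simp
   have "ennreal (C5 / K) * ennreal ((CS * (W * K)) powr (1 - \<alpha>) * measure \<mu> A powr \<alpha>) + ennreal (C5 * d) * ennreal (cw * measure \<mu> A powr \<alpha>)
    = ennreal (C5 / K * ((CS * (W * K)) powr (1 - \<alpha>) * measure \<mu> A powr \<alpha>) + C5 * d * (cw * measure \<mu> A powr \<alpha>))"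
    using C5(1) K d cw(1) by (simp add: ennreal_mult[symmetric] ennreal_plus[symmetric] del: ennreal_plus)
   also have "... \<le> ennreal ((C5 * (CS * W) powr (1 - \<alpha>) + C5 * d * cw) * measure \<mu> A powr \<alpha>)"
    using 1 by (intro ennreal_leI) (simp add: algebra_simps)
   finally show ?thesis .
  qed
  finally show "mass (A \<inter> ball c (\<kappa> * r) \<inter> {x. \<rho>\<^sub>1 * r' \<le> dist c' x}) (\<lambda>x. cmod (b x - m c r) * cmod (T a x))
   \<le> ennreal ((C5 * (CS * W) powr (1 - \<alpha>) + C5 * d * cw) * measure \<mu> A powr \<alpha>)" .
 qed
qed

lemma times_geometric_bounded:
 fixes z :: real
 assumes "0 < z" "z < 1"
 shows "\<exists>B\<ge>0. \<forall>k. real (k + 1) * z ^ k \<le> B"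
proof -
 have "(\<lambda>n. real n * z ^ n) \<longlonglongrightarrow> 0" using powser_times_n_limit_0[of z] assms by simp
 then have "Bseq (\<lambda>n. real n * z ^ n)" by (intro convergent_imp_Bseq convergentI)
 then obtain B where B: "0 < B" "\<forall>n. norm (real n * z ^ n) \<le> B" by (auto simp: Bseq_def)
 show ?thesis
 proof (intro exI[of _ "B + 1"] conjI allI)
  fix k
  have "z ^ k \<le> 1" using assms by (intro power_le_one) auto
  moreover have "real k * z ^ k \<le> B" using B(2) spec[OF B(2), of k] assms by (simp add: abs_mult)
  ultimately show "real (k + 1) * z ^ k \<le> B + 1" by (simp add: algebra_simps)
 qed (use B in simp)
qed

text \<open>The integral of \<open>h\<close> vanishes, so the kernel may be replaced by its increment
  between a point of the ball and the centre. The gain \<open>(r / dist c x)\<close> to the power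
  \<open>\<delta>\<close> decays geometrically over the shells and beats the linear growth of the
  differences of means.\<close>

lemma block_far:
 "\<exists>\<kappa>\<ge>1. \<exists>C\<ge>0. \<forall>b m. regular_means b m --> (\<forall>c r h A. 0 < r --> h \<in> Lp p -->
  (AE x in \<mu>. x \<notin> ball c r --> h x = 0) --> integral\<^sup>L \<mu> h = 0 --> A \<in> sets \<mu> --> emeasure \<mu> A < \<infinity> -->
  (mass (A \<inter> {x. \<kappa> * r \<le> dist c x}) (\<lambda>x. cmod (b x - m c r) * cmod (T h x)))
   \<le> ennreal (C * (\<integral>x. cmod (h x) \<partial>\<mu>) * measure \<mu> A powr \<alpha>))"
proof -
 obtain CK \<delta> cK where CK: "0 < CK" "0 < \<delta>" "\<delta> \<le> 1" "0 < cK"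
  "\<forall>x x' y. x \<noteq> y --> x' \<noteq> y --> dist x y \<ge> cK * dist x x' -->
     cmod (K x y - K x' y) + cmod (K y x - K y x')
      \<le> CK * (dist x x' powr \<delta> / (dist x y powr \<delta> * lam x (dist x y) powr (1 - \<alpha>)))"
  by (rule kernel_constants)
 define \<kappa> where "\<kappa> = max 2 cK"
 have \<kappa>: "2 \<le> \<kappa>" "cK \<le> \<kappa>" by (auto simp: \<kappa>_def)
 have k1: "1 \<le> \<kappa>" using \<kappa> by simp
 define z where "z = 2 powr (- \<delta>)"
 have z: "0 < z" "z < 1" using CK powr_less_mono[of "- \<delta>" 0 2] by (auto simp: z_def)
 obtain B where B: "0 \<le> B" "\<And>k. real (k + 1) * z ^ k \<le> B" using times_geometric_bounded[OF z] by blast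
 have two: "1 < (2::real)" by simp
 obtain C1 where C1: "0 \<le> C1" "\<forall>b m. regular_means b m --> (\<forall>c r c1 r1. 0 < r --> 0 < r1 -->
  ball c r \<subseteq> ball c1 r1 --> r1 \<le> \<kappa> * r --> cmod (m c r - m c1 r1) \<le> C1)"
  using means_comparable[OF k1] by (elim exE conjE) (rule that)
 obtain CG where CG: "0 \<le> CG" "\<forall>b m. regular_means b m --> (\<forall>c r n. 0 < r -->
  cmod (m c r - m c (2 ^ n * r)) \<le> CG * (1 + (\<Sum>i\<le>n. theta c (2 ^ i * r))))"
  using means_chain[OF two] by (elim exE conjE) (rule that)
 obtain CS where CS: "0 \<le> CS" "\<forall>b m. regular_means b m --> (\<forall>c u w V A. 0 < u --> (\<forall>k. 0 \<le> w k) --> 0 \<le> V -->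
  (\<forall>n. (\<Sum>k<n. w k powr q\<^sub>0 * vol c (2 ^ (k + 2) * u)) \<le> V) --> A \<in> sets \<mu> --> emeasure \<mu> A < \<infinity> -->
  (mass (A \<inter> {x. u \<le> dist c x}) (\<lambda>x. cmod (b x - m c (2 ^ (shell_index 2 u c x + 1) * u)) * w (shell_index 2 u c x)))
   \<le> ennreal ((CS * V) powr (1 - \<alpha>) * measure \<mu> A powr \<alpha>))"
  using shell_bound[OF two] by (elim exE conjE) (rule that)
 obtain cw where cw: "0 < cw" "\<forall>y. \<forall>A\<in>sets \<mu>. emeasure \<mu> A < \<infinity> -->
  (mass (A - {y}) (\<lambda>x. lam y (dist y x) powr (\<alpha> - 1))) \<le> ennreal (cw * measure \<mu> A powr \<alpha>)"
  using fractional_kernel_weak_bound[OF alpha] by (elim exE conjE) (rule that)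
 define V where "V = dil (2\<^sup>2) / (1 - z)"
 have V: "0 \<le> V" using z dil_ge_1[of "2\<^sup>2"] by (simp add: V_def)
 define d where "d = C1 + 3 * CG"
 have d: "0 \<le> d" using C1 CG by (simp add: d_def)
 show ?thesis
 proof (rule exI[of _ \<kappa>], rule conjI[OF k1], rule exI[of _ "CK * ((CS * V) powr (1 - \<alpha>) + d * B * cw)"], intro conjI allI impI)
  show "0 \<le> CK * ((CS * V) powr (1 - \<alpha>) + d * B * cw)" using CK(1) d B(1) cw(1) by simp
  fix b :: "'a => complex" and m :: "'a => real => complex" and c :: 'a and r :: real and h A
  assume rm: "regular_means b m" and r: "0 < r" and h: "h \<in> Lp p"
   and supp: "AE x in \<mu>. x \<notin> ball c r --> h x = 0" and int0: "integral\<^sup>L \<mu> h = 0"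
   and A[measurable]: "A \<in> sets \<mu>" and fin: "emeasure \<mu> A < \<infinity>"
  have Tm: "T h \<in> borel_measurable \<mu>" by (rule T_measurable[OF p h])
  have hm: "bmeas h" using h by (simp add: Lp_space_def)
  note [measurable] = regular_means_measurable[OF rm] hm Tm
  have hi: "integrable \<mu> h"
   by (rule integrable_of_Lp_finite_support[OF h _ _ _ supp]) (use admissible_pos(2)[OF p] emeasure_ball_finite in auto)
  define H where "H = (\<integral>x. cmod (h x) \<partial>\<mu>)"
  have H: "0 \<le> H" by (simp add: H_def)
  define u where "u = \<kappa> * r"
  have u: "0 < u" "r \<le> u" "r < u" using \<kappa> r by (auto simp: u_def intro!: mult_right_mono)
  have supp': "AE x in \<mu>. x \<notin> cball c r --> h x = 0" using supp by eventually_elim auto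
  \<comment> \<open>Since \<open>h\<close> has integral zero, \<open>K0 x c\<close> may be subtracted
    from the kernel.\<close>
  have Th: "AE x in \<mu>. u \<le> dist c x --> cmod (T h x) \<le> CK * H * ((r / dist c x) powr \<delta> * lam c (dist c x) powr (\<alpha> - 1))"
   using T_kernel_Lp[OF p h supp']
  proof eventually_elim
   case (elim x)
   show ?case
   proof
    assume x: "u \<le> dist c x"
    define e where "e = dist c x"
    have e: "0 < e" "r < e" "u \<le> e" using x u by (auto simp: e_def)
    have xr: "x \<notin> cball c r" "x \<noteq> c" using e by (auto simp: e_def)
    define Y where "Y = CK * ((r / e) powr \<delta> * lam c e powr (\<alpha> - 1))"
    have ix: "integrable \<mu> (\<lambda>y. K0 x y * h y)" and Tx: "T h x = (\<integral>y. K0 x y * h y \<partial>\<mu>)" using elim xr by auto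
    have ic: "integrable \<mu> (\<lambda>y. K0 x c * h y)" using hi by simp
    have "T h x = (\<integral>y. K0 x y * h y \<partial>\<mu>) - (\<integral>y. K0 x c * h y \<partial>\<mu>)" using Tx int0 by simp
    also have "... = (\<integral>y. (K0 x y - K0 x c) * h y \<partial>\<mu>)"
     using ix ic by (subst Bochner_Integration.integral_diff[symmetric]) (auto simp: algebra_simps)
    finally have "cmod (T h x) \<le> (\<integral>y. cmod ((K0 x y - K0 x c) * h y) \<partial>\<mu>)" by simp
    also have "... \<le> (\<integral>y. Y * cmod (h y) \<partial>\<mu>)"
    proof (rule integral_mono_AE)
     have "integrable \<mu> (\<lambda>y. K0 x y * h y - K0 x c * h y)" using ix ic by (rule Bochner_Integration.integrable_diff)
     then have "integrable \<mu> (\<lambda>y. (K0 x y - K0 x c) * h y)" by (simp add: algebra_simps)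
     then show "integrable \<mu> (\<lambda>y. cmod ((K0 x y - K0 x c) * h y))" by (rule integrable_norm)
     show "integrable \<mu> (\<lambda>y. Y * cmod (h y))" using hi by simp
     show "AE y in \<mu>. cmod ((K0 x y - K0 x c) * h y) \<le> Y * cmod (h y)"
      using supp
     proof eventually_elim
      case (elim y)
      show ?case
      proof (cases "y \<in> ball c r")
       case True
       then have y: "dist c y < r" by simp
       have yx: "y \<noteq> x" using y e by (auto simp: e_def)
       have "cK * dist c y \<le> \<kappa> * r" using y \<kappa> CK(4) by (intro mult_mono) auto
       also have "... \<le> dist c x" using x by (simp add: u_def)
       finally have "cmod (K c x - K y x) + cmod (K x c - K x y) \<le> CK * (dist c y powr \<delta> / (dist c x powr \<delta> * lam c (dist c x) powr (1 - \<alpha>)))"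
        by (rule CK(5)[rule_format, OF not_sym[OF xr(2)] yx])
       then have "cmod (K x y - K x c) \<le> CK * (dist c y powr \<delta> / (e powr \<delta> * lam c e powr (1 - \<alpha>)))"
        by (simp add: e_def norm_minus_commute) (smt (verit) norm_ge_zero)
       also have "... \<le> CK * (r powr \<delta> / (e powr \<delta> * lam c e powr (1 - \<alpha>)))"
        using y CK(1,2) by (intro mult_left_mono divide_right_mono powr_mono2) auto
       also have "... = Y"
        using e r powr_minus_divide[of "lam c e" "1 - \<alpha>"] by (simp add: Y_def powr_divide)
       finally have "cmod (K0 x y - K0 x c) \<le> Y" using yx xr by (simp add: K0_def)
       then show ?thesis by (simp add: norm_mult mult_right_mono)
      qed (use elim in simp)
     qed
    qed
    finally show "cmod (T h x) \<le> CK * H * ((r / dist c x) powr \<delta> * lam c (dist c x) powr (\<alpha> - 1))"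
     by (simp add: Y_def H_def e_def mult_ac)
   qed
  qed
  define k where "k = shell_index 2 u c"
  have [measurable]: "k \<in> measurable \<mu> (count_space UNIV)" unfolding k_def by measurable
  define w where "w i = z ^ i * lam c (2 ^ i * u) powr (\<alpha> - 1)" for i
  have sumV: "(\<Sum>i<n. w i powr q\<^sub>0 * vol c (2 ^ (i + 2) * u)) \<le> V" for n
  proof -
   have "w i powr q\<^sub>0 * vol c (2 ^ (i + 2) * u) \<le> dil (2\<^sup>2) * z ^ i" for i
   proof -
    have zi: "0 \<le> z ^ i" "z ^ i \<le> 1" using z by (auto intro: power_le_one)
    have "(z ^ i) powr q\<^sub>0 \<le> (z ^ i) powr 1" using zi q0(1) by (intro powr_mono') auto
    then have f1: "(z ^ i) powr q\<^sub>0 \<le> z ^ i" using zi by simp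
    have f2: "(lam c (2 ^ i * u) powr (\<alpha> - 1)) powr q\<^sub>0 * vol c (2 ^ (i + 2) * u) \<le> dil (2\<^sup>2) * 1"
    proof -
     have "theta c (2 ^ (i + 2) * u) \<le> 1" using u by (intro theta_le_1) simp
     then have "dil (2\<^sup>2) * theta c (2 ^ (i + 2) * u) \<le> dil (2\<^sup>2) * 1" using dil_ge_1[of "2\<^sup>2"] by (intro mult_left_mono) auto
     then show ?thesis using shell_weight[OF two u(1), of c i] by linarith
    qed
    have "(z ^ i) powr q\<^sub>0 * ((lam c (2 ^ i * u) powr (\<alpha> - 1)) powr q\<^sub>0 * vol c (2 ^ (i + 2) * u)) \<le> z ^ i * (dil (2\<^sup>2) * 1)"
     by (rule mult_mono[OF f1 f2 zi(1)]) (intro mult_nonneg_nonneg powr_ge_zero measure_nonneg)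
    then show ?thesis using zi by (simp add: w_def powr_mult mult_ac)
   qed
   then have "(\<Sum>i<n. w i powr q\<^sub>0 * vol c (2 ^ (i + 2) * u)) \<le> (\<Sum>i<n. dil (2\<^sup>2) * z ^ i)"
    by (intro sum_mono)
   also have "... = dil (2\<^sup>2) * ((1 - z ^ n) / (1 - z))" using z by (simp add: sum_distrib_left[symmetric] sum_gp_strict)
   also have "... \<le> V" unfolding V_def using z dil_ge_1[of "2\<^sup>2"]
    by (simp add: divide_right_mono mult_left_mono mult_le_cancel_left1)
   finally show ?thesis .
  qed
  \<comment> \<open>As \<open>theta \<le> 1\<close>, the means drift at most linearly in the number of
    shells.\<close>
  have mk: "cmod (m c (2 ^ (i + 1) * u) - m c r) \<le> d * real (i + 1)" for i
  proof -
   have "cmod (m c r - m c u) \<le> C1"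
    by (rule C1(2)[rule_format, OF rm r u(1)]) (use u in \<open>auto simp: u_def\<close>)
   moreover have "cmod (m c u - m c (2 ^ (i + 1) * u)) \<le> CG * (real i + 3)"
   proof -
    have "(\<Sum>j\<le>i + 1. theta c (2 ^ j * u)) \<le> real (card {..i + 1}) * 1"
     using u by (intro sum_bounded_above theta_le_1) auto
    then have "CG * (1 + (\<Sum>j\<le>i + 1. theta c (2 ^ j * u))) \<le> CG * (real i + 3)"
     using CG(1) by (intro mult_left_mono) auto
    then show ?thesis using CG(2)[rule_format, OF rm u(1), of c "i + 1"] by simp
   qed
   moreover have "cmod (m c (2 ^ (i + 1) * u) - m c r) \<le> cmod (m c r - m c u) + cmod (m c u - m c (2 ^ (i + 1) * u))"
    using norm_triangle_ineq[of "m c r - m c u" "m c u - m c (2 ^ (i + 1) * u)"] by (simp add: norm_minus_commute)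
   moreover have "0 \<le> C1 * real i" "0 \<le> CG * real i" using C1(1) CG(1) by auto
   ultimately show ?thesis by (simp add: d_def algebra_simps)
  qed
  define g1 where "g1 x = ennreal (cmod (b x - m c (2 ^ (k x + 1) * u)) * w (k x)) * indicator (A \<inter> {x. u \<le> dist c x}) x" for x
  define g2 where "g2 x = ennreal (lam c (dist c x) powr (\<alpha> - 1)) * indicator (A - {c}) x" for x
  have wm: "bmeas (\<lambda>x. w (k x))" by measurable
  have g1m[measurable]: "bmeas g1"
  proof -
   have "bmeas (\<lambda>x. cmod (b x - m c (2 ^ (i + 1) * u)))" for i by measurable
   then have "bmeas (\<lambda>x. cmod (b x - m c (2 ^ (k x + 1) * u)))"
    by (rule measurable_compose_countable) measurable
   then show ?thesis using wm unfolding g1_def by measurable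
  qed
  have g2m[measurable]: "bmeas g2" unfolding g2_def by measurable
  have "mass (A \<inter> {x. \<kappa> * r \<le> dist c x}) (\<lambda>x. cmod (b x - m c r) * cmod (T h x))
   \<le> (\<integral>\<^sup>+x. ennreal (CK * H) * g1 x + ennreal (CK * H * (d * B)) * g2 x \<partial>\<mu>)"
  proof (rule nn_integral_mono_AE)
   show "AE x in \<mu>. ennreal (cmod (b x - m c r) * cmod (T h x)) * indicator (A \<inter> {x. \<kappa> * r \<le> dist c x}) x
    \<le> ennreal (CK * H) * g1 x + ennreal (CK * H * (d * B)) * g2 x"
    using Th
   proof eventually_elim
    case (elim x)
    show ?case
    proof (cases "x \<in> A \<inter> {x. \<kappa> * r \<le> dist c x}")
     case True
     then have x: "x \<in> A" "u \<le> dist c x" by (auto simp: u_def)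
     have xc: "x \<noteq> c" "0 < dist c x" using x u by auto
     define l where "l = lam c (dist c x) powr (\<alpha> - 1)"
     have l0: "0 \<le> l" by (simp add: l_def)
     have si: "2 ^ k x * u \<le> dist c x" using shell_index(1)[OF two u(1) x(2)] by (simp add: k_def)
     have "lam c (2 ^ k x * u) \<le> lam c (dist c x)" using si u by (intro lam_mono) auto
     then have lw: "z ^ k x * l \<le> w (k x)" unfolding l_def w_def using alpha lam_pos[of "2 ^ k x * u" c] u z
      by (intro mult_left_mono powr_mono2') auto
     have "2 ^ k x * r \<le> dist c x" using si u(2) by (smt (verit) mult_left_mono zero_less_power)
     then have "r / dist c x \<le> (1 / 2) ^ k x" using xc by (simp add: field_simps power_divide)
     then have "(r / dist c x) powr \<delta> \<le> ((1 / 2) ^ k x) powr \<delta>" using r xc CK(2) by (intro powr_mono2) auto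
     also have "((1 / 2) ^ k x) powr \<delta> = z ^ k x"
     proof -
      have "((1 / 2) ^ k x) powr \<delta> = ((1 / 2) powr real (k x)) powr \<delta>" by (simp add: powr_realpow)
      also have "... = ((1 / 2) powr \<delta>) powr real (k x)" by (simp add: powr_powr mult.commute)
      also have "(1 / 2) powr \<delta> = z" by (simp add: z_def powr_divide powr_minus_divide)
      also have "z powr real (k x) = z ^ k x" using z by (simp add: powr_realpow)
      finally show ?thesis .
     qed
     finally have rz: "(r / dist c x) powr \<delta> \<le> z ^ k x" .
     have "cmod (T h x) \<le> CK * H * ((r / dist c x) powr \<delta> * l)" using elim x by (simp add: l_def)
     also have "... \<le> CK * H * (z ^ k x * l)"
      using rz CK(1) H l0 by (intro mult_left_mono mult_right_mono) auto
     finally have Tx: "cmod (T h x) \<le> CK * H * (z ^ k x * l)" .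
     define X where "X = cmod (b x - m c (2 ^ (k x + 1) * u))"
     have "cmod (b x - m c r) \<le> X + d * real (k x + 1)"
      unfolding X_def using norm_triangle_ineq[of "b x - m c (2 ^ (k x + 1) * u)" "m c (2 ^ (k x + 1) * u) - m c r"] mk[of "k x"] by simp
     then have "cmod (b x - m c r) * cmod (T h x) \<le> (X + d * real (k x + 1)) * (CK * H * (z ^ k x * l))"
      using Tx d by (intro mult_mono) (auto simp: X_def)
     also have "... = CK * H * (X * (z ^ k x * l)) + CK * H * (d * (real (k x + 1) * z ^ k x)) * l" by (simp add: algebra_simps)
     also have "... \<le> CK * H * (X * w (k x)) + CK * H * (d * B) * l"
      using lw B(2)[of "k x"] CK(1) H d l0 by (intro add_mono mult_left_mono mult_right_mono) (auto simp: X_def)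
     finally have "cmod (b x - m c r) * cmod (T h x) \<le> CK * H * (X * w (k x)) + CK * H * (d * B) * l" .
     then have "ennreal (cmod (b x - m c r) * cmod (T h x)) \<le> ennreal (CK * H) * ennreal (X * w (k x)) + ennreal (CK * H * (d * B)) * ennreal l"
      using CK(1) H d B(1) z by (simp add: ennreal_leI ennreal_mult[symmetric] ennreal_plus[symmetric] X_def w_def l_def del: ennreal_plus)
     then show ?thesis using True x xc by (simp add: g1_def g2_def X_def l_def)
    qed simp
   qed
  qed
  also have "... = ennreal (CK * H) * (\<integral>\<^sup>+x. g1 x \<partial>\<mu>) + ennreal (CK * H * (d * B)) * (\<integral>\<^sup>+x. g2 x \<partial>\<mu>)"
   by (subst nn_integral_add) (auto simp: nn_integral_cmult)
  also have "... \<le> ennreal (CK * H) * ennreal ((CS * V) powr (1 - \<alpha>) * measure \<mu> A powr \<alpha>) + ennreal (CK * H * (d * B)) * ennreal (cw * measure \<mu> A powr \<alpha>)"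
  proof (intro add_mono mult_left_mono)
   show "(\<integral>\<^sup>+x. g1 x \<partial>\<mu>) \<le> ennreal ((CS * V) powr (1 - \<alpha>) * measure \<mu> A powr \<alpha>)"
    unfolding g1_def k_def
    by (rule CS(2)[rule_format, OF rm u(1)]) (use sumV V A fin z in \<open>auto simp: w_def\<close>)
   show "(\<integral>\<^sup>+x. g2 x \<partial>\<mu>) \<le> ennreal (cw * measure \<mu> A powr \<alpha>)"
    unfolding g2_def using cw(2) A fin by blast
  qed auto
  also have "... = ennreal (CK * ((CS * V) powr (1 - \<alpha>) + d * B * cw) * H * measure \<mu> A powr \<alpha>)"
   using CK(1) H d B(1) cw(1) by (simp add: ennreal_mult[symmetric] ennreal_plus[symmetric] algebra_simps del: ennreal_plus)
  finally show "mass (A \<inter> {x. \<kappa> * r \<le> dist c x}) (\<lambda>x. cmod (b x - m c r) * cmod (T h x))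
   \<le> ennreal (CK * ((CS * V) powr (1 - \<alpha>) + d * B * cw) * (\<integral>x. cmod (h x) \<partial>\<mu>) * measure \<mu> A powr \<alpha>)" by (simp only: H_def)
 qed
qed

text \<open>The atomic blocks in terms of atoms with exponent \<open>p\<close>; the cost of the block
  is \<open>cmod l1 + cmod l2\<close>.\<close>

definition block :: "complex => complex => ('a => complex) => bool" where
 "block l1 l2 h \<longleftrightarrow> (\<exists>c r c1 r1 a1 c2 r2 a2. atom_on c1 r1 c r a1 \<and> atom_on c2 r2 c r a2 \<and>
  h \<in> borel_measurable \<mu> \<and> (AE x in \<mu>. h x = l1 * a1 x + l2 * a2 x) \<and> integral\<^sup>L \<mu> h = 0)"

text \<open>An exponent strictly between \<open>1\<close> and \<open>p\<close>, so that both a block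
  and its product with the symbol lie in the space with exponent \<open>p\<^sub>1\<close>.\<close>

definition p\<^sub>1 :: real where "p\<^sub>1 = (1 + p) / 2"

lemma p1: "1 < p\<^sub>1" "p\<^sub>1 < p" "admissible p\<^sub>1"
 using p by (auto simp: p\<^sub>1_def admissible_def)

lemma Lp_space_cong_AE:
 assumes "f \<in> Lp s" "bmeas g" "AE x in \<mu>. g x = f x" "0 < s"
 shows "g \<in> Lp s"
proof -
 have "tmass (\<lambda>x. cmod (g x) powr s) = tmass (\<lambda>x. cmod (f x) powr s)"
 proof (rule nn_integral_cong_AE)
  show "AE x in \<mu>. ennreal (cmod (g x) powr s) = ennreal (cmod (f x) powr s)"
   using assms(3) by eventually_elim simp
 qed
 then show ?thesis using assms by (simp add: Lp_space_iff)
qed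

lemma block_facts:
 assumes b: "atom_on c1 r1 c r a1" "atom_on c2 r2 c r a2" "bmeas h"
  "AE x in \<mu>. h x = l1 * a1 x + l2 * a2 x"
 shows "h \<in> Lp p" "AE x in \<mu>. x \<notin> ball c r --> h x = 0"
  "integrable \<mu> h" "(\<integral>x. cmod (h x) \<partial>\<mu>) \<le> cmod l1 + cmod l2"
  "AE x in \<mu>. T h x = l1 * T a1 x + l2 * T a2 x"
proof -
 note D1 = atom_onD[OF b(1)] and D2 = atom_onD[OF b(2)]
 have pp: "0 < p" by (rule admissible_pos(1)[OF p])
 have g: "(\<lambda>x. l1 * a1 x + l2 * a2 x) \<in> Lp p" by (rule Lp_space_add[OF pp D1(6) D2(6)])
 show hp: "h \<in> Lp p" by (rule Lp_space_cong_AE[OF g b(3,4) pp])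
 show supp: "AE x in \<mu>. x \<notin> ball c r --> h x = 0"
  using b(4) D1(4) D2(4)
 proof eventually_elim
  case (elim x)
  then show ?case using D1(3) D2(3) by (auto simp: subset_iff)
 qed
 show hi: "integrable \<mu> h"
  by (rule integrable_of_Lp_finite_support[OF hp _ _ _ supp]) (use admissible_pos(2)[OF p] emeasure_ball_finite in auto)
 have "(\<integral>x. cmod (h x) \<partial>\<mu>) \<le> (\<integral>x. cmod l1 * cmod (a1 x) + cmod l2 * cmod (a2 x) \<partial>\<mu>)"
 proof (rule integral_mono_AE)
  show "AE x in \<mu>. cmod (h x) \<le> cmod l1 * cmod (a1 x) + cmod l2 * cmod (a2 x)"
   using b(4)
  proof eventually_elim
   case (elim x)
   then show ?case using norm_triangle_ineq[of "l1 * a1 x" "l2 * a2 x"] by (simp add: norm_mult)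
  qed
 qed (use hi atom_L1(1)[OF b(1)] atom_L1(1)[OF b(2)] in auto)
 also have "... = cmod l1 * (\<integral>x. cmod (a1 x) \<partial>\<mu>) + cmod l2 * (\<integral>x. cmod (a2 x) \<partial>\<mu>)"
  using atom_L1(1)[OF b(1)] atom_L1(1)[OF b(2)] by simp
 also have "... \<le> cmod l1 * 1 + cmod l2 * 1"
 proof (intro add_mono mult_left_mono)
  show "(\<integral>x. cmod (a1 x) \<partial>\<mu>) \<le> 1"
   using atom_L1(2)[OF b(1)] D1(8) by (smt (verit) divide_le_eq_1_pos)
  show "(\<integral>x. cmod (a2 x) \<partial>\<mu>) \<le> 1"
   using atom_L1(2)[OF b(2)] D2(8) by (smt (verit) divide_le_eq_1_pos)
 qed auto
 finally show "(\<integral>x. cmod (h x) \<partial>\<mu>) \<le> cmod l1 + cmod l2" by simp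
 have "AE x in \<mu>. T h x = T (\<lambda>x. l1 * a1 x + l2 * a2 x) x" by (rule T_cong_AE[OF p hp g b(4)])
 moreover have "AE x in \<mu>. T (\<lambda>x. l1 * a1 x + l2 * a2 x) x = l1 * T a1 x + l2 * T a2 x"
  by (intro T_linear Lp_in_sum_space[OF p] D1(6) D2(6))
 ultimately show "AE x in \<mu>. T h x = l1 * T a1 x + l2 * T a2 x" by eventually_elim simp
qed

text \<open>The constant is uniform over all symbols with normalised means. This uniformity is what
  makes the norm of \<open>b\<close> appear linearly and what makes truncated symbols admissible with
  the same bound.\<close>

lemma block_weak_bound:
 "\<exists>C\<ge>0. \<forall>b m. regular_means b m --> (\<forall>l1 l2 h. block l1 l2 h -->
  weak (C * (cmod l1 + cmod l2)) (commutator b T h))"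
proof -
 obtain \<kappa> CF where \<kappa>: "1 \<le> \<kappa>" and CF: "0 \<le> CF" "\<forall>b m. regular_means b m --> (\<forall>c r h A. 0 < r --> h \<in> Lp p -->
  (AE x in \<mu>. x \<notin> ball c r --> h x = 0) --> integral\<^sup>L \<mu> h = 0 --> A \<in> sets \<mu> --> emeasure \<mu> A < \<infinity> -->
  (mass (A \<inter> {x. \<kappa> * r \<le> dist c x}) (\<lambda>x. cmod (b x - m c r) * cmod (T h x)))
   \<le> ennreal (CF * (\<integral>x. cmod (h x) \<partial>\<mu>) * measure \<mu> A powr \<alpha>))"
  using block_far by (elim exE conjE) (rule that)
 obtain CN where CN: "0 \<le> CN" "\<forall>b m. regular_means b m --> (\<forall>c' r' c r a A. atom_on c' r' c r a --> A \<in> sets \<mu> --> emeasure \<mu> A < \<infinity> -->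
  (mass (A \<inter> ball c' (\<rho>\<^sub>1 * r')) (\<lambda>x. cmod (b x - m c r) * cmod (T a x))) \<le> ennreal (CN * measure \<mu> A powr \<alpha>))"
  using atom_near by (elim exE conjE) (rule that)
 obtain CM where CM: "0 \<le> CM" "\<forall>b m. regular_means b m --> (\<forall>c' r' c r a A. atom_on c' r' c r a --> A \<in> sets \<mu> --> emeasure \<mu> A < \<infinity> -->
  (mass (A \<inter> ball c (\<kappa> * r) \<inter> {x. \<rho>\<^sub>1 * r' \<le> dist c' x}) (\<lambda>x. cmod (b x - m c r) * cmod (T a x))) \<le> ennreal (CM * measure \<mu> A powr \<alpha>))"
  using atom_mid[OF \<kappa>] by (elim exE conjE) (rule that)
 obtain CA where CA: "0 \<le> CA" "\<forall>b m. regular_means b m --> (\<forall>c' r' c r a. atom_on c' r' c r a -->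
  (tmass (\<lambda>x. cmod (b x - m c r) * cmod (a x))) \<le> ennreal CA)"
  using atom_times_oscillation by (elim exE conjE) (rule that)
 obtain CW where CW: "0 \<le> CW" "\<forall>p f. admissible p --> f \<in> Lp p --> integrable \<mu> f -->
  weak (CW * (\<integral>x. cmod (f x) \<partial>\<mu>)) (T f)"
  using T_weak_type by (elim exE conjE) (rule that)
 show ?thesis
 proof (intro exI[of _ "CN + CM + CF + CW * CA"] conjI allI impI)
  show "0 \<le> CN + CM + CF + CW * CA" using CN CM CF CW CA by simp
  fix b :: "'a => complex" and m :: "'a => real => complex" and l1 l2 h
  assume rm: "regular_means b m" and bl: "block l1 l2 h"
  obtain c r c1 r1 a1 c2 r2 a2 where a1: "atom_on c1 r1 c r a1" and a2: "atom_on c2 r2 c r a2"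
   and hm: "bmeas h" and heq: "AE x in \<mu>. h x = l1 * a1 x + l2 * a2 x" and int0: "integral\<^sup>L \<mu> h = 0"
   using bl unfolding block_def by (elim exE conjE) (rule that)
  note h = block_facts[OF a1 a2 hm heq]
  note D1 = atom_onD[OF a1] and D2 = atom_onD[OF a2]
  have bm: "bmeas b" by (rule regular_means_measurable[OF rm])
  have Tm: "T h \<in> borel_measurable \<mu>" "T a1 \<in> borel_measurable \<mu>" "T a2 \<in> borel_measurable \<mu>"
   using h(1) D1(6) D2(6) by (auto intro: T_measurable[OF p])
  note [measurable] = hm bm Tm
  define z where "z = m c r"
  define l where "l = cmod l1 + cmod l2"
  have l: "0 \<le> l" by (simp add: l_def)
  have bz: "(\<lambda>x. (b x - z) * h x) \<in> Lp p\<^sub>1" and hp1: "h \<in> Lp p\<^sub>1"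
   by (fact times_b_Lp(2)[OF rm h(1,2) D1(2) p1(1,2)], fact times_b_Lp(1)[OF rm h(1,2) D1(2) p1(1,2)])
  have b0': "(\<lambda>x. b x * h x) \<in> Lp p\<^sub>1"
   using times_b_Lp(2)[OF rm h(1,2) D1(2) p1(1,2), of 0] by (simp only: diff_zero)
  \<comment> \<open>For the term \<open>(b - z) T h\<close> the set is split at distance
    \<open>\<kappa> * r\<close>; inside, \<open>h\<close> is resolved into its two atoms, outside, its
    cancellation is used.\<close>
  have part1: "weak ((CN + CM + CF) * l) (\<lambda>x. (b x - z) * T h x)"
   unfolding weak_bound_def
  proof (intro conjI ballI impI)
   show "bmeas (\<lambda>x. (b x - z) * T h x)" by measurable
   show "0 \<le> (CN + CM + CF) * l" using CN CM CF l by simp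
   fix A assume A[measurable]: "A \<in> sets \<mu>" and fin: "emeasure \<mu> A < \<infinity>"
   define S where "S = measure \<mu> A powr \<alpha>"
   have S: "0 \<le> S" by (simp add: S_def)
   have inner: "mass (A \<inter> ball c (\<kappa> * r)) (\<lambda>x. cmod (b x - z) * cmod (T a x)) \<le> ennreal ((CN + CM) * S)"
    if a: "atom_on c' r' c r a" for c' r' a
   proof -
    have [measurable]: "T a \<in> borel_measurable \<mu>" by (rule T_measurable[OF p atom_onD(6)[OF a]])
    have "mass (A \<inter> ball c (\<kappa> * r)) (\<lambda>x. cmod (b x - z) * cmod (T a x)) \<le>
     (\<integral>\<^sup>+x. ennreal (cmod (b x - z) * cmod (T a x)) * indicator (A \<inter> ball c' (\<rho>\<^sub>1 * r')) x +
      ennreal (cmod (b x - z) * cmod (T a x)) * indicator (A \<inter> ball c (\<kappa> * r) \<inter> {x. \<rho>\<^sub>1 * r' \<le> dist c' x}) x \<partial>\<mu>)"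
     by (intro nn_integral_mono) (auto simp: indicator_def)
    also have "... = mass (A \<inter> ball c' (\<rho>\<^sub>1 * r')) (\<lambda>x. cmod (b x - z) * cmod (T a x)) +
     (mass (A \<inter> ball c (\<kappa> * r) \<inter> {x. \<rho>\<^sub>1 * r' \<le> dist c' x}) (\<lambda>x. cmod (b x - z) * cmod (T a x)))"
     by (intro nn_integral_add) measurable
    also have "... \<le> ennreal (CN * S) + ennreal (CM * S)"
     unfolding z_def S_def
     by (intro add_mono CN(2)[rule_format, OF rm a A fin] CM(2)[rule_format, OF rm a A fin])
    also have "... = ennreal ((CN + CM) * S)" using CN CM S by (simp add: algebra_simps flip: ennreal_plus)
    finally show ?thesis .
   qed
   have on: "mass (A \<inter> ball c (\<kappa> * r)) (\<lambda>x. cmod (b x - z) * cmod (T h x)) \<le> ennreal ((CN + CM) * l * S)"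
   proof -
    have "mass (A \<inter> ball c (\<kappa> * r)) (\<lambda>x. cmod (b x - z) * cmod (T h x)) \<le>
     (\<integral>\<^sup>+x. ennreal (cmod l1) * (ennreal (cmod (b x - z) * cmod (T a1 x)) * indicator (A \<inter> ball c (\<kappa> * r)) x) +
      ennreal (cmod l2) * (ennreal (cmod (b x - z) * cmod (T a2 x)) * indicator (A \<inter> ball c (\<kappa> * r)) x) \<partial>\<mu>)"
    proof (rule nn_integral_mono_AE)
     show "AE x in \<mu>. ennreal (cmod (b x - z) * cmod (T h x)) * indicator (A \<inter> ball c (\<kappa> * r)) x \<le>
      ennreal (cmod l1) * (ennreal (cmod (b x - z) * cmod (T a1 x)) * indicator (A \<inter> ball c (\<kappa> * r)) x) +
      ennreal (cmod l2) * (ennreal (cmod (b x - z) * cmod (T a2 x)) * indicator (A \<inter> ball c (\<kappa> * r)) x)"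
      using h(5)
     proof eventually_elim
      case (elim x)
      have "cmod (T h x) \<le> cmod l1 * cmod (T a1 x) + cmod l2 * cmod (T a2 x)"
       using elim norm_triangle_ineq[of "l1 * T a1 x" "l2 * T a2 x"] by (simp add: norm_mult)
      then have "cmod (b x - z) * cmod (T h x) \<le> cmod (b x - z) * (cmod l1 * cmod (T a1 x) + cmod l2 * cmod (T a2 x))"
       by (intro mult_left_mono) auto
      also have "... = cmod l1 * (cmod (b x - z) * cmod (T a1 x)) + cmod l2 * (cmod (b x - z) * cmod (T a2 x))"
       by (simp add: algebra_simps)
      finally have "ennreal (cmod (b x - z) * cmod (T h x)) \<le>
       ennreal (cmod l1) * ennreal (cmod (b x - z) * cmod (T a1 x)) + ennreal (cmod l2) * ennreal (cmod (b x - z) * cmod (T a2 x))"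
       by (simp add: ennreal_leI ennreal_mult'[symmetric] ennreal_plus[symmetric] del: ennreal_plus)
      then show ?case by (auto simp: indicator_def)
     qed
    qed
    also have "... = ennreal (cmod l1) * mass (A \<inter> ball c (\<kappa> * r)) (\<lambda>x. cmod (b x - z) * cmod (T a1 x)) +
     ennreal (cmod l2) * mass (A \<inter> ball c (\<kappa> * r)) (\<lambda>x. cmod (b x - z) * cmod (T a2 x))"
     by (subst nn_integral_add) (auto simp: nn_integral_cmult)
    also have "... \<le> ennreal (cmod l1) * ennreal ((CN + CM) * S) + ennreal (cmod l2) * ennreal ((CN + CM) * S)"
     by (intro add_mono mult_left_mono inner[OF a1] inner[OF a2]) auto
    also have "... = ennreal ((CN + CM) * l * S)"
     using CN CM S by (simp add: l_def ennreal_mult[symmetric] ennreal_plus[symmetric] algebra_simps del: ennreal_plus)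
    finally show ?thesis .
   qed
   have off: "mass (A \<inter> {x. \<kappa> * r \<le> dist c x}) (\<lambda>x. cmod (b x - z) * cmod (T h x)) \<le> ennreal (CF * l * S)"
   proof -
    have "mass (A \<inter> {x. \<kappa> * r \<le> dist c x}) (\<lambda>x. cmod (b x - z) * cmod (T h x)) \<le> ennreal (CF * (\<integral>x. cmod (h x) \<partial>\<mu>) * S)"
     unfolding z_def S_def by (rule CF(2)[rule_format, OF rm D1(2) h(1,2) int0 A fin])
    also have "... \<le> ennreal (CF * l * S)"
     using h(4) CF(1) S by (intro ennreal_leI mult_right_mono mult_left_mono) (auto simp: l_def)
    finally show ?thesis .
   qed
   have "mass A (\<lambda>x. cmod ((b x - z) * T h x)) \<le>
    (\<integral>\<^sup>+x. ennreal (cmod (b x - z) * cmod (T h x)) * indicator (A \<inter> ball c (\<kappa> * r)) x +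
      ennreal (cmod (b x - z) * cmod (T h x)) * indicator (A \<inter> {x. \<kappa> * r \<le> dist c x}) x \<partial>\<mu>)"
    by (intro nn_integral_mono) (auto simp: indicator_def norm_mult)
   also have "... = mass (A \<inter> ball c (\<kappa> * r)) (\<lambda>x. cmod (b x - z) * cmod (T h x)) +
     (mass (A \<inter> {x. \<kappa> * r \<le> dist c x}) (\<lambda>x. cmod (b x - z) * cmod (T h x)))"
    by (intro nn_integral_add) measurable
   also have "... \<le> ennreal ((CN + CM) * l * S) + ennreal (CF * l * S)" by (intro add_mono on off)
   also have "... = ennreal ((CN + CM + CF) * l * S)"
    using CN CM CF l S by (simp add: algebra_simps flip: ennreal_plus)
   finally show "mass A (\<lambda>x. cmod ((b x - z) * T h x)) \<le> ennreal ((CN + CM + CF) * l * measure \<mu> A powr \<alpha>)"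
    by (simp only: S_def)
  qed
  \<comment> \<open>For the term \<open>T ((b - z) h)\<close> the weak type of \<open>T\<close> only
    asks for the \<open>L\<^sup>1\<close> norm.\<close>
  have nn: "tmass (\<lambda>x. cmod ((b x - z) * h x)) \<le> ennreal (CA * l)"
  proof -
   have m12[measurable]: "bmeas a1" "bmeas a2" using D1(7) D2(7) .
   have "tmass (\<lambda>x. cmod ((b x - z) * h x)) \<le>
    (\<integral>\<^sup>+x. ennreal (cmod l1) * ennreal (cmod (b x - z) * cmod (a1 x)) + ennreal (cmod l2) * ennreal (cmod (b x - z) * cmod (a2 x)) \<partial>\<mu>)"
   proof (rule nn_integral_mono_AE)
    show "AE x in \<mu>. ennreal (cmod ((b x - z) * h x)) \<le>
     ennreal (cmod l1) * ennreal (cmod (b x - z) * cmod (a1 x)) + ennreal (cmod l2) * ennreal (cmod (b x - z) * cmod (a2 x))"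
     using heq
    proof eventually_elim
     case (elim x)
     have "cmod (h x) \<le> cmod l1 * cmod (a1 x) + cmod l2 * cmod (a2 x)"
      using elim norm_triangle_ineq[of "l1 * a1 x" "l2 * a2 x"] by (simp add: norm_mult)
     then have "cmod (b x - z) * cmod (h x) \<le> cmod (b x - z) * (cmod l1 * cmod (a1 x) + cmod l2 * cmod (a2 x))"
      by (intro mult_left_mono) auto
     also have "... = cmod l1 * (cmod (b x - z) * cmod (a1 x)) + cmod l2 * (cmod (b x - z) * cmod (a2 x))"
      by (simp add: algebra_simps)
     finally show ?case
      by (simp add: norm_mult ennreal_leI ennreal_mult'[symmetric] ennreal_plus[symmetric] del: ennreal_plus)
    qed
   qed
   also have "... = ennreal (cmod l1) * tmass (\<lambda>x. cmod (b x - z) * cmod (a1 x)) + ennreal (cmod l2) * tmass (\<lambda>x. cmod (b x - z) * cmod (a2 x))"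
    by (subst nn_integral_add) (auto simp: nn_integral_cmult)
   also have "... \<le> ennreal (cmod l1) * ennreal CA + ennreal (cmod l2) * ennreal CA"
    unfolding z_def by (intro add_mono mult_left_mono CA(2)[rule_format, OF rm a1] CA(2)[rule_format, OF rm a2]) auto
   also have "... = ennreal (CA * l)"
    using CA(1) by (simp add: l_def ennreal_mult[symmetric] ennreal_plus[symmetric] algebra_simps del: ennreal_plus)
   finally show ?thesis .
  qed
  have bzi: "integrable \<mu> (\<lambda>x. (b x - z) * h x)"
   using order_le_less_trans[OF nn ennreal_less_top] by (intro integrableI_bounded) auto
  have "ennreal (\<integral>x. cmod ((b x - z) * h x) \<partial>\<mu>) \<le> ennreal (CA * l)"
   using nn bzi by (subst nn_integral_eq_integral[symmetric]) auto
  then have bzn: "(\<integral>x. cmod ((b x - z) * h x) \<partial>\<mu>) \<le> CA * l" using CA(1) l by (subst (asm) ennreal_le_iff) auto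
  have part2: "weak (CW * (CA * l)) (T (\<lambda>x. (b x - z) * h x))"
  proof (rule weak_bound_mono)
   show "weak (CW * (\<integral>x. cmod ((b x - z) * h x) \<partial>\<mu>)) (T (\<lambda>x. (b x - z) * h x))"
    by (rule CW(2)[rule_format, OF p1(3) bz bzi])
   show "CW * (\<integral>x. cmod ((b x - z) * h x) \<partial>\<mu>) \<le> CW * (CA * l)" using bzn CW(1) by (intro mult_left_mono)
  qed
  have sum: "weak ((CN + CM + CF) * l + cmod (- 1) * (CW * (CA * l))) (\<lambda>x. (b x - z) * T h x + (- 1) * T (\<lambda>x. (b x - z) * h x) x)"
   by (rule weak_bound_add[OF part1 weak_bound_cmult[OF part2]])
  have "AE x in \<mu>. T (\<lambda>x. 1 * (b x * h x) + (- z) * h x) x = 1 * T (\<lambda>x. b x * h x) x + (- z) * T h x"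
   by (intro T_linear Lp_in_sum_space[OF p1(3)] b0' hp1)
  moreover have "(\<lambda>x. 1 * (b x * h x) + (- z) * h x) = (\<lambda>x. (b x - z) * h x)" by (auto simp: algebra_simps)
  ultimately have "AE x in \<mu>. T (\<lambda>x. (b x - z) * h x) x = T (\<lambda>x. b x * h x) x - z * T h x" by simp
  then have eq: "AE x in \<mu>. commutator b T h x = (b x - z) * T h x + (- 1) * T (\<lambda>x. (b x - z) * h x) x"
   by eventually_elim (simp add: commutator_def algebra_simps)
  have cm: "commutator b T h \<in> borel_measurable \<mu>"
   unfolding commutator_def using T_measurable[OF p1(3) b0'] by measurable
  have "weak ((CN + CM + CF) * l + cmod (- 1) * (CW * (CA * l))) (commutator b T h)"
   by (rule weak_bound_cong_AE[OF sum cm eq])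
  moreover have "(CN + CM + CF) * l + cmod (- 1) * (CW * (CA * l)) = (CN + CM + CF + CW * CA) * (cmod l1 + cmod l2)"
   by (simp add: l_def algebra_simps)
  ultimately show "weak ((CN + CM + CF + CW * CA) * (cmod l1 + cmod l2)) (commutator b T h)" by simp
 qed
qed

text \<open>Hoelder on the supporting ball from the exponent \<open>q\<close> to \<open>p\<close>; the
  normalisation by the measure of the dilated ball is scaled accordingly.\<close>

lemma block_atom_atom_on:
 assumes a: "block_atom \<mu> lam q g \<rho> c r a" and r: "0 < r" and q: "ennreal p < q" and g: "1 \<le> g"
 shows "\<exists>c' r'. atom_on c' r' c r a"
proof -
 obtain c' r' where r': "0 < r'" and sub: "ball c' r' \<subseteq> ball c r" and aq: "a \<in> Lp_space \<mu> q"
  and es: "ess_support \<mu> a \<subseteq> ball c' r'"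
  and nrm: "Lp_norm \<mu> q a \<le> vol c' (\<rho> * r') powr (enn2real (1 / q) - 1) * K_tilde \<mu> lam \<rho> c' r' r powr (- g)"
  using a unfolding block_atom_def by (elim exE conjE) (rule that)
 have [measurable]: "bmeas a" using aq by (simp add: Lp_space_def)
 have pp: "0 < p" "1 < p" using admissible_pos[OF p] by auto
 define K where "K = K_tilde \<mu> lam \<rho> c' r' r"
 define M where "M = vol c' (\<rho> * r')"
 have K: "1 \<le> K" unfolding K_def by (rule K_tilde_ge_1[OF rho r' r])
 have M: "0 \<le> M" by (simp add: M_def)
 have supp: "AE x in \<mu>. x \<notin> ball c' r' --> a x = 0"
  using AE_ess_support[of a] by eventually_elim (use es in blast)
 have BM: "vol c' r' \<le> M" unfolding M_def
  using r' rho by (intro measure_ball_mono subset_ball) auto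
 have Kg: "K powr (- g) \<le> 1 / K" using K g powr_mono[of "- g" "- 1" K] by (simp add: powr_minus_divide)
 have nrm': "Lp_norm \<mu> q a \<le> M powr (enn2real (1 / q) - 1) / K"
  using nrm mult_left_mono[OF Kg, of "M powr (enn2real (1 / q) - 1)"] unfolding K_def M_def by simp
 have "tmass (\<lambda>x. cmod (a x) powr p) = mass (ball c' r') (\<lambda>x. cmod (a x) powr p)"
 proof (rule nn_integral_cong_AE)
  show "AE x in \<mu>. ennreal (cmod (a x) powr p) = ennreal (cmod (a x) powr p) * indicator (ball c' r') x"
   using supp by eventually_elim (auto simp: indicator_def)
 qed
 also have "... \<le> ennreal ((M powr (1 / p - 1) / K) powr p)"
 proof (cases "q = \<infinity>")
  case True
  define Q where "Q = Lp_norm \<mu> q a"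
  have lt: "esssup \<mu> (\<lambda>x. ereal (cmod (a x))) < \<infinity>" using aq True by (simp add: Lp_space_def)
  have Qle: "Q \<le> M powr (- 1) / K" using nrm' True by (simp add: Q_def)
  have "AE x in \<mu>. cmod (a x) \<le> Q"
   using esssup_AE[of "\<lambda>x. ereal (cmod (a x))" \<mu>]
  proof eventually_elim
   case (elim x)
   then have "ereal (cmod (a x)) \<le> esssup \<mu> (\<lambda>x. ereal (cmod (a x)))" .
   then show ?case using lt True by (cases "esssup \<mu> (\<lambda>x. ereal (cmod (a x)))") (auto simp: Q_def Lp_norm_def)
  qed
  then have "mass (ball c' r') (\<lambda>x. cmod (a x) powr p) \<le> (\<integral>\<^sup>+x. ennreal ((M powr (- 1) / K) powr p) * indicator (ball c' r') x \<partial>\<mu>)"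
  proof (intro nn_integral_mono_AE, eventually_elim)
   case (elim x)
   then have "cmod (a x) powr p \<le> (M powr (- 1) / K) powr p" using Qle pp by (intro powr_mono2) auto
   then show ?case by (intro mult_right_mono ennreal_leI) auto
  qed
  also have "... = ennreal ((M powr (- 1) / K) powr p * vol c' r')"
   by (simp add: nn_integral_cmult_indicator emeasure_ball ennreal_mult)
  also have "... \<le> ennreal ((M powr (1 / p - 1) / K) powr p)"
  proof (rule ennreal_leI)
   have "(M powr (- 1) / K) powr p * vol c' r' \<le> (M powr (- 1) / K) powr p * M"
    using BM by (intro mult_left_mono) auto
   also have "... = (M powr (1 / p - 1) / K) powr p"
   proof (cases "M = 0")
    case False
    then have "M powr (- p) * M = M powr (1 - p)" using M powr_add[of M "- p" 1] by simp
    moreover have "(1 / p - 1) * p = 1 - p" using pp by (simp add: field_simps)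
    moreover have "(M powr (- 1) / K) powr p = M powr (- p) / K powr p"
    proof -
     have "(M powr (- 1)) powr p = M powr (- p)" by (simp only: powr_powr) simp
     then show ?thesis using powr_divide[of "M powr (- 1)" K p] K by simp
    qed
    moreover have "(M powr (1 / p - 1) / K) powr p = M powr ((1 / p - 1) * p) / K powr p"
     using K by (simp add: powr_divide powr_powr)
    ultimately show ?thesis by simp
   qed simp
   finally show "(M powr (- 1) / K) powr p * vol c' r' \<le> (M powr (1 / p - 1) / K) powr p" .
  qed
  finally show ?thesis .
 next
  case False
  define s where "s = enn2real q"
  have qs: "q = ennreal s" using False by (simp add: s_def less_top)
  have sp: "p < s" using q pp unfolding qs by (simp add: ennreal_less_iff)
  have s0: "0 < s" using sp pp by simp
  have e1: "enn2real (1 / q) = 1 / s"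
   using s0 by (simp add: qs divide_ennreal flip: ennreal_1)
  define F where "F = M powr (1 / s - 1) / K"
  have F: "0 \<le> F" using K by (simp add: F_def)
  have b: "Lp_bound \<mu> s F a" unfolding F_def
   using aq nrm' s0 e1 unfolding qs by (intro Lp_spaceD) auto
  have "mass (ball c' r') (\<lambda>x. cmod (a x) powr p) \<le> ennreal (F powr p * vol c' r' powr (1 - 1 / (s / p)))"
  proof (rule nn_integral_Holder_set)
   show "tmass (\<lambda>x. (cmod (a x) powr p) powr (s / p)) \<le> ennreal ((F powr p) powr (s / p))"
    using b pp by (simp add: Lp_bound_def powr_powr)
  qed (use emeasure_ball_finite sp pp in auto)
  also have "... \<le> ennreal ((M powr (1 / p - 1) / K) powr p)"
  proof (rule ennreal_leI)
   have "0 \<le> 1 - 1 / (s / p)" using sp pp by simp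
   then have "F powr p * vol c' r' powr (1 - 1 / (s / p)) \<le> F powr p * M powr (1 - 1 / (s / p))"
    using BM by (intro mult_left_mono powr_mono2) auto
   also have "... = (M powr (1 / p - 1) / K) powr p"
   proof (cases "M = 0")
    case True
    then show ?thesis by (simp add: F_def)
   next
    case False
    have ex: "(1 / s - 1) * p + (1 - 1 / (s / p)) = (1 / p - 1) * p" using pp s0 by (simp add: field_simps)
    have "F powr p * M powr (1 - 1 / (s / p)) = (M powr ((1 / s - 1) * p) * M powr (1 - 1 / (s / p))) / K powr p"
     using K M by (simp add: F_def powr_divide powr_powr)
    also have "... = M powr ((1 / p - 1) * p) / K powr p" by (simp only: powr_add[symmetric] ex)
    finally show ?thesis using K M by (simp add: powr_divide powr_powr)
   qed
   finally show "F powr p * vol c' r' powr (1 - 1 / (s / p)) \<le> (M powr (1 / p - 1) / K) powr p" .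
  qed
  finally show ?thesis .
 qed
 finally have "Lp_bound \<mu> p (M powr (1 / p - 1) / K) a" using K by (simp add: Lp_bound_def)
 then show ?thesis using r r' sub supp unfolding atom_on_def M_def K_def by blast
qed

lemma atomic_block_block:
 assumes "atomic_block \<mu> lam q g \<rho> h l1 l2" "ennreal p < q" "1 \<le> g"
 shows "block l1 l2 h"
proof -
 obtain c r a1 a2 where r: "0 < r" and a: "block_atom \<mu> lam q g \<rho> c r a1" "block_atom \<mu> lam q g \<rho> c r a2"
  and eq: "AE x in \<mu>. h x = l1 * a1 x + l2 * a2 x" and i: "integrable \<mu> h" "integral\<^sup>L \<mu> h = 0"
  using assms(1) unfolding atomic_block_def by (elim exE conjE) (rule that)
 obtain c1 r1 where 1: "atom_on c1 r1 c r a1" using block_atom_atom_on[OF a(1) r assms(2,3)] by (elim exE)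
 obtain c2 r2 where 2: "atom_on c2 r2 c r a2" using block_atom_atom_on[OF a(2) r assms(2,3)] by (elim exE)
 have hm: "bmeas h" using i by auto
 show ?thesis unfolding block_def
  by (intro exI conjI) (rule 1, rule 2, rule hm, rule eq, rule i(2))
qed

end

section \<open>Series of weakly bounded functions and truncated symbols\<close>

lemma weak_bound_tendsto:
 assumes g: "\<And>j. weak_bound M \<alpha> (B j) g" and B: "B \<longlonglongrightarrow> C"
 shows "weak_bound M \<alpha> C g"
 by (rule weak_bound_limit[OF weak_boundD(1)[OF g] g B]) simp

lemma weak_bound_sum:
 assumes "\<And>i. i < n ==> weak_bound M \<alpha> (c i) (U i)"
 shows "weak_bound M \<alpha> (\<Sum>i<n. c i) (\<lambda>x. \<Sum>i<(n::nat). U i x)"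
 using assms
proof (induction n)
 case 0
 then show ?case by (simp add: weak_bound_def)
next
 case (Suc n)
 have "weak_bound M \<alpha> ((\<Sum>i<n. c i) + c n) (\<lambda>x. (\<Sum>i<n. U i x) + U n x)"
  by (rule weak_bound_add) (use Suc in auto)
 then show ?case by simp
qed

lemma weak_bound_zero:
 assumes "weak_bound M \<alpha> 0 g" "A \<in> sets M" "emeasure M A < \<infinity>"
 shows "AE x in M. x \<in> A --> g x = 0"
proof -
 have [measurable]: "g \<in> borel_measurable M" "A \<in> sets M" using weak_boundD(1)[OF assms(1)] assms(2) by auto
 have "(\<integral>\<^sup>+x\<in>A. ennreal (cmod (g x)) \<partial>M) = 0" using weak_boundD(3)[OF assms] by simp
 then have "AE x in M. ennreal (cmod (g x)) * indicator A x = 0" by (subst (asm) nn_integral_0_iff_AE) auto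
 then show ?thesis
 proof eventually_elim
  case (elim x)
  then show ?case by (auto simp: indicator_def split: if_splits)
 qed
qed

text \<open>Monotone convergence on each set of finite measure.\<close>

lemma weak_bound_series:
 assumes U: "\<And>i. weak_bound M \<alpha> (c i) (U i)" and c: "summable c"
  and sf: "sigma_finite_measure M"
 shows "AE x in M. summable (\<lambda>i. cmod (U i x))"
  and "weak_bound M \<alpha> (\<Sum>i. c i) (\<lambda>x. \<Sum>i. U i x)"
proof -
 have [measurable]: "U i \<in> borel_measurable M" for i by (rule weak_boundD(1)[OF U])
 have c0: "0 \<le> c i" for i by (rule weak_boundD(2)[OF U])
 have sm: "(\<integral>\<^sup>+x\<in>A. (\<Sum>i. ennreal (cmod (U i x))) \<partial>M) \<le> ennreal ((\<Sum>i. c i) * measure M A powr \<alpha>)"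
  if [measurable]: "A \<in> sets M" and fin: "emeasure M A < \<infinity>" for A
 proof -
  have "(\<integral>\<^sup>+x\<in>A. (\<Sum>i. ennreal (cmod (U i x))) \<partial>M) = (\<integral>\<^sup>+x. (\<Sum>i. ennreal (cmod (U i x)) * indicator A x) \<partial>M)"
   by simp
  also have "... = (\<Sum>i. \<integral>\<^sup>+x\<in>A. ennreal (cmod (U i x)) \<partial>M)" by (rule nn_integral_suminf) measurable
  also have "... \<le> (\<Sum>i. ennreal (c i * measure M A powr \<alpha>))"
   by (intro suminf_le weak_boundD(3)[OF U]) (use that in auto)
  also have "... = ennreal (\<Sum>i. c i * measure M A powr \<alpha>)"
   using c0 c by (intro suminf_ennreal2 summable_mult2) auto
  also have "... = ennreal ((\<Sum>i. c i) * measure M A powr \<alpha>)" using c by (simp add: suminf_mult2)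
  finally show ?thesis .
 qed
 obtain A :: "nat => 'a set" where A: "range A \<subseteq> sets M" "(\<Union>i. A i) = space M" "\<And>i. emeasure M (A i) \<noteq> \<infinity>"
  by (rule sigma_finite_measure.sigma_finite[OF sf]) (rule that)
 have "AE x in M. x \<in> A k --> (\<Sum>i. ennreal (cmod (U i x))) \<noteq> \<infinity>" for k
 proof -
  have [measurable]: "A k \<in> sets M" using A(1) by auto
  have fin: "emeasure M (A k) < \<infinity>" using A(3)[of k] by (simp add: less_top)
  have Ak: "A k \<in> sets M" using A(1) by auto
  have "(\<integral>\<^sup>+x\<in>A k. (\<Sum>i. ennreal (cmod (U i x))) \<partial>M) < \<infinity>"
   unfolding infinity_ennreal_def by (rule order_le_less_trans[OF sm[OF Ak fin] ennreal_less_top])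
  then have "(\<integral>\<^sup>+x\<in>A k. (\<Sum>i. ennreal (cmod (U i x))) \<partial>M) \<noteq> \<infinity>" by (rule less_imp_neq)
  then have "AE x in M. (\<Sum>i. ennreal (cmod (U i x))) * indicator (A k) x \<noteq> \<infinity>"
   by (intro nn_integral_noteq_infinite) auto
  then show ?thesis
  proof eventually_elim
   case (elim x)
   then show ?case by (auto simp: indicator_def)
  qed
 qed
 then have "AE x in M. \<forall>k. x \<in> A k --> (\<Sum>i. ennreal (cmod (U i x))) \<noteq> \<infinity>"
  unfolding AE_all_countable by (rule allI)
 then show S: "AE x in M. summable (\<lambda>i. cmod (U i x))"
  using AE_space
 proof eventually_elim
  case (elim x)
  then obtain k where "x \<in> A k" using A(2) by blast
  then have "(\<Sum>i. ennreal (cmod (U i x))) \<noteq> top" using elim(1) by auto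
  then show ?case by (rule summable_suminf_not_top[rotated]) auto
 qed
 show "weak_bound M \<alpha> (\<Sum>i. c i) (\<lambda>x. \<Sum>i. U i x)"
  unfolding weak_bound_def
 proof (intro conjI ballI impI)
  show "(\<lambda>x. \<Sum>i. U i x) \<in> borel_measurable M" by measurable
  show "0 \<le> (\<Sum>i. c i)" using c c0 by (rule suminf_nonneg)
  fix B assume B: "B \<in> sets M" "emeasure M B < \<infinity>"
  have "(\<integral>\<^sup>+x\<in>B. ennreal (cmod (\<Sum>i. U i x)) \<partial>M) \<le> (\<integral>\<^sup>+x\<in>B. (\<Sum>i. ennreal (cmod (U i x))) \<partial>M)"
  proof (rule nn_integral_mono_AE)
   show "AE x in M. ennreal (cmod (\<Sum>i. U i x)) * indicator B x \<le> (\<Sum>i. ennreal (cmod (U i x))) * indicator B x"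
    using S
   proof eventually_elim
    case (elim x)
    have "ennreal (cmod (\<Sum>i. U i x)) \<le> ennreal (\<Sum>i. cmod (U i x))"
     by (intro ennreal_leI summable_norm elim)
    also have "... = (\<Sum>i. ennreal (cmod (U i x)))" using elim by (subst suminf_ennreal2) auto
    finally show ?case by (rule mult_right_mono) simp
   qed
  qed
  also have "... \<le> ennreal ((\<Sum>i. c i) * measure M B powr \<alpha>)" by (rule sm[OF B])
  finally show "(\<integral>\<^sup>+x\<in>B. ennreal (cmod (\<Sum>i. U i x)) \<partial>M) \<le> ennreal ((\<Sum>i. c i) * measure M B powr \<alpha>)" .
 qed
qed

lemma Lp_multiplier:
 assumes f: "f \<in> Lp_space M (ennreal s)" and s: "0 < s" and b: "\<beta> \<in> borel_measurable M" "\<And>x. cmod (\<beta> x) \<le> N"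
 shows "(\<lambda>x. \<beta> x * f x) \<in> Lp_space M (ennreal s)"
proof -
 have [measurable]: "f \<in> borel_measurable M" and i: "integrable M (\<lambda>x. cmod (f x) powr s)"
  using f s by (auto simp: Lp_space_def)
 note [measurable] = b(1)
 have "integrable M (\<lambda>x. cmod (\<beta> x * f x) powr s)"
 proof (rule Bochner_Integration.integrable_bound)
  show "integrable M (\<lambda>x. N powr s * cmod (f x) powr s)" using i by simp
  show "AE x in M. norm (cmod (\<beta> x * f x) powr s) \<le> norm (N powr s * cmod (f x) powr s)"
  proof (rule AE_I2)
   fix x
   have "cmod (\<beta> x) powr s \<le> N powr s" using b(2) s by (intro powr_mono2) auto
   then show "norm (cmod (\<beta> x * f x) powr s) \<le> norm (N powr s * cmod (f x) powr s)"
    by (simp add: norm_mult powr_mult mult_right_mono)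
  qed
 qed measurable
 then show ?thesis using s by (simp add: Lp_space_def)
qed

text \<open>Where the modulus is at most \<open>1\<close>, integrability dominates the power
  \<open>s\<close>; the rest of the space has finite measure, and there the higher exponents dominate
  it. A function in a sum of two spaces thus lies in a single one once it is integrable.\<close>

lemma Lp_sum_integrable:
 assumes f: "integrable M f" "f = (\<lambda>x. f1 x + f2 x)" and f1: "f1 \<in> Lp_space M (ennreal p1)" and f2: "f2 \<in> Lp_space M (ennreal p2)"
  and s: "1 \<le> s" "s \<le> p1" "s \<le> p2"
 shows "f \<in> Lp_space M (ennreal s)"
proof -
 have [measurable]: "f \<in> borel_measurable M" using f by auto
 have i: "integrable M (\<lambda>x. cmod (f1 x) powr p1)" "integrable M (\<lambda>x. cmod (f2 x) powr p2)"
  using f1 f2 s by (auto simp: Lp_space_def)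
 have "integrable M (\<lambda>x. cmod (f x) powr s)"
 proof (rule Bochner_Integration.integrable_bound)
  show "integrable M (\<lambda>x. (1 + 2 * 2 powr s) * cmod (f x) + 2 powr s * (cmod (f1 x) powr p1 + cmod (f2 x) powr p2))"
   using i f(1) by auto
  have "cmod (f x) powr s \<le> (1 + 2 * 2 powr s) * cmod (f x) + 2 powr s * (cmod (f1 x) powr p1 + cmod (f2 x) powr p2)" for x
  proof (cases "cmod (f x) \<le> 1")
   case True
   have "cmod (f x) powr s \<le> cmod (f x)"
   proof (cases "f x = 0")
    case False
    then show ?thesis using powr_mono'[of 1 s "cmod (f x)"] True s by simp
   qed (use s in simp)
   also have "... \<le> (1 + 2 * 2 powr s) * cmod (f x)" using mult_right_mono[of 1 "1 + 2 * 2 powr s" "cmod (f x)"] by simp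
   finally show ?thesis by (smt (verit) mult_nonneg_nonneg powr_ge_zero)
  next
   case False
   have pw: "a powr s \<le> 1 + a powr t" if "0 \<le> a" "s \<le> t" for a t :: real
   proof (cases "a \<le> 1")
    case True
    then show ?thesis using powr_le1[of s a] that s by (smt (verit) powr_ge_zero)
   next
    case False
    then have "a powr s \<le> a powr t" using that by (intro powr_mono) auto
    then show ?thesis by simp
   qed
   have "cmod (f x) \<le> 2 * max (cmod (f1 x)) (cmod (f2 x))" using norm_triangle_ineq[of "f1 x" "f2 x"] f(2) by auto
   then have "cmod (f x) powr s \<le> (2 * max (cmod (f1 x)) (cmod (f2 x))) powr s" using s by (intro powr_mono2) auto
   also have "... \<le> 2 powr s * (cmod (f1 x) powr s + cmod (f2 x) powr s)" by (simp add: powr_mult max_def)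
   also have "... \<le> 2 powr s * ((1 + cmod (f1 x) powr p1) + (1 + cmod (f2 x) powr p2))"
    using s by (intro mult_left_mono add_mono pw) auto
   also have "... = 2 * 2 powr s * 1 + 2 powr s * (cmod (f1 x) powr p1 + cmod (f2 x) powr p2)" by (simp add: algebra_simps)
   also have "... \<le> 2 * 2 powr s * cmod (f x) + 2 powr s * (cmod (f1 x) powr p1 + cmod (f2 x) powr p2)"
    using False by (intro add_right_mono mult_left_mono) auto
   also have "... \<le> (1 + 2 * 2 powr s) * cmod (f x) + 2 powr s * (cmod (f1 x) powr p1 + cmod (f2 x) powr p2)"
    by (simp add: distrib_right)
   finally show ?thesis .
  qed
  then show "AE x in M. norm (cmod (f x) powr s) \<le> norm ((1 + 2 * 2 powr s) * cmod (f x) + 2 powr s * (cmod (f1 x) powr p1 + cmod (f2 x) powr p2))"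
   by (intro AE_I2) (smt (verit) powr_ge_zero real_norm_def)
 qed measurable
 then show ?thesis using s by (simp add: Lp_space_def)
qed

text \<open>The radial retraction of the plane onto the disc of radius \<open>N\<close> is \<open>1\<close>-Lipschitz, so it turns
 regular means of \<open>b\<close> into regular means of a bounded function.\<close>

definition disc_clamp :: "nat => complex => complex" where "disc_clamp N = closest_point (cball 0 (real N))"

lemma disc_clamp:
 shows "cmod (disc_clamp N z - disc_clamp N w) \<le> cmod (z - w)" "cmod (disc_clamp N z) \<le> real N"
  "cmod z \<le> real N ==> disc_clamp N z = z" "cmod (z - disc_clamp N z) \<le> cmod z"
  "disc_clamp N \<in> borel_measurable borel"
proof -
 have c: "convex (cball (0::complex) (real N))" "closed (cball (0::complex) (real N))" "cball (0::complex) (real N) \<noteq> {}"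
  by auto
 show "cmod (disc_clamp N z - disc_clamp N w) \<le> cmod (z - w)"
  using closest_point_lipschitz[OF c, of z w] by (simp add: disc_clamp_def dist_norm)
 show "cmod (disc_clamp N z) \<le> real N" using closest_point_in_set[OF c(2,3), of z] by (simp add: disc_clamp_def)
 show "cmod z \<le> real N ==> disc_clamp N z = z" unfolding disc_clamp_def by (intro closest_point_self) simp
 show "cmod (z - disc_clamp N z) \<le> cmod z"
  using closest_point_le[OF c(2), of 0 z] by (simp add: disc_clamp_def dist_norm)
 show "disc_clamp N \<in> borel_measurable borel"
  unfolding disc_clamp_def by (intro borel_measurable_continuous_onI continuous_on_closest_point c)
qed

lemma disc_clamp_measurable [measurable (raw)]: "f \<in> borel_measurable M ==> (\<lambda>x. disc_clamp N (f x)) \<in> borel_measurable M"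
 by (rule measurable_compose[OF _ disc_clamp(5)])

lemma (in regular_mean_exponents) regular_means_Lipschitz:
 assumes rm: "regular_means b m" and \<phi>: "\<And>z w. cmod (\<phi> z - \<phi> w) \<le> cmod (z - w)"
  and [measurable]: "\<phi> \<in> borel_measurable borel"
 shows "regular_means (\<lambda>x. \<phi> (b x)) (\<lambda>c r. \<phi> (m c r))"
 unfolding regular_means_def
proof (intro conjI allI impI)
 note [measurable] = regular_means_measurable[OF rm]
 show "bmeas (\<lambda>x. \<phi> (b x))" by measurable
 fix c :: 'a and r :: real assume r: "0 < r"
 have "mass (ball c r) (\<lambda>x. cmod (\<phi> (b x) - \<phi> (m c r))) \<le> (mass (ball c r) (\<lambda>x. cmod (b x - m c r)))"
  by (intro nn_integral_mono mult_right_mono ennreal_leI \<phi>) auto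
 then show "mass (ball c r) (\<lambda>x. cmod (\<phi> (b x) - \<phi> (m c r))) \<le> emeasure \<mu> (ball c (\<rho>\<^sub>b * r))"
  using regular_means_oscillation[OF rm r, of c] by (rule order_trans)
next
 fix c c1 :: 'a and r r1 :: real assume h: "0 < r" "0 < r1" "ball c r \<subseteq> ball c1 r1"
 show "cmod (\<phi> (m c r) - \<phi> (m c1 r1)) \<le> K_tilde \<mu> lam \<rho>\<^sub>b c r r1 powr \<gamma>\<^sub>b"
  using \<phi>[of "m c r" "m c1 r1"] regular_means_diff[OF rm h] by linarith
qed

context commutator_setting
begin

text \<open>What a single block contributes to the construction. The bounds for all truncated symbols
  are recorded along with the one for \<open>b\<close>, because consistency is proved through
  them.\<close>

definition good :: "('a => complex) => ('a => complex) => real => bool" where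
 "good b h c \<longleftrightarrow> h \<in> Lp p\<^sub>1 \<and> integrable \<mu> h \<and> (\<lambda>x. b x * h x) \<in> Lp p\<^sub>1 \<and>
  weak c (commutator b T h) \<and> (\<forall>N. weak c (commutator (\<lambda>x. disc_clamp N (b x)) T h))"

lemma commutator_measurable:
 assumes s: "admissible s" and "bmeas \<beta>" "h \<in> Lp s" "(\<lambda>x. \<beta> x * h x) \<in> Lp s"
 shows "commutator \<beta> T h \<in> borel_measurable \<mu>"
proof -
 note [measurable] = assms(2) T_measurable[OF s assms(3)] T_measurable[OF s assms(4)]
 show ?thesis unfolding commutator_def by measurable
qed

lemma commutator_linear:
 assumes s: "admissible s" and u: "u \<in> Lp s" "(\<lambda>x. \<beta> x * u x) \<in> Lp s"
  and v: "v \<in> Lp s" "(\<lambda>x. \<beta> x * v x) \<in> Lp s"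
 shows "AE x in \<mu>. commutator \<beta> T (\<lambda>x. c * u x + d * v x) x = c * commutator \<beta> T u x + d * commutator \<beta> T v x"
proof -
 note S = Lp_in_sum_space[OF s]
 have e: "(\<lambda>y. \<beta> y * (c * u y + d * v y)) = (\<lambda>y. c * (\<beta> y * u y) + d * (\<beta> y * v y))"
  by (auto simp: algebra_simps)
 show ?thesis
  using T_linear[OF S[OF u(1)] S[OF v(1)], of c d] T_linear[OF S[OF u(2)] S[OF v(2)], of c d]
  by eventually_elim (simp add: commutator_def e algebra_simps)
qed

lemma commutator_scale:
 assumes s: "admissible s" and u: "u \<in> Lp s" "(\<lambda>x. \<beta> x * u x) \<in> Lp s"
 shows "AE x in \<mu>. commutator (\<lambda>x. c * \<beta> x) T u x = c * commutator \<beta> T u x"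
proof -
 note S = Lp_in_sum_space[OF s u(2)]
 have e: "(\<lambda>y. c * (\<beta> y * u y) + 0 * (\<beta> y * u y)) = (\<lambda>y. c * \<beta> y * u y)" by (auto simp: algebra_simps)
 show ?thesis
  using T_linear[OF S S, of c 0] unfolding e
  by eventually_elim (simp add: commutator_def algebra_simps)
qed

text \<open>The number \<open>L\<close> is a bound for the symbol. Clamping at radius \<open>N\<close>
  and dividing by \<open>L\<close> is again a Lipschitz operation on the normalised symbol.\<close>

lemma block_good:
 "\<exists>C\<ge>0. \<forall>b m L. 0 < L --> regular_means (\<lambda>x. b x / of_real L) m -->
  (\<forall>l1 l2 h. block l1 l2 h --> good b h (C * L * (cmod l1 + cmod l2)))"
proof -
 obtain C where C: "0 \<le> C" "\<forall>b m. regular_means b m --> (\<forall>l1 l2 h. block l1 l2 h -->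
  weak (C * (cmod l1 + cmod l2)) (commutator b T h))"
  using block_weak_bound by (elim exE conjE) (rule that)
 show ?thesis
 proof (intro exI[of _ C] conjI C(1) allI impI)
  fix b :: "'a => complex" and m :: "'a => real => complex" and L l1 l2 h
  assume L: "0 < L" and rm: "regular_means (\<lambda>x. b x / of_real L) m" and bl: "block l1 l2 h"
  obtain c r c1 r1 a1 c2 r2 a2 where a1: "atom_on c1 r1 c r a1" and a2: "atom_on c2 r2 c r a2"
   and hm: "bmeas h" and heq: "AE x in \<mu>. h x = l1 * a1 x + l2 * a2 x"
   using bl unfolding block_def by (elim exE conjE) (rule that)
  note h = block_facts[OF a1 a2 hm heq]
  have r: "0 < r" using a1 by (simp add: atom_on_def)
  have step: "h \<in> Lp p\<^sub>1" "(\<lambda>x. \<beta> x * h x) \<in> Lp p\<^sub>1"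
   "weak (C * L * (cmod l1 + cmod l2)) (commutator \<beta> T h)"
   if r': "regular_means (\<lambda>x. \<beta> x / of_real L) n" for \<beta> n
  proof -
   have [measurable]: "bmeas (\<lambda>x. \<beta> x / of_real L)" by (rule regular_means_measurable[OF r'])
   have eb: "\<beta> = (\<lambda>x. of_real L * (\<beta> x / of_real L))" using L by auto
   have bm: "bmeas \<beta>" by (subst eb) measurable
   show h1: "h \<in> Lp p\<^sub>1" by (rule times_b_Lp(1)[OF r' h(1,2) r p1(1,2)])
   have q1: "(\<lambda>x. (\<beta> x / of_real L) * h x) \<in> Lp p\<^sub>1"
    using times_b_Lp(2)[OF r' h(1,2) r p1(1,2), of 0] by simp
   show q2: "(\<lambda>x. \<beta> x * h x) \<in> Lp p\<^sub>1"
   proof -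
    have "(\<lambda>x. of_real L * ((\<beta> x / of_real L) * h x) + 0 * h x) \<in> Lp p\<^sub>1"
     using p1 by (intro Lp_space_add q1 h1) auto
    moreover have "(\<lambda>x. of_real L * ((\<beta> x / of_real L) * h x) + 0 * h x) = (\<lambda>x. \<beta> x * h x)" using L by auto
    ultimately show ?thesis by simp
   qed
   have w: "weak (cmod (of_real L) * (C * (cmod l1 + cmod l2))) (\<lambda>x. of_real L * commutator (\<lambda>x. \<beta> x / of_real L) T h x)"
    by (rule weak_bound_cmult[OF C(2)[rule_format, OF r' bl]])
   have "AE x in \<mu>. commutator \<beta> T h x = of_real L * commutator (\<lambda>x. \<beta> x / of_real L) T h x"
    using commutator_scale[OF p1(3) h1 q1, of "of_real L"] eb by simp
   from weak_bound_cong_AE[OF w commutator_measurable[OF p1(3) bm h1 q2] this]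
   show "weak (C * L * (cmod l1 + cmod l2)) (commutator \<beta> T h)" using L by (simp add: ac_simps)
  qed
  have cl: "\<exists>n. regular_means (\<lambda>x. disc_clamp N (b x) / of_real L) n" for N
  proof -
   define \<phi> where "\<phi> z = disc_clamp N (of_real L * z) / of_real L" for z
   have "regular_means (\<lambda>x. \<phi> (b x / of_real L)) (\<lambda>c r. \<phi> (m c r))"
   proof (rule regular_means_Lipschitz[OF rm])
    show "cmod (\<phi> z - \<phi> w) \<le> cmod (z - w)" for z w
    proof -
     have "cmod (\<phi> z - \<phi> w) = cmod (disc_clamp N (of_real L * z) - disc_clamp N (of_real L * w)) / L"
      using L by (simp add: \<phi>_def norm_divide diff_divide_distrib[symmetric])
     also have "... \<le> cmod (of_real L * z - of_real L * w) / L" using L by (intro divide_right_mono disc_clamp) auto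
     also have "... = cmod (z - w)" using L by (simp add: norm_mult right_diff_distrib[symmetric])
     finally show ?thesis .
    qed
    show "\<phi> \<in> borel_measurable borel" unfolding \<phi>_def by measurable
   qed
   then show ?thesis using L by (intro exI[of _ "\<lambda>c r. \<phi> (m c r)"]) (simp add: \<phi>_def)
  qed
  show "good b h (C * L * (cmod l1 + cmod l2))"
   unfolding good_def
  proof (intro conjI allI h(3) step[OF rm])
   fix N
   obtain n where "regular_means (\<lambda>x. disc_clamp N (b x) / of_real L) n" using cl[of N] by (elim exE)
   then show "weak (C * L * (cmod l1 + cmod l2)) (commutator (\<lambda>x. disc_clamp N (b x)) T h)" by (rule step(3))
  qed
 qed
qed

lemma good_combine:
 assumes bm: "bmeas b" and u: "good b u c" and v: "good b v d"
 shows "good b (\<lambda>x. z * u x + w * v x) (cmod z * c + cmod w * d)"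
proof -
 note pp = p1(3) admissible_pos(1)[OF p1(3)]
 have comb: "weak (cmod z * c + cmod w * d) (commutator \<beta> T (\<lambda>x. z * u x + w * v x))"
  if b: "bmeas \<beta>" and U: "weak c (commutator \<beta> T u)" and V: "weak d (commutator \<beta> T v)"
   and u1: "u \<in> Lp p\<^sub>1" and u2: "(\<lambda>x. \<beta> x * u x) \<in> Lp p\<^sub>1"
   and v1: "v \<in> Lp p\<^sub>1" and v2: "(\<lambda>x. \<beta> x * v x) \<in> Lp p\<^sub>1" for \<beta>
 proof (rule weak_bound_cong_AE[OF weak_bound_add[OF weak_bound_cmult[OF U] weak_bound_cmult[OF V]]])
  show "AE x in \<mu>. commutator \<beta> T (\<lambda>x. z * u x + w * v x) x = z * commutator \<beta> T u x + w * commutator \<beta> T v x"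
   by (rule commutator_linear[OF pp(1) u1 u2 v1 v2])
  have "(\<lambda>x. z * (\<beta> x * u x) + w * (\<beta> x * v x)) \<in> Lp p\<^sub>1" by (rule Lp_space_add[OF pp(2) u2 v2])
  then show "commutator \<beta> T (\<lambda>x. z * u x + w * v x) \<in> borel_measurable \<mu>"
   by (intro commutator_measurable[OF pp(1) b] Lp_space_add[OF pp(2) u1 v1]) (simp add: algebra_simps)
 qed
 have lp: "u \<in> Lp p\<^sub>1" "v \<in> Lp p\<^sub>1"
  "(\<lambda>x. b x * u x) \<in> Lp p\<^sub>1" "(\<lambda>x. b x * v x) \<in> Lp p\<^sub>1"
  and int: "integrable \<mu> u" "integrable \<mu> v"
  using u v by (auto simp: good_def)
 have "(\<lambda>x. z * (b x * u x) + w * (b x * v x)) \<in> Lp p\<^sub>1" by (rule Lp_space_add[OF pp(2) lp(3,4)])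
 then have bz: "(\<lambda>x. b x * (z * u x + w * v x)) \<in> Lp p\<^sub>1" by (simp add: algebra_simps)
 show ?thesis
  unfolding good_def
 proof (intro conjI allI bz)
  show "(\<lambda>x. z * u x + w * v x) \<in> Lp p\<^sub>1" by (rule Lp_space_add[OF pp(2) lp(1,2)])
  show "integrable \<mu> (\<lambda>x. z * u x + w * v x)" using int by auto
  show "weak (cmod z * c + cmod w * d) (commutator b T (\<lambda>x. z * u x + w * v x))"
   using u v by (intro comb bm lp) (auto simp: good_def)
  fix N
  have cm: "bmeas (\<lambda>x. disc_clamp N (b x))" using bm by measurable
  show "weak (cmod z * c + cmod w * d) (commutator (\<lambda>x. disc_clamp N (b x)) T (\<lambda>x. z * u x + w * v x))"
   using u v by (intro comb cm lp Lp_multiplier[OF _ pp(2) cm disc_clamp(2)]) (auto simp: good_def)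
 qed
qed

text \<open>For a bounded symbol the two terms of the commutator need no cancellation: each is
  controlled by the weak type of \<open>T\<close>. The factor \<open>N\<close> is harmless, since the
  estimate is only used for convergence at fixed \<open>N\<close>.\<close>

lemma bounded_commutator_weak_bound:
 "\<exists>C\<ge>0. \<forall>\<beta> N s u. admissible s --> u \<in> Lp s --> integrable \<mu> u -->
  \<beta> \<in> borel_measurable \<mu> --> (\<forall>x. cmod (\<beta> x) \<le> N) -->
  weak (C * N * (\<integral>x. cmod (u x) \<partial>\<mu>)) (commutator \<beta> T u)"
proof -
 obtain CW where CW: "0 \<le> CW" "\<forall>p f. admissible p --> f \<in> Lp p --> integrable \<mu> f -->
  weak (CW * (\<integral>x. cmod (f x) \<partial>\<mu>)) (T f)"
  using T_weak_type by (elim exE conjE) (rule that)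
 show ?thesis
 proof (intro exI[of _ "2 * CW"] conjI allI impI)
  show "0 \<le> 2 * CW" using CW by simp
  fix \<beta> :: "'a => complex" and N s u
  assume s: "admissible s" and u: "u \<in> Lp s" and ui: "integrable \<mu> u"
   and bm[measurable]: "bmeas \<beta>" and bN: "\<forall>x. cmod (\<beta> x) \<le> N"
  have N: "0 \<le> N" using bN norm_ge_zero order_trans by blast
  note [measurable] = T_measurable[OF s u]
  have um[measurable]: "bmeas u" using ui by auto
  have bu: "(\<lambda>x. \<beta> x * u x) \<in> Lp s" using bN by (intro Lp_multiplier[OF u admissible_pos(1)[OF s] bm]) auto
  have bd: "cmod (\<beta> x * u x) \<le> N * cmod (u x)" for x using bN by (simp add: norm_mult mult_right_mono)
  have bi: "integrable \<mu> (\<lambda>x. \<beta> x * u x)"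
   by (rule Bochner_Integration.integrable_bound[of _ "\<lambda>x. N * cmod (u x)"]) (use ui bd N in \<open>auto simp: abs_mult\<close>)
  have "(\<integral>x. cmod (\<beta> x * u x) \<partial>\<mu>) \<le> (\<integral>x. N * cmod (u x) \<partial>\<mu>)"
   using bi ui bd by (intro integral_mono) auto
  then have "CW * (\<integral>x. cmod (\<beta> x * u x) \<partial>\<mu>) \<le> CW * (\<integral>x. N * cmod (u x) \<partial>\<mu>)"
   using CW(1) by (rule mult_left_mono)
  then have le: "CW * (\<integral>x. cmod (\<beta> x * u x) \<partial>\<mu>) \<le> N * (CW * (\<integral>x. cmod (u x) \<partial>\<mu>))"
   by (simp add: ac_simps)
  have w1: "weak (N * (CW * (\<integral>x. cmod (u x) \<partial>\<mu>))) (\<lambda>x. \<beta> x * T u x)"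
   by (rule weak_bound_AE_le[OF CW(2)[rule_format, OF s u ui]]) (use bN N in \<open>auto simp: norm_mult mult_right_mono\<close>)
  have w2: "weak (N * (CW * (\<integral>x. cmod (u x) \<partial>\<mu>))) (T (\<lambda>x. \<beta> x * u x))"
   by (rule weak_bound_mono[OF CW(2)[rule_format, OF s bu bi] le])
  have "weak (N * (CW * (\<integral>x. cmod (u x) \<partial>\<mu>)) + cmod (- 1) * (N * (CW * (\<integral>x. cmod (u x) \<partial>\<mu>))))
   (\<lambda>x. \<beta> x * T u x + (- 1) * T (\<lambda>x. \<beta> x * u x) x)"
   by (rule weak_bound_add[OF w1 weak_bound_cmult[OF w2]])
  then show "weak (2 * CW * N * (\<integral>x. cmod (u x) \<partial>\<mu>)) (commutator \<beta> T u)"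
   by (simp add: commutator_def algebra_simps)
 qed
qed

section \<open>Independence of the decomposition\<close>

text \<open>On the set where \<open>b\<close> is at most \<open>k\<close> in modulus the truncation at
  \<open>N \<ge> k\<close> does not change the first term of the commutator. The difference is then
  \<open>T\<close> applied to \<open>\<eta> * (b * u)\<close> with \<open>|\<eta>| \<le> 1\<close> and
  \<open>\<eta>\<close> tending to \<open>0\<close>, and dominated convergence applies in each of the
  two spaces to whose sum \<open>b * u\<close> belongs.\<close>

lemma truncation_limit:
 assumes s: "admissible s" and bm: "bmeas b" and u: "u \<in> Lp s"
  and bu: "(\<lambda>x. b x * u x) \<in> Lp_sum_space \<mu> \<alpha>"
  and A: "A \<in> sets \<mu>" "emeasure \<mu> A < \<infinity>" "\<And>x. x \<in> A ==> cmod (b x) \<le> k"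
 shows "(\<lambda>N. \<integral>\<^sup>+x\<in>A. ennreal (cmod (commutator b T u x - commutator (\<lambda>x. disc_clamp N (b x)) T u x)) \<partial>\<mu>) \<longlonglongrightarrow> 0"
proof -
 obtain p1 p2 g1 g2 where p1: "p1 \<in> {1<..<1/\<alpha>}" and p2: "p2 \<in> {1<..<1/\<alpha>}" and g1: "g1 \<in> Lp p1"
  and g2: "g2 \<in> Lp p2" and eq: "(\<lambda>x. b x * u x) = (\<lambda>x. g1 x + g2 x)"
  using bu unfolding Lp_sum_space_def by blast
 have ad: "admissible p1" "admissible p2" using p1 p2 by (auto simp: admissible_def)
 note [measurable] = bm A(1)
 define \<eta> where "\<eta> N x = (b x - disc_clamp N (b x)) / b x" for N x
 have eb: "\<eta> N x * b x = b x - disc_clamp N (b x)" for N x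
  using disc_clamp(3)[of 0 N] by (auto simp: \<eta>_def)
 have e1: "cmod (\<eta> N x) \<le> 1" for N x
  using disc_clamp(4)[of "b x" N] by (auto simp: \<eta>_def norm_divide divide_le_eq_1)
 have em[measurable]: "\<eta> N \<in> borel_measurable \<mu>" for N unfolding \<eta>_def by measurable
 have Lp: "(\<lambda>x. \<eta> N x * g x) \<in> Lp t" if "admissible t" "g \<in> Lp t" for N t g
  by (rule Lp_multiplier[OF that(2) admissible_pos(1)[OF that(1)] em e1])
 have lim: "(\<lambda>N. \<integral>\<^sup>+x\<in>A. ennreal (cmod (T (\<lambda>x. \<eta> N x * g x) x)) \<partial>\<mu>) \<longlonglongrightarrow> 0"
  if t: "admissible t" and g: "g \<in> Lp t" for t g
 proof (rule T_tendsto_zero[OF t _ _ A(1,2)])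
  have tp: "0 < t" by (rule admissible_pos(1)[OF t])
  have gm[measurable]: "bmeas g" and gf: "tmass (\<lambda>x. cmod (g x) powr t) < \<infinity>"
   using g tp by (auto simp: Lp_space_iff)
  show "bmeas (\<lambda>x. \<eta> N x * g x)" for N by measurable
  have "(\<lambda>N. \<integral>\<^sup>+x. ennreal (cmod (\<eta> N x * g x) powr t) \<partial>\<mu>) \<longlonglongrightarrow> (\<integral>\<^sup>+x. 0 \<partial>\<mu>)"
  proof (rule nn_integral_dominated_convergence[where w = "\<lambda>x. ennreal (cmod (g x) powr t)"])
   show "AE x in \<mu>. ennreal (cmod (\<eta> N x * g x) powr t) \<le> ennreal (cmod (g x) powr t)" for N
   proof (rule AE_I2)
    fix x
    have "cmod (\<eta> N x * g x) \<le> cmod (g x)" using mult_right_mono[OF e1[of N x], of "cmod (g x)"] by (simp add: norm_mult)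
    then show "ennreal (cmod (\<eta> N x * g x) powr t) \<le> ennreal (cmod (g x) powr t)"
     using tp by (intro ennreal_leI powr_mono2) auto
   qed
   show "AE x in \<mu>. (\<lambda>N. ennreal (cmod (\<eta> N x * g x) powr t)) \<longlonglongrightarrow> 0"
   proof (rule AE_I2, rule tendsto_eventually)
    fix x
    show "eventually (\<lambda>N. ennreal (cmod (\<eta> N x * g x) powr t) = 0) sequentially"
     using eventually_ge_at_top[of "nat \<lceil>cmod (b x)\<rceil>"]
    proof eventually_elim
     case (elim N)
     then have "cmod (b x) \<le> real N" by linarith
     then have "disc_clamp N (b x) = b x" by (rule disc_clamp(3))
     then show ?case by (simp add: \<eta>_def)
    qed
   qed
  qed (use gf in measurable)
  then show "(\<lambda>N. \<integral>\<^sup>+x. ennreal (cmod (\<eta> N x * g x) powr t) \<partial>\<mu>) \<longlonglongrightarrow> 0" by simp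
 qed
 have up: "(\<lambda>N. (mass A (\<lambda>x. cmod (T (\<lambda>x. \<eta> N x * g1 x) x))) +
   (mass A (\<lambda>x. cmod (T (\<lambda>x. \<eta> N x * g2 x) x)))) \<longlonglongrightarrow> 0"
  using tendsto_add[OF lim[OF ad(1) g1] lim[OF ad(2) g2]] by simp
 show ?thesis
 proof (rule tendsto_sandwich[OF _ _ tendsto_const up])
  show "eventually (\<lambda>N. (mass A (\<lambda>x. cmod (commutator b T u x - commutator (\<lambda>x. disc_clamp N (b x)) T u x))) \<le>
   (mass A (\<lambda>x. cmod (T (\<lambda>x. \<eta> N x * g1 x) x))) + mass A (\<lambda>x. cmod (T (\<lambda>x. \<eta> N x * g2 x) x))) sequentially"
   using eventually_ge_at_top[of "nat \<lceil>k\<rceil>"]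
  proof eventually_elim
   case (elim N)
   have kN: "k \<le> real N" using elim by linarith
   have cu: "(\<lambda>x. disc_clamp N (b x) * u x) \<in> Lp s"
    by (rule Lp_multiplier[OF u admissible_pos(1)[OF s] _ disc_clamp(2)]) measurable
   have df: "AE x in \<mu>. T (\<lambda>y. b y * u y - disc_clamp N (b y) * u y) x = T (\<lambda>y. b y * u y) x - T (\<lambda>y. disc_clamp N (b y) * u y) x"
    by (rule T_diff[OF bu Lp_in_sum_space[OF s cu]])
   have "b y * u y - disc_clamp N (b y) * u y = 1 * (\<eta> N y * g1 y) + 1 * (\<eta> N y * g2 y)" for y
   proof -
    have "b y * u y - disc_clamp N (b y) * u y = \<eta> N y * (b y * u y)"
     unfolding mult.assoc[symmetric] eb by (simp add: left_diff_distrib)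
    also have "... = \<eta> N y * (g1 y + g2 y)" using fun_cong[OF eq, of y] by simp
    finally show ?thesis by (simp only: distrib_left mult_1)
   qed
   then have e: "(\<lambda>y. b y * u y - disc_clamp N (b y) * u y) = (\<lambda>y. 1 * (\<eta> N y * g1 y) + 1 * (\<eta> N y * g2 y))" by (rule ext)
   have sp: "AE x in \<mu>. T (\<lambda>y. 1 * (\<eta> N y * g1 y) + 1 * (\<eta> N y * g2 y)) x = 1 * T (\<lambda>y. \<eta> N y * g1 y) x + 1 * T (\<lambda>y. \<eta> N y * g2 y) x"
    by (rule T_linear[OF Lp_in_sum_space[OF ad(1) Lp[OF ad(1) g1]] Lp_in_sum_space[OF ad(2) Lp[OF ad(2) g2]]])
   note [measurable] = T_measurable[OF ad(1) Lp[OF ad(1) g1]] T_measurable[OF ad(2) Lp[OF ad(2) g2]]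
   have "mass A (\<lambda>x. cmod (commutator b T u x - commutator (\<lambda>x. disc_clamp N (b x)) T u x)) \<le>
    (\<integral>\<^sup>+x. ennreal (cmod (T (\<lambda>x. \<eta> N x * g1 x) x)) * indicator A x + ennreal (cmod (T (\<lambda>x. \<eta> N x * g2 x) x)) * indicator A x \<partial>\<mu>)"
   proof (rule nn_integral_mono_AE)
    show "AE x in \<mu>. ennreal (cmod (commutator b T u x - commutator (\<lambda>x. disc_clamp N (b x)) T u x)) * indicator A x \<le>
     ennreal (cmod (T (\<lambda>x. \<eta> N x * g1 x) x)) * indicator A x + ennreal (cmod (T (\<lambda>x. \<eta> N x * g2 x) x)) * indicator A x"
     using df sp unfolding e
    proof eventually_elim
     case (elim x)
     show ?case
     proof (cases "x \<in> A")
      case True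
      have "disc_clamp N (b x) = b x" using A(3)[OF True] kN by (intro disc_clamp(3)) simp
      then have "commutator b T u x - commutator (\<lambda>x. disc_clamp N (b x)) T u x
        = - (T (\<lambda>y. \<eta> N y * g1 y) x + T (\<lambda>y. \<eta> N y * g2 y) x)"
      proof -
       have "T (\<lambda>y. b y * u y) x - T (\<lambda>y. disc_clamp N (b y) * u y) x = T (\<lambda>y. \<eta> N y * g1 y) x + T (\<lambda>y. \<eta> N y * g2 y) x"
        using elim by simp
       then show ?thesis using \<open>disc_clamp N (b x) = b x\<close> by (simp only: commutator_def) (simp add: algebra_simps)
      qed
      then have "cmod (commutator b T u x - commutator (\<lambda>x. disc_clamp N (b x)) T u x)
        \<le> cmod (T (\<lambda>y. \<eta> N y * g1 y) x) + cmod (T (\<lambda>y. \<eta> N y * g2 y) x)"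
       by (simp only: norm_minus_cancel norm_triangle_ineq)
      then show ?thesis using True by (simp add: ennreal_leI flip: ennreal_plus)
     qed simp
    qed
   qed
   also have "... = mass A (\<lambda>x. cmod (T (\<lambda>x. \<eta> N x * g1 x) x)) + mass A (\<lambda>x. cmod (T (\<lambda>x. \<eta> N x * g2 x) x))"
    by (rule nn_integral_add) measurable
   finally show ?case .
  qed
 qed simp
qed

lemma commutator_minus_sum:
 assumes s: "admissible s" and bm: "bmeas \<beta>" and bN: "\<And>x. cmod (\<beta> x) \<le> N"
  and f: "f \<in> Lp s" and h: "\<And>i. h i \<in> Lp s"
 shows "(\<lambda>x. f x - (\<Sum>i<(n::nat). h i x)) \<in> Lp s"
  "AE x in \<mu>. commutator \<beta> T (\<lambda>x. f x - (\<Sum>i<n. h i x)) x = commutator \<beta> T f x - (\<Sum>i<n. commutator \<beta> T (h i) x)"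
proof (induction n)
 case 0
 case 1 show ?case using f by simp
 case 2 show ?case by simp
next
 case (Suc n)
 have e: "(\<lambda>x. f x - (\<Sum>i<Suc n. h i x)) = (\<lambda>x. 1 * (f x - (\<Sum>i<n. h i x)) + (- 1) * h n x)" by auto
 note L = Lp_multiplier[OF _ admissible_pos(1)[OF s] bm bN]
 case 1 show ?case unfolding e by (rule Lp_space_add[OF admissible_pos(1)[OF s] Suc(1) h])
 case 2 show ?case
  using commutator_linear[OF s Suc(1) L[OF Suc(1)] h[of n] L[OF h[of n]], of 1 "- 1"] Suc(2) unfolding e
  by eventually_elim simp
qed

definition good_series :: "('a => complex) => ('a => complex) => (nat => 'a => complex) => (nat => real) => bool" where
 "good_series b f h c \<longleftrightarrow> integrable \<mu> f \<and> (\<forall>i. good b (h i) (c i)) \<and> summable c \<and>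
  (\<lambda>n. \<integral>x. cmod (f x - (\<Sum>i<n. h i x)) \<partial>\<mu>) \<longlonglongrightarrow> 0"

lemma good_series_weak_bound:
 assumes "good_series b f h c"
 shows "AE x in \<mu>. summable (\<lambda>i. cmod (commutator b T (h i) x))"
  "weak (\<Sum>i. c i) (\<lambda>x. \<Sum>i. commutator b T (h i) x)"
  "weak (\<Sum>i. c (i + n)) (\<lambda>x. \<Sum>i. commutator b T (h (i + n)) x)"
proof -
 have c: "summable c" and U: "\<And>i. weak (c i) (commutator b T (h i))"
  using assms by (auto simp: good_series_def good_def)
 show "AE x in \<mu>. summable (\<lambda>i. cmod (commutator b T (h i) x))"
  "weak (\<Sum>i. c i) (\<lambda>x. \<Sum>i. commutator b T (h i) x)"
  "weak (\<Sum>i. c (i + n)) (\<lambda>x. \<Sum>i. commutator b T (h (i + n)) x)"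
  by (rule weak_bound_series[OF U c sigma_finite_mu])+
   (rule weak_bound_series(2)[OF U summable_ignore_initial_segment[OF c] sigma_finite_mu])
qed

text \<open>Decisive for the construction: the sum of the commutators of the blocks is the commutator
  of the sum, whenever the latter makes sense. The difference of the commutator of \<open>f\<close> and
  the first \<open>n\<close> terms is weakly bounded by the tail of the costs, on every bounded set
  where \<open>b\<close> is bounded. For truncated symbols this holds by continuity on
  \<open>L\<^sup>1\<close>; the truncation is then removed.\<close>

lemma good_series_consistent:
 assumes bm: "bmeas b" and gs: "good_series b f h c"
  and f: "f \<in> Lp_sum_space \<mu> \<alpha>" and bf: "(\<lambda>x. b x * f x) \<in> Lp_sum_space \<mu> \<alpha>"
 shows "AE x in \<mu>. commutator b T f x = (\<Sum>i. commutator b T (h i) x)"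
proof -
 have fi: "integrable \<mu> f" and gd: "\<And>i. good b (h i) (c i)" and c: "summable c"
  and lim: "(\<lambda>n. \<integral>x. cmod (f x - (\<Sum>i<n. h i x)) \<partial>\<mu>) \<longlonglongrightarrow> 0"
  using gs by (auto simp: good_series_def)
 have hp: "h i \<in> Lp p\<^sub>1" and hi: "integrable \<mu> (h i)" and bh: "(\<lambda>x. b x * h i x) \<in> Lp p\<^sub>1"
  and cU: "weak (c i) (commutator b T (h i))"
  and cN: "weak (c i) (commutator (\<lambda>x. disc_clamp N (b x)) T (h i))" for i N
  using gd[of i] by (auto simp: good_def)
 obtain q1 q2 f1 f2 where q: "q1 \<in> {1<..<1/\<alpha>}" "q2 \<in> {1<..<1/\<alpha>}" and f1: "f1 \<in> Lp q1"
  and f2: "f2 \<in> Lp q2" and fe: "f = (\<lambda>x. f1 x + f2 x)"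
  using f unfolding Lp_sum_space_def by blast
 define s where "s = min (min q1 q2) p\<^sub>1"
 have s: "admissible s" "1 \<le> s" "s \<le> q1" "s \<le> q2" "s \<le> p\<^sub>1"
  using q p1 by (auto simp: s_def admissible_def min_def)
 have fs: "f \<in> Lp s" by (rule Lp_sum_integrable[OF fi fe f1 f2 s(2,3,4)])
 have hs: "h i \<in> Lp s" for i
  by (rule Lp_sum_integrable[OF hi _ hp zero_Lp[of "p\<^sub>1"] s(2,5,5)]) simp
 define U where "U i = commutator b T (h i)" for i
 define GN where "GN N = commutator (\<lambda>x. disc_clamp N (b x)) T f" for N
 define VN where "VN N i = commutator (\<lambda>x. disc_clamp N (b x)) T (h i)" for N i
 have nm: "bmeas (\<lambda>x. disc_clamp N (b x))" for N using bm by measurable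
 have Um[measurable]: "U i \<in> borel_measurable \<mu>" "VN N i \<in> borel_measurable \<mu>" for i N
  unfolding U_def VN_def by (fact weak_boundD(1)[OF cU] weak_boundD(1)[OF cN])+
 have GNm[measurable]: "GN N \<in> borel_measurable \<mu>" for N
  unfolding GN_def by (rule commutator_measurable[OF s(1) nm fs Lp_multiplier[OF fs admissible_pos(1)[OF s(1)] nm disc_clamp(2)]])
 obtain r1 r2 k1 k2 where r: "r1 \<in> {1<..<1/\<alpha>}" "r2 \<in> {1<..<1/\<alpha>}" and k1: "k1 \<in> Lp r1"
  and k2: "k2 \<in> Lp r2" and ke: "(\<lambda>x. b x * f x) = (\<lambda>x. k1 x + k2 x)"
  using bf unfolding Lp_sum_space_def by blast
 have ra: "admissible r1" "admissible r2" using r by (auto simp: admissible_def)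
 \<comment> \<open>The function \<open>T (b f)\<close> is only known to agree almost everywhere with a
   measurable one, so a measurable version of the commutator is used.\<close>
 define G where "G x = b x * T f x - (T k1 x + T k2 x)" for x
 note [measurable] = bm T_measurable[OF s(1) fs] T_measurable[OF ra(1) k1] T_measurable[OF ra(2) k2]
 have Gm[measurable]: "bmeas G" unfolding G_def by measurable
 have Geq: "AE x in \<mu>. commutator b T f x = G x"
  using T_linear[OF Lp_in_sum_space[OF ra(1) k1] Lp_in_sum_space[OF ra(2) k2], of 1 1]
  by eventually_elim (simp add: commutator_def G_def ke)
 define tail where "tail n = (\<Sum>i. c (i + n))" for n
 have tail0: "tail \<longlonglongrightarrow> 0"
 proof -
  have "(\<lambda>n. (\<Sum>i. c i) - (\<Sum>i<n. c i)) \<longlonglongrightarrow> (\<Sum>i. c i) - (\<Sum>i. c i)"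
   by (intro tendsto_diff tendsto_const summable_LIMSEQ c)
  then show ?thesis unfolding tail_def using suminf_minus_initial_segment[OF c] by simp
 qed
 \<comment> \<open>The remainder \<open>f\<close> minus \<open>n\<close> terms is a later remainder,
   small in \<open>L\<^sup>1\<close>, plus finitely many further blocks, whose costs are part of the
   tail.\<close>
 have trunc: "weak (tail n) (\<lambda>x. GN N x - (\<Sum>i<n. VN N i x))" for n N
 proof -
  obtain CB where CB: "0 \<le> CB" "\<forall>\<beta> N s u. admissible s --> u \<in> Lp s --> integrable \<mu> u -->
   \<beta> \<in> borel_measurable \<mu> --> (\<forall>x. cmod (\<beta> x) \<le> N) -->
   weak (CB * N * (\<integral>x. cmod (u x) \<partial>\<mu>)) (commutator \<beta> T u)"
   using bounded_commutator_weak_bound by (elim exE conjE) (rule that)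
  define e where "e m = CB * real N * (\<integral>x. cmod (f x - (\<Sum>i<m. h i x)) \<partial>\<mu>)" for m
  have e0: "e \<longlonglongrightarrow> 0" using tendsto_mult[OF tendsto_const lim, of "CB * real N"] by (simp add: e_def[abs_def])
  have em: "weak (e m) (\<lambda>x. GN N x - (\<Sum>i<m. VN N i x))" for m
  proof -
   note cm = commutator_minus_sum[OF s(1) nm[of N] disc_clamp(2) fs, of h m, OF hs]
   have "integrable \<mu> (\<lambda>x. f x - (\<Sum>i<m. h i x))" using fi hi by auto
   then have "weak (e m) (commutator (\<lambda>x. disc_clamp N (b x)) T (\<lambda>x. f x - (\<Sum>i<m. h i x)))"
    unfolding e_def by (intro CB(2)[rule_format, OF s(1) cm(1) _ nm disc_clamp(2)])
   then show ?thesis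
   proof (rule weak_bound_cong_AE)
    show "bmeas (\<lambda>x. GN N x - (\<Sum>i<m. VN N i x))" by measurable
    show "AE x in \<mu>. GN N x - (\<Sum>i<m. VN N i x) = commutator (\<lambda>x. disc_clamp N (b x)) T (\<lambda>x. f x - (\<Sum>i<m. h i x)) x"
     using cm(2) by eventually_elim (simp add: GN_def VN_def)
   qed
  qed
  have sp: "(\<Sum>i<j + n. (a i :: complex)) = (\<Sum>i<n. a i) + (\<Sum>i<j. a (i + n))" for a j
   by (induction j) (auto simp: algebra_simps)
  show ?thesis
  proof (rule weak_bound_tendsto)
   fix j
   have "weak (e (j + n) + (\<Sum>i<j. c (i + n))) (\<lambda>x. (GN N x - (\<Sum>i<j + n. VN N i x)) + (\<Sum>i<j. VN N (i + n) x))"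
    by (intro weak_bound_add weak_bound_sum em) (simp add: VN_def cN)
   then show "weak (e (j + n) + (\<Sum>i<j. c (i + n))) (\<lambda>x. GN N x - (\<Sum>i<n. VN N i x))"
    by (simp add: sp)
  next
   have "(\<lambda>j. e (j + n) + (\<Sum>i<j. c (i + n))) \<longlonglongrightarrow> 0 + tail n"
    unfolding tail_def by (intro tendsto_add LIMSEQ_ignore_initial_segment e0 summable_LIMSEQ summable_ignore_initial_segment c)
   then show "(\<lambda>j. e (j + n) + (\<Sum>i<j. c (i + n))) \<longlonglongrightarrow> tail n" by simp
  qed
 qed
 note ser = good_series_weak_bound[OF gs, folded U_def]
 \<comment> \<open>Where \<open>b\<close> is bounded the truncated commutators converge, and the tail
   bound survives.\<close>
 have local: "AE x in \<mu>. x \<in> A --> G x - (\<Sum>i. U i x) = 0"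
  if A: "A \<in> sets \<mu>" "emeasure \<mu> A < \<infinity>" "\<And>x. x \<in> A ==> cmod (b x) \<le> k" for A k
 proof -
  note [measurable] = A(1)
  have limf: "(\<lambda>N. \<integral>\<^sup>+x\<in>A. ennreal (cmod (G x - GN N x)) \<partial>\<mu>) \<longlonglongrightarrow> 0"
  proof -
   have "mass A (\<lambda>x. cmod (G x - GN N x)) = mass A (\<lambda>x. cmod (commutator b T f x - commutator (\<lambda>x. disc_clamp N (b x)) T f x))" for N
   proof (rule nn_integral_cong_AE)
    show "AE x in \<mu>. ennreal (cmod (G x - GN N x)) * indicator A x = ennreal (cmod (commutator b T f x - commutator (\<lambda>x. disc_clamp N (b x)) T f x)) * indicator A x"
     using Geq by eventually_elim (simp add: GN_def)
   qed
   then show ?thesis using truncation_limit[OF s(1) bm fs bf A] by simp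
  qed
  have limh: "(\<lambda>N. \<integral>\<^sup>+x\<in>A. ennreal (cmod (U i x - VN N i x)) \<partial>\<mu>) \<longlonglongrightarrow> 0" for i
   unfolding U_def VN_def by (rule truncation_limit[OF p1(3) bm hp Lp_in_sum_space[OF p1(3) bh] A])
  have W: "weak (tail n) (\<lambda>x. indicator A x * (G x - (\<Sum>i<n. U i x)))" for n
  proof (rule weak_bound_limit[where D = "\<lambda>_. tail n" and f = "\<lambda>N x. indicator A x * (GN N x - (\<Sum>i<n. VN N i x))"])
   show "bmeas (\<lambda>x. indicator A x * (G x - (\<Sum>i<n. U i x)))" by measurable
   show "weak (tail n) (\<lambda>x. indicator A x * (GN N x - (\<Sum>i<n. VN N i x)))" for N
   proof -
    have "weak (1 * tail n) (\<lambda>x. indicator A x * (GN N x - (\<Sum>i<n. VN N i x)))"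
     by (rule weak_bound_AE_le[OF trunc]) (measurable, auto simp: indicator_def)
    then show ?thesis by simp
   qed
   fix B assume B[measurable]: "B \<in> sets \<mu>"
   have up: "(\<lambda>N. (mass A (\<lambda>x. cmod (G x - GN N x))) + (\<Sum>i<n. \<integral>\<^sup>+x\<in>A. ennreal (cmod (U i x - VN N i x)) \<partial>\<mu>)) \<longlonglongrightarrow> 0"
    using tendsto_add[OF limf tendsto_sum[of "{..<n}", OF limh]] by simp
   show "(\<lambda>N. \<integral>\<^sup>+x\<in>B. ennreal (cmod (indicator A x * (G x - (\<Sum>i<n. U i x)) - indicator A x * (GN N x - (\<Sum>i<n. VN N i x)))) \<partial>\<mu>) \<longlonglongrightarrow> 0"
   proof (rule tendsto_sandwich[OF _ _ tendsto_const up])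
    show "eventually (\<lambda>N. (mass B (\<lambda>x. cmod (indicator A x * (G x - (\<Sum>i<n. U i x)) - indicator A x * (GN N x - (\<Sum>i<n. VN N i x))))) \<le>
     (mass A (\<lambda>x. cmod (G x - GN N x))) + (\<Sum>i<n. \<integral>\<^sup>+x\<in>A. ennreal (cmod (U i x - VN N i x)) \<partial>\<mu>)) sequentially"
    proof (rule always_eventually, rule allI)
     fix N
     have "mass B (\<lambda>x. cmod (indicator A x * (G x - (\<Sum>i<n. U i x)) - indicator A x * (GN N x - (\<Sum>i<n. VN N i x)))) \<le>
      (\<integral>\<^sup>+x. ennreal (cmod (G x - GN N x)) * indicator A x + (\<Sum>i<n. ennreal (cmod (U i x - VN N i x)) * indicator A x) \<partial>\<mu>)"
     proof (rule nn_integral_mono)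
      fix x
      show "ennreal (cmod (indicator A x * (G x - (\<Sum>i<n. U i x)) - indicator A x * (GN N x - (\<Sum>i<n. VN N i x)))) * indicator B x \<le>
       ennreal (cmod (G x - GN N x)) * indicator A x + (\<Sum>i<n. ennreal (cmod (U i x - VN N i x)) * indicator A x)"
      proof (cases "x \<in> A")
       case True
       have "(G x - (\<Sum>i<n. U i x)) - (GN N x - (\<Sum>i<n. VN N i x)) = (G x - GN N x) - (\<Sum>i<n. U i x - VN N i x)"
        by (simp add: sum_subtractf)
       then have "cmod ((G x - (\<Sum>i<n. U i x)) - (GN N x - (\<Sum>i<n. VN N i x))) \<le> cmod (G x - GN N x) + cmod (\<Sum>i<n. U i x - VN N i x)"
        using norm_triangle_ineq4 by metis
       moreover have "cmod (\<Sum>i<n. U i x - VN N i x) \<le> (\<Sum>i<n. cmod (U i x - VN N i x))" by (rule norm_sum)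
       ultimately have "cmod ((G x - (\<Sum>i<n. U i x)) - (GN N x - (\<Sum>i<n. VN N i x))) \<le> cmod (G x - GN N x) + (\<Sum>i<n. cmod (U i x - VN N i x))"
        by linarith
       then have "ennreal (cmod ((G x - (\<Sum>i<n. U i x)) - (GN N x - (\<Sum>i<n. VN N i x)))) \<le> ennreal (cmod (G x - GN N x) + (\<Sum>i<n. cmod (U i x - VN N i x)))"
        by (rule ennreal_leI)
       then have "ennreal (cmod ((G x - (\<Sum>i<n. U i x)) - (GN N x - (\<Sum>i<n. VN N i x)))) \<le> ennreal (cmod (G x - GN N x)) + (\<Sum>i<n. ennreal (cmod (U i x - VN N i x)))"
        by (subst sum_ennreal) (auto simp: sum_nonneg)
       then show ?thesis using True by (cases "x \<in> B") auto
      qed simp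
     qed
     also have "... = mass A (\<lambda>x. cmod (G x - GN N x)) + (\<Sum>i<n. \<integral>\<^sup>+x\<in>A. ennreal (cmod (U i x - VN N i x)) \<partial>\<mu>)"
     proof -
      have "(\<integral>\<^sup>+x. (\<Sum>i<n. ennreal (cmod (U i x - VN N i x)) * indicator A x) \<partial>\<mu>) = (\<Sum>i<n. \<integral>\<^sup>+x\<in>A. ennreal (cmod (U i x - VN N i x)) \<partial>\<mu>)"
       by (rule nn_integral_sum) measurable
      moreover have "(\<integral>\<^sup>+x. ennreal (cmod (G x - GN N x)) * indicator A x + (\<Sum>i<n. ennreal (cmod (U i x - VN N i x)) * indicator A x) \<partial>\<mu>) =
       (mass A (\<lambda>x. cmod (G x - GN N x))) + (\<integral>\<^sup>+x. (\<Sum>i<n. ennreal (cmod (U i x - VN N i x)) * indicator A x) \<partial>\<mu>)"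
       by (rule nn_integral_add) measurable
      ultimately show ?thesis by (simp only:)
     qed
     finally show "mass B (\<lambda>x. cmod (indicator A x * (G x - (\<Sum>i<n. U i x)) - indicator A x * (GN N x - (\<Sum>i<n. VN N i x)))) \<le>
      (mass A (\<lambda>x. cmod (G x - GN N x))) + (\<Sum>i<n. \<integral>\<^sup>+x\<in>A. ennreal (cmod (U i x - VN N i x)) \<partial>\<mu>)" .
    qed
   qed simp
  qed (rule tendsto_const)
  have "weak (tail n + cmod (- 1) * (1 * tail n)) (\<lambda>x. indicator A x * (G x - (\<Sum>i. U i x)))" for n
  proof (rule weak_bound_cong_AE)
   have "weak (1 * tail n) (\<lambda>x. indicator A x * (\<Sum>i. U (i + n) x))"
    by (rule weak_bound_AE_le[OF ser(3)[of n, folded tail_def]]) (measurable, auto simp: indicator_def)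
   then show "weak (tail n + cmod (- 1) * (1 * tail n)) (\<lambda>x. indicator A x * (G x - (\<Sum>i<n. U i x)) + (- 1) * (indicator A x * (\<Sum>i. U (i + n) x)))"
    by (rule weak_bound_add[OF W weak_bound_cmult])
   show "bmeas (\<lambda>x. indicator A x * (G x - (\<Sum>i. U i x)))" by measurable
   show "AE x in \<mu>. indicator A x * (G x - (\<Sum>i. U i x)) = indicator A x * (G x - (\<Sum>i<n. U i x)) + (- 1) * (indicator A x * (\<Sum>i. U (i + n) x))"
    using ser(1)
   proof eventually_elim
    case (elim x)
    have "(\<Sum>i. U (i + n) x) = (\<Sum>i. U i x) - (\<Sum>i<n. U i x)"
     by (rule suminf_minus_initial_segment[OF summable_norm_cancel[OF elim]])
    then show ?case by (simp only: right_diff_distrib) (simp add: algebra_simps)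
   qed
  qed
  moreover have "(\<lambda>n. tail n + cmod (- 1) * (1 * tail n)) \<longlonglongrightarrow> 0 + cmod (- 1) * (1 * 0)"
   by (intro tendsto_add tendsto_mult tendsto_const tail0)
  ultimately have "weak (0 + cmod (- 1) * (1 * 0)) (\<lambda>x. indicator A x * (G x - (\<Sum>i. U i x)))"
   by (rule weak_bound_tendsto)
  then have "weak 0 (\<lambda>x. indicator A x * (G x - (\<Sum>i. U i x)))" by simp
  from weak_bound_zero[OF this A(1,2)] show ?thesis
   by eventually_elim auto
 qed
 define x0 :: 'a where "x0 = undefined"
 define A where "A k = ball x0 (real k) \<inter> {x. cmod (b x) \<le> real k}" for k :: nat
 have "AE x in \<mu>. x \<in> A k --> G x - (\<Sum>i. U i x) = 0" for k
 proof (rule local)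
  have "{x \<in> space \<mu>. cmod (b x) \<le> real k} \<in> sets \<mu>" by measurable
  then show As: "A k \<in> sets \<mu>" unfolding A_def by (intro sets.Int) auto
  have "emeasure \<mu> (A k) \<le> emeasure \<mu> (ball x0 (real k))" by (rule emeasure_mono) (auto simp: A_def)
  then show "emeasure \<mu> (A k) < \<infinity>" using emeasure_ball_finite by (rule order_le_less_trans)
  show "cmod (b x) \<le> real k" if "x \<in> A k" for x using that by (simp add: A_def)
 qed
 then have "AE x in \<mu>. \<forall>k. x \<in> A k --> G x - (\<Sum>i. U i x) = 0"
  unfolding AE_all_countable by (rule allI)
 then show ?thesis
  using Geq
 proof eventually_elim
  case (elim x)
  obtain k where k: "max (dist x0 x + 1) (cmod (b x)) < real k" using reals_Archimedean2 by blast
  then have "x \<in> A k" by (auto simp: A_def)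
  then show ?case using elim by (auto simp: U_def)
 qed
qed

lemma good_series_combine:
 assumes bm: "bmeas b" and f: "good_series b f h c" and g: "good_series b g k d"
 shows "good_series b (\<lambda>x. z * f x + w * g x) (\<lambda>i x. z * h i x + w * k i x) (\<lambda>i. cmod z * c i + cmod w * d i)"
  "AE x in \<mu>. (\<Sum>i. commutator b T (\<lambda>x. z * h i x + w * k i x) x)
   = z * (\<Sum>i. commutator b T (h i) x) + w * (\<Sum>i. commutator b T (k i) x)"
proof -
 have fi: "integrable \<mu> f" "integrable \<mu> g" and gd: "\<And>i. good b (h i) (c i)" "\<And>i. good b (k i) (d i)"
  and sm: "summable c" "summable d"
  and lim: "(\<lambda>n. \<integral>x. cmod (f x - (\<Sum>i<n. h i x)) \<partial>\<mu>) \<longlonglongrightarrow> 0" "(\<lambda>n. \<integral>x. cmod (g x - (\<Sum>i<n. k i x)) \<partial>\<mu>) \<longlonglongrightarrow> 0"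
  using f g by (auto simp: good_series_def)
 have hi: "integrable \<mu> (h i)" "integrable \<mu> (k i)" for i using gd[of i] by (auto simp: good_def)
 show "good_series b (\<lambda>x. z * f x + w * g x) (\<lambda>i x. z * h i x + w * k i x) (\<lambda>i. cmod z * c i + cmod w * d i)"
  unfolding good_series_def
 proof (intro conjI allI)
  show "integrable \<mu> (\<lambda>x. z * f x + w * g x)" using fi by auto
  show "good b (\<lambda>x. z * h i x + w * k i x) (cmod z * c i + cmod w * d i)" for i by (rule good_combine[OF bm gd])
  show "summable (\<lambda>i. cmod z * c i + cmod w * d i)" using sm by (intro summable_add summable_mult)
  have up: "(\<lambda>n. cmod z * (\<integral>x. cmod (f x - (\<Sum>i<n. h i x)) \<partial>\<mu>) + cmod w * (\<integral>x. cmod (g x - (\<Sum>i<n. k i x)) \<partial>\<mu>)) \<longlonglongrightarrow> 0"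
   using tendsto_add[OF tendsto_mult[OF tendsto_const lim(1)] tendsto_mult[OF tendsto_const lim(2)], of "cmod z" "cmod w"] by simp
  show "(\<lambda>n. \<integral>x. cmod (z * f x + w * g x - (\<Sum>i<n. z * h i x + w * k i x)) \<partial>\<mu>) \<longlonglongrightarrow> 0"
  proof (rule tendsto_sandwich[OF _ _ tendsto_const up])
   show "eventually (\<lambda>n. (\<integral>x. cmod (z * f x + w * g x - (\<Sum>i<n. z * h i x + w * k i x)) \<partial>\<mu>) \<le>
    cmod z * (\<integral>x. cmod (f x - (\<Sum>i<n. h i x)) \<partial>\<mu>) + cmod w * (\<integral>x. cmod (g x - (\<Sum>i<n. k i x)) \<partial>\<mu>)) sequentially"
   proof (rule always_eventually, rule allI)
    fix n
    have e: "z * f x + w * g x - (\<Sum>i<n. z * h i x + w * k i x) = z * (f x - (\<Sum>i<n. h i x)) + w * (g x - (\<Sum>i<n. k i x))" for x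
     by (simp add: sum.distrib sum_distrib_left algebra_simps)
    have "(\<integral>x. cmod (z * f x + w * g x - (\<Sum>i<n. z * h i x + w * k i x)) \<partial>\<mu>) \<le>
     (\<integral>x. cmod z * cmod (f x - (\<Sum>i<n. h i x)) + cmod w * cmod (g x - (\<Sum>i<n. k i x)) \<partial>\<mu>)"
     unfolding e
    proof (rule integral_mono)
     fix x
     show "cmod (z * (f x - (\<Sum>i<n. h i x)) + w * (g x - (\<Sum>i<n. k i x))) \<le> cmod z * cmod (f x - (\<Sum>i<n. h i x)) + cmod w * cmod (g x - (\<Sum>i<n. k i x))"
      using norm_triangle_ineq[of "z * (f x - (\<Sum>i<n. h i x))" "w * (g x - (\<Sum>i<n. k i x))"] by (simp add: norm_mult)
    qed (use fi hi in auto)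
    also have "... = cmod z * (\<integral>x. cmod (f x - (\<Sum>i<n. h i x)) \<partial>\<mu>) + cmod w * (\<integral>x. cmod (g x - (\<Sum>i<n. k i x)) \<partial>\<mu>)"
     using fi hi by (subst Bochner_Integration.integral_add) auto
    finally show "(\<integral>x. cmod (z * f x + w * g x - (\<Sum>i<n. z * h i x + w * k i x)) \<partial>\<mu>) \<le>
     cmod z * (\<integral>x. cmod (f x - (\<Sum>i<n. h i x)) \<partial>\<mu>) + cmod w * (\<integral>x. cmod (g x - (\<Sum>i<n. k i x)) \<partial>\<mu>)" .
   qed
  qed simp
 qed
 have "AE x in \<mu>. commutator b T (\<lambda>x. z * h i x + w * k i x) x = z * commutator b T (h i) x + w * commutator b T (k i) x" for i
  using gd[of i] by (intro commutator_linear[OF p1(3)]) (auto simp: good_def)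
 then have "AE x in \<mu>. \<forall>i. commutator b T (\<lambda>x. z * h i x + w * k i x) x = z * commutator b T (h i) x + w * commutator b T (k i) x"
  unfolding AE_all_countable by (rule allI)
 then show "AE x in \<mu>. (\<Sum>i. commutator b T (\<lambda>x. z * h i x + w * k i x) x)
   = z * (\<Sum>i. commutator b T (h i) x) + w * (\<Sum>i. commutator b T (k i) x)"
  using good_series_weak_bound(1)[OF f] good_series_weak_bound(1)[OF g]
 proof eventually_elim
  case (elim x)
  have "(\<lambda>i. z * commutator b T (h i) x + w * commutator b T (k i) x) sums
    (z * (\<Sum>i. commutator b T (h i) x) + w * (\<Sum>i. commutator b T (k i) x))"
   by (rule sums_add[OF sums_mult[OF summable_sums[OF summable_norm_cancel[OF elim(2)]]]
      sums_mult[OF summable_sums[OF summable_norm_cancel[OF elim(3)]]]])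
  then show ?case using elim(1) by (simp add: sums_iff)
 qed
qed

text \<open>Consistency for the zero function, applied to the termwise difference of the two
  sides.\<close>

lemma good_series_linear:
 assumes bm: "bmeas b" and f: "good_series b f h c" and g: "good_series b g k d"
  and l: "good_series b (\<lambda>x. z * f x + w * g x) l e"
 shows "AE x in \<mu>. (\<Sum>i. commutator b T (l i) x) = z * (\<Sum>i. commutator b T (h i) x) + w * (\<Sum>i. commutator b T (k i) x)"
proof -
 note C = good_series_combine[OF bm f g, of z w]
 note D = good_series_combine[OF bm C(1) l, of 1 "- 1"]
 have zero: "(\<lambda>x. 0) \<in> Lp_sum_space \<mu> \<alpha>" by (rule Lp_in_sum_space[OF p zero_Lp])
 have D1: "good_series b (\<lambda>x. 0) (\<lambda>i x. 1 * (z * h i x + w * k i x) + (- 1) * l i x) (\<lambda>i. cmod 1 * (cmod z * c i + cmod w * d i) + cmod (- 1) * e i)"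
  using D(1) by simp
 have "AE x in \<mu>. commutator b T (\<lambda>x. 0) x = (\<Sum>i. commutator b T (\<lambda>x. 1 * (z * h i x + w * k i x) + (- 1) * l i x) x)"
  by (rule good_series_consistent[OF bm D1 zero]) (use zero in simp)
 then show ?thesis
  using C(2) D(2) T_zero by eventually_elim (simp add: commutator_def)
qed

section \<open>The commutator on the Hardy space\<close>

text \<open>By \<open>good_series_linear\<close> the choice of the series changes the sum on a null set
  only. An arbitrary choice may therefore be made separately for each \<open>f\<close>, without any
  loss of linearity.\<close>

definition hardy_commutator :: "('a => complex) => ('a => complex) => 'a => complex" where
 "hardy_commutator b f x = (\<Sum>i. commutator b T ((SOME h. \<exists>c. good_series b f h c) i) x)"

lemma hardy_commutator_eq:
 assumes bm: "bmeas b" and f: "good_series b f h c"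
 shows "AE x in \<mu>. hardy_commutator b f x = (\<Sum>i. commutator b T (h i) x)"
  "weak (\<Sum>i. c i) (hardy_commutator b f)"
proof -
 define k where "k = (SOME h. \<exists>c. good_series b f h c)"
 have "\<exists>c. good_series b f k c" unfolding k_def by (rule someI[of _ h]) (use f in blast)
 then obtain d where k: "good_series b f k d" by (elim exE)
 have hc: "hardy_commutator b f = (\<lambda>x. \<Sum>i. commutator b T (k i) x)" by (auto simp: hardy_commutator_def k_def)
 have "good_series b (\<lambda>x. 1 * f x + 0 * f x) k d" using k by simp
 from good_series_linear[OF bm f f this]
 show eq: "AE x in \<mu>. hardy_commutator b f x = (\<Sum>i. commutator b T (h i) x)" by (simp add: hc)
 show "weak (\<Sum>i. c i) (hardy_commutator b f)"
  by (rule weak_bound_cong_AE[OF good_series_weak_bound(2)[OF f] _ eq])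
   (use weak_boundD(1)[OF good_series_weak_bound(2)[OF k]] in \<open>simp add: hc\<close>)
qed

lemma extends_hardy_commutator:
 assumes bm: "bmeas b" and H: "\<And>f. f \<in> H ==> \<exists>h c. good_series b f h c"
 shows "extends_commutator \<mu> \<alpha> b T H (hardy_commutator b)"
 unfolding extends_commutator_def linear_ae_on_def
proof (intro conjI ballI allI impI)
 fix f g z w assume fg: "f \<in> H" "g \<in> H"
 obtain h c where f: "good_series b f h c" using H[OF fg(1)] by (elim exE)
 obtain k d where g: "good_series b g k d" using H[OF fg(2)] by (elim exE)
 note C = good_series_combine[OF bm f g, of z w]
 show "AE x in \<mu>. hardy_commutator b (\<lambda>y. z * f y + w * g y) x = z * hardy_commutator b f x + w * hardy_commutator b g x"
  using hardy_commutator_eq(1)[OF bm C(1)] C(2) hardy_commutator_eq(1)[OF bm f] hardy_commutator_eq(1)[OF bm g]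
  by eventually_elim simp
next
 fix f assume fH: "f \<in> H" and f: "f \<in> Lp_sum_space \<mu> \<alpha>" "(\<lambda>x. b x * f x) \<in> Lp_sum_space \<mu> \<alpha>"
 obtain h c where gs: "good_series b f h c" using H[OF fH] by (elim exE)
 show "AE x in \<mu>. hardy_commutator b f x = commutator b T f x"
  using hardy_commutator_eq(1)[OF bm gs] good_series_consistent[OF bm gs f] by eventually_elim simp
qed

lemma H1_good_series:
 "\<exists>C\<ge>0. \<forall>b m L. 0 < L --> regular_means (\<lambda>x. b x / of_real L) m -->
  (\<forall>q \<gamma> f s. ennreal p < q --> 1 \<le> \<gamma> --> integrable \<mu> f --> s \<in> H1_costs \<mu> lam q \<gamma> \<rho> f -->
   (\<exists>h c. good_series b f h c \<and> suminf c = C * L * s))"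
proof -
 obtain C where C: "0 \<le> C" "\<forall>b m L. 0 < L --> regular_means (\<lambda>x. b x / of_real L) m -->
  (\<forall>l1 l2 h. block l1 l2 h --> good b h (C * L * (cmod l1 + cmod l2)))"
  using block_good by (elim exE conjE) (rule that)
 show ?thesis
 proof (intro exI[of _ C] conjI C(1) allI impI)
  fix b :: "'a => complex" and m L q \<gamma> f s
  assume L: "0 < L" and rm: "regular_means (\<lambda>x. b x / of_real L) m" and q: "ennreal p < q" and \<gamma>: "1 \<le> (\<gamma>::real)"
   and fi: "integrable \<mu> f" and s: "s \<in> H1_costs \<mu> lam q \<gamma> \<rho> f"
  obtain h l1 l2 where ab: "\<forall>i::nat. atomic_block \<mu> lam q \<gamma> \<rho> (h i) (l1 i) (l2 i)"
   and lim: "(\<lambda>n. \<integral>x. cmod (f x - (\<Sum>i<n. h i x)) \<partial>\<mu>) \<longlonglongrightarrow> 0"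
   and sm: "(\<lambda>i. cmod (l1 i) + cmod (l2 i)) sums s"
   using s unfolding H1_costs_def mem_Collect_eq by (elim exE conjE) (rule that)
  have gd: "good b (h i) (C * L * (cmod (l1 i) + cmod (l2 i)))" for i
   by (rule C(2)[rule_format, OF L rm atomic_block_block[OF ab[rule_format] q \<gamma>]])
  have ss: "(\<lambda>i. C * L * (cmod (l1 i) + cmod (l2 i))) sums (C * L * s)" by (rule sums_mult[OF sm])
  show "\<exists>h c. good_series b f h c \<and> suminf c = C * L * s"
   unfolding good_series_def
   by (intro exI[of _ h] exI[of _ "\<lambda>i. C * L * (cmod (l1 i) + cmod (l2 i))"] conjI allI fi gd lim sums_summable[OF ss] sums_unique[OF ss, symmetric])
 qed
qed

end

text \<open>Normalisation of the symbol. If the dilated ball is null, the quotient in the hypothesis is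
  infinite unless the oscillation vanishes.\<close>

lemma (in regular_mean_exponents) RBMO_bounds_regular_means:
 assumes L: "L \<in> RBMO_bounds \<mu> lam \<gamma>\<^sub>b \<rho>\<^sub>b b" and bm: "bmeas b"
 shows "0 < L" "\<exists>m. regular_means (\<lambda>x. b x / of_real L) m"
proof -
 show L0: "0 < L" using L by (simp add: RBMO_bounds_def)
 obtain m where m1: "\<forall>c. \<forall>r>0. (mass (ball c r) (\<lambda>x. cmod (b x - m c r))) / emeasure \<mu> (ball c (\<rho>\<^sub>b * r)) \<le> ennreal L"
  and m2: "\<forall>c r c1 r1. 0 < r --> 0 < r1 --> ball c r \<subseteq> ball c1 r1 --> cmod (m c r - m c1 r1) \<le> L * K_tilde \<mu> lam \<rho>\<^sub>b c r r1 powr \<gamma>\<^sub>b"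
  using L unfolding RBMO_bounds_def mem_Collect_eq by (elim exE conjE) (rule that)
 have nd: "cmod (z / of_real L - w / of_real L) = cmod (z - w) / L" for z w
  using L0 by (simp add: norm_divide diff_divide_distrib[symmetric])
 have "regular_means (\<lambda>x. b x / of_real L) (\<lambda>c r. m c r / of_real L)"
  unfolding regular_means_def nd
 proof (intro conjI allI impI)
  note [measurable] = bm
  show "bmeas (\<lambda>x. b x / of_real L)" by measurable
  fix c :: 'a and r :: real assume r: "0 < r"
  define e where "e = emeasure \<mu> (ball c (\<rho>\<^sub>b * r))"
  define I where "I = mass (ball c r) (\<lambda>x. cmod (b x - m c r))"
  have le: "I / e \<le> ennreal L" using m1 r unfolding I_def e_def by blast
  have e: "e \<noteq> top" unfolding e_def using emeasure_ball_finite by (simp add: less_top)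
  have "I \<le> ennreal L * e"
  proof (cases "e = 0")
   case True
   then have "I = 0" using le by (cases "I = 0") (auto simp: ennreal_divide_zero top_unique)
   then show ?thesis by simp
  next
   case False
   have "I = I / e * e" using False e by (simp add: ennreal_divide_times less_top)
   also have "... \<le> ennreal L * e" using le by (rule mult_right_mono) simp
   finally show ?thesis .
  qed
  then have "ennreal (1 / L) * I \<le> ennreal (1 / L) * (ennreal L * e)" by (rule mult_left_mono) simp
  also have "... = e" using L0 by (simp add: mult.assoc[symmetric] ennreal_mult[symmetric])
  finally have "ennreal (1 / L) * I \<le> e" .
  moreover have "mass (ball c r) (\<lambda>x. cmod (b x - m c r) / L) = ennreal (1 / L) * I"
  proof -
   have "ennreal (cmod (b x - m c r) / L) * indicator (ball c r) x = ennreal (1 / L) * (ennreal (cmod (b x - m c r)) * indicator (ball c r) x)" for x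
    using L0 by (simp add: mult.assoc[symmetric] ennreal_mult[symmetric])
   then show ?thesis unfolding I_def by (simp add: nn_integral_cmult)
  qed
  ultimately show "mass (ball c r) (\<lambda>x. cmod (b x - m c r) / L) \<le> emeasure \<mu> (ball c (\<rho>\<^sub>b * r))"
   by (simp add: e_def)
 next
  fix c c1 :: 'a and r r1 :: real assume h: "0 < r" "0 < r1" "ball c r \<subseteq> ball c1 r1"
  have "cmod (m c r - m c1 r1) \<le> L * K_tilde \<mu> lam \<rho>\<^sub>b c r r1 powr \<gamma>\<^sub>b" using m2 h by blast
  then show "cmod (m c r - m c1 r1) / L \<le> K_tilde \<mu> lam \<rho>\<^sub>b c r r1 powr \<gamma>\<^sub>b" using L0 by (simp add: field_simps)
 qed
 then show "\<exists>m. regular_means (\<lambda>x. b x / of_real L) m" by blast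
qed

text \<open>The bound for each admissible pair of constants passes to the product of the two
  infima.\<close>

lemma le_mult_Inf_Inf:
 fixes A S :: "real set"
 assumes "A \<noteq> {}" "S \<noteq> {}" and A: "\<And>a. a \<in> A ==> 0 < a" and S: "\<And>s. s \<in> S ==> 0 \<le> s" and D: "0 < D"
  and le: "\<And>a s. a \<in> A ==> s \<in> S ==> M \<le> D * a * s"
 shows "M \<le> D * Inf A * Inf S"
proof -
 have S0: "0 \<le> Inf S" using assms by (intro cInf_greatest) auto
 have 1: "M \<le> D * a * Inf S" if a: "a \<in> A" for a
 proof -
  have "M / (D * a) \<le> Inf S"
  proof (rule cInf_greatest[OF assms(2)])
   fix s assume "s \<in> S"
   from le[OF a this] show "M / (D * a) \<le> s" using A[OF a] D by (simp add: field_simps)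
  qed
  then show ?thesis using A[OF a] D by (simp add: field_simps)
 qed
 show ?thesis
 proof (cases "Inf S = 0")
  case True
  obtain a where "a \<in> A" using assms(1) by blast
  from 1[OF this] show ?thesis using True by simp
 next
  case False
  have "M / (D * Inf S) \<le> Inf A"
  proof (rule cInf_greatest[OF assms(1)])
   fix a assume "a \<in> A"
   from 1[OF this] show "M / (D * Inf S) \<le> a" using False S0 D by (simp add: field_simps)
  qed
  then show ?thesis using False S0 D by (simp add: field_simps)
 qed
qed

theorem theorem4p2:
  fixes \<mu> :: "'a::metric_space measure"
    and lam :: "'a \<Rightarrow> real \<Rightarrow> real"
    and \<alpha> \<rho>\<^sub>b \<gamma>\<^sub>b \<rho> \<gamma> :: real
    and q :: ennreal
    and b :: "'a \<Rightarrow> complex"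
    and K :: "'a \<Rightarrow> 'a \<Rightarrow> complex"
    and T :: "('a \<Rightarrow> complex) \<Rightarrow> ('a \<Rightarrow> complex)"
  assumes "nonhomogeneous_space \<mu> lam"
    and "0 < \<alpha>" and "\<alpha> < 1"
    and "1 < \<rho>\<^sub>b" and "1 \<le> \<gamma>\<^sub>b"
    and "b \<in> RBMO_space \<mu> lam \<gamma>\<^sub>b \<rho>\<^sub>b"
    and "1 < \<rho>" and "1 \<le> \<gamma>" and "1 < q"
    and "fractional_kernel \<mu> lam \<alpha> K"
    and "fractional_integral \<mu> \<alpha> K T"
    and "\<And>p s::real. 1 < p \<Longrightarrow> p < 1 / \<alpha> \<Longrightarrow> 1 / s = 1 / p - \<alpha> \<Longrightarrow>
           bounded_Lp_Lq \<mu> (ennreal p) (ennreal s) T"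
  shows "\<exists>Tb. extends_commutator \<mu> \<alpha> b T (H1_space \<mu> lam q \<gamma> \<rho>) Tb \<and>
           (\<exists>C>0. \<forall>t>0. \<forall>f\<in>H1_space \<mu> lam q \<gamma> \<rho>.
              Tb f \<in> borel_measurable \<mu> \<and>
              emeasure \<mu> {x. cmod (Tb f x) > t} < \<infinity> \<and>
              measure \<mu> {x. cmod (Tb f x) > t} powr (1 - \<alpha>)
                \<le> C * RBMO_norm \<mu> lam \<gamma>\<^sub>b \<rho>\<^sub>b b * (1 / t) * H1_norm \<mu> lam q \<gamma> \<rho> f)"
proof -
 obtain N0 :: nat where N0: "\<forall>x\<in>(UNIV::'a set). \<forall>r>0. \<exists>F\<subseteq>UNIV. finite F \<and> card F \<le> N0 \<and> ball x r \<inter> UNIV \<subseteq> (\<Union>y\<in>F. ball y (r / 2))"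
  using assms(1) unfolding nonhomogeneous_space_def geometrically_doubling_def by (elim exE conjE) (rule that)
 obtain Cl where ud: "upper_doubling \<mu> lam Cl" and lc: "\<forall>x y r. 0 < r --> dist x y \<le> r --> lam x r \<le> Cl * lam y r"
  using assms(1) unfolding nonhomogeneous_space_def by (elim exE conjE) (rule that)
 have "1 < 1 / \<alpha>" using assms(2,3) by simp
 then have "1 < min q (ennreal (1 / \<alpha>))" using assms(9) by (simp add: ennreal_less_iff flip: ennreal_1)
 \<comment> \<open>An exponent below both \<open>q\<close> and \<open>1 / \<alpha>\<close>: atoms of
   exponent \<open>q\<close> are then atoms of exponent \<open>p\<close>, on which \<open>T\<close> is
   bounded.\<close>
 then obtain p' where p': "1 < p'" "p' < min q (ennreal (1 / \<alpha>))" using dense by blast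
 define p where "p = enn2real p'"
 have pe: "p' = ennreal p" unfolding p_def using p'(2) by (intro ennreal_enn2real[symmetric]) (auto simp: less_top[symmetric] dest: less_trans[OF _ ennreal_less_top])
 have p_bounds: "1 < p" "p < 1 / \<alpha>" "ennreal p < q"
  using p' unfolding pe by (auto simp: ennreal_less_iff simp flip: ennreal_1)
 interpret fractional_operator \<mu> lam Cl N0 \<alpha> K T
 proof
  fix x :: 'a and r :: real assume "0 < r"
  then show "\<exists>F. finite F \<and> card F \<le> N0 \<and> ball x r \<subseteq> (\<Union>y\<in>F. ball y (r / 2))" using N0 by fastforce
 qed (use ud lc assms in \<open>auto simp: upper_doubling_def\<close>)
 interpret commutator_setting \<mu> lam Cl N0 \<alpha> K T \<rho>\<^sub>b \<gamma>\<^sub>b \<rho> p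
  by unfold_locales (use assms p_bounds in \<open>auto simp: admissible_def\<close>)
 have bm: "bmeas b" and ne: "RBMO_bounds \<mu> lam \<gamma>\<^sub>b \<rho>\<^sub>b b \<noteq> {}"
  using assms(6) locally_integrable_measurable by (auto simp: RBMO_space_def)
 obtain C where C: "0 \<le> C" "\<forall>b m L. 0 < L --> regular_means (\<lambda>x. b x / of_real L) m -->
  (\<forall>q \<gamma> f s. ennreal p < q --> 1 \<le> \<gamma> --> integrable \<mu> f --> s \<in> H1_costs \<mu> lam q \<gamma> \<rho> f -->
   (\<exists>h c. good_series b f h c \<and> suminf c = C * L * s))"
  using H1_good_series by (elim exE conjE) (rule that)
 have gs: "\<exists>h c. good_series b f h c \<and> suminf c = C * L * s"
  if L: "L \<in> RBMO_bounds \<mu> lam \<gamma>\<^sub>b \<rho>\<^sub>b b" and f: "integrable \<mu> f" "s \<in> H1_costs \<mu> lam q \<gamma> \<rho> f" for L f s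
 proof -
  obtain m where "regular_means (\<lambda>x. b x / of_real L) m" using RBMO_bounds_regular_means(2)[OF L bm] by (elim exE)
  then show ?thesis by (rule C(2)[rule_format, OF RBMO_bounds_regular_means(1)[OF L bm] _ p_bounds(3) assms(8) f])
 qed
 have H: "integrable \<mu> f \<and> H1_costs \<mu> lam q \<gamma> \<rho> f \<noteq> {}" if "f \<in> H1_space \<mu> lam q \<gamma> \<rho>" for f
  using that by (simp add: H1_space_def)
 have Hgs: "\<exists>h c. good_series b f h c" if "f \<in> H1_space \<mu> lam q \<gamma> \<rho>" for f
  using H[OF that] gs ne by blast
 have wb: "weak (C * L * s) (hardy_commutator b f)"
  if L: "L \<in> RBMO_bounds \<mu> lam \<gamma>\<^sub>b \<rho>\<^sub>b b" and f: "integrable \<mu> f" "s \<in> H1_costs \<mu> lam q \<gamma> \<rho> f" for L f s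
 proof -
  obtain h c where "good_series b f h c" "suminf c = C * L * s" using gs[OF L f] by (elim exE conjE)
  then show ?thesis using hardy_commutator_eq(2)[OF bm] by metis
 qed
 show ?thesis
 proof (intro exI[of _ "hardy_commutator b"] exI[of _ "C + 1"] conjI allI ballI impI)
  show "extends_commutator \<mu> \<alpha> b T (H1_space \<mu> lam q \<gamma> \<rho>) (hardy_commutator b)"
   by (rule extends_hardy_commutator[OF bm Hgs])
  show "0 < C + 1" using C(1) by simp
  fix t :: real and f assume t: "0 < t" and f: "f \<in> H1_space \<mu> lam q \<gamma> \<rho>"
  note fH = H[OF f]
  obtain L s where L: "L \<in> RBMO_bounds \<mu> lam \<gamma>\<^sub>b \<rho>\<^sub>b b" and s: "s \<in> H1_costs \<mu> lam q \<gamma> \<rho> f" using ne fH by blast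
  note w = wb[OF L conjunct1[OF fH] s]
  show "hardy_commutator b f \<in> borel_measurable \<mu>" by (rule weak_boundD(1)[OF w])
  show "emeasure \<mu> {x. t < cmod (hardy_commutator b f x)} < \<infinity>"
   using weak_bound_measure(1)[OF w t alpha sigma_finite_mu] by simp
  define M where "M = measure \<mu> {x. t < cmod (hardy_commutator b f x)} powr (1 - \<alpha>)"
  have "M * t \<le> (C + 1) * Inf (RBMO_bounds \<mu> lam \<gamma>\<^sub>b \<rho>\<^sub>b b) * Inf (H1_costs \<mu> lam q \<gamma> \<rho> f)"
  proof (rule le_mult_Inf_Inf[OF ne conjunct2[OF fH]])
   show s0: "0 \<le> s" if "s \<in> H1_costs \<mu> lam q \<gamma> \<rho> f" for s
   proof -
    obtain l1 l2 where "(\<lambda>i. cmod (l1 i) + cmod (l2 i)) sums s"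
     using \<open>s \<in> _\<close> unfolding H1_costs_def by blast
    then show ?thesis by (rule sums_le[OF _ sums_zero, rotated]) simp
   qed
   show L0: "0 < L" if "L \<in> RBMO_bounds \<mu> lam \<gamma>\<^sub>b \<rho>\<^sub>b b" for L using that by (simp add: RBMO_bounds_def)
   show "0 < C + 1" using C(1) by simp
   fix L s assume Ls: "L \<in> RBMO_bounds \<mu> lam \<gamma>\<^sub>b \<rho>\<^sub>b b" "s \<in> H1_costs \<mu> lam q \<gamma> \<rho> f"
   have "M \<le> C * L * s / t"
    using weak_bound_measure(2)[OF wb[OF Ls(1) conjunct1[OF fH] Ls(2)] t alpha sigma_finite_mu] by (simp add: M_def)
   then have "M * t \<le> C * L * s" using t by (simp add: field_simps)
   moreover have "0 \<le> L * s" using L0[OF Ls(1)] s0[OF Ls(2)] by simp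
   ultimately show "M * t \<le> (C + 1) * L * s" by (simp add: algebra_simps)
  qed
  then have "M \<le> (C + 1) * RBMO_norm \<mu> lam \<gamma>\<^sub>b \<rho>\<^sub>b b * (1 / t) * H1_norm \<mu> lam q \<gamma> \<rho> f"
   using t by (simp add: RBMO_norm_def H1_norm_def field_simps)
  then show "measure \<mu> {x. t < cmod (hardy_commutator b f x)} powr (1 - \<alpha>)
    \<le> (C + 1) * RBMO_norm \<mu> lam \<gamma>\<^sub>b \<rho>\<^sub>b b * (1 / t) * H1_norm \<mu> lam q \<gamma> \<rho> f"
   by (simp only: M_def)
 qed
qed

end
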